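(* Let $d\ge1$ be an integer, $s=\frac d2$ and $\varepsilon>0$. There exists a constant $C_{d,\varepsilon}>0$, depending only on $d$ and $\varepsilon$, such that for every measurable $V:\mathbb{R}^d\to[0,\infty)$ for which $v:=V^{1/2}$ belongs to the domain of $(\ln\mathbf h)^{\frac12}(\ln\ln\mathbf h)^{\frac12+\varepsilon}$ (that is, the right-hand side below is finite), $$N_{<0}(H_s)-1\le C_{d,\varepsilon}\,\big\|(\ln\mathbf h)^{\frac12}(\ln\ln\mathbf h)^{\frac12+\varepsilon}\,v\big\|_{L^2}^2 .$$
   Context: $L^2=L^2(\mathbb{R}^d)$. The operator $\mathbf h:=c_d(-\Delta+x^2)$ is the harmonic oscillator on $L^2(\mathbb{R}^d)$ with $c_d:=e^e/d$, so that $\mathbf h\ge e^e$; functions of $\mathbf h$ are defined by the spectral functional calculus for self-adjoint operators, and $v\in L^2$ is regarded as a vector to which these operators are applied. The fractional Schrödinger operator $H_s=(-\Delta)^s-V(x)$ on $L^2(\mathbb{R}^d)$, with $s=d/2$, is the self-adjoint operator associated, by the KLMN theorem, with the quadratic form $u\mapsto\int_{\mathbb{R}^d}|\xi|^{2s}|\hat u(\xi)|^2\,\mathrm{d}\xi-\int_{\mathbb{R}^d}V|u|^2\,\mathrm{d}x$ with form domain the Sobolev space $H^s(\mathbb{R}^d)$ (under the stated condition on $v$ this form is closed and bounded below, and the essential spectrum of $H_s$ is $[0,\infty)$). Here $\hat u$ is the unitary Fourier transform. $N_{<0}(H_s)$ denotes the number of negative eigenvalues of $H_s$, counted with multiplicity.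 *)

theory Defs
  imports "HOL-Analysis.Analysis"
begin

section \<open>Square-integrable functions\<close>

text \<open>
  Elements of \<open>L\<^sup>2(\<real>\<^sup>d)\<close>, \<open>d = CARD('n)\<close>, are represented by functions; equality in
  \<open>L\<^sup>2\<close> is equality almost everywhere. An unbounded operator is represented by its graph, a
  set of pairs of representatives that is closed under changes on null sets.
\<close>

definition L2 :: "(real^'n \<Rightarrow> complex) set" where
  "L2 = {u \<in> borel_measurable lebesgue. integrable lebesgue (\<lambda>x. (cmod (u x))\<^sup>2)}"

definition L2_inner :: "(real^'n \<Rightarrow> complex) \<Rightarrow> (real^'n \<Rightarrow> complex) \<Rightarrow> complex" where
  "L2_inner u v = (LINT x|lebesgue. cnj (u x) * v x)"

definition L2_norm :: "(real^'n \<Rightarrow> complex) \<Rightarrow> real" where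
  "L2_norm u = sqrt (LINT x|lebesgue. (cmod (u x))\<^sup>2)"

type_synonym 'n operator = "((real^'n \<Rightarrow> complex) \<times> (real^'n \<Rightarrow> complex)) set"


section \<open>Unitary Fourier transform\<close>

definition fourier_cutoff :: "nat \<Rightarrow> (real^'n \<Rightarrow> complex) \<Rightarrow> real^'n \<Rightarrow> complex" where
  "fourier_cutoff n u \<xi> = complex_of_real ((2 * pi) powr (- real CARD('n) / 2)) *
     (LINT x:cball 0 (real n)|lebesgue. cis (- (x \<bullet> \<xi>)) * u x)"

text \<open>The Plancherel transform as a limit in \<open>L\<^sup>2\<close>; for \<open>u \<in> L2\<close> it is determined up to
  null sets.\<close>

definition fourier :: "(real^'n \<Rightarrow> complex) \<Rightarrow> real^'n \<Rightarrow> complex" where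
  "fourier u = (SOME g. g \<in> L2 \<and>
     ((\<lambda>n. \<integral>\<^sup>+ \<xi>. ennreal ((cmod (fourier_cutoff n u \<xi> - g \<xi>))\<^sup>2) \<partial>lebesgue) \<longlonglongrightarrow> 0))"


section \<open>Spectral functional calculus\<close>

text \<open>An operator \<open>P\<close> with these properties is automatically linear, bounded and compatible with
  equality almost everywhere.\<close>

definition orthogonal_projection ::
  "((real^'n \<Rightarrow> complex) \<Rightarrow> (real^'n \<Rightarrow> complex)) \<Rightarrow> bool" where
  "orthogonal_projection P \<longleftrightarrow>
     (\<forall>u\<in>L2. P u \<in> L2) \<and>
     (\<forall>u\<in>L2. \<forall>v\<in>L2. L2_inner (P u) v = L2_inner u (P v)) \<and>
     (\<forall>u\<in>L2. AE x in lebesgue. P (P u) x = P u x)"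

definition projection_valued_measure ::
  "(real set \<Rightarrow> (real^'n \<Rightarrow> complex) \<Rightarrow> (real^'n \<Rightarrow> complex)) \<Rightarrow> bool" where
  "projection_valued_measure E \<longleftrightarrow>
     (\<forall>S\<in>sets borel. orthogonal_projection (E S)) \<and>
     (\<forall>u\<in>L2. AE x in lebesgue. E UNIV u x = u x) \<and>
     (\<forall>A :: nat \<Rightarrow> real set. range A \<subseteq> sets borel \<longrightarrow> disjoint_family A \<longrightarrow>
        (\<forall>u\<in>L2. (\<lambda>n. L2_norm (\<lambda>x. E (\<Union>i. A i) u x - (\<Sum>i<n. E (A i) u x))) \<longlonglongrightarrow> 0))"

text \<open>The scalar measure \<open>S \<mapsto> \<langle>v, E(S) v\<rangle> = \<parallel>E(S) v\<parallel>\<^sup>2\<close>.\<close>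

definition scalar_spectral_measure ::
  "(real set \<Rightarrow> (real^'n \<Rightarrow> complex) \<Rightarrow> (real^'n \<Rightarrow> complex)) \<Rightarrow> (real^'n \<Rightarrow> complex)
     \<Rightarrow> real measure" where
  "scalar_spectral_measure E v =
     measure_of UNIV (sets borel) (\<lambda>S. ennreal ((L2_norm (E S v))\<^sup>2))"

definition simple_spectral_integral ::
  "(real set \<Rightarrow> (real^'n \<Rightarrow> complex) \<Rightarrow> (real^'n \<Rightarrow> complex)) \<Rightarrow> (real \<Rightarrow> real)
     \<Rightarrow> (real^'n \<Rightarrow> complex) \<Rightarrow> real^'n \<Rightarrow> complex" where
  "simple_spectral_integral E g v =
     (\<lambda>x. \<Sum>y\<in>range g. complex_of_real y * E (g -` {y}) v x)"

text \<open>The operator \<open>\<integral> f dE\<close>, with domain the \<open>v\<close> for which \<open>f\<close> is square-integrable with respect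
  to the scalar measure of \<open>v\<close>; its value is the limit of the integrals of simple functions
  approximating \<open>f\<close>.\<close>

definition spectral_integral ::
  "(real set \<Rightarrow> (real^'n \<Rightarrow> complex) \<Rightarrow> (real^'n \<Rightarrow> complex)) \<Rightarrow> (real \<Rightarrow> real)
     \<Rightarrow> 'n operator" where
  "spectral_integral E f = {(v, w). v \<in> L2 \<and> w \<in> L2 \<and>
     (\<integral>\<^sup>+ t. ennreal ((f t)\<^sup>2) \<partial>scalar_spectral_measure E v) < \<infinity> \<and>
     (\<exists>g. (\<forall>n. simple_function borel (g n)) \<and>
        ((\<lambda>n. \<integral>\<^sup>+ t. ennreal ((g n t - f t)\<^sup>2) \<partial>scalar_spectral_measure E v) \<longlonglongrightarrow> 0) \<and>
        ((\<lambda>n. L2_norm (\<lambda>x. simple_spectral_integral E (g n) v x - w x)) \<longlonglongrightarrow> 0))}"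

definition spectral_measure_of ::
  "'n::finite operator \<Rightarrow> (real set \<Rightarrow> (real^'n \<Rightarrow> complex) \<Rightarrow> (real^'n \<Rightarrow> complex)) \<Rightarrow> bool" where
  "spectral_measure_of A E \<longleftrightarrow>
     projection_valued_measure E \<and> spectral_integral E (\<lambda>t. t) = A"

text \<open>The operator \<open>f(A)\<close>. For self-adjoint \<open>A\<close> the spectral measure exists and is unique up to
  null sets, so the existential quantifier below picks out the spectral measure of \<open>A\<close>.\<close>

definition functional_calculus :: "'n::finite operator \<Rightarrow> (real \<Rightarrow> real) \<Rightarrow> 'n operator" where
  "functional_calculus A f =
     {(v, w). \<exists>E. spectral_measure_of A E \<and> (v, w) \<in> spectral_integral E f}"


section \<open>The harmonic oscillator\<close>

definition neg_laplacian :: "'n::finite operator" where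
  "neg_laplacian = {(u, f). u \<in> L2 \<and> f \<in> L2 \<and>
     (AE \<xi> in lebesgue. fourier f \<xi> = complex_of_real ((norm \<xi>)\<^sup>2) * fourier u \<xi>)}"

definition square_multiplication :: "'n::finite operator" where
  "square_multiplication = {(u, f). u \<in> L2 \<and> f \<in> L2 \<and>
     (AE x in lebesgue. f x = complex_of_real ((norm x)\<^sup>2) * u x)}"

text \<open>\<open>(e\<^sup>e / d) (-\<Delta> + x\<^sup>2)\<close> as an operator sum; it is self-adjoint on the intersection of the
  domains of \<open>-\<Delta>\<close> and \<open>x\<^sup>2\<close>.\<close>

definition harmonic_oscillator :: "'n::finite operator" where
  "harmonic_oscillator = {(u, f). f \<in> L2 \<and>
     (\<exists>g k. (u, g) \<in> neg_laplacian \<and> (u, k) \<in> square_multiplication \<and>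
        (AE x in lebesgue.
           f x = complex_of_real (exp (exp 1) / real CARD('n)) * (g x + k x)))}"


section \<open>Fractional Schroedinger operators\<close>

definition sobolev :: "real \<Rightarrow> (real^'n \<Rightarrow> complex) set" where
  "sobolev s = {u \<in> L2.
     integrable lebesgue (\<lambda>\<xi>. (1 + (norm \<xi>)\<^sup>2) powr s * (cmod (fourier u \<xi>))\<^sup>2)}"

text \<open>The sesquilinear form whose quadratic form is
  \<open>\<integral> |\<xi>|\<^bsup>2s\<^esup> |F u|\<^sup>2 d\<xi> - \<integral> V |u|\<^sup>2 dx\<close>, \<open>F\<close> the Fourier
  transform. It is meaningful for those \<open>V\<close> for which \<open>V |u|\<^sup>2\<close> is integrable for all \<open>u\<close> in \<open>sobolev s\<close>.\<close>

definition schroedinger_form ::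
  "real \<Rightarrow> (real^'n \<Rightarrow> real) \<Rightarrow> (real^'n \<Rightarrow> complex) \<Rightarrow> (real^'n \<Rightarrow> complex) \<Rightarrow> complex" where
  "schroedinger_form s V w u =
     (LINT \<xi>|lebesgue. complex_of_real (norm \<xi> powr (2 * s)) * cnj (fourier w \<xi>) * fourier u \<xi>)
     - (LINT x|lebesgue. complex_of_real (V x) * cnj (w x) * u x)"

text \<open>The operator associated with a sesquilinear form \<open>q\<close> with form domain \<open>Q\<close>
  (first representation theorem).\<close>

definition form_operator ::
  "(real^'n \<Rightarrow> complex) set \<Rightarrow> ((real^'n \<Rightarrow> complex) \<Rightarrow> (real^'n \<Rightarrow> complex) \<Rightarrow> complex)
     \<Rightarrow> 'n operator" where
  "form_operator Q q = {(u, f). u \<in> Q \<and> f \<in> L2 \<and> (\<forall>w\<in>Q. q w u = L2_inner w f)}"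

definition fractional_schroedinger :: "real \<Rightarrow> (real^'n \<Rightarrow> real) \<Rightarrow> 'n operator" where
  "fractional_schroedinger s V = form_operator (sobolev s) (schroedinger_form s V)"


section \<open>Counting negative eigenvalues\<close>

definition eigenspace :: "'n::finite operator \<Rightarrow> real \<Rightarrow> (real^'n \<Rightarrow> complex) set" where
  "eigenspace A \<mu> = {u \<in> L2. (u, \<lambda>x. complex_of_real \<mu> * u x) \<in> A}"

definition L2_independent :: "nat \<Rightarrow> (nat \<Rightarrow> real^'n \<Rightarrow> complex) \<Rightarrow> bool" where
  "L2_independent n u \<longleftrightarrow>
     (\<forall>c. (AE x in lebesgue. (\<Sum>i<n. c i * u i x) = 0) \<longrightarrow> (\<forall>i<n. c i = 0))"

text \<open>Dimension over \<open>\<complex>\<close> of a subspace of \<open>L\<^sup>2\<close>.\<close>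

definition L2_dim :: "(real^'n \<Rightarrow> complex) set \<Rightarrow> enat" where
  "L2_dim S = (SUP n\<in>{n. \<exists>u. (\<forall>i<n. u i \<in> S) \<and> L2_independent n u}. enat n)"

text \<open>The sum over all \<open>\<mu> < 0\<close> of the multiplicities; it vanishes where \<open>\<mu>\<close> is not an
  eigenvalue.\<close>

definition num_negative_eigenvalues :: "'n::finite operator \<Rightarrow> enat" where
  "num_negative_eigenvalues A =
     (SUP F\<in>{F. finite F \<and> F \<subseteq> {..<0}}. \<Sum>\<mu>\<in>F. L2_dim (eigenspace A \<mu>))"

end

(*
  By the uncertainty principle h >= e^e, so ln ln h >= 1 on the spectrum and the hypothesis bounds
  <v, (ln h) v>. Splitting v at the spectral levels e^k of h and using h >= c_d x^2 and
  h >= c_d |p|^2, this yields the two logarithmic moments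
    int ln(2 + |x|) |v|^2 dx <= K,   int ln(2 + |xi|) |v^|^2 dxi <= K.

  Let the kinetic form be dominated by the norm of v u on a space of dimension N + 1, as it is on the
  span of eigenfunctions to negative eigenvalues. On a subspace of dimension N the transforms u^ have
  mean zero on the unit ball. Choose u_1, ..., u_N there with psi_i = v u_i orthonormal; then the
  |p|^(d/2) u_i satisfy Bessel's inequality, and N = sum_i <psi_i, v u_i> is estimated by splitting
  u_i into frequencies:
  - |p| < 1: by the mean-zero condition the kernel e^(i x xi) may be replaced by e^(i x xi) - 1, and
    then v |p|^(-d/2) is Hilbert-Schmidt, with norm controlled by the first moment;
  - 2^j <= |p| < 2^(j+1), with shell projection P_j: the blocks (1 - P_j) v P_j |p|^(-d/2) are
    Hilbert-Schmidt, and the sum over j of their squared norms is controlled by the second moment,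
    because |xi| ~ 2^j and |eta| outside the shell make |xi - eta| small only near its boundary;
  - in P_j v P_j |p|^(-d/2) the part |v| <= 2^(jd/2) / 8 has small operator norm, and the trace norms
    of the parts |v| > 2^(jd/2) / 8 add up to a multiple of the squared norm of v.
  The small parts cost at most N/2, whence N <= C K.
*)

theory Submission
  imports Defs "HOL-Probability.Characteristic_Functions"
begin

section \<open>The Hilbert space structure of \<open>L\<^sup>2\<close>\<close>

text \<open>At the critical order \<open>s = d/2\<close> the weight \<open>|\<xi>|^(-d)\<close>
  diverges logarithmically at both ends, and the two ends are treated differently. At the origin one
  linear condition removes the divergence; it is the source of the \<open>- 1\<close>. At infinity
  \<open>v |p|^(-d/2)\<close> has infinite Hilbert-Schmidt norm unless \<open>v = 0\<close>, so only
  the off-diagonal blocks are measured in that norm, and the diagonal ones are cut by the size of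
  \<open>v\<close>. The estimated sum is linear in \<open>v\<close>, the bound quadratic.
  Hilbert-Schmidt pieces become quadratic by the arithmetic-geometric mean, at the price of a share
  of \<open>N\<close>: 1/8 at low frequency and 1/8 off the diagonal; the small diagonal parts cost
  1/16 + 1/16. The trace-norm pieces are quadratic because the powers \<open>2^(jd/2)\<close> below
  \<open>8 |v|\<close> sum to a multiple of \<open>|v|\<close>. That \<open>v u\<close> is
  square-integrable for \<open>u\<close> in the form domain is proved, not assumed: the shell
  estimate, for families with one member, makes the products of \<open>v\<close> with the frequency
  truncations of \<open>u\<close> a Cauchy sequence.\<close>

lemma lebesgue_measurable_lborel [measurable (raw)]:
  "f \<in> borel_measurable borel \<Longrightarrow> f \<in> borel_measurable lebesgue"
  by (simp add: measurable_completion)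

text \<open>Sigma-finiteness passes to the completion; with it Fubini's theorem is available for
  functions that are only Lebesgue measurable.\<close>

interpretation lebesgue_sf: sigma_finite_measure "lebesgue :: 'a::euclidean_space measure"
proof
  obtain A :: "nat \<Rightarrow> 'a set" where "range A \<subseteq> sets lborel" "(\<Union>i. A i) = space lborel"
    "\<And>i. emeasure lborel (A i) \<noteq> \<infinity>"
    using lborel.sigma_finite by metis
  then show "\<exists>A. countable A \<and> A \<subseteq> sets lebesgue \<and> \<Union>A = space (lebesgue :: 'a measure) \<and>
      (\<forall>a\<in>A. emeasure lebesgue a \<noteq> \<infinity>)"
    by (intro exI[of _ "range A"]) (auto simp: emeasure_completion)
qed

interpretation lebesgue_pair: pair_sigma_finite "lebesgue :: 'a::euclidean_space measure"
    "lebesgue :: 'b::euclidean_space measure"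
  by unfold_locales

lemma borel_measurable_cnj_lebesgue [measurable (raw)]:
  "f \<in> borel_measurable M \<Longrightarrow> (\<lambda>x. cnj (f x)) \<in> borel_measurable M"
  by (rule borel_measurable_continuous_on[where f=cnj]) (auto intro: continuous_intros)

lemma L2_measurable: "u \<in> L2 \<Longrightarrow> u \<in> borel_measurable lebesgue"
  by (simp add: L2_def)

lemma L2_iff: "u \<in> L2 \<longleftrightarrow> u \<in> borel_measurable lebesgue \<and>
    (\<integral>\<^sup>+x. ennreal ((cmod (u x))\<^sup>2) \<partial>lebesgue) < \<infinity>"
  by (auto simp: L2_def integrable_iff_bounded)

lemma L2_norm_nonneg [simp]: "0 \<le> L2_norm u"
  by (simp add: L2_norm_def)

lemma L2_norm_sq: "(L2_norm u)\<^sup>2 = (LINT x|lebesgue. (cmod (u x))\<^sup>2)"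
  by (simp add: L2_norm_def)

text \<open>Most estimates run in \<open>ennreal\<close>, where no integrability has to be checked
  in advance; this identity leads back to the real-valued norm.\<close>

lemma L2_norm_nn: "u \<in> L2 \<Longrightarrow> ennreal ((L2_norm u)\<^sup>2) = (\<integral>\<^sup>+x. ennreal ((cmod (u x))\<^sup>2) \<partial>lebesgue)"
  by (subst nn_integral_eq_integral) (auto simp: L2_def L2_norm_sq)

lemma L2I_dom:
  assumes "u \<in> L2" "v \<in> borel_measurable lebesgue" "AE x in lebesgue. cmod (v x) \<le> cmod (u x)"
  shows "v \<in> L2" "L2_norm v \<le> L2_norm u"
proof -
  have le: "(\<integral>\<^sup>+x. ennreal ((cmod (v x))\<^sup>2) \<partial>lebesgue) \<le> (\<integral>\<^sup>+x. ennreal ((cmod (u x))\<^sup>2) \<partial>lebesgue)"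
    using assms(3) by (intro nn_integral_mono_AE) (auto elim!: eventually_mono intro!: ennreal_leI power_mono)
  then show v: "v \<in> L2" using assms by (auto simp: L2_iff)
  have "ennreal ((L2_norm v)\<^sup>2) \<le> ennreal ((L2_norm u)\<^sup>2)"
    using le assms(1) v by (simp add: L2_norm_nn)
  then have "(L2_norm v)\<^sup>2 \<le> (L2_norm u)\<^sup>2" by simp
  then show "L2_norm v \<le> L2_norm u" by (rule power2_le_imp_le) simp
qed

lemma L2_cong_AE:
  assumes "u \<in> L2" "v \<in> borel_measurable lebesgue" "AE x in lebesgue. v x = u x"
  shows "v \<in> L2" "L2_norm v = L2_norm u"
proof -
  show v: "v \<in> L2" using assms by (intro L2I_dom(1)[OF assms(1,2)]) auto
  show "L2_norm v = L2_norm u"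
    using assms by (auto simp: L2_norm_def intro!: integral_cong_AE elim!: eventually_mono dest: L2_measurable)
qed

lemma L2_norm_cong_AE:
  assumes "u \<in> borel_measurable lebesgue" "v \<in> borel_measurable lebesgue" "AE x in lebesgue. v x = u x"
  shows "L2_norm v = L2_norm u"
  using assms by (auto simp: L2_norm_def intro!: integral_cong_AE elim!: eventually_mono)

lemma L2_inner_cong_AE:
  assumes "u \<in> borel_measurable lebesgue" "u' \<in> borel_measurable lebesgue"
    "v \<in> borel_measurable lebesgue" "v' \<in> borel_measurable lebesgue"
    "AE x in lebesgue. u x = u' x" "AE x in lebesgue. v x = v' x"
  shows "L2_inner u v = L2_inner u' v'"
  unfolding L2_inner_def using assms by (intro integral_cong_AE) auto

lemma L2_zero [simp]: "(\<lambda>_. 0) \<in> L2" by (simp add: L2_iff)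

lemma L2_norm_zero [simp]: "L2_norm (\<lambda>_. 0) = 0" by (simp add: L2_norm_def)

lemma L2_add: assumes "u \<in> L2" "v \<in> L2" shows "(\<lambda>x. u x + v x) \<in> L2"
proof -
  have [measurable]: "u \<in> borel_measurable lebesgue" "v \<in> borel_measurable lebesgue"
    using assms by (auto dest: L2_measurable)
  have "(\<integral>\<^sup>+x. ennreal ((cmod (u x + v x))\<^sup>2) \<partial>lebesgue)
      \<le> (\<integral>\<^sup>+x. 2 * ennreal ((cmod (u x))\<^sup>2) + 2 * ennreal ((cmod (v x))\<^sup>2) \<partial>lebesgue)"
  proof (intro nn_integral_mono)
    fix x
    have "(cmod (u x + v x))\<^sup>2 \<le> (cmod (u x) + cmod (v x))\<^sup>2"
      by (intro power_mono norm_triangle_ineq) auto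
    also have "\<dots> \<le> 2 * (cmod (u x))\<^sup>2 + 2 * (cmod (v x))\<^sup>2"
      using sum_squares_bound[of "cmod (u x)" "cmod (v x)"] by (simp add: power2_sum)
    finally show "ennreal ((cmod (u x + v x))\<^sup>2) \<le> 2 * ennreal ((cmod (u x))\<^sup>2) + 2 * ennreal ((cmod (v x))\<^sup>2)"
      by (simp add: ennreal_mult'[symmetric] flip: ennreal_plus ennreal_numeral)
  qed
  also have "\<dots> < \<infinity>" using assms
    by (subst nn_integral_add) (auto simp: nn_integral_cmult L2_iff ennreal_mult_less_top)
  finally show ?thesis by (simp add: L2_iff)
qed

lemma L2_norm_scale: "L2_norm (\<lambda>x. c * u x) = cmod c * L2_norm u"
  by (simp add: L2_norm_def norm_mult power_mult_distrib real_sqrt_mult)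

lemma L2_scale: assumes "u \<in> L2" shows "(\<lambda>x. c * u x) \<in> L2"
  using assms by (auto simp: L2_def norm_mult power_mult_distrib)

lemma L2_minus: "u \<in> L2 \<Longrightarrow> (\<lambda>x. - u x) \<in> L2"
  using L2_scale[of u "-1"] by simp

lemma L2_diff: assumes "u \<in> L2" "v \<in> L2" shows "(\<lambda>x. u x - v x) \<in> L2"
  using L2_add[OF assms(1) L2_minus[OF assms(2)]] by simp

lemma L2_sum: "(\<And>i. i \<in> I \<Longrightarrow> u i \<in> L2) \<Longrightarrow> (\<lambda>x. \<Sum>i\<in>I. u i x) \<in> L2"
  by (induction I rule: infinite_finite_induct) (auto intro!: L2_add)

lemma L2_cnj: "u \<in> L2 \<Longrightarrow> (\<lambda>x. cnj (u x)) \<in> L2"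
  by (auto simp: L2_def)

lemma L2_norm_cnj: "L2_norm (\<lambda>x. cnj (u x)) = L2_norm u"
  by (simp add: L2_norm_def)

lemma L2_norm_minus_commute: "L2_norm (\<lambda>x. u x - v x) = L2_norm (\<lambda>x. v x - u x)"
  by (simp add: L2_norm_def norm_minus_commute)

lemma L2_mult_bounded:
  assumes u: "u \<in> L2" and f: "f \<in> borel_measurable lebesgue" and B: "\<And>x. cmod (f x) \<le> B"
  shows "(\<lambda>x. f x * u x) \<in> L2" "L2_norm (\<lambda>x. f x * u x) \<le> B * L2_norm u"
proof -
  have B0: "0 \<le> B" using B[of 0] norm_ge_zero order_trans by blast
  have a: "(\<lambda>x. complex_of_real B * u x) \<in> L2" by (rule L2_scale[OF u])
  have m: "(\<lambda>x. f x * u x) \<in> borel_measurable lebesgue" using f L2_measurable[OF u] by simp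
  have c: "AE x in lebesgue. cmod (f x * u x) \<le> cmod (complex_of_real B * u x)"
    using B B0 by (auto simp: norm_mult mult_right_mono)
  show "(\<lambda>x. f x * u x) \<in> L2" by (rule L2I_dom(1)[OF a m c])
  show "L2_norm (\<lambda>x. f x * u x) \<le> B * L2_norm u"
    using L2I_dom(2)[OF a m c] B0 by (simp add: L2_norm_scale)
qed

lemma L2_indicator: assumes "u \<in> L2" "A \<in> sets lebesgue"
  shows "(\<lambda>x. indicator A x * u x) \<in> L2" "L2_norm (\<lambda>x. indicator A x * u x) \<le> L2_norm u"
  using L2_mult_bounded[OF assms(1), of "indicator A" 1] assms(2) by (auto simp: indicator_def)

lemma Cauchy_Schwarz_cmod:
  assumes u: "u \<in> L2" and v: "v \<in> L2"
  shows "integrable lebesgue (\<lambda>x. cmod (u x) * cmod (v x))"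
    "(LINT x|lebesgue. cmod (u x) * cmod (v x)) \<le> L2_norm u * L2_norm v"
proof -
  have [measurable]: "u \<in> borel_measurable lebesgue" "v \<in> borel_measurable lebesgue"
    using assms by (auto dest: L2_measurable)
  have iu: "integrable lebesgue (\<lambda>x. (cmod (u x))\<^sup>2 + (cmod (v x))\<^sup>2)"
    using u v by (auto simp: L2_def)
  show i: "integrable lebesgue (\<lambda>x. cmod (u x) * cmod (v x))"
  proof (rule Bochner_Integration.integrable_bound[OF iu], measurable, intro AE_I2)
    fix x
    have "2 * (cmod (u x) * cmod (v x)) \<le> (cmod (u x))\<^sup>2 + (cmod (v x))\<^sup>2"
      using sum_squares_bound[of "cmod (u x)" "cmod (v x)"] by simp
    moreover have "0 \<le> cmod (u x) * cmod (v x)" by simp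
    ultimately have "cmod (u x) * cmod (v x) \<le> (cmod (u x))\<^sup>2 + (cmod (v x))\<^sup>2" by linarith
    then show "norm (cmod (u x) * cmod (v x)) \<le> norm ((cmod (u x))\<^sup>2 + (cmod (v x))\<^sup>2)"
      by simp
  qed
  have "ennreal ((LINT x|lebesgue. cmod (u x) * cmod (v x))\<^sup>2) = (\<integral>\<^sup>+x. ennreal (cmod (u x)) * ennreal (cmod (v x)) \<partial>lebesgue)\<^sup>2"
    using i by (simp add: nn_integral_eq_integral ennreal_mult' flip: ennreal_mult' ennreal_power)
  also have "\<dots> \<le> (\<integral>\<^sup>+x. ennreal (cmod (u x))^2 \<partial>lebesgue) * (\<integral>\<^sup>+x. ennreal (cmod (v x)) ^2 \<partial>lebesgue)"
    by (rule Cauchy_Schwarz_nn_integral) auto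
  also have "\<dots> = ennreal ((L2_norm u)\<^sup>2 * (L2_norm v)\<^sup>2)"
    using u v by (simp add: L2_norm_nn ennreal_mult ennreal_power)
  finally have "(LINT x|lebesgue. cmod (u x) * cmod (v x))\<^sup>2 \<le> (L2_norm u * L2_norm v)\<^sup>2"
    by (simp add: power_mult_distrib)
  then show "(LINT x|lebesgue. cmod (u x) * cmod (v x)) \<le> L2_norm u * L2_norm v"
    by (rule power2_le_imp_le) simp
qed

lemma L2_inner_integrable:
  assumes "u \<in> L2" "v \<in> L2" shows "integrable lebesgue (\<lambda>x. cnj (u x) * v x)"
  using Cauchy_Schwarz_cmod(1)[OF assms] L2_measurable[OF assms(1)] L2_measurable[OF assms(2)]
  by (subst integrable_norm_iff[symmetric]) (auto simp: norm_mult)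

lemma L2_Cauchy_Schwarz:
  assumes "u \<in> L2" "v \<in> L2" shows "cmod (L2_inner u v) \<le> L2_norm u * L2_norm v"
proof -
  have "cmod (L2_inner u v) \<le> (LINT x|lebesgue. cmod (cnj (u x) * v x))"
    unfolding L2_inner_def by (rule integral_norm_bound)
  also have "\<dots> \<le> L2_norm u * L2_norm v"
    using Cauchy_Schwarz_cmod(2)[OF assms] by (simp add: norm_mult)
  finally show ?thesis .
qed

lemma L2_inner_add_right: "u \<in> L2 \<Longrightarrow> v \<in> L2 \<Longrightarrow> w \<in> L2 \<Longrightarrow>
    L2_inner u (\<lambda>x. v x + w x) = L2_inner u v + L2_inner u w"
  unfolding L2_inner_def by (simp add: L2_inner_integrable ring_distribs)

lemma L2_inner_diff_right: "u \<in> L2 \<Longrightarrow> v \<in> L2 \<Longrightarrow> w \<in> L2 \<Longrightarrow>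
    L2_inner u (\<lambda>x. v x - w x) = L2_inner u v - L2_inner u w"
  unfolding L2_inner_def by (simp add: L2_inner_integrable ring_distribs)

lemma L2_inner_add_left: "u \<in> L2 \<Longrightarrow> v \<in> L2 \<Longrightarrow> w \<in> L2 \<Longrightarrow>
    L2_inner (\<lambda>x. v x + w x) u = L2_inner v u + L2_inner w u"
  unfolding L2_inner_def by (simp add: L2_inner_integrable ring_distribs)

lemma L2_inner_diff_left: "u \<in> L2 \<Longrightarrow> v \<in> L2 \<Longrightarrow> w \<in> L2 \<Longrightarrow>
    L2_inner (\<lambda>x. v x - w x) u = L2_inner v u - L2_inner w u"
  unfolding L2_inner_def by (simp add: L2_inner_integrable ring_distribs)

lemma L2_inner_scale_right: "L2_inner u (\<lambda>x. c * v x) = c * L2_inner u v"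
  unfolding L2_inner_def by (simp add: mult.left_commute)

lemma L2_inner_scale_left: "L2_inner (\<lambda>x. c * v x) u = cnj c * L2_inner v u"
  unfolding L2_inner_def by (simp add: mult.assoc)

lemma L2_inner_sum_right: "u \<in> L2 \<Longrightarrow> (\<And>i. i \<in> I \<Longrightarrow> v i \<in> L2) \<Longrightarrow>
    L2_inner u (\<lambda>x. \<Sum>i\<in>I. v i x) = (\<Sum>i\<in>I. L2_inner u (v i))"
  unfolding L2_inner_def by (simp add: L2_inner_integrable sum_distrib_left)

lemma L2_inner_cnj: "cnj (L2_inner u v) = L2_inner v u"
  using Bochner_Integration.integral_cnj[of lebesgue "\<lambda>x. cnj (u x) * v x"] unfolding L2_inner_def by (simp add: mult.commute)

lemma L2_inner_sum_left: "u \<in> L2 \<Longrightarrow> (\<And>i. i \<in> I \<Longrightarrow> v i \<in> L2) \<Longrightarrow>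
    L2_inner (\<lambda>x. \<Sum>i\<in>I. v i x) u = (\<Sum>i\<in>I. L2_inner (v i) u)"
  using L2_inner_sum_right[of u I v] by (metis (no_types, lifting) L2_inner_cnj cnj_sum sum.cong)

lemma L2_inner_self: "L2_inner u u = complex_of_real ((L2_norm u)\<^sup>2)"
proof -
  have "L2_inner u u = (LINT x|lebesgue. complex_of_real ((cmod (u x))\<^sup>2))"
    unfolding L2_inner_def by (intro Bochner_Integration.integral_cong refl) (simp add: complex_norm_square mult.commute del: of_real_power)
  then show ?thesis by (simp only: L2_norm_sq integral_complex_of_real)
qed

lemma L2_norm_add_sq:
  assumes "u \<in> L2" "v \<in> L2"
  shows "(L2_norm (\<lambda>x. u x + v x))\<^sup>2 = (L2_norm u)\<^sup>2 + (L2_norm v)\<^sup>2 + 2 * Re (L2_inner u v)"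
proof -
  have "complex_of_real ((L2_norm (\<lambda>x. u x + v x))\<^sup>2) = L2_inner u u + L2_inner u v + (L2_inner v u + L2_inner v v)"
    unfolding L2_inner_self[symmetric] using assms
    by (subst L2_inner_add_left) (auto simp: L2_inner_add_right L2_add)
  also have "L2_inner v u = cnj (L2_inner u v)" by (simp add: L2_inner_cnj)
  finally have "Re (complex_of_real ((L2_norm (\<lambda>x. u x + v x))\<^sup>2))
     = Re (L2_inner u u + L2_inner u v + (cnj (L2_inner u v) + L2_inner v v))" by (rule arg_cong)
  then show ?thesis by (simp add: L2_inner_self del: of_real_power)
qed

lemma L2_norm_triangle:
  assumes "u \<in> L2" "v \<in> L2"
  shows "L2_norm (\<lambda>x. u x + v x) \<le> L2_norm u + L2_norm v"
proof (rule power2_le_imp_le)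
  have "Re (L2_inner u v) \<le> L2_norm u * L2_norm v"
    using L2_Cauchy_Schwarz[OF assms] complex_Re_le_cmod order_trans by blast
  then show "(L2_norm (\<lambda>x. u x + v x))\<^sup>2 \<le> (L2_norm u + L2_norm v)\<^sup>2"
    by (simp add: L2_norm_add_sq[OF assms] power2_sum)
qed simp

lemma L2_norm_triangle3:
  assumes "u \<in> L2" "v \<in> L2" "w \<in> L2"
  shows "L2_norm (\<lambda>x. u x - w x) \<le> L2_norm (\<lambda>x. u x - v x) + L2_norm (\<lambda>x. v x - w x)"
  using L2_norm_triangle[OF L2_diff[OF assms(1,2)] L2_diff[OF assms(2,3)]] by simp

lemma L2_norm_diff_abs:
  assumes "u \<in> L2" "v \<in> L2"
  shows "\<bar>L2_norm u - L2_norm v\<bar> \<le> L2_norm (\<lambda>x. u x - v x)"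
proof -
  have "L2_norm u \<le> L2_norm (\<lambda>x. u x - v x) + L2_norm v"
    using L2_norm_triangle3[OF assms(1,2) L2_zero] by simp
  moreover have "L2_norm v \<le> L2_norm (\<lambda>x. v x - u x) + L2_norm u"
    using L2_norm_triangle3[OF assms(2,1) L2_zero] by simp
  moreover have "L2_norm (\<lambda>x. v x - u x) = L2_norm (\<lambda>x. u x - v x)"
    by (rule L2_norm_minus_commute)
  ultimately show ?thesis by linarith
qed

lemma L2_norm_eq_0:
  assumes "u \<in> L2" shows "L2_norm u = 0 \<longleftrightarrow> (AE x in lebesgue. u x = 0)"
  using assms by (auto simp: L2_norm_def L2_def integral_nonneg_eq_0_iff_AE)

lemma L2_tendsto_norm:
  assumes "\<And>n. u n \<in> L2" "v \<in> L2" "(\<lambda>n. L2_norm (\<lambda>x. u n x - v x)) \<longlonglongrightarrow> 0"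
  shows "(\<lambda>n. L2_norm (u n)) \<longlonglongrightarrow> L2_norm v"
proof (rule LIM_zero_cancel, rule tendsto_rabs_zero_cancel)
  show "(\<lambda>n. \<bar>L2_norm (u n) - L2_norm v\<bar>) \<longlonglongrightarrow> 0"
    using L2_norm_diff_abs[OF assms(1,2)] by (intro tendsto_sandwich[OF _ _ tendsto_const assms(3)]) auto
qed

lemma L2_tendsto_inner:
  assumes "\<And>n. u n \<in> L2" "v \<in> L2" "(\<lambda>n. L2_norm (\<lambda>x. u n x - v x)) \<longlonglongrightarrow> 0" "w \<in> L2"
  shows "(\<lambda>n. L2_inner w (u n)) \<longlonglongrightarrow> L2_inner w v" "(\<lambda>n. L2_inner (u n) w) \<longlonglongrightarrow> L2_inner v w"
proof -
  have z: "(\<lambda>n. L2_norm w * L2_norm (\<lambda>x. u n x - v x)) \<longlonglongrightarrow> 0"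
    using tendsto_mult_left[OF assms(3), of "L2_norm w"] by simp
  have b: "cmod (L2_inner w (u n) - L2_inner w v) \<le> L2_norm w * L2_norm (\<lambda>x. u n x - v x)" for n
    using L2_Cauchy_Schwarz[OF assms(4) L2_diff[OF assms(1)[of n] assms(2)]] assms
    by (simp add: L2_inner_diff_right)
  show *: "(\<lambda>n. L2_inner w (u n)) \<longlonglongrightarrow> L2_inner w v"
    by (rule LIM_zero_cancel, rule tendsto_norm_zero_cancel, rule tendsto_sandwich[OF _ _ tendsto_const z])
      (use b in auto)
  show "(\<lambda>n. L2_inner (u n) w) \<longlonglongrightarrow> L2_inner v w"
    using tendsto_cnj[OF *] by (simp add: L2_inner_cnj)
qed

lemma L2_limit_unique:
  assumes "\<And>n. u n \<in> L2" "v \<in> L2" "w \<in> L2" "(\<lambda>n. L2_norm (\<lambda>x. u n x - v x)) \<longlonglongrightarrow> 0"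
    "(\<lambda>n. L2_norm (\<lambda>x. u n x - w x)) \<longlonglongrightarrow> 0"
  shows "AE x in lebesgue. v x = w x"
proof -
  have "(\<lambda>n. L2_norm (\<lambda>x. u n x - v x) + L2_norm (\<lambda>x. u n x - w x)) \<longlonglongrightarrow> 0"
    using tendsto_add[OF assms(4,5)] by simp
  moreover have "L2_norm (\<lambda>x. v x - w x) \<le> L2_norm (\<lambda>x. u n x - v x) + L2_norm (\<lambda>x. u n x - w x)" for n
    using L2_norm_triangle3[OF assms(2) assms(1)[of n] assms(3)] by (simp add: L2_norm_minus_commute[of v])
  ultimately have "L2_norm (\<lambda>x. v x - w x) \<le> 0"
    by (intro LIMSEQ_le_const[of _ 0]) auto
  then have "L2_norm (\<lambda>x. v x - w x) = 0" by (simp add: order_antisym)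
  then show ?thesis using L2_norm_eq_0[OF L2_diff[OF assms(2,3)]] by auto
qed

lemma L2_norm_tendsto_iff_nn:
  assumes "\<And>n. u n \<in> L2"
  shows "(\<lambda>n. \<integral>\<^sup>+x. ennreal ((cmod (u n x))\<^sup>2) \<partial>lebesgue) \<longlonglongrightarrow> 0 \<longleftrightarrow> (\<lambda>n. L2_norm (u n)) \<longlonglongrightarrow> 0"
proof -
  have "(\<lambda>n. \<integral>\<^sup>+x. ennreal ((cmod (u n x))\<^sup>2) \<partial>lebesgue) = (\<lambda>n. ennreal ((L2_norm (u n))\<^sup>2))"
    using assms by (simp add: L2_norm_nn)
  moreover have "(\<lambda>n. ennreal ((L2_norm (u n))\<^sup>2)) \<longlonglongrightarrow> ennreal 0 \<longleftrightarrow> (\<lambda>n. (L2_norm (u n))\<^sup>2) \<longlonglongrightarrow> 0"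
    by (intro tendsto_ennreal_iff) auto
  moreover have "(\<lambda>n. (L2_norm (u n))\<^sup>2) \<longlonglongrightarrow> 0 \<longleftrightarrow> (\<lambda>n. L2_norm (u n)) \<longlonglongrightarrow> 0"
    using tendsto_power[of "\<lambda>n. L2_norm (u n)" 0 sequentially 2] tendsto_real_sqrt[of "\<lambda>n. (L2_norm (u n))\<^sup>2" 0 sequentially]
    by auto
  ultimately show ?thesis by simp
qed

lemma L2_dominated:
  fixes g :: "real^'n \<Rightarrow> complex"
  assumes g: "g \<in> L2" and u: "\<And>n. u n \<in> borel_measurable lebesgue" and v: "v \<in> borel_measurable lebesgue"
    and lim: "AE x in lebesgue. (\<lambda>n. u n x) \<longlonglongrightarrow> v x"
    and dom: "\<And>n. AE x in lebesgue. cmod (u n x) \<le> cmod (g x)"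
  shows "v \<in> L2" "\<And>n. u n \<in> L2" "(\<lambda>n. L2_norm (\<lambda>x. u n x - v x)) \<longlonglongrightarrow> 0"
proof -
  have domv: "AE x in lebesgue. cmod (v x) \<le> cmod (g x)"
  proof -
    have "AE x in lebesgue. \<forall>n. cmod (u n x) \<le> cmod (g x)" using dom by (simp add: AE_all_countable)
    then show ?thesis using lim
      by eventually_elim (auto intro!: LIMSEQ_le_const2[OF tendsto_norm])
  qed
  show v2: "v \<in> L2" using L2I_dom(1)[OF g v domv] .
  show un: "u n \<in> L2" for n using L2I_dom(1)[OF g u dom] .
  have "(\<lambda>n. LINT x|lebesgue. (cmod (u n x - v x))\<^sup>2) \<longlonglongrightarrow> (LINT (x::real^'n)|lebesgue. (0::real))"
  proof (rule integral_dominated_convergence[where w="\<lambda>x. 4 * (cmod (g x))\<^sup>2"])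
    show "integrable lebesgue (\<lambda>x. 4 * (cmod (g x))\<^sup>2)" using g by (auto simp: L2_def)
    show "AE x in lebesgue. (\<lambda>n. (cmod (u n x - v x))\<^sup>2) \<longlonglongrightarrow> 0"
      using lim by eventually_elim (auto intro!: tendsto_eq_intros simp: LIM_zero_iff)
    show "AE x in lebesgue. norm ((cmod (u n x - v x))\<^sup>2) \<le> 4 * (cmod (g x))\<^sup>2" for n
      using dom[of n] domv
    proof eventually_elim
      case (elim x)
      have "cmod (u n x - v x) \<le> 2 * cmod (g x)" using elim norm_triangle_ineq4[of "u n x" "v x"] by linarith
      then have "(cmod (u n x - v x))\<^sup>2 \<le> (2 * cmod (g x))\<^sup>2" by (intro power_mono) auto
      then show ?case by (simp add: power_mult_distrib)
    qed
  qed (use u v in auto)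
  then have "(\<lambda>n. sqrt (LINT x|lebesgue. (cmod (u n x - v x))\<^sup>2)) \<longlonglongrightarrow> sqrt 0"
    by (intro tendsto_real_sqrt) simp
  then show "(\<lambda>n. L2_norm (\<lambda>x. u n x - v x)) \<longlonglongrightarrow> 0" by (simp add: L2_norm_def)
qed

text \<open>The squared distances tend to 0 in \<open>L1\<close>, so the subsequence theorem for
  \<open>L1\<close> applies. Pointwise limits are needed later to identify the limit of products
  with an unbounded factor \<open>v\<close>, which are not continuous in \<open>L2\<close>.\<close>

lemma L2_tendsto_subseq_AE:
  assumes u: "\<And>n. u n \<in> L2" and v: "v \<in> L2" and lim: "(\<lambda>n. L2_norm (\<lambda>x. u n x - v x)) \<longlonglongrightarrow> 0"
  shows "\<exists>r. strict_mono r \<and> (AE x in lebesgue. (\<lambda>n. u (r n) x) \<longlonglongrightarrow> v x)"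
proof -
  have i: "integrable lebesgue (\<lambda>x. (cmod (u n x - v x))\<^sup>2)" for n
    using L2_diff[OF u v] by (simp add: L2_def)
  have "(\<lambda>n. (L2_norm (\<lambda>x. u n x - v x))\<^sup>2) \<longlonglongrightarrow> 0"
    using tendsto_power[OF lim, of 2] by simp
  then have "(\<lambda>n. LINT x|lebesgue. norm ((cmod (u n x - v x))\<^sup>2)) \<longlonglongrightarrow> 0"
    by (simp add: L2_norm_sq)
  from tendsto_L1_AE_subseq[OF i this] obtain r where
    r: "strict_mono r" "AE x in lebesgue. (\<lambda>n. (cmod (u (r n) x - v x))\<^sup>2) \<longlonglongrightarrow> 0" by blast
  have "AE x in lebesgue. (\<lambda>n. u (r n) x) \<longlonglongrightarrow> v x"
    using r(2)
  proof eventually_elim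
    case (elim x)
    from tendsto_real_sqrt[OF elim] show ?case
      by (simp add: LIM_zero_iff tendsto_norm_zero_iff)
  qed
  with r show ?thesis by blast
qed

text \<open>Riesz--Fischer: along a subsequence with summable increments, the increments are
  dominated by an \<open>L\<^sup>2\<close> function.\<close>

lemma L2_complete:
  fixes u :: "nat \<Rightarrow> real^'n \<Rightarrow> complex"
  assumes u: "\<And>n. u n \<in> L2"
    and cauchy: "\<And>e. e > 0 \<Longrightarrow> \<exists>N. \<forall>m\<ge>N. \<forall>n\<ge>N. L2_norm (\<lambda>x. u m x - u n x) < e"
  shows "\<exists>v\<in>L2. (\<lambda>n. L2_norm (\<lambda>x. u n x - v x)) \<longlonglongrightarrow> 0"
proof -
  obtain N where N: "\<And>k m n. m \<ge> N k \<Longrightarrow> n \<ge> N k \<Longrightarrow> L2_norm (\<lambda>x. u m x - u n x) < (1/2)^(k::nat)"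
    using cauchy[of "(1/2)^_"] by (metis zero_less_power half_gt_zero_iff zero_less_one)
  \<comment> \<open>\<open>N\<close> need not be monotone. The partial sum dominates
    \<open>N k\<close> at both \<open>k\<close> and \<open>Suc k\<close>, which bounds the increment
    by \<open>(1/2)^k\<close>; the summand \<open>k\<close> ensures
    \<open>r k \<ge> k\<close>.\<close>
  define r where "r k = (\<Sum>i\<le>k. N i) + k" for k
  have rN: "r k \<ge> N k" "r (Suc k) \<ge> N k" for k
  proof -
    have "N k \<le> (\<Sum>i\<le>k. N i)" by (rule member_le_sum) auto
    then show "r k \<ge> N k" "r (Suc k) \<ge> N k" by (auto simp: r_def)
  qed
  have rk: "r k \<ge> k" for k by (simp add: r_def)
  define d where "d k x = cmod (u (r (Suc k)) x - u (r k) x)" for k x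
  have [measurable]: "\<And>n. u n \<in> borel_measurable lebesgue" using u by (rule L2_measurable)
  have [measurable]: "d k \<in> borel_measurable lebesgue" for k unfolding d_def by measurable
  have dL: "(\<lambda>x. complex_of_real (d k x)) \<in> L2" "L2_norm (\<lambda>x. complex_of_real (d k x)) \<le> (1/2)^k" for k
  proof -
    have a: "(\<lambda>x. u (r (Suc k)) x - u (r k) x) \<in> L2" by (intro L2_diff u)
    show "(\<lambda>x. complex_of_real (d k x)) \<in> L2"
      by (rule L2I_dom(1)[OF a]) (auto simp: d_def)
    have "L2_norm (\<lambda>x. complex_of_real (d k x)) = L2_norm (\<lambda>x. u (r (Suc k)) x - u (r k) x)"
      by (simp add: L2_norm_def d_def)
    then show "L2_norm (\<lambda>x. complex_of_real (d k x)) \<le> (1/2)^k"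
      using N[OF rN(2) rN(1), of k] by linarith
  qed
  define s where "s K x = (\<Sum>k<K. d k x)" for K x
  have sL: "(\<lambda>x. complex_of_real (s K x)) \<in> L2" for K
    unfolding s_def of_real_sum by (intro L2_sum dL)
  have sN: "L2_norm (\<lambda>x. complex_of_real (s K x)) \<le> 2" for K
  proof -
    have "L2_norm (\<lambda>x. complex_of_real (s K x)) \<le> (\<Sum>k<K. (1/2)^k)"
    proof (induction K)
      case 0 then show ?case by (simp add: s_def)
    next
      case (Suc K)
      have "L2_norm (\<lambda>x. complex_of_real (s K x) + complex_of_real (d K x)) \<le>
          L2_norm (\<lambda>x. complex_of_real (s K x)) + L2_norm (\<lambda>x. complex_of_real (d K x))"
        by (rule L2_norm_triangle[OF sL dL(1)])
      then show ?case using Suc dL(2)[of K] by (simp add: s_def)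
    qed
    also have "\<dots> \<le> 2" using sum_gp_strict[of "1/2::real" K] by simp
    finally show ?thesis .
  qed
  have s0: "0 \<le> s K x" "s K x \<le> s (Suc K) x" for K x by (auto simp: s_def d_def intro!: sum_nonneg)
  have incs: "incseq (\<lambda>K. ennreal ((s K x)\<^sup>2))" for x
    using s0 by (intro incseq_SucI ennreal_leI power_mono) auto
  have [measurable]: "s K \<in> borel_measurable lebesgue" for K unfolding s_def by measurable
  have "(\<integral>\<^sup>+x. (SUP K. ennreal ((s K x)\<^sup>2)) \<partial>lebesgue) = (SUP K. \<integral>\<^sup>+x. ennreal ((s K x)\<^sup>2) \<partial>lebesgue)"
    using incs by (intro nn_integral_monotone_convergence_SUP) (auto simp: incseq_def le_fun_def)
  also have "\<dots> \<le> 4"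
  proof (rule SUP_least)
    fix K
    have "(\<integral>\<^sup>+x. ennreal ((s K x)\<^sup>2) \<partial>lebesgue) = ennreal ((L2_norm (\<lambda>x. complex_of_real (s K x)))\<^sup>2)"
      using L2_norm_nn[OF sL] by simp
    also have "\<dots> \<le> ennreal (2\<^sup>2)" using sN by (intro ennreal_leI power_mono) auto
    finally show "(\<integral>\<^sup>+x. ennreal ((s K x)\<^sup>2) \<partial>lebesgue) \<le> 4" by simp
  qed
  finally have fin: "(\<integral>\<^sup>+x. (SUP K. ennreal ((s K x)\<^sup>2)) \<partial>lebesgue) \<le> 4" .
  then have "(\<integral>\<^sup>+x. (SUP K. ennreal ((s K x)\<^sup>2)) \<partial>lebesgue) \<noteq> \<infinity>" by (auto simp: top_unique)
  then have ae: "AE x in lebesgue. (SUP K. ennreal ((s K x)\<^sup>2)) \<noteq> \<infinity>"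
    by (intro nn_integral_PInf_AE) auto
  \<comment> \<open>The supremum is infinite on a null set only. The default value 0 there makes the
    majorant a real function without enlarging its norm.\<close>
  define S where "S x = (if (SUP K. ennreal ((s K x)\<^sup>2)) \<noteq> \<infinity> then sqrt (enn2real (SUP K. ennreal ((s K x)\<^sup>2))) else 0)" for x
  have [measurable]: "S \<in> borel_measurable lebesgue" unfolding S_def by measurable
  have sS: "s K x \<le> S x" if "(SUP K. ennreal ((s K x)\<^sup>2)) \<noteq> \<infinity>" for K x
  proof -
    have "ennreal ((s K x)\<^sup>2) \<le> (SUP K. ennreal ((s K x)\<^sup>2))" by (rule SUP_upper) simp
    then have "(s K x)\<^sup>2 \<le> enn2real (SUP K. ennreal ((s K x)\<^sup>2))"
      using that by (metis enn2real_ennreal enn2real_mono infinity_ennreal_def less_top zero_le_power2)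
    then show ?thesis using that s0 by (simp add: S_def real_le_rsqrt)
  qed
  have SL: "(\<lambda>x. complex_of_real (S x)) \<in> L2"
  proof -
    have "(\<integral>\<^sup>+x. ennreal ((S x)\<^sup>2) \<partial>lebesgue) \<le> (\<integral>\<^sup>+x. (SUP K. ennreal ((s K x)\<^sup>2)) \<partial>lebesgue)"
      by (intro nn_integral_mono) (auto simp: S_def less_top[symmetric] real_sqrt_pow2)
    then show ?thesis using fin by (auto simp: L2_iff top_unique less_top[symmetric])
  qed
  \<comment> \<open>Subtracting the first member leaves a telescoping sum of increments, which
    \<open>s k\<close> dominates.\<close>
  define f where "f k x = u (r k) x - u (r 0) x" for k x
  have fs: "cmod (f k x) \<le> s k x" for k x
  proof -
    have "f k x = (\<Sum>i<k. u (r (Suc i)) x - u (r i) x)" using sum_lessThan_telescope[of "\<lambda>i. u (r i) x" k] by (simp add: f_def)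
    then show ?thesis unfolding s_def d_def by (simp add: norm_sum)
  qed
  have conv: "convergent (\<lambda>k. f k x)" if "(SUP K. ennreal ((s K x)\<^sup>2)) \<noteq> \<infinity>" for x
  proof -
    have "summable (\<lambda>k. d k x)"
      by (rule summableI_nonneg_bounded[where x="S x"]) (use sS[OF that] in \<open>auto simp: s_def d_def\<close>)
    then have "summable (\<lambda>i. u (r (Suc i)) x - u (r i) x)"
      unfolding d_def by (rule summable_norm_cancel)
    then show ?thesis unfolding summable_iff_convergent f_def
      using sum_lessThan_telescope[of "\<lambda>i. u (r i) x"] by simp
  qed
  define g where "g x = lim (\<lambda>k. f k x)" for x
  have fm [measurable]: "f k \<in> borel_measurable lebesgue" for k unfolding f_def by measurable
  have [measurable]: "g \<in> borel_measurable lebesgue" unfolding g_def by (rule borel_measurable_lim_metric) (rule fm)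
  have lim: "AE x in lebesgue. (\<lambda>n. f n x) \<longlonglongrightarrow> g x"
    using ae by eventually_elim (use conv in \<open>auto simp: g_def convergent_LIMSEQ_iff\<close>)
  have dom: "AE x in lebesgue. cmod (f n x) \<le> cmod (complex_of_real (S x))" for n
    using ae
  proof eventually_elim
    case (elim x)
    have "cmod (f n x) \<le> s n x" by (rule fs)
    also have "\<dots> \<le> S x" by (rule sS[OF elim])
    also have "\<dots> \<le> cmod (complex_of_real (S x))" by simp
    finally show ?case .
  qed
  note D = L2_dominated[OF SL fm _ lim dom]
  define v where "v x = g x + u (r 0) x" for x
  have gL: "g \<in> L2" by (rule D(1)) simp
  have vL: "v \<in> L2" unfolding v_def by (intro L2_add gL u)
  have sub: "(\<lambda>k. L2_norm (\<lambda>x. u (r k) x - v x)) \<longlonglongrightarrow> 0"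
  proof -
    have "(\<lambda>k. L2_norm (\<lambda>x. f k x - g x)) \<longlonglongrightarrow> 0" by (rule D(3)) simp
    moreover have "(\<lambda>x. f k x - g x) = (\<lambda>x. u (r k) x - v x)" for k
      by (auto simp: f_def v_def)
    ultimately show ?thesis by simp
  qed
  have "(\<lambda>n. L2_norm (\<lambda>x. u n x - v x)) \<longlonglongrightarrow> 0"
  proof (rule LIMSEQ_I)
    fix e :: real assume e: "e > 0"
    obtain M where M: "\<And>m n. m \<ge> M \<Longrightarrow> n \<ge> M \<Longrightarrow> L2_norm (\<lambda>x. u m x - u n x) < e / 2"
      using cauchy[of "e/2"] e by (auto)
    obtain K where K: "\<And>k. k \<ge> K \<Longrightarrow> L2_norm (\<lambda>x. u (r k) x - v x) < e / 2"
      using LIMSEQ_D[OF sub, of "e/2"] e by auto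
    show "\<exists>no. \<forall>n\<ge>no. norm (L2_norm (\<lambda>x. u n x - v x) - 0) < e"
    proof (intro exI allI impI)
      fix n assume n: "n \<ge> M"
      define k where "k = max K M"
      have "r k \<ge> M" using rk[of k] by (simp add: k_def)
      have "L2_norm (\<lambda>x. u n x - v x) \<le> L2_norm (\<lambda>x. u n x - u (r k) x) + L2_norm (\<lambda>x. u (r k) x - v x)"
        by (rule L2_norm_triangle3[OF u u vL])
      also have "\<dots> < e" using M[OF n \<open>r k \<ge> M\<close>] K[of k] by (simp add: k_def)
      finally show "norm (L2_norm (\<lambda>x. u n x - v x) - 0) < e" by simp
    qed
  qed
  with vL show ?thesis by blast
qed

section \<open>Translations and density\<close>

lemma lebesgue_translation:
  fixes t :: "'a::euclidean_space"
  shows "distr lebesgue lebesgue (\<lambda>x. x + t) = (lebesgue :: 'a measure)"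
    and measurable_lebesgue_translation [measurable]: "(\<lambda>x. x + t) \<in> lebesgue \<rightarrow>\<^sub>M (lebesgue :: 'a measure)"
proof -
  have T: "(\<lambda>x. t + (\<Sum>j\<in>Basis. (1 * (x \<bullet> j)) *\<^sub>R j)) = (\<lambda>x. x + t)"
    by (simp add: euclidean_representation add.commute)
  show "distr lebesgue lebesgue (\<lambda>x. x + t) = (lebesgue :: 'a measure)"
    using lebesgue_affine_euclidean[of "\<lambda>_. 1" t] unfolding T by (simp add: density_1)
  show "(\<lambda>x. x + t) \<in> lebesgue \<rightarrow>\<^sub>M (lebesgue :: 'a measure)"
    using lebesgue_affine_measurable[of "\<lambda>_. 1" t] unfolding T by simp
qed

lemma lebesgue_integral_translation:
  fixes u :: "'a::euclidean_space \<Rightarrow> 'b::{banach, second_countable_topology}"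
  assumes "u \<in> borel_measurable lebesgue"
  shows "(LINT x|lebesgue. u (x + t)) = (LINT x|lebesgue. u x)"
  using integral_distr[OF measurable_lebesgue_translation assms, of t] by (simp add: lebesgue_translation)

lemma lebesgue_nn_integral_translation:
  fixes u :: "'a::euclidean_space \<Rightarrow> ennreal"
  assumes "u \<in> borel_measurable lebesgue"
  shows "(\<integral>\<^sup>+x. u (x + t) \<partial>lebesgue) = (\<integral>\<^sup>+x. u x \<partial>lebesgue)"
  using nn_integral_distr[OF measurable_lebesgue_translation, of u t] assms by (simp add: lebesgue_translation)

lemma AE_lebesgue_translation:
  fixes t :: "'a::euclidean_space"
  assumes "AE x in lebesgue. P x" shows "AE x in lebesgue. P (x + t)"
proof -
  obtain N where N: "N \<in> null_sets lebesgue" "{x\<in>space lebesgue. \<not> P x} \<subseteq> N"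
    using assms by (force elim!: AE_E simp: null_sets_def)
  have "(\<lambda>x. x + t) -` N \<inter> space lebesgue \<in> null_sets lebesgue"
    using N(1) null_sets_distr_iff[OF measurable_lebesgue_translation, of N t] by (simp add: lebesgue_translation)
  then show ?thesis by (rule AE_I') (use N(2) in auto)
qed

lemma L2_translate:
  assumes "u \<in> L2"
  shows "(\<lambda>x. u (x + t)) \<in> L2" "L2_norm (\<lambda>x. u (x + t)) = L2_norm u"
proof -
  have m [measurable]: "u \<in> borel_measurable lebesgue" using assms by (rule L2_measurable)
  have m': "(\<lambda>x. u (x + t)) \<in> borel_measurable lebesgue"
    using measurable_compose[OF measurable_lebesgue_translation m] .
  show "(\<lambda>x. u (x + t)) \<in> L2"
    using assms lebesgue_nn_integral_translation[of "\<lambda>x. ennreal ((cmod (u x))\<^sup>2)" t] m' by (simp add: L2_iff)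
  show "L2_norm (\<lambda>x. u (x + t)) = L2_norm u"
    using lebesgue_integral_translation[of "\<lambda>x. (cmod (u x))\<^sup>2" t] by (simp add: L2_norm_def)
qed

lemma L2_approx_bounded:
  fixes u :: "real^'n \<Rightarrow> complex"
  assumes u: "u \<in> L2"
  shows "(\<lambda>n. L2_norm (\<lambda>x. indicator {x. norm x \<le> real n \<and> cmod (u x) \<le> real n} x * u x - u x)) \<longlonglongrightarrow> 0"
proof (rule L2_dominated(3)[OF u])
  have [measurable]: "u \<in> borel_measurable lebesgue" using u by (rule L2_measurable)
  have "{x \<in> space lebesgue. norm x \<le> real n \<and> cmod (u x) \<le> real n} \<in> sets lebesgue" for n by measurable
  then show "(\<lambda>x. indicator {x. norm x \<le> real n \<and> cmod (u x) \<le> real n} x * u x) \<in> borel_measurable lebesgue" for n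
    by simp
  show "AE x in lebesgue. (\<lambda>n. indicator {x. norm x \<le> real n \<and> cmod (u x) \<le> real n} x * u x) \<longlonglongrightarrow> u x"
  proof (intro AE_I2)
    fix x
    obtain N where N: "max (norm x) (cmod (u x)) \<le> real N" using real_arch_simple by blast
    have "eventually (\<lambda>n. indicator {x. norm x \<le> real n \<and> cmod (u x) \<le> real n} x * u x = u x) sequentially"
      using eventually_ge_at_top[of N]
    proof eventually_elim
      case (elim n)
      then have "real N \<le> real n" by simp
      with N have "norm x \<le> real n" "cmod (u x) \<le> real n" by linarith+
      then show ?case by simp
    qed
    then show "(\<lambda>n. indicator {x. norm x \<le> real n \<and> cmod (u x) \<le> real n} x * u x) \<longlonglongrightarrow> u x"
      by (rule tendsto_eventually)
  qed
qed (use u L2_measurable in \<open>auto simp: indicator_def\<close>)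

lemma L2_indicator_cball: "(indicator (cball 0 r) :: real^'n \<Rightarrow> complex) \<in> L2"
proof -
  have "(\<integral>\<^sup>+x. ennreal ((cmod (indicator (cball 0 r) (x::real^'n)))\<^sup>2) \<partial>lebesgue) =
      (\<integral>\<^sup>+x. indicator (cball 0 r) (x::real^'n) \<partial>lebesgue)"
    by (intro nn_integral_cong) (auto simp: indicator_def)
  also have "\<dots> = emeasure lborel (cball 0 r :: (real^'n) set)" by (simp add: emeasure_completion)
  also have "\<dots> < \<infinity>" using emeasure_bounded_finite[of "cball 0 r :: (real^'n) set"] by simp
  finally show ?thesis by (auto simp: L2_iff intro!: borel_measurable_indicator)
qed

text \<open>Lebesgue measurability provides continuous functions converging to \<open>u\<close> off
  a negligible set, but neither bounded nor of bounded support. Clipping the modulus at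
  \<open>B\<close> and multiplying by the tent \<open>ch\<close> both leave \<open>u\<close>
  unchanged, so the limit survives and dominated convergence applies.\<close>

lemma L2_bounded_support_approx_continuous:
  fixes u :: "real^'n \<Rightarrow> complex"
  assumes u [measurable]: "u \<in> borel_measurable lebesgue" and bd: "\<And>x. cmod (u x) \<le> B"
    and sp: "\<And>x. norm x > R \<Longrightarrow> u x = 0" and e: "e > 0"
  shows "\<exists>g. continuous_on UNIV g \<and> (\<forall>x. cmod (g x) \<le> B) \<and> (\<forall>x. norm x > R + 1 \<longrightarrow> g x = 0) \<and>
     g \<in> L2 \<and> L2_norm (\<lambda>x. g x - u x) < e"
proof -
  have "u measurable_on UNIV"
    using lebesgue_measurable_imp_measurable_on[of u UNIV] u by simp
  then obtain N g where N: "negligible N" and gc: "\<And>n::nat. continuous_on UNIV (g n)"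
    and gl: "\<And>x. x \<notin> N \<Longrightarrow> (\<lambda>n. g n x) \<longlonglongrightarrow> u x"
    unfolding measurable_on_def by auto
  \<comment> \<open>Radial projection onto the disc of radius \<open>B\<close>. Its continuity needs
    a nonzero denominator at \<open>z = 0\<close>, hence the separate case
    \<open>B = 0\<close>.\<close>
  define clip where "clip z = complex_of_real (B / max B (cmod z)) * z" for z
  define ch where "ch x = max 0 (min 1 (R + 1 - norm x))" for x :: "real^'n"
  have B0: "0 \<le> B" using bd[of 0] norm_ge_zero order_trans by blast
  show ?thesis
  proof (cases "B = 0")
    case True
    then have "u = (\<lambda>_. 0)" using bd by (auto simp: fun_eq_iff)
    then show ?thesis using e by (intro exI[of _ "\<lambda>_. 0"]) (auto simp: True)
  next
    case False
    with B0 have B: "B > 0" by simp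
    have clipc: "continuous_on UNIV clip"
      unfolding clip_def using B by (intro continuous_intros) (auto simp: max_def)
    have clipb: "cmod (clip z) \<le> B" for z
    proof -
      have "cmod (clip z) = B * (cmod z / max B (cmod z))"
        using B by (simp add: clip_def norm_mult norm_divide)
      also have "\<dots> \<le> B * 1" using B by (intro mult_left_mono) (auto simp: divide_le_eq max_def)
      finally show ?thesis by simp
    qed
    have clipi: "clip z = z" if "cmod z \<le> B" for z using that B by (simp add: clip_def max_def)
    define f where "f n x = complex_of_real (ch x) * clip (g n x)" for n x
    have ch01: "0 \<le> ch x" "ch x \<le> 1" for x by (auto simp: ch_def)
    have chu: "complex_of_real (ch x) * u x = u x" for x
      using sp[of x] by (cases "norm x > R") (simp_all add: ch_def)
    have chc: "continuous_on UNIV (\<lambda>x. complex_of_real (ch x))" unfolding ch_def by (intro continuous_intros)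
    have fc: "continuous_on UNIV (f n)" for n unfolding f_def
      by (intro continuous_on_mult chc continuous_on_compose2[OF clipc gc]) auto
    have fb: "cmod (f n x) \<le> B" for n x
      using mult_mono[OF ch01(2)[of x] clipb[of "g n x"]] ch01(1)[of x] by (simp add: f_def norm_mult)
    have fs: "norm x > R + 1 \<Longrightarrow> f n x = 0" for n x by (simp add: f_def ch_def)
    have D: "(\<lambda>x. complex_of_real B * indicator (cball 0 (R+1)) x) \<in> (L2 :: (real^'n \<Rightarrow> complex) set)"
      by (intro L2_scale L2_indicator_cball)
    have lim: "AE x in lebesgue. (\<lambda>n. f n x) \<longlonglongrightarrow> u x"
    proof (rule AE_I')
      show "N \<in> null_sets lebesgue" using N by (simp add: negligible_iff_null_sets)
      have "(\<lambda>n. f n x) \<longlonglongrightarrow> u x" if "x \<notin> N" for x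
      proof -
        have "(\<lambda>n. f n x) \<longlonglongrightarrow> complex_of_real (ch x) * clip (u x)"
          unfolding f_def using clipc by (intro tendsto_mult tendsto_const continuous_on_tendsto_compose[OF _ gl[OF that]]) auto
        then show ?thesis using clipi[OF bd] chu by simp
      qed
      then show "{x \<in> space lebesgue. \<not> (\<lambda>n. f n x) \<longlonglongrightarrow> u x} \<subseteq> N" by auto
    qed
    have fm: "f n \<in> borel_measurable lebesgue" for n
      using borel_measurable_continuous_onI[OF fc] by simp
    have dom: "AE x in lebesgue. cmod (f n x) \<le> cmod (complex_of_real B * indicator (cball 0 (R+1)) x)" for n
      using fb fs B by (intro AE_I2) (auto simp: indicator_def norm_mult not_le)
    note Z = L2_dominated[OF D fm u lim dom]
    have "eventually (\<lambda>n. L2_norm (\<lambda>x. f n x - u x) < e) sequentially"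
      using order_tendstoD(2)[OF Z(3) e] .
    then obtain n where "L2_norm (\<lambda>x. f n x - u x) < e" using eventually_happens by fastforce
    then show ?thesis using fc fb fs Z(2) by (intro exI[of _ "f n"]) auto
  qed
qed

lemma L2_approx_continuous:
  fixes u :: "real^'n \<Rightarrow> complex"
  assumes u: "u \<in> L2" and e: "e > 0"
  shows "\<exists>g R B. continuous_on UNIV g \<and> (\<forall>x. cmod (g x) \<le> B) \<and> (\<forall>x. norm x > R \<longrightarrow> g x = 0) \<and>
     g \<in> L2 \<and> L2_norm (\<lambda>x. g x - u x) < e"
proof -
  obtain n where n: "L2_norm (\<lambda>x. indicator {x. norm x \<le> real n \<and> cmod (u x) \<le> real n} x * u x - u x) < e/2"
    using order_tendstoD(2)[OF L2_approx_bounded[OF u], of "e/2"] e eventually_happens by fastforce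
  define w where "w x = indicator {x. norm x \<le> real n \<and> cmod (u x) \<le> real n} x * u x" for x
  have [measurable]: "u \<in> borel_measurable lebesgue" using u by (rule L2_measurable)
  have S: "{x. norm x \<le> real n \<and> cmod (u x) \<le> real n} \<in> sets lebesgue"
  proof -
    have "{x \<in> space lebesgue. norm x \<le> real n \<and> cmod (u x) \<le> real n} \<in> sets lebesgue" by measurable
    then show ?thesis by simp
  qed
  have w: "w \<in> L2" unfolding w_def by (rule L2_indicator(1)[OF u S])
  have "\<exists>g. continuous_on UNIV g \<and> (\<forall>x. cmod (g x) \<le> real n) \<and> (\<forall>x. norm x > real n + 1 \<longrightarrow> g x = 0) \<and>
     g \<in> L2 \<and> L2_norm (\<lambda>x. g x - w x) < e/2"
    by (rule L2_bounded_support_approx_continuous) (use w L2_measurable e in \<open>auto simp: w_def indicator_def\<close>)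
  then obtain g where g: "continuous_on UNIV g" "\<forall>x. cmod (g x) \<le> real n" "\<forall>x. norm x > real n + 1 \<longrightarrow> g x = 0"
     "g \<in> L2" "L2_norm (\<lambda>x. g x - w x) < e/2" by blast
  have "L2_norm (\<lambda>x. g x - u x) < e"
    using L2_norm_triangle3[OF g(4) w u] g(5) n by (simp add: w_def)
  with g show ?thesis by blast
qed

text \<open>Translation is an isometry, so density reduces the claim to continuous functions of
  bounded support. It drives the limits in the Plancherel identity and in the commutator
  argument.\<close>

lemma L2_translation_continuous:
  fixes u :: "real^'n \<Rightarrow> complex"
  assumes u: "u \<in> L2" and h: "h \<longlonglongrightarrow> 0"
  shows "(\<lambda>n. L2_norm (\<lambda>x. u (x + h n) - u x)) \<longlonglongrightarrow> 0"
proof (rule LIMSEQ_I)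
  fix e :: real assume e: "e > 0"
  obtain g R B where g: "continuous_on UNIV g" "\<And>x. cmod (g x) \<le> B" "\<And>x. norm x > R \<Longrightarrow> g x = 0"
     "g \<in> L2" "L2_norm (\<lambda>x. g x - u x) < e/3"
    using L2_approx_continuous[OF u, of "e/3"] e by auto
  have gm [measurable]: "g \<in> borel_measurable borel" using borel_measurable_continuous_onI[OF g(1)] .
  \<comment> \<open>Shifts shorter than 1 keep all translates of \<open>g\<close> inside one ball,
    whose indicator times \<open>B\<close> dominates; this is why the sequence is started at
    \<open>M\<close>.\<close>
  obtain M where M: "\<And>n. n \<ge> M \<Longrightarrow> norm (h n) < 1" using LIMSEQ_D[OF h, of 1] by auto
  have B0: "0 \<le> B" using g(2)[of 0] norm_ge_zero order_trans by blast
  have "(\<lambda>n. L2_norm (\<lambda>x. g (x + h (n + M)) - g x)) \<longlonglongrightarrow> 0"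
  proof (rule L2_dominated(3))
    show "(\<lambda>x. complex_of_real B * indicator (cball 0 (R+1)) x) \<in> (L2 :: (real^'n \<Rightarrow> complex) set)"
      by (intro L2_scale L2_indicator_cball)
    show "(\<lambda>x. g (x + h (n + M))) \<in> borel_measurable lebesgue" for n by measurable
    show "g \<in> borel_measurable lebesgue" by measurable
    show "AE x in lebesgue. (\<lambda>n. g (x + h (n + M))) \<longlonglongrightarrow> g x"
    proof (intro AE_I2)
      fix x
      have "(\<lambda>n. x + h (n + M)) \<longlonglongrightarrow> x" 
        using tendsto_add[OF tendsto_const LIMSEQ_ignore_initial_segment[OF h], of x] by simp
      then show "(\<lambda>n. g (x + h (n + M))) \<longlonglongrightarrow> g x" 
        by (rule continuous_on_tendsto_compose[OF g(1)]) auto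
    qed
    show "AE x in lebesgue. cmod (g (x + h (n + M))) \<le> cmod (complex_of_real B * indicator (cball 0 (R+1)) x)" for n
    proof (intro AE_I2)
      fix x
      show "cmod (g (x + h (n + M))) \<le> cmod (complex_of_real B * indicator (cball 0 (R+1)) x)"
      proof (cases "norm x \<le> R + 1")
        case True then show ?thesis using g(2) B0 by (simp add: norm_mult)
      next
        case False
        have "norm x \<le> norm (x + h (n+M)) + norm (h (n+M))" 
          using norm_triangle_ineq4[of "x + h (n+M)" "h (n+M)"] by simp
        then have "norm (x + h (n+M)) > R" using False M[of "n+M"] by simp
        then show ?thesis using g(3) by simp
      qed
    qed
  qed
  from LIMSEQ_D[OF this, of "e/3"] e obtain K where
    K: "\<And>n. n \<ge> K \<Longrightarrow> L2_norm (\<lambda>x. g (x + h (n + M)) - g x) < e/3" by auto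
  show "\<exists>no. \<forall>n\<ge>no. norm (L2_norm (\<lambda>x. u (x + h n) - u x) - 0) < e"
  proof (intro exI allI impI)
    fix n assume n: "n \<ge> K + M"
    have 1: "L2_norm (\<lambda>x. g (x + h n) - g x) < e/3" using K[of "n - M"] n by simp
    have "L2_norm (\<lambda>x. u (x + h n) - g (x + h n)) = L2_norm (\<lambda>x. u x - g x)"
      using L2_translate(2)[OF L2_diff[OF u g(4)]] .
    also have "\<dots> < e/3" using g(5) by (subst L2_norm_minus_commute)
    finally have 2: "L2_norm (\<lambda>x. u (x + h n) - g (x + h n)) < e/3" .
    have "L2_norm (\<lambda>x. u (x + h n) - u x) \<le> L2_norm (\<lambda>x. u (x + h n) - g (x + h n)) + L2_norm (\<lambda>x. g (x + h n) - u x)"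
      by (rule L2_norm_triangle3) (intro L2_translate u g)+
    also have "L2_norm (\<lambda>x. g (x + h n) - u x) \<le> L2_norm (\<lambda>x. g (x + h n) - g x) + L2_norm (\<lambda>x. g x - u x)"
      by (rule L2_norm_triangle3) (intro L2_translate u g)+
    finally have "L2_norm (\<lambda>x. u (x + h n) - u x) < e" using 1 2 g(5) by simp
    then show "norm (L2_norm (\<lambda>x. u (x + h n) - u x) - 0) < e" by simp
  qed
qed

section \<open>Gaussian integrals and tools for Fubini's theorem\<close>

lemma lborel_integral_prod:
  fixes f :: "'a::euclidean_space \<Rightarrow> real \<Rightarrow> complex"
  assumes "\<And>b. b \<in> Basis \<Longrightarrow> integrable lborel (f b)"
  shows "integrable lborel (\<lambda>x. \<Prod>b\<in>Basis. f b (x \<bullet> b))"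
    "(LINT x|lborel. (\<Prod>b\<in>Basis. f b (x \<bullet> b))) = (\<Prod>b\<in>Basis. LINT t|lborel. f b t)"
proof -
  interpret product_sigma_finite "\<lambda>_::'a. lborel :: real measure" by standard
  have [measurable]: "b \<in> Basis \<Longrightarrow> f b \<in> borel_measurable borel" for b using assms by (auto dest: borel_measurable_integrable)
  have m: "(\<lambda>x. \<Prod>b\<in>Basis. f b (x \<bullet> b)) \<in> borel_measurable borel" by measurable
  have eq: "(\<Prod>b\<in>Basis. f b ((\<Sum>i\<in>Basis. g i *\<^sub>R i) \<bullet> b)) = (\<Prod>b\<in>Basis. f b (g b))" for g :: "'a \<Rightarrow> real"
    by (intro prod.cong refl) (simp add: inner_sum_left inner_Basis if_distrib cong: if_cong)
  have m2: "(\<lambda>g. \<Sum>i\<in>Basis. g i *\<^sub>R i) \<in> (\<Pi>\<^sub>M b\<in>Basis. lborel :: real measure) \<rightarrow>\<^sub>M (borel :: 'a measure)"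
    by measurable
  show "integrable lborel (\<lambda>x. \<Prod>b\<in>Basis. f b (x \<bullet> b))"
    unfolding lborel_eq[where 'a='a] using m by (subst integrable_distr_eq[OF m2]) (auto simp: eq intro!: product_integrable_prod assms)
  show "(LINT x|lborel. (\<Prod>b\<in>Basis. f b (x \<bullet> b))) = (\<Prod>b\<in>Basis. LINT t|lborel. f b t)"
    unfolding lborel_eq[where 'a='a] using m by (subst integral_distr[OF m2]) (auto simp: eq intro!: product_integral_prod assms)
qed

text \<open>After the substitution \<open>x \<mapsto> s * x\<close> this is the characteristic
  function of the standard normal distribution, freed of its normalisation.\<close>

lemma gaussian_fourier_real:
  "integrable lborel (\<lambda>x. complex_of_real (exp (- (s * x)\<^sup>2 / 2)) * cis (x * y))" (is "integrable _ ?f")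
  "(LINT x|lborel. complex_of_real (exp (- (s * x)\<^sup>2 / 2)) * cis (x * y))
     = complex_of_real (sqrt (2 * pi) / s * exp (- (y / s)\<^sup>2 / 2))" if s: "s > 0" for s y :: real
proof -
  define F where "F z x = complex_of_real (exp (- x\<^sup>2 / 2)) * cis (x * z)" for x z :: real
  have i0: "integrable lborel (\<lambda>x. std_normal_density x)" using integrable_std_normal_moment[of 0] by simp
  have nd: "exp (- x\<^sup>2 / 2) = sqrt (2 * pi) * std_normal_density x" for x :: real
    by (simp add: std_normal_density_def)
  have Fi: "integrable lborel (F z)" for z
  proof (rule Bochner_Integration.integrable_bound[where f="\<lambda>x. sqrt (2*pi) * std_normal_density x"])
    show "F z \<in> borel_measurable lborel" unfolding F_def cis_conv_exp by measurable
    show "AE x in lborel. norm (F z x) \<le> norm (sqrt (2*pi) * std_normal_density x)"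
      unfolding F_def nd[symmetric] by (auto simp: norm_mult)
  qed (use i0 in auto)
  have FI: "(LINT x|lborel. F z x) = complex_of_real (sqrt (2*pi) * exp (- z\<^sup>2 / 2))" for z
  proof -
    have "complex_of_real (exp (- z\<^sup>2 / 2)) = char std_normal_distribution z"
      by (simp add: char_std_normal_distribution)
    also have "\<dots> = (LINT x|lborel. std_normal_density x *\<^sub>R iexp (z * x))"
      unfolding char_def by (subst integral_density) (auto intro!: AE_I2)
    also have "\<dots> = (LINT x|lborel. complex_of_real (1 / sqrt (2*pi)) * F z x)"
      by (intro Bochner_Integration.integral_cong refl)
        (simp add: F_def std_normal_density_def cis_conv_exp scaleR_conv_of_real mult_ac exp_of_real)
    also have "\<dots> = complex_of_real (1 / sqrt (2*pi)) * (LINT x|lborel. F z x)" by simp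
    finally show ?thesis by (simp add: field_simps)
  qed
  have eq: "?f = (\<lambda>x. F (y / s) (0 + s * x))" using s by (auto simp: F_def fun_eq_iff)
  show "integrable lborel ?f" unfolding eq using s Fi by (intro lborel_integrable_real_affine) auto
  have "(LINT x|lborel. F (y/s) x) = s *\<^sub>R (LINT x|lborel. F (y/s) (0 + s * x))"
    using lborel_integral_real_affine[of s "F (y/s)" 0] s by simp
  then show "(LINT x|lborel. complex_of_real (exp (- (s * x)\<^sup>2 / 2)) * cis (x * y))
     = complex_of_real (sqrt (2 * pi) / s * exp (- (y / s)\<^sup>2 / 2))"
    unfolding eq FI using s by (simp add: scaleR_conv_of_real field_simps)
qed

lemma cis_inner: "cis (x \<bullet> y) = (\<Prod>b\<in>Basis. cis ((x \<bullet> b) * (y \<bullet> b)))"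
  by (subst euclidean_inner) (simp add: cis_conv_exp exp_sum sum_distrib_left)

lemma exp_norm_sq: "exp (- (s * norm x)\<^sup>2 / 2) = (\<Prod>b\<in>Basis. exp (- (s * (x \<bullet> b))\<^sup>2 / 2))"
proof -
  have "(s * norm x)\<^sup>2 = (\<Sum>b\<in>Basis. (s * (x \<bullet> b))\<^sup>2)"
    by (simp add: power_mult_distrib power2_norm_eq_inner euclidean_inner[of x x] sum_distrib_left power2_eq_square
        flip: power2_eq_square)
  then show ?thesis by (simp add: exp_sum sum_divide_distrib flip: sum_negf)
qed

lemma gaussian_fourier:
  fixes h :: "'a::euclidean_space"
  assumes s: "s > 0"
  shows "integrable lborel (\<lambda>x. complex_of_real (exp (- (s * norm x)\<^sup>2 / 2)) * cis (x \<bullet> h))" 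
    "(LINT x|lborel. complex_of_real (exp (- (s * norm x)\<^sup>2 / 2)) * cis (x \<bullet> h))
     = complex_of_real ((sqrt (2 * pi) / s) ^ DIM('a) * exp (- (norm h / s)\<^sup>2 / 2))"
proof -
  define f where "f b t = complex_of_real (exp (- (s * t)\<^sup>2 / 2)) * cis (t * (h \<bullet> b))" for b t
  have eq: "complex_of_real (exp (- (s * norm x)\<^sup>2 / 2)) * cis (x \<bullet> h) = (\<Prod>b\<in>Basis. f b (x \<bullet> b))" for x
    by (simp only: f_def prod.distrib exp_norm_sq cis_inner of_real_prod)
  have fi: "integrable lborel (f b)" for b unfolding f_def by (rule gaussian_fourier_real[OF s])
  show "integrable lborel (\<lambda>x. complex_of_real (exp (- (s * norm x)\<^sup>2 / 2)) * cis (x \<bullet> h))"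
    unfolding eq by (rule lborel_integral_prod) (rule fi)
  have "(LINT x|lborel. complex_of_real (exp (- (s * norm x)\<^sup>2 / 2)) * cis (x \<bullet> h)) =
      (\<Prod>b\<in>Basis. complex_of_real (sqrt (2 * pi) / s * exp (- ((h \<bullet> b) / s)\<^sup>2 / 2)))"
    unfolding eq using lborel_integral_prod(2)[OF fi] gaussian_fourier_real(2)[OF s]
    by (simp add: f_def)
  also have "\<dots> = complex_of_real ((sqrt (2 * pi) / s) ^ DIM('a) * (\<Prod>b\<in>Basis. exp (- ((1/s) * (h \<bullet> b))\<^sup>2 / 2)))"
    by (simp only: of_real_prod[symmetric] prod.distrib prod_constant) simp
  also have "(\<Prod>b\<in>Basis. exp (- ((1/s) * (h \<bullet> b))\<^sup>2 / 2)) = exp (- ((1/s) * norm h)\<^sup>2 / 2)"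
    by (rule exp_norm_sq[symmetric])
  finally show "(LINT x|lborel. complex_of_real (exp (- (s * norm x)\<^sup>2 / 2)) * cis (x \<bullet> h))
     = complex_of_real ((sqrt (2 * pi) / s) ^ DIM('a) * exp (- (norm h / s)\<^sup>2 / 2))" by simp
qed

lemma lborel_integral_scale:
  fixes f :: "'a::euclidean_space \<Rightarrow> 'b::{banach, second_countable_topology}"
  assumes f [measurable]: "f \<in> borel_measurable borel" and c: "c > 0"
  shows "(LINT x|lborel. f x) = c ^ DIM('a) *\<^sub>R (LINT x|lborel. f (c *\<^sub>R x))"
proof -
  have "(LINT x|lborel. f x) = (LINT x|density (distr lborel borel (\<lambda>x. 0 + c *\<^sub>R x)) (\<lambda>_. ennreal (c ^ DIM('a))). f x)"
    using lborel_affine[of c "0::'a"] c by simp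
  also have "\<dots> = (LINT x|distr lborel borel (\<lambda>x. 0 + c *\<^sub>R x). c ^ DIM('a) *\<^sub>R f x)"
    using c by (subst integral_density) auto
  also have "\<dots> = c ^ DIM('a) *\<^sub>R (LINT x|lborel. f (c *\<^sub>R x))"
    by (subst integral_distr) auto
  finally show ?thesis .
qed

lemma (in pair_sigma_finite) integrable_product_mult:
  fixes f :: "'a \<Rightarrow> complex" and g :: "'b \<Rightarrow> complex"
  assumes f: "integrable M1 f" and g: "integrable M2 g"
  shows "integrable (M1 \<Otimes>\<^sub>M M2) (\<lambda>(x, y). f x * g y)"
proof (rule Fubini_integrable)
  have [measurable]: "f \<in> borel_measurable M1" "g \<in> borel_measurable M2" using f g by auto
  show "(\<lambda>(x, y). f x * g y) \<in> borel_measurable (M1 \<Otimes>\<^sub>M M2)" by measurable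
  show "integrable M1 (\<lambda>x. \<integral>y. norm (case (x, y) of (x, y) \<Rightarrow> f x * g y) \<partial>M2)"
    using f by (simp add: norm_mult)
  show "AE x in M1. integrable M2 (\<lambda>y. case (x, y) of (x, y) \<Rightarrow> f x * g y)"
    using g by simp
qed

text \<open>The form in which exchanges of integrals are usually justified below: a bounded or
  unimodular factor is discarded and a product of two integrable functions remains.\<close>

lemma (in pair_sigma_finite) integrable_product_dom:
  fixes f :: "'a \<Rightarrow> complex" and g :: "'b \<Rightarrow> complex"
  assumes f: "integrable M1 f" and g: "integrable M2 g"
    and k: "k \<in> borel_measurable (M1 \<Otimes>\<^sub>M M2)" and le: "\<And>x y. cmod (k (x, y)) \<le> cmod (f x) * cmod (g y)"
  shows "integrable (M1 \<Otimes>\<^sub>M M2) k"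
proof (rule Bochner_Integration.integrable_bound[OF integrable_product_mult[OF f g] k], rule AE_I2)
  fix p :: "'a \<times> 'b"
  obtain x y where "p = (x, y)" by (cases p)
  then show "cmod (k p) \<le> cmod (case p of (x, y) \<Rightarrow> f x * g y)" using le[of x y] by (simp add: norm_mult)
qed

text \<open>The identity is measurable from \<open>lebesgue\<close> to \<open>borel\<close>, so a
  jointly Borel kernel stays measurable when either factor is completed. The characters are such
  kernels, while the functions they multiply are only Lebesgue measurable.\<close>

lemma measurable_pair_lebesgue:
  fixes k :: "'a::euclidean_space \<times> 'b::euclidean_space \<Rightarrow> complex"
  assumes k: "k \<in> borel_measurable (borel \<Otimes>\<^sub>M borel)"
  shows "k \<in> borel_measurable (lebesgue \<Otimes>\<^sub>M lebesgue)" "k \<in> borel_measurable (borel \<Otimes>\<^sub>M lebesgue)"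
    "k \<in> borel_measurable (lebesgue \<Otimes>\<^sub>M borel)"
proof -
  have f: "fst \<in> lebesgue \<Otimes>\<^sub>M N \<rightarrow>\<^sub>M borel" for N :: "'b measure"
    using measurable_compose[OF measurable_fst[of lebesgue N] lebesgue_measurable_lborel[of "\<lambda>x. x"]] by simp
  have s: "snd \<in> N \<Otimes>\<^sub>M lebesgue \<rightarrow>\<^sub>M borel" for N :: "'a measure"
    using measurable_compose[OF measurable_snd[of N lebesgue] lebesgue_measurable_lborel[of "\<lambda>x. x"]] by simp
  show "k \<in> borel_measurable (lebesgue \<Otimes>\<^sub>M lebesgue)"
    using measurable_compose[OF measurable_Pair[OF f s] k] by simp
  show "k \<in> borel_measurable (borel \<Otimes>\<^sub>M lebesgue)"
    using measurable_compose[OF measurable_Pair[OF measurable_fst s] k] by simp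
  show "k \<in> borel_measurable (lebesgue \<Otimes>\<^sub>M borel)"
    using measurable_compose[OF measurable_Pair[OF f measurable_snd] k] by simp
qed

section \<open>The Fourier transform\<close>

definition fourier1 :: "(real^'n \<Rightarrow> complex) \<Rightarrow> real^'n \<Rightarrow> complex" where
  "fourier1 u \<xi> = complex_of_real ((2 * pi) powr (- real CARD('n) / 2)) *
     (LINT x|lebesgue. cis (- (x \<bullet> \<xi>)) * u x)"

abbreviation fconst :: "'n::finite itself \<Rightarrow> real" where
  "fconst _ \<equiv> (2 * pi) powr (- real CARD('n) / 2)"

lemma fconst_sq: "fconst TYPE('n::finite) * fconst TYPE('n) * (2 * pi) ^ CARD('n) = 1"
proof -
  have "fconst TYPE('n) * fconst TYPE('n) = (2 * pi) powr (- real CARD('n))"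
    by (simp flip: powr_add)
  then have "fconst TYPE('n) * fconst TYPE('n) = inverse ((2 * pi) ^ CARD('n))"
    by (simp only: powr_minus powr_realpow) (simp add: powr_realpow)
  moreover have "(2 * pi) ^ CARD('n) \<noteq> 0" by simp
  ultimately show ?thesis by (metis left_inverse)
qed

lemma fourier_cutoff_eq: "fourier_cutoff n u = fourier1 (\<lambda>x. indicator (cball 0 (real n)) x * u x)"
  unfolding fourier_cutoff_def fourier1_def set_lebesgue_integral_def
  by (intro ext arg_cong2[where f="(*)"] refl Bochner_Integration.integral_cong) (auto simp: indicator_def)

lemma borel_measurable_cis [measurable (raw)]:
  "f \<in> borel_measurable M \<Longrightarrow> (\<lambda>x. cis (f x)) \<in> borel_measurable M"
  unfolding cis_conv_exp by measurable

lemma integrable_cis_mult: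
  assumes "integrable lebesgue u" 
  shows "integrable lebesgue (\<lambda>x::real^'n. cis (- (x \<bullet> \<xi>)) * u x)"
    "integrable lebesgue (\<lambda>x::real^'n. cis (x \<bullet> \<xi>) * u x)"
proof -
  have [measurable]: "u \<in> borel_measurable lebesgue" using assms by auto
  show "integrable lebesgue (\<lambda>x::real^'n. cis (- (x \<bullet> \<xi>)) * u x)"
    by (rule Bochner_Integration.integrable_bound[OF assms]) (auto simp: norm_mult)
  show "integrable lebesgue (\<lambda>x::real^'n. cis (x \<bullet> \<xi>) * u x)"
    by (rule Bochner_Integration.integrable_bound[OF assms]) (auto simp: norm_mult)
qed

lemma fourier1_measurable:
  assumes "integrable lebesgue u" shows "fourier1 u \<in> borel_measurable borel"
proof -
  have [measurable]: "u \<in> borel_measurable lebesgue" using assms by auto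
  have "(\<lambda>\<xi>. LINT x|lebesgue. cis (- (x \<bullet> \<xi>)) * u x) \<in> borel_measurable borel"
  proof (rule lebesgue_sf.borel_measurable_lebesgue_integral)
    have "(\<lambda>p. cis (- (snd p \<bullet> fst p))) \<in> borel_measurable (borel \<Otimes>\<^sub>M lebesgue)"
      by (rule measurable_pair_lebesgue) measurable
    moreover have "(\<lambda>p. u (snd p)) \<in> borel_measurable (borel \<Otimes>\<^sub>M lebesgue)"
      using assms by (intro measurable_compose[OF measurable_snd]) auto
    ultimately have "(\<lambda>p. cis (- (snd p \<bullet> fst p)) * u (snd p)) \<in> borel_measurable (borel \<Otimes>\<^sub>M lebesgue)"
      by (rule borel_measurable_times)
    then show "(\<lambda>(\<xi>, x). cis (- (x \<bullet> \<xi>)) * u x) \<in> borel_measurable (borel \<Otimes>\<^sub>M lebesgue)"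
      by (simp add: case_prod_beta')
  qed
  then show ?thesis unfolding fourier1_def by measurable
qed

lemma fourier1_bound: "cmod (fourier1 u \<xi>) \<le> fconst TYPE('n) * (LINT x|lebesgue. cmod (u x))"
  for u :: "real^'n \<Rightarrow> complex"
proof -
  have "cmod (LINT x|lebesgue. cis (- (x \<bullet> \<xi>)) * u x) \<le> (LINT x|lebesgue. cmod (cis (- (x \<bullet> \<xi>)) * u x))"
    by (rule integral_norm_bound)
  then show ?thesis unfolding fourier1_def by (simp add: norm_mult)
qed

lemma fourier1_diff: "integrable lebesgue u \<Longrightarrow> integrable lebesgue v \<Longrightarrow>
    fourier1 (\<lambda>x. u x - v x) \<xi> = fourier1 u \<xi> - fourier1 v \<xi>"
  unfolding fourier1_def by (simp add: integrable_cis_mult ring_distribs)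

lemma fourier1_cong_AE:
  assumes "u \<in> borel_measurable lebesgue" "v \<in> borel_measurable lebesgue" "AE x in lebesgue. u x = v x"
  shows "fourier1 u = fourier1 v"
proof
  fix \<xi>
  have "(LINT x|lebesgue. cis (- (x \<bullet> \<xi>)) * u x) = (LINT x|lebesgue. cis (- (x \<bullet> \<xi>)) * v x)"
    using assms by (intro integral_cong_AE) auto
  then show "fourier1 u \<xi> = fourier1 v \<xi>" by (simp add: fourier1_def)
qed

text \<open>Expressions such as \<open>u (x + h)\<close> or \<open>g (\<eta> - \<xi>)\<close> must
  be measurable in both variables jointly, which a Borel representative guarantees.\<close>

lemma lebesgue_ex_borel:
  fixes u :: "'a::euclidean_space \<Rightarrow> complex"
  assumes "u \<in> borel_measurable lebesgue"
  shows "\<exists>u'\<in>borel_measurable borel. AE x in lebesgue. u x = u' x"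
proof -
  have "(\<lambda>x. Re (u x)) \<in> borel_measurable lebesgue" "(\<lambda>x. Im (u x)) \<in> borel_measurable lebesgue"
    using assms by auto
  then obtain a b where ab: "a \<in> borel_measurable lborel" "AE x in lborel. Re (u x) = a x"
     "b \<in> borel_measurable lborel" "AE x in lborel. Im (u x) = b x"
    by (metis completion_ex_borel_measurable_real)
  have "AE x in lebesgue. u x = Complex (a x) (b x)"
    using AE_completion[OF ab(2)] AE_completion[OF ab(4)] by eventually_elim (simp add: complex_eq_iff)
  moreover have "(\<lambda>x. Complex (a x) (b x)) \<in> borel_measurable borel"
    using ab unfolding Complex_eq by simp
  ultimately show ?thesis by (intro bexI)
qed

text \<open>The Gaussian weight makes the integral over \<open>x\<close>, \<open>y\<close> and
  \<open>\<xi>\<close> absolutely convergent. Integrating \<open>\<xi>\<close> first leaves a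
  Gaussian in \<open>y - x\<close>; the scaling \<open>h = s *\<^sub>R z\<close> turns this into a
  weight independent of \<open>s\<close>, against which autocorrelations of \<open>u\<close> at
  distance \<open>s *\<^sub>R z\<close> are averaged, so that \<open>s\<close> may tend to
  0.\<close>

lemma plancherel_regularized:
  fixes u :: "real^'n \<Rightarrow> complex"
  assumes u [measurable]: "u \<in> borel_measurable borel" and ui: "integrable lborel u" and s: "s > 0"
  defines "U \<equiv> \<lambda>\<xi>. LINT x|lborel. cis (- (x \<bullet> \<xi>)) * u x"
  shows "(LINT \<xi>|lborel. complex_of_real (exp (- (s * norm \<xi>)\<^sup>2 / 2)) * (U \<xi> * cnj (U \<xi>))) =
    (LINT z|lborel. complex_of_real (sqrt (2 * pi) ^ CARD('n) * exp (- (norm z)\<^sup>2 / 2)) * 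
        (LINT x|lborel. u x * cnj (u (x + s *\<^sub>R z))))"
proof -
  define w where "w \<xi> = complex_of_real (exp (- (s * norm \<xi>)\<^sup>2 / 2))" for \<xi> :: "real^'n"
  \<comment> \<open>The Fourier integral of the weight \<open>w\<close>, as computed by
    \<open>gaussian_fourier\<close>; being even, it is insensitive to the sign of its
    argument.\<close>
  define K where "K h = complex_of_real ((sqrt (2 * pi) / s) ^ CARD('n) * exp (- (norm h / s)\<^sup>2 / 2))" for h :: "real^'n"
  have [measurable]: "w \<in> borel_measurable borel" unfolding w_def by measurable
  have [measurable]: "K \<in> borel_measurable borel" unfolding K_def by measurable
  have Um [measurable]: "U \<in> borel_measurable borel" unfolding U_def by measurable
  have wi: "integrable lborel w" using gaussian_fourier(1)[OF s, of "0::real^'n"] by (simp add: w_def[abs_def])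
  have Ub: "cmod (U \<xi>) \<le> (LINT x|lborel. cmod (u x))" for \<xi>
  proof -
    have "cmod (U \<xi>) \<le> (LINT x|lborel. cmod (cis (- (x \<bullet> \<xi>)) * u x))"
      unfolding U_def by (rule integral_norm_bound)
    then show ?thesis by (simp add: norm_mult)
  qed
  define L where "L = (LINT x|lborel. cmod (u x))"
  have L0: "0 \<le> L" unfolding L_def by simp
  have cu: "integrable lborel (\<lambda>x. cnj (u x))" using ui by simp
  have cU: "cnj (U \<xi>) = (LINT y|lborel. cis (y \<bullet> \<xi>) * cnj (u y))" for \<xi>
    unfolding U_def by (subst Bochner_Integration.integral_cnj[symmetric]) (simp add: cis_cnj)
  have "(LINT \<xi>|lborel. w \<xi> * (U \<xi> * cnj (U \<xi>))) =
      (LINT \<xi>|lborel. LINT x|lborel. w \<xi> * cnj (U \<xi>) * (cis (- (x \<bullet> \<xi>)) * u x))"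
    unfolding Bochner_Integration.integral_mult_right_zero U_def by (simp add: mult_ac)
  also have "\<dots> = (LINT x|lborel. LINT \<xi>|lborel. w \<xi> * cnj (U \<xi>) * (cis (- (x \<bullet> \<xi>)) * u x))"
  proof (rule lborel_pair.Fubini_integral)
    have "integrable lborel (\<lambda>\<xi>. complex_of_real L * w \<xi>)" using wi by simp
    moreover have "(\<lambda>(x, \<xi>). w \<xi> * cnj (U \<xi>) * (cis (- (x \<bullet> \<xi>)) * u x)) \<in> borel_measurable (lborel \<Otimes>\<^sub>M lborel)"
      by measurable
    moreover have "cmod (case (x, \<xi>) of (x, \<xi>) \<Rightarrow> w \<xi> * cnj (U \<xi>) * (cis (- (x \<bullet> \<xi>)) * u x)) \<le> cmod (u x) * cmod (complex_of_real L * w \<xi>)" for x \<xi>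
      using mult_right_mono[OF Ub[of \<xi>], of "cmod (w \<xi>) * cmod (u x)"] L0 by (simp add: norm_mult L_def mult_ac)
    ultimately show "integrable (lborel \<Otimes>\<^sub>M lborel) (\<lambda>(x, \<xi>). w \<xi> * cnj (U \<xi>) * (cis (- (x \<bullet> \<xi>)) * u x))"
      by (rule lborel_pair.integrable_product_dom[OF ui])
  qed
  also have "\<dots> = (LINT x|lborel. u x * (LINT \<xi>|lborel. w \<xi> * cis (- (x \<bullet> \<xi>)) * cnj (U \<xi>)))"
    by (intro Bochner_Integration.integral_cong refl, subst Bochner_Integration.integral_mult_right_zero[symmetric])
      (simp add: mult_ac)
  also have "\<dots> = (LINT x|lborel. u x * (LINT h|lborel. cnj (u (x + h)) * K h))"
  proof -
    have "(LINT \<xi>|lborel. w \<xi> * cis (- (x \<bullet> \<xi>)) * cnj (U \<xi>)) = (LINT h|lborel. cnj (u (x + h)) * K h)" for x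
    proof -
    have "(LINT \<xi>|lborel. w \<xi> * cis (- (x \<bullet> \<xi>)) * cnj (U \<xi>)) =
        (LINT \<xi>|lborel. LINT y|lborel. cnj (u y) * (w \<xi> * cis (\<xi> \<bullet> (y - x))))"
    proof -
      have e: "cis (\<xi> \<bullet> (y - x)) = cis (- (x \<bullet> \<xi>)) * cis (y \<bullet> \<xi>)" for \<xi> y
        by (simp add: cis_mult inner_diff_right inner_commute)
      show ?thesis unfolding cU e
        by (intro Bochner_Integration.integral_cong refl, subst Bochner_Integration.integral_mult_right_zero[symmetric])
          (simp only: mult_ac)
    qed
    also have "\<dots> = (LINT y|lborel. LINT \<xi>|lborel. cnj (u y) * (w \<xi> * cis (\<xi> \<bullet> (y - x))))"
    proof (rule lborel_pair.Fubini_integral)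
      have "(\<lambda>(y, \<xi>). cnj (u y) * (w \<xi> * cis (\<xi> \<bullet> (y - x)))) \<in> borel_measurable (lborel \<Otimes>\<^sub>M lborel)"
        by measurable
      then show "integrable (lborel \<Otimes>\<^sub>M lborel) (\<lambda>(y, \<xi>). cnj (u y) * (w \<xi> * cis (\<xi> \<bullet> (y - x))))"
        by (rule lborel_pair.integrable_product_dom[OF cu wi]) (simp add: norm_mult)
    qed
    also have "\<dots> = (LINT y|lborel. cnj (u y) * K (y - x))"
      using gaussian_fourier(2)[OF s, where 'a="real^'n"] by (simp add: w_def K_def)
    also have "\<dots> = (LINT h|lborel. cnj (u (x + h)) * K h)"
      using lebesgue_integral_translation[of "\<lambda>y. cnj (u y) * K (y - x)" x]
      by (simp add: integral_completion add.commute)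
    finally show "(LINT \<xi>|lborel. w \<xi> * cis (- (x \<bullet> \<xi>)) * cnj (U \<xi>)) = (LINT h|lborel. cnj (u (x + h)) * K h)" .
    qed
    then show ?thesis by simp
  qed
  also have "\<dots> = (LINT x|lborel. LINT h|lborel. u x * (cnj (u (x + h)) * K h))" by simp
  \<comment> \<open>Here \<open>u (x + h)\<close> is not a product in \<open>x\<close> and
    \<open>h\<close>, so integrability comes from iterated integrals instead: by translation
    invariance the \<open>h\<close>-integral of \<open>cmod (u (x + h))\<close> equals
    \<open>L\<close> for every \<open>x\<close>.\<close>
  also have "\<dots> = (LINT h|lborel. LINT x|lborel. u x * (cnj (u (x + h)) * K h))"
  proof (rule lborel_pair.Fubini_integral[symmetric], rule lborel_pair.Fubini_integrable)
    define C where "C = (sqrt (2 * pi) / s) ^ CARD('n)"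
    have C0: "C \<ge> 0" using s by (simp add: C_def)
    have Kb: "cmod (K h) \<le> C" for h
    proof -
      have "cmod (K h) = C * exp (- (norm h / s)\<^sup>2 / 2)" using s by (simp add: K_def C_def norm_mult norm_power norm_divide)
      also have "\<dots> \<le> C * 1" using C0 by (intro mult_left_mono) auto
      finally show ?thesis by simp
    qed
    have ti: "integrable lborel (\<lambda>h. cmod (u (x + h)))" "(LINT h|lborel. cmod (u (x + h))) = L" for x
    proof -
      have "(\<integral>\<^sup>+h. ennreal (cmod (u (h + x))) \<partial>lborel) = (\<integral>\<^sup>+h. ennreal (cmod (u h)) \<partial>lborel)"
        using lebesgue_nn_integral_translation[of "\<lambda>h. ennreal (cmod (u h))" x] by (simp add: nn_integral_completion)
      then show "integrable lborel (\<lambda>h. cmod (u (x + h)))" using ui by (simp add: integrable_iff_bounded add.commute)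
      show "(LINT h|lborel. cmod (u (x + h))) = L"
        using lebesgue_integral_translation[of "\<lambda>h. cmod (u h)" x] by (simp add: integral_completion L_def add.commute)
    qed
    have nb: "cmod (u x * (cnj (u (x + h)) * K h)) \<le> cmod (u x) * C * cmod (u (x + h))" for x h
      using mult_right_mono[OF Kb[of h], of "cmod (u x) * cmod (u (x + h))"] by (simp add: norm_mult mult_ac)
    have i2: "integrable lborel (\<lambda>h. u x * (cnj (u (x + h)) * K h))" for x
    proof (rule Bochner_Integration.integrable_bound[where f="\<lambda>h. cmod (u x) * C * cmod (u (x + h))"])
      show "AE h in lborel. cmod (u x * (cnj (u (x + h)) * K h)) \<le> norm (cmod (u x) * C * cmod (u (x + h)))"
        unfolding real_norm_def by (rule AE_I2) (rule order_trans[OF nb abs_ge_self])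
    qed (use ti(1) in simp, measurable)
    show "(\<lambda>(x, h). u x * (cnj (u (x + h)) * K h)) \<in> borel_measurable (lborel \<Otimes>\<^sub>M lborel)" by measurable
    show "AE x in lborel. integrable lborel (\<lambda>h. case (x, h) of (x, h) \<Rightarrow> u x * (cnj (u (x + h)) * K h))"
      using i2 by simp
    have n: "(LINT h|lborel. cmod (u x * (cnj (u (x + h)) * K h))) \<le> C * L * cmod (u x)" for x
    proof -
      have "(LINT h|lborel. cmod (u x * (cnj (u (x + h)) * K h))) \<le> (LINT h|lborel. cmod (u x) * C * cmod (u (x + h)))"
        using i2[of x] ti(1) nb by (intro integral_mono) auto
      also have "\<dots> = C * L * cmod (u x)" using ti(2) by simp
      finally show ?thesis .
    qed
    show "integrable lborel (\<lambda>x. LINT h|lborel. norm (case (x, h) of (x, h) \<Rightarrow> u x * (cnj (u (x + h)) * K h)))"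
    proof (rule Bochner_Integration.integrable_bound[where f="\<lambda>x. C * L * cmod (u x)"])
      show "integrable lborel (\<lambda>x. C * L * cmod (u x))" using ui by simp
      show "(\<lambda>x. LINT h|lborel. norm (case (x, h) of (x, h) \<Rightarrow> u x * (cnj (u (x + h)) * K h))) \<in> borel_measurable lborel"
        by measurable
      show "AE x in lborel. norm (LINT h|lborel. norm (case (x, h) of (x, h) \<Rightarrow> u x * (cnj (u (x + h)) * K h)))
          \<le> norm (C * L * cmod (u x))"
      proof (rule AE_I2)
        fix x
        have "0 \<le> (LINT h|lborel. cmod (u x * (cnj (u (x + h)) * K h)))" by simp
        then show "norm (LINT h|lborel. norm (case (x, h) of (x, h) \<Rightarrow> u x * (cnj (u (x + h)) * K h)))
          \<le> norm (C * L * cmod (u x))" using n[of x] by (simp only: split_conv real_norm_def abs_of_nonneg)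
      qed
    qed
  qed
  also have "\<dots> = (LINT h|lborel. K h * (LINT x|lborel. u x * cnj (u (x + h))))"
    by (intro Bochner_Integration.integral_cong refl, subst Bochner_Integration.integral_mult_right_zero[symmetric])
      (simp add: mult_ac)
  also have "\<dots> = s ^ CARD('n) *\<^sub>R (LINT z|lborel. K (s *\<^sub>R z) * (LINT x|lborel. u x * cnj (u (x + s *\<^sub>R z))))"
    by (subst lborel_integral_scale[OF _ s]) (auto)
  also have "\<dots> = (LINT z|lborel. complex_of_real (sqrt (2 * pi) ^ CARD('n) * exp (- (norm z)\<^sup>2 / 2)) * 
        (LINT x|lborel. u x * cnj (u (x + s *\<^sub>R z))))"
    unfolding Bochner_Integration.integral_scaleR_right[symmetric]
    using s by (intro Bochner_Integration.integral_cong refl) (simp add: K_def scaleR_conv_of_real[where 'a=complex] power_divide)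
  finally show ?thesis by (simp add: w_def)
qed

text \<open>The regularisation is removed along \<open>s = 1/(n+1)\<close>. The weights increase to
  1, so one side converges monotonically. On the other side the correlations are bounded by
  \<open>(L2_norm u)\<^sup>2\<close> and tend to it by continuity of translations, so dominated
  convergence applies.\<close>

lemma plancherel_borel:
  fixes u :: "real^'n \<Rightarrow> complex"
  assumes u [measurable]: "u \<in> borel_measurable borel" and ui: "integrable lborel u" and u2: "u \<in> L2"
  shows "(\<integral>\<^sup>+\<xi>. ennreal ((cmod (fourier1 u \<xi>))\<^sup>2) \<partial>lborel) = ennreal ((L2_norm u)\<^sup>2)"
proof -
  define s where "s n = 1 / real (Suc n)" for n
  have s: "s n > 0" for n by (simp add: s_def)
  have s0: "s \<longlonglongrightarrow> 0" unfolding s_def using LIMSEQ_inverse_real_of_nat by (simp add: inverse_eq_divide)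
  have s_le: "s (Suc n) \<le> s n" for n by (simp add: s_def frac_le)
  define U where "U \<xi> = (LINT x|lborel. cis (- (x \<bullet> \<xi>)) * u x)" for \<xi>
  have Um [measurable]: "U \<in> borel_measurable borel" unfolding U_def by measurable
  define w where "w n \<xi> = exp (- (s n * norm \<xi>)\<^sup>2 / 2)" for n and \<xi> :: "real^'n"
  have [measurable]: "w n \<in> borel_measurable borel" for n unfolding w_def by measurable
  have Ub: "cmod (U \<xi>) \<le> (LINT x|lborel. cmod (u x))" for \<xi>
  proof -
    have "cmod (U \<xi>) \<le> (LINT x|lborel. cmod (cis (- (x \<bullet> \<xi>)) * u x))"
      unfolding U_def by (rule integral_norm_bound)
    then show ?thesis by (simp add: norm_mult)
  qed
  define L where "L = (LINT x|lborel. cmod (u x))"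
  have wc: "integrable lborel (\<lambda>\<xi>. complex_of_real (w n \<xi>))" for n
    using gaussian_fourier(1)[OF s, of n "0::real^'n"] by (simp add: w_def[abs_def])
  then have wi: "integrable lborel (w n)" for n by (simp only: complex_of_real_integrable_eq)
  have iw: "integrable lborel (\<lambda>\<xi>. w n \<xi> * (cmod (U \<xi>))\<^sup>2)" for n
  proof (rule Bochner_Integration.integrable_bound[where f="\<lambda>\<xi>. L\<^sup>2 * w n \<xi>"])
    show "AE \<xi> in lborel. norm (w n \<xi> * (cmod (U \<xi>))\<^sup>2) \<le> norm (L\<^sup>2 * w n \<xi>)"
      using Ub by (auto simp: w_def L_def mult.commute intro!: mult_left_mono power_mono)
  qed (use wi in auto)
  define r where "r n = (LINT \<xi>|lborel. w n \<xi> * (cmod (U \<xi>))\<^sup>2)" for n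
  define A where "A n z = (LINT x|lborel. u x * cnj (u (x + s n *\<^sub>R z)))" for n z
  have Am [measurable]: "A n \<in> borel_measurable borel" for n unfolding A_def by measurable
  have A_inner: "A n z = L2_inner (\<lambda>x. u (x + s n *\<^sub>R z)) u" for n z
    unfolding A_def L2_inner_def by (subst integral_completion) (auto simp: mult.commute)
  have Ab: "cmod (A n z) \<le> (L2_norm u)\<^sup>2" for n z
    unfolding A_inner using L2_Cauchy_Schwarz[OF L2_translate(1)[OF u2, of "s n *\<^sub>R z"] u2]
    by (simp add: L2_translate(2)[OF u2] power2_eq_square)
  have Alim: "(\<lambda>n. A n z) \<longlonglongrightarrow> complex_of_real ((L2_norm u)\<^sup>2)" for z
    unfolding A_inner L2_inner_self[symmetric]
    by (rule L2_tendsto_inner(2)) (use u2 in \<open>auto intro!: L2_translate L2_translation_continuous tendsto_eq_intros s0\<close>)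
  define K where "K z = complex_of_real (sqrt (2 * pi) ^ CARD('n) * exp (- (norm z)\<^sup>2 / 2))" for z :: "real^'n"
  have [measurable]: "K \<in> borel_measurable borel" unfolding K_def by measurable
  have Ki: "integrable lborel K" and KI: "(LINT z|lborel. K z) = complex_of_real ((2 * pi) ^ CARD('n))"
  proof -
    have a: "integrable lborel (\<lambda>x::real^'n. complex_of_real (exp (- (norm x)\<^sup>2 / 2)))"
      "(LINT (x::real^'n)|lborel. complex_of_real (exp (- (norm x)\<^sup>2 / 2))) = complex_of_real (sqrt (2 * pi) ^ CARD('n))"
      using gaussian_fourier[of 1 "0::real^'n"] by simp_all
    show "integrable lborel K" unfolding K_def[abs_def] of_real_mult using a(1) by (intro integrable_mult_right) simp
    show "(LINT z|lborel. K z) = complex_of_real ((2 * pi) ^ CARD('n))"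
      unfolding K_def[abs_def] of_real_mult Bochner_Integration.integral_mult_right_zero a(2)
      by (simp only: of_real_mult[symmetric] power_mult_distrib[symmetric]) simp
  qed
  have eq: "complex_of_real (r n) = (LINT z|lborel. K z * A n z)" for n
  proof -
    have "complex_of_real (r n) = (LINT \<xi>|lborel. complex_of_real (w n \<xi> * (cmod (U \<xi>))\<^sup>2))"
      unfolding r_def by (rule integral_complex_of_real[symmetric])
    also have "\<dots> = (LINT \<xi>|lborel. complex_of_real (exp (- (s n * norm \<xi>)\<^sup>2 / 2)) * (U \<xi> * cnj (U \<xi>)))"
      by (intro Bochner_Integration.integral_cong refl) (simp only: w_def complex_norm_square of_real_mult)
    also have "\<dots> = (LINT z|lborel. K z * A n z)"
      unfolding U_def K_def A_def by (rule plancherel_regularized[OF u ui s])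
    finally show ?thesis .
  qed
  have "(\<lambda>n. LINT z|lborel. K z * A n z) \<longlonglongrightarrow> (LINT z|lborel. K z * complex_of_real ((L2_norm u)\<^sup>2))"
  proof (rule integral_dominated_convergence[where w="\<lambda>z. (L2_norm u)\<^sup>2 * cmod (K z)"])
    show "integrable lborel (\<lambda>z. (L2_norm u)\<^sup>2 * cmod (K z))" using Ki by simp
    show "AE z in lborel. (\<lambda>n. K z * A n z) \<longlonglongrightarrow> K z * complex_of_real ((L2_norm u)\<^sup>2)"
      by (intro AE_I2 tendsto_mult tendsto_const Alim)
    show "AE z in lborel. norm (K z * A n z) \<le> (L2_norm u)\<^sup>2 * cmod (K z)" for n
      using mult_right_mono[OF Ab[of n]] by (auto simp: norm_mult mult.commute)
  qed auto
  then have "(\<lambda>n. complex_of_real (r n)) \<longlonglongrightarrow> complex_of_real ((2 * pi) ^ CARD('n) * (L2_norm u)\<^sup>2)"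
    unfolding eq by (simp add: KI)
  then have rl: "r \<longlonglongrightarrow> (2 * pi) ^ CARD('n) * (L2_norm u)\<^sup>2" by (simp only: tendsto_of_real_iff)
  have "(\<lambda>n. \<integral>\<^sup>+\<xi>. ennreal (w n \<xi> * (cmod (U \<xi>))\<^sup>2) \<partial>lborel) \<longlonglongrightarrow> (\<integral>\<^sup>+\<xi>. ennreal ((cmod (U \<xi>))\<^sup>2) \<partial>lborel)"
  proof (rule nn_integral_LIMSEQ)
    show "incseq (\<lambda>n \<xi>. ennreal (w n \<xi> * (cmod (U \<xi>))\<^sup>2))"
    proof (intro incseq_SucI le_funI ennreal_leI mult_right_mono)
      fix n and \<xi> :: "real^'n"
      have "(s (Suc n) * norm \<xi>)\<^sup>2 \<le> (s n * norm \<xi>)\<^sup>2"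
        using s_le[of n] s[of "Suc n"] by (intro power_mono mult_right_mono) (auto simp: less_imp_le)
      then show "w n \<xi> \<le> w (Suc n) \<xi>" by (simp add: w_def)
    qed auto
    fix \<xi> :: "real^'n"
    have "(\<lambda>n. w n \<xi>) \<longlonglongrightarrow> 1" unfolding w_def
      by (rule tendsto_eq_intros refl s0 | simp)+
    then have "(\<lambda>n. w n \<xi> * (cmod (U \<xi>))\<^sup>2) \<longlonglongrightarrow> 1 * (cmod (U \<xi>))\<^sup>2" by (intro tendsto_intros)
    then show "(\<lambda>n. ennreal (w n \<xi> * (cmod (U \<xi>))\<^sup>2)) \<longlonglongrightarrow> ennreal ((cmod (U \<xi>))\<^sup>2)" by simp
  qed auto
  moreover have "(\<integral>\<^sup>+\<xi>. ennreal (w n \<xi> * (cmod (U \<xi>))\<^sup>2) \<partial>lborel) = ennreal (r n)" for n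
    unfolding r_def by (rule nn_integral_eq_integral[OF iw]) (simp add: w_def)
  ultimately have "(\<lambda>n. ennreal (r n)) \<longlonglongrightarrow> (\<integral>\<^sup>+\<xi>. ennreal ((cmod (U \<xi>))\<^sup>2) \<partial>lborel)" by simp
  moreover have "(\<lambda>n. ennreal (r n)) \<longlonglongrightarrow> ennreal ((2 * pi) ^ CARD('n) * (L2_norm u)\<^sup>2)"
    by (rule tendsto_ennrealI[OF rl])
  ultimately have UI: "(\<integral>\<^sup>+\<xi>. ennreal ((cmod (U \<xi>))\<^sup>2) \<partial>lborel) = ennreal ((2 * pi) ^ CARD('n) * (L2_norm u)\<^sup>2)"
    by (rule LIMSEQ_unique)
  have fU: "fourier1 u \<xi> = complex_of_real (fconst TYPE('n)) * U \<xi>" for \<xi>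
    unfolding fourier1_def U_def by (subst integral_completion) auto
  have "(\<integral>\<^sup>+\<xi>. ennreal ((cmod (fourier1 u \<xi>))\<^sup>2) \<partial>lborel) = 
     (\<integral>\<^sup>+\<xi>. ennreal ((fconst TYPE('n))\<^sup>2) * ennreal ((cmod (U \<xi>))\<^sup>2) \<partial>lborel)"
    unfolding fU by (simp add: norm_mult power_mult_distrib ennreal_mult')
  also have "\<dots> = ennreal ((fconst TYPE('n))\<^sup>2) * (\<integral>\<^sup>+\<xi>. ennreal ((cmod (U \<xi>))\<^sup>2) \<partial>lborel)"
    by (rule nn_integral_cmult) measurable
  also have "\<dots> = ennreal ((fconst TYPE('n))\<^sup>2 * ((2 * pi) ^ CARD('n) * (L2_norm u)\<^sup>2))"
    unfolding UI by (simp add: ennreal_mult')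
  also have "(fconst TYPE('n))\<^sup>2 * ((2 * pi) ^ CARD('n) * (L2_norm u)\<^sup>2) = 
      (fconst TYPE('n) * fconst TYPE('n) * (2 * pi) ^ CARD('n)) * (L2_norm u)\<^sup>2"
    by (simp only: power2_eq_square mult_ac)
  finally show ?thesis unfolding fconst_sq by simp
qed

lemma plancherel_fourier1:
  fixes u :: "real^'n \<Rightarrow> complex"
  assumes ui: "integrable lebesgue u" and u2: "u \<in> L2"
  shows "fourier1 u \<in> L2" "L2_norm (fourier1 u) = L2_norm u"
proof -
  have um: "u \<in> borel_measurable lebesgue" using ui by auto
  obtain v where v: "v \<in> borel_measurable borel" "AE x in lebesgue. u x = v x"
    using lebesgue_ex_borel[OF um] by blast
  have vm: "v \<in> borel_measurable lebesgue" using v by auto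
  have v2: "v \<in> L2" "L2_norm v = L2_norm u"
    using L2_cong_AE[OF u2 vm] v(2) by (simp_all add: eq_commute)
  have "integrable lebesgue v" using ui v(2) vm um by (subst integrable_cong_AE[where g=u]) (auto elim: eventually_mono)
  then have vi: "integrable lborel v" using v by (simp add: integrable_completion)
  have f: "fourier1 u = fourier1 v" using um vm v(2) by (rule fourier1_cong_AE)
  have fm: "fourier1 v \<in> borel_measurable borel" using fourier1_measurable[OF ui] f by simp
  have n: "(\<integral>\<^sup>+\<xi>. ennreal ((cmod (fourier1 u \<xi>))\<^sup>2) \<partial>lebesgue) = ennreal ((L2_norm u)\<^sup>2)"
    using plancherel_borel[OF v(1) vi v2(1)] v2(2) by (simp add: f nn_integral_completion)
  show f2: "fourier1 u \<in> L2" using n fm f by (auto simp: L2_iff)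
  then have "ennreal ((L2_norm (fourier1 u))\<^sup>2) = ennreal ((L2_norm u)\<^sup>2)" using n by (simp add: L2_norm_nn)
  then show "L2_norm (fourier1 u) = L2_norm u" by simp
qed

section \<open>The unitary extension to square-integrable functions\<close>

lemma integrable_cutoff:
  fixes u :: "real^'n \<Rightarrow> complex"
  assumes "u \<in> L2" shows "integrable lebesgue (\<lambda>x. indicator (cball 0 r) x * u x)"
proof -
  have "integrable lebesgue (\<lambda>x. cnj (indicator (cball 0 r) x) * u x)"
    by (rule L2_inner_integrable[OF L2_indicator_cball assms])
  then show ?thesis by (rule back_subst[of "integrable lebesgue"]) (auto simp: indicator_def)
qed

lemma integrable_indicator_L2:
  fixes u :: "real^'n \<Rightarrow> complex"
  assumes u: "u \<in> L2" and A: "A \<in> sets lebesgue" "A \<subseteq> cball 0 r"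
  shows "integrable lebesgue (\<lambda>x. indicator A x * u x)"
proof (rule Bochner_Integration.integrable_bound[OF integrable_cutoff[OF u, of r]])
  show "(\<lambda>x. indicator A x * u x) \<in> borel_measurable lebesgue" using L2_measurable[OF u] A by auto
  show "AE x in lebesgue. norm (indicator A x * u x) \<le> norm (indicator (cball 0 r) x * u x)"
    using A(2) by (intro AE_I2) (auto simp: indicator_def)
qed

lemma cutoff_L2: "u \<in> L2 \<Longrightarrow> (\<lambda>x. indicator (cball 0 r) x * u x) \<in> L2" for u :: "real^'n \<Rightarrow> complex"
  by (rule L2_indicator(1)) auto

lemma cutoff_tendsto:
  fixes u :: "real^'n \<Rightarrow> complex"
  assumes u: "u \<in> L2" shows "(\<lambda>n. L2_norm (\<lambda>x. indicator (cball 0 (real n)) x * u x - u x)) \<longlonglongrightarrow> 0"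
proof (rule L2_dominated(3)[OF u])
  show "AE x in lebesgue. (\<lambda>n. indicator (cball 0 (real n)) x * u x) \<longlonglongrightarrow> u x"
  proof (intro AE_I2)
    fix x :: "real^'n"
    obtain N where N: "norm x \<le> real N" using real_arch_simple by blast
    have "eventually (\<lambda>n. indicator (cball 0 (real n)) x * u x = u x) sequentially"
      using eventually_ge_at_top[of N]
    proof eventually_elim
      case (elim n)
      then have "real N \<le> real n" by simp
      with N have "norm x \<le> real n" by linarith
      then show ?case by simp
    qed
    then show "(\<lambda>n. indicator (cball 0 (real n)) x * u x) \<longlonglongrightarrow> u x" by (rule tendsto_eventually)
  qed
  show "(\<lambda>x. indicator (cball 0 (real n)) x * u x) \<in> borel_measurable lebesgue" for n
    by (rule L2_measurable[OF cutoff_L2[OF u]])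
qed (use u in \<open>auto simp: indicator_def L2_measurable\<close>)

lemma fourier_cutoff_L2: "u \<in> L2 \<Longrightarrow> fourier_cutoff n u \<in> L2" for u :: "real^'n \<Rightarrow> complex"
  unfolding fourier_cutoff_eq by (intro plancherel_fourier1 integrable_cutoff cutoff_L2)

lemma fourier1_diff_norm:
  fixes u v :: "real^'n \<Rightarrow> complex"
  assumes "integrable lebesgue u" "u \<in> L2" "integrable lebesgue v" "v \<in> L2"
  shows "L2_norm (\<lambda>\<xi>. fourier1 u \<xi> - fourier1 v \<xi>) = L2_norm (\<lambda>x. u x - v x)"
proof -
  have "(\<lambda>\<xi>. fourier1 u \<xi> - fourier1 v \<xi>) = fourier1 (\<lambda>x. u x - v x)"
    using assms by (intro ext) (simp add: fourier1_diff)
  then show ?thesis using plancherel_fourier1(2)[of "\<lambda>x. u x - v x"] assms by (simp add: L2_diff)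
qed

text \<open>The choice operator in \<open>fourier\<close> needs a witness. Plancherel's identity
  turns differences of transformed cutoffs into differences of cutoffs, so the former are a Cauchy
  sequence and completeness supplies the limit.\<close>

lemma fourier_spec:
  fixes u :: "real^'n \<Rightarrow> complex"
  assumes u: "u \<in> L2"
  shows "fourier u \<in> L2" "(\<lambda>n. L2_norm (\<lambda>\<xi>. fourier_cutoff n u \<xi> - fourier u \<xi>)) \<longlonglongrightarrow> 0"
proof -
  let ?P = "\<lambda>g. g \<in> L2 \<and> ((\<lambda>n. \<integral>\<^sup>+ \<xi>. ennreal ((cmod (fourier_cutoff n u \<xi> - g \<xi>))\<^sup>2) \<partial>lebesgue) \<longlonglongrightarrow> 0)"
  define w where "w n x = indicator (cball 0 (real n)) x * u x" for n x
  have wi: "integrable lebesgue (w n)" and w2: "w n \<in> L2" for n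
    unfolding w_def[abs_def] by (rule integrable_cutoff[OF u], rule cutoff_L2[OF u])
  have wl: "(\<lambda>n. L2_norm (\<lambda>x. w n x - u x)) \<longlonglongrightarrow> 0" unfolding w_def by (rule cutoff_tendsto[OF u])
  have fw: "fourier_cutoff n u = fourier1 (w n)" for n by (simp add: fourier_cutoff_eq w_def[abs_def])
  have "\<exists>g\<in>L2. (\<lambda>n. L2_norm (\<lambda>\<xi>. fourier_cutoff n u \<xi> - g \<xi>)) \<longlonglongrightarrow> 0"
  proof (rule L2_complete)
    show "fourier_cutoff n u \<in> L2" for n by (rule fourier_cutoff_L2[OF u])
    fix e :: real assume e: "e > 0"
    obtain N where N: "\<And>n. n \<ge> N \<Longrightarrow> L2_norm (\<lambda>x. w n x - u x) < e/2"
      using LIMSEQ_D[OF wl, of "e/2"] e by auto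
    show "\<exists>N. \<forall>m\<ge>N. \<forall>n\<ge>N. L2_norm (\<lambda>\<xi>. fourier_cutoff m u \<xi> - fourier_cutoff n u \<xi>) < e"
    proof (intro exI allI impI)
      fix m n assume mn: "m \<ge> N" "n \<ge> N"
      have "L2_norm (\<lambda>\<xi>. fourier_cutoff m u \<xi> - fourier_cutoff n u \<xi>) = L2_norm (\<lambda>x. w m x - w n x)"
        unfolding fw by (rule fourier1_diff_norm[OF wi w2 wi w2])
      also have "\<dots> \<le> L2_norm (\<lambda>x. w m x - u x) + L2_norm (\<lambda>x. u x - w n x)"
        by (rule L2_norm_triangle3[OF w2 u w2])
      also have "L2_norm (\<lambda>x. u x - w n x) = L2_norm (\<lambda>x. w n x - u x)" by (rule L2_norm_minus_commute)
      finally show "L2_norm (\<lambda>\<xi>. fourier_cutoff m u \<xi> - fourier_cutoff n u \<xi>) < e"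
        using N[OF mn(1)] N[OF mn(2)] by linarith
    qed
  qed
  then obtain g where g: "g \<in> L2" "(\<lambda>n. L2_norm (\<lambda>\<xi>. fourier_cutoff n u \<xi> - g \<xi>)) \<longlonglongrightarrow> 0" by blast
  have iff: "(\<lambda>n. \<integral>\<^sup>+ \<xi>. ennreal ((cmod (fourier_cutoff n u \<xi> - g \<xi>))\<^sup>2) \<partial>lebesgue) \<longlonglongrightarrow> 0 \<longleftrightarrow>
      (\<lambda>n. L2_norm (\<lambda>\<xi>. fourier_cutoff n u \<xi> - g \<xi>)) \<longlonglongrightarrow> 0" if "g \<in> L2" for g
    using L2_norm_tendsto_iff_nn[of "\<lambda>n \<xi>. fourier_cutoff n u \<xi> - g \<xi>"] L2_diff[OF fourier_cutoff_L2[OF u] that] by blast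
  have "?P g" using g iff by blast
  then have "\<exists>g. ?P g" by (intro exI[of _ g])
  then have P: "?P (fourier u)" unfolding fourier_def by (rule someI_ex)
  then show f: "fourier u \<in> L2" by blast
  show "(\<lambda>n. L2_norm (\<lambda>\<xi>. fourier_cutoff n u \<xi> - fourier u \<xi>)) \<longlonglongrightarrow> 0"
    using P iff[OF f] by blast
qed

lemma fourier_unique:
  fixes u :: "real^'n \<Rightarrow> complex"
  assumes "u \<in> L2" "g \<in> L2" "(\<lambda>n. L2_norm (\<lambda>\<xi>. fourier_cutoff n u \<xi> - g \<xi>)) \<longlonglongrightarrow> 0"
  shows "AE \<xi> in lebesgue. fourier u \<xi> = g \<xi>"
  by (rule L2_limit_unique[OF fourier_cutoff_L2[OF assms(1)] fourier_spec(1)[OF assms(1)] assms(2)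
     fourier_spec(2)[OF assms(1)] assms(3)])

lemma fourier_measurable: "u \<in> L2 \<Longrightarrow> fourier u \<in> borel_measurable lebesgue" for u :: "real^'n \<Rightarrow> complex"
  by (intro L2_measurable fourier_spec)

text \<open>Equality holds everywhere, not just almost everywhere: the transformed cutoffs coincide
  as functions, so the same choice is made from the same set.\<close>

lemma fourier_cong_AE:
  fixes u v :: "real^'n \<Rightarrow> complex"
  assumes "u \<in> borel_measurable lebesgue" "v \<in> borel_measurable lebesgue" "AE x in lebesgue. u x = v x"
  shows "fourier u = fourier v"
proof -
  have "fourier_cutoff n u = fourier_cutoff n v" for n
    unfolding fourier_cutoff_eq using assms
    by (intro fourier1_cong_AE) (auto elim: eventually_mono intro!: borel_measurable_times borel_measurable_indicator)
  then show ?thesis by (simp add: fourier_def)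
qed

lemma fourier_eq_fourier1:
  fixes u :: "real^'n \<Rightarrow> complex"
  assumes "integrable lebesgue u" "u \<in> L2"
  shows "AE \<xi> in lebesgue. fourier u \<xi> = fourier1 u \<xi>"
proof (rule fourier_unique)
  show "fourier1 u \<in> L2" using assms by (rule plancherel_fourier1)
  show "(\<lambda>n. L2_norm (\<lambda>\<xi>. fourier_cutoff n u \<xi> - fourier1 u \<xi>)) \<longlonglongrightarrow> 0"
    unfolding fourier_cutoff_eq fourier1_diff_norm[OF integrable_cutoff[OF assms(2)] cutoff_L2[OF assms(2)] assms]
    by (rule cutoff_tendsto[OF assms(2)])
qed (rule assms)

lemma fourier_norm: "L2_norm (fourier u) = L2_norm u" if u: "u \<in> L2" for u :: "real^'n \<Rightarrow> complex"
proof -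
  have "(\<lambda>n. L2_norm (fourier_cutoff n u)) \<longlonglongrightarrow> L2_norm (fourier u)"
    by (rule L2_tendsto_norm[OF fourier_cutoff_L2[OF u] fourier_spec[OF u]])
  moreover have "L2_norm (fourier_cutoff n u) = L2_norm (\<lambda>x. indicator (cball 0 (real n)) x * u x)" for n
    unfolding fourier_cutoff_eq by (intro plancherel_fourier1 integrable_cutoff cutoff_L2 u)
  moreover have "(\<lambda>n. L2_norm (\<lambda>x. indicator (cball 0 (real n)) x * u x)) \<longlonglongrightarrow> L2_norm u"
    by (rule L2_tendsto_norm[OF cutoff_L2[OF u] u cutoff_tendsto[OF u]])
  ultimately show ?thesis using LIMSEQ_unique by force
qed

text \<open>In contrast to the integral transform this holds only almost everywhere, since each of
  the three transforms is a separately chosen representative.\<close>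

lemma fourier_linear:
  fixes u v :: "real^'n \<Rightarrow> complex"
  assumes u: "u \<in> L2" and v: "v \<in> L2"
  shows "AE \<xi> in lebesgue. fourier (\<lambda>x. a * u x + b * v x) \<xi> = a * fourier u \<xi> + b * fourier v \<xi>"
proof (rule fourier_unique)
  note fu = fourier_spec[OF u] fourier_cutoff_L2[OF u]
  note fv = fourier_spec[OF v] fourier_cutoff_L2[OF v]
  show "(\<lambda>x. a * u x + b * v x) \<in> L2" by (intro L2_add L2_scale u v)
  show "(\<lambda>\<xi>. a * fourier u \<xi> + b * fourier v \<xi>) \<in> L2" by (intro L2_add L2_scale fu fv)
  have c: "fourier_cutoff n (\<lambda>x. a * u x + b * v x) \<xi> = a * fourier_cutoff n u \<xi> + b * fourier_cutoff n v \<xi>" for n \<xi>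
  proof -
    have "(LINT x|lebesgue. cis (- (x \<bullet> \<xi>)) * (indicator (cball 0 (real n)) x * (a * u x + b * v x))) =
      (LINT x|lebesgue. a * (cis (- (x \<bullet> \<xi>)) * (indicator (cball 0 (real n)) x * u x)) + b * (cis (- (x \<bullet> \<xi>)) * (indicator (cball 0 (real n)) x * v x)))"
      by (intro Bochner_Integration.integral_cong refl) (simp add: algebra_simps)
    also have "\<dots> = a * (LINT x|lebesgue. cis (- (x \<bullet> \<xi>)) * (indicator (cball 0 (real n)) x * u x)) +
       b * (LINT x|lebesgue. cis (- (x \<bullet> \<xi>)) * (indicator (cball 0 (real n)) x * v x))"
      using integrable_cis_mult(1)[OF integrable_cutoff[OF u]] integrable_cis_mult(1)[OF integrable_cutoff[OF v]]
      by (subst Bochner_Integration.integral_add) auto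
    finally show ?thesis unfolding fourier_cutoff_eq fourier1_def by (simp add: algebra_simps)
  qed
  have z: "(\<lambda>n. cmod a * L2_norm (\<lambda>\<xi>. fourier_cutoff n u \<xi> - fourier u \<xi>) + cmod b * L2_norm (\<lambda>\<xi>. fourier_cutoff n v \<xi> - fourier v \<xi>)) \<longlonglongrightarrow> 0"
    by (rule tendsto_eq_intros refl fu(2) fv(2) | simp)+
  show "(\<lambda>n. L2_norm (\<lambda>\<xi>. fourier_cutoff n (\<lambda>x. a * u x + b * v x) \<xi> - (a * fourier u \<xi> + b * fourier v \<xi>))) \<longlonglongrightarrow> 0"
  proof (rule tendsto_sandwich[OF _ _ tendsto_const z])
    have "L2_norm (\<lambda>\<xi>. fourier_cutoff n (\<lambda>x. a * u x + b * v x) \<xi> - (a * fourier u \<xi> + b * fourier v \<xi>)) \<le>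
      cmod a * L2_norm (\<lambda>\<xi>. fourier_cutoff n u \<xi> - fourier u \<xi>) + cmod b * L2_norm (\<lambda>\<xi>. fourier_cutoff n v \<xi> - fourier v \<xi>)" for n
    proof -
      have "L2_norm (\<lambda>\<xi>. a * (fourier_cutoff n u \<xi> - fourier u \<xi>) + b * (fourier_cutoff n v \<xi> - fourier v \<xi>)) \<le>
         L2_norm (\<lambda>\<xi>. a * (fourier_cutoff n u \<xi> - fourier u \<xi>)) + L2_norm (\<lambda>\<xi>. b * (fourier_cutoff n v \<xi> - fourier v \<xi>))"
        by (intro L2_norm_triangle L2_scale L2_diff fu fv)
      then show ?thesis unfolding L2_norm_scale by (simp add: c algebra_simps)
    qed
    then show "\<forall>\<^sub>F n in sequentially. L2_norm (\<lambda>\<xi>. fourier_cutoff n (\<lambda>x. a * u x + b * v x) \<xi> - (a * fourier u \<xi> + b * fourier v \<xi>)) \<le>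
      cmod a * L2_norm (\<lambda>\<xi>. fourier_cutoff n u \<xi> - fourier u \<xi>) + cmod b * L2_norm (\<lambda>\<xi>. fourier_cutoff n v \<xi> - fourier v \<xi>)" by simp
  qed simp
qed

lemma fourier_inner:
  fixes u v :: "real^'n \<Rightarrow> complex"
  assumes u: "u \<in> L2" and v: "v \<in> L2"
  shows "L2_inner (fourier u) (fourier v) = L2_inner u v"
proof -
  \<comment> \<open>Polarisation: comparing the norms of sums yields real parts only. The values
    \<open>b = 1\<close> and \<open>b = - \<i>\<close> then recover the real and the imaginary
    part.\<close>
  have re: "Re (L2_inner (fourier u) (\<lambda>\<xi>. b * fourier v \<xi>)) = Re (L2_inner u (\<lambda>x. b * v x))" for b
  proof -
    have bv: "(\<lambda>x. b * v x) \<in> L2" "(\<lambda>\<xi>. b * fourier v \<xi>) \<in> L2" by (intro L2_scale v fourier_spec)+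
    have "L2_norm (fourier (\<lambda>x. 1 * u x + b * v x)) = L2_norm (\<lambda>\<xi>. 1 * fourier u \<xi> + b * fourier v \<xi>)"
      using fourier_linear[OF u v, of 1 b] u v bv
      by (intro L2_norm_cong_AE fourier_measurable L2_measurable L2_add) (auto intro: fourier_spec)
    then have "L2_norm (\<lambda>x. u x + b * v x) = L2_norm (\<lambda>\<xi>. fourier u \<xi> + b * fourier v \<xi>)"
      using fourier_norm[OF L2_add[OF u bv(1)]] by simp
    then have "(L2_norm (\<lambda>x. u x + b * v x))\<^sup>2 = (L2_norm (\<lambda>\<xi>. fourier u \<xi> + b * fourier v \<xi>))\<^sup>2" by simp
    then show ?thesis
      unfolding L2_norm_add_sq[OF u bv(1)] L2_norm_add_sq[OF fourier_spec(1)[OF u] bv(2)]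
      by (simp add: L2_norm_scale fourier_norm u v)
  qed
  show ?thesis
    using re[of 1] re[of "- \<i>"] by (intro complex_eqI) (simp_all only: L2_inner_scale_right, simp_all)
qed

section \<open>The inverse transform\<close>

definition ifourier :: "(real^'n \<Rightarrow> complex) \<Rightarrow> real^'n \<Rightarrow> complex" where
  "ifourier g x = cnj (fourier (\<lambda>\<xi>. cnj (g \<xi>)) x)"

definition ifourier1 :: "(real^'n \<Rightarrow> complex) \<Rightarrow> real^'n \<Rightarrow> complex" where
  "ifourier1 g x = complex_of_real (fconst TYPE('n)) * (LINT \<xi>|lebesgue. cis (x \<bullet> \<xi>) * g \<xi>)"

lemma ifourier1_eq: "ifourier1 g x = cnj (fourier1 (\<lambda>\<xi>. cnj (g \<xi>)) x)"
  unfolding ifourier1_def fourier1_def complex_cnj_mult Bochner_Integration.integral_cnj[symmetric]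
  by (simp add: cis_cnj inner_commute)

lemma ifourier_L2: "g \<in> L2 \<Longrightarrow> ifourier g \<in> L2" for g :: "real^'n \<Rightarrow> complex"
  unfolding ifourier_def[abs_def] by (intro L2_cnj fourier_spec)

lemma ifourier_norm: "g \<in> L2 \<Longrightarrow> L2_norm (ifourier g) = L2_norm g" for g :: "real^'n \<Rightarrow> complex"
  unfolding ifourier_def[abs_def] L2_norm_cnj by (simp add: fourier_norm L2_cnj L2_norm_cnj)

lemma ifourier_eq_ifourier1:
  fixes g :: "real^'n \<Rightarrow> complex"
  assumes "integrable lebesgue g" "g \<in> L2"
  shows "AE x in lebesgue. ifourier g x = ifourier1 g x"
  using fourier_eq_fourier1[of "\<lambda>\<xi>. cnj (g \<xi>)"] assms by (simp add: ifourier_def ifourier1_eq L2_cnj)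

lemma fourier1_adjoint:
  fixes a b :: "real^'n \<Rightarrow> complex"
  assumes a: "integrable lebesgue a" and b: "integrable lebesgue b"
  shows "L2_inner (fourier1 a) b = L2_inner a (ifourier1 b)"
proof -
  have "L2_inner (fourier1 a) b = complex_of_real (fconst TYPE('n)) * (LINT \<xi>|lebesgue. LINT x|lebesgue. cnj (a x) * (cis (x \<bullet> \<xi>) * b \<xi>))"
  proof -
    have "cnj (fourier1 a \<xi>) * b \<xi> = complex_of_real (fconst TYPE('n)) * (LINT x|lebesgue. cnj (a x) * (cis (x \<bullet> \<xi>) * b \<xi>))" for \<xi>
    proof -
      have "(LINT x|lebesgue. cnj (a x) * (cis (x \<bullet> \<xi>) * b \<xi>)) = (LINT x|lebesgue. cnj (cis (- (x \<bullet> \<xi>)) * a x)) * b \<xi>"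
        by (subst Bochner_Integration.integral_mult_left_zero[symmetric]) (simp add: cis_cnj mult_ac)
      then show ?thesis unfolding fourier1_def Bochner_Integration.integral_cnj by simp
    qed
    then show ?thesis unfolding L2_inner_def by simp
  qed
  also have "(LINT \<xi>|lebesgue. LINT x|lebesgue. cnj (a x) * (cis (x \<bullet> \<xi>) * b \<xi>)) =
      (LINT x|lebesgue. LINT \<xi>|lebesgue. cnj (a x) * (cis (x \<bullet> \<xi>) * b \<xi>))"
  proof (rule lebesgue_pair.Fubini_integral)
    have ac: "integrable lebesgue (\<lambda>x. cnj (a x))" using a by simp
    have "(\<lambda>p. cis (fst p \<bullet> snd p)) \<in> borel_measurable (lebesgue \<Otimes>\<^sub>M lebesgue :: ((real^'n) \<times> (real^'n)) measure)"
      by (rule measurable_pair_lebesgue) measurable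
    moreover have "(\<lambda>p. cnj (a (fst p))) \<in> borel_measurable (lebesgue \<Otimes>\<^sub>M lebesgue :: ((real^'n) \<times> (real^'n)) measure)"
      using ac by (intro measurable_compose[OF measurable_fst]) auto
    moreover have "(\<lambda>p. b (snd p)) \<in> borel_measurable (lebesgue \<Otimes>\<^sub>M lebesgue :: ((real^'n) \<times> (real^'n)) measure)"
      using b by (intro measurable_compose[OF measurable_snd]) auto
    ultimately have "(\<lambda>p. cnj (a (fst p)) * (cis (fst p \<bullet> snd p) * b (snd p))) \<in> borel_measurable (lebesgue \<Otimes>\<^sub>M lebesgue)"
      by (intro borel_measurable_times)
    then have "(\<lambda>(x, \<xi>). cnj (a x) * (cis (x \<bullet> \<xi>) * b \<xi>)) \<in> borel_measurable (lebesgue \<Otimes>\<^sub>M lebesgue)"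
      by (simp add: case_prod_beta')
    then show "integrable (lebesgue \<Otimes>\<^sub>M lebesgue) (\<lambda>(x, \<xi>). cnj (a x) * (cis (x \<bullet> \<xi>) * b \<xi>))"
      by (rule lebesgue_pair.integrable_product_dom[OF ac b]) (simp add: norm_mult)
  qed
  also have "complex_of_real (fconst TYPE('n)) * \<dots> = L2_inner a (ifourier1 b)"
  proof -
    have "cnj (a x) * ifourier1 b x = complex_of_real (fconst TYPE('n)) * (LINT \<xi>|lebesgue. cnj (a x) * (cis (x \<bullet> \<xi>) * b \<xi>))" for x
      unfolding ifourier1_def by (simp add: mult.left_commute)
    then show ?thesis unfolding L2_inner_def by (simp only: Bochner_Integration.integral_mult_right_zero)
  qed
  finally show ?thesis .
qed

text \<open>Fubini's theorem covers integrable functions only, so both arguments are cut off to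
  balls. The two limits are taken one after the other, first in \<open>g\<close> and then in
  \<open>u\<close>.\<close>

lemma fourier_adjoint:
  fixes u g :: "real^'n \<Rightarrow> complex"
  assumes u: "u \<in> L2" and g: "g \<in> L2"
  shows "L2_inner (fourier u) g = L2_inner u (ifourier g)"
proof -
  define a where "a n x = indicator (cball 0 (real n)) x * u x" for n x
  define b where "b n x = indicator (cball 0 (real n)) x * g x" for n x
  have a: "integrable lebesgue (a n)" "a n \<in> L2" for n unfolding a_def[abs_def] by (rule integrable_cutoff[OF u] cutoff_L2[OF u])+
  have b: "integrable lebesgue (b n)" "b n \<in> L2" for n unfolding b_def[abs_def] by (rule integrable_cutoff[OF g] cutoff_L2[OF g])+
  have al: "(\<lambda>n. L2_norm (\<lambda>x. a n x - u x)) \<longlonglongrightarrow> 0" unfolding a_def by (rule cutoff_tendsto[OF u])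
  have bl: "(\<lambda>n. L2_norm (\<lambda>x. b n x - g x)) \<longlonglongrightarrow> 0" unfolding b_def by (rule cutoff_tendsto[OF g])
  have fa: "fourier_cutoff n u = fourier1 (a n)" for n by (simp add: fourier_cutoff_eq a_def[abs_def])
  have fb: "(\<lambda>x. cnj (fourier_cutoff n (\<lambda>\<xi>. cnj (g \<xi>)) x)) = ifourier1 (b n)" for n
  proof -
    have "(\<lambda>\<xi>. cnj (b n \<xi>)) = (\<lambda>x. indicator (cball 0 (real n)) x * cnj (g x))"
      by (auto simp: b_def indicator_def)
    then show ?thesis by (intro ext) (simp only: fourier_cutoff_eq ifourier1_eq)
  qed
  have fal: "(\<lambda>n. L2_norm (\<lambda>x. fourier1 (a n) x - fourier u x)) \<longlonglongrightarrow> 0" using fourier_spec(2)[OF u] unfolding fa .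
  have fbl: "(\<lambda>n. L2_norm (\<lambda>x. ifourier1 (b n) x - ifourier g x)) \<longlonglongrightarrow> 0"
  proof -
    have "L2_norm (\<lambda>x. ifourier1 (b n) x - ifourier g x) = L2_norm (\<lambda>x. cnj (fourier_cutoff n (\<lambda>\<xi>. cnj (g \<xi>)) x - fourier (\<lambda>\<xi>. cnj (g \<xi>)) x))" for n
      unfolding fb[symmetric] ifourier_def by simp
    then show ?thesis using fourier_spec(2)[OF L2_cnj[OF g]] unfolding L2_norm_cnj by simp
  qed
  have fa2: "fourier1 (a n) \<in> L2" for n by (rule plancherel_fourier1[OF a])
  have fb2: "ifourier1 (b n) \<in> L2" for n unfolding fb[symmetric] by (intro L2_cnj fourier_cutoff_L2 g)
  have 1: "L2_inner (fourier1 (a n)) g = L2_inner (a n) (ifourier g)" for n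
  proof (rule LIMSEQ_unique)
    show "(\<lambda>m. L2_inner (fourier1 (a n)) (b m)) \<longlonglongrightarrow> L2_inner (fourier1 (a n)) g"
      by (rule L2_tendsto_inner(1)[OF b(2) g bl fa2])
    show "(\<lambda>m. L2_inner (fourier1 (a n)) (b m)) \<longlonglongrightarrow> L2_inner (a n) (ifourier g)"
      unfolding fourier1_adjoint[OF a(1) b(1)] by (rule L2_tendsto_inner(1)[OF fb2 ifourier_L2[OF g] fbl a(2)])
  qed
  show ?thesis
  proof (rule LIMSEQ_unique)
    show "(\<lambda>n. L2_inner (fourier1 (a n)) g) \<longlonglongrightarrow> L2_inner (fourier u) g"
      by (rule L2_tendsto_inner(2)[OF fa2 fourier_spec(1)[OF u] fal g])
    show "(\<lambda>n. L2_inner (fourier1 (a n)) g) \<longlonglongrightarrow> L2_inner u (ifourier g)"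
      unfolding 1 by (rule L2_tendsto_inner(2)[OF a(2) u al ifourier_L2[OF g]])
  qed
qed

text \<open>The adjoint relation and the preservation of inner products show that
  \<open>ifourier (fourier u)\<close> and \<open>u\<close> have the same inner product with every
  function; tested on their difference \<open>w\<close>, this makes \<open>w\<close> orthogonal to
  itself.\<close>

lemma ifourier_fourier:
  fixes u :: "real^'n \<Rightarrow> complex"
  assumes u: "u \<in> L2" shows "AE x in lebesgue. ifourier (fourier u) x = u x"
proof -
  define w where "w x = ifourier (fourier u) x - u x" for x
  have f: "ifourier (fourier u) \<in> L2" by (intro ifourier_L2 fourier_spec u)
  then have w: "w \<in> L2" unfolding w_def[abs_def] by (intro L2_diff u)
  have "L2_inner w (ifourier (fourier u)) = L2_inner (fourier w) (fourier u)"
    by (rule fourier_adjoint[OF w fourier_spec(1)[OF u], symmetric])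
  also have "\<dots> = L2_inner w u" by (rule fourier_inner[OF w u])
  finally have "L2_inner w w = 0" unfolding w_def[abs_def]
    using L2_inner_diff_right[OF w f u] by (simp add: w_def[abs_def])
  then have "L2_norm w = 0" by (simp add: L2_inner_self)
  then have "AE x in lebesgue. w x = 0" using L2_norm_eq_0[OF w] by simp
  then show ?thesis by (simp add: w_def)
qed

text \<open>The conjugations that define \<open>ifourier\<close> exchange the two compositions, so
  surjectivity follows from the other inversion formula applied to the conjugate of
  \<open>g\<close>.\<close>

lemma fourier_ifourier:
  fixes g :: "real^'n \<Rightarrow> complex"
  assumes g: "g \<in> L2" shows "AE x in lebesgue. fourier (ifourier g) x = g x"
proof -
  have "AE x in lebesgue. ifourier (fourier (\<lambda>x. cnj (g x))) x = cnj (g x)" by (rule ifourier_fourier[OF L2_cnj[OF g]])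
  then show ?thesis by eventually_elim (simp add: ifourier_def[abs_def] complex_cnj_cancel_iff)
qed

section \<open>Modulations and translations\<close>

lemma fourier_modulation:
  fixes u :: "real^'n \<Rightarrow> complex"
  assumes u: "u \<in> L2"
  shows "(\<lambda>x. cis (x \<bullet> a) * u x) \<in> L2" "AE \<xi> in lebesgue. fourier (\<lambda>x. cis (x \<bullet> a) * u x) \<xi> = fourier u (\<xi> - a)"
proof -
  show c: "(\<lambda>x. cis (x \<bullet> a) * u x) \<in> L2" by (rule L2_mult_bounded(1)[OF u, where B=1]) auto
  have eq: "fourier_cutoff n (\<lambda>x. cis (x \<bullet> a) * u x) \<xi> = fourier_cutoff n u (\<xi> - a)" for n \<xi>
  proof -
    have "cis (- (x \<bullet> \<xi>)) * (indicator (cball 0 (real n)) x * (cis (x \<bullet> a) * u x)) = 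
       cis (- (x \<bullet> (\<xi> - a))) * (indicator (cball 0 (real n)) x * u x)" for x
    proof -
      have "cis (- (x \<bullet> (\<xi> - a))) = cis (- (x \<bullet> \<xi>)) * cis (x \<bullet> a)" by (simp add: cis_mult inner_diff_right)
      then show ?thesis by simp
    qed
    then show ?thesis unfolding fourier_cutoff_eq fourier1_def by (simp only:)
  qed
  show "AE \<xi> in lebesgue. fourier (\<lambda>x. cis (x \<bullet> a) * u x) \<xi> = fourier u (\<xi> - a)"
  proof (rule fourier_unique[OF c])
    show "(\<lambda>\<xi>. fourier u (\<xi> - a)) \<in> L2" using L2_translate(1)[OF fourier_spec(1)[OF u], of "- a"] by simp
    have "L2_norm (\<lambda>\<xi>. fourier_cutoff n u (\<xi> - a) - fourier u (\<xi> - a)) = L2_norm (\<lambda>\<xi>. fourier_cutoff n u \<xi> - fourier u \<xi>)" for n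
      using L2_translate(2)[OF L2_diff[OF fourier_cutoff_L2[OF u, of n] fourier_spec(1)[OF u]], of "- a"] by simp
    then show "(\<lambda>n. L2_norm (\<lambda>\<xi>. fourier_cutoff n (\<lambda>x. cis (x \<bullet> a) * u x) \<xi> - fourier u (\<xi> - a))) \<longlonglongrightarrow> 0"
      unfolding eq using fourier_spec(2)[OF u] by simp
  qed
qed

text \<open>Balls are not translation invariant, so the cutoffs do not commute with a shift. The
  rule is therefore obtained from the one for modulations through the inverse transform.\<close>

lemma fourier_translation:
  fixes u :: "real^'n \<Rightarrow> complex"
  assumes u: "u \<in> L2"
  shows "AE \<xi> in lebesgue. fourier (\<lambda>x. u (x + t)) \<xi> = cis (\<xi> \<bullet> t) * fourier u \<xi>"
proof -
  define g where "g \<xi> = cis (\<xi> \<bullet> t) * fourier u \<xi>" for \<xi>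
  have fu: "fourier u \<in> L2" by (rule fourier_spec[OF u])
  have g: "g \<in> L2" unfolding g_def[abs_def] by (rule fourier_modulation(1)[OF fu])
  have cg: "(\<lambda>\<xi>. cnj (g \<xi>)) = (\<lambda>\<xi>. cis (\<xi> \<bullet> - t) * cnj (fourier u \<xi>))"
    by (rule ext) (simp add: g_def cis_cnj)
  have "AE x in lebesgue. ifourier g x = ifourier (fourier u) (x + t)"
    using fourier_modulation(2)[OF L2_cnj[OF fu], of "- t"] unfolding ifourier_def cg
    by eventually_elim simp
  moreover have "AE x in lebesgue. ifourier (fourier u) (x + t) = u (x + t)"
    by (rule AE_lebesgue_translation[OF ifourier_fourier[OF u]])
  ultimately have "AE x in lebesgue. ifourier g x = u (x + t)" by eventually_elim simp
  then have "fourier (ifourier g) = fourier (\<lambda>x. u (x + t))"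
    using ifourier_L2[OF g] L2_translate(1)[OF u, of t] by (intro fourier_cong_AE L2_measurable)
  then show ?thesis using fourier_ifourier[OF g] by (simp add: g_def)
qed

text \<open>The symmetric difference has the Fourier multiplier
  \<open>2 * \<i> * sin (\<xi> \<bullet> t)\<close>, which is bounded by that of twice the
  directional derivative. This gives a quantitative bound without differentiating
  \<open>u\<close>.\<close>

lemma translation_difference_norm:
  fixes u :: "real^'n \<Rightarrow> complex"
  assumes u: "u \<in> L2" and Y: "(\<lambda>\<xi>. complex_of_real (\<xi> \<bullet> t) * fourier u \<xi>) \<in> L2"
  shows "L2_norm (\<lambda>x. u (x + t) - u (x - t)) \<le> 2 * L2_norm (\<lambda>\<xi>. complex_of_real (\<xi> \<bullet> t) * fourier u \<xi>)"
proof -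
  have t1: "(\<lambda>x. u (x + t)) \<in> L2" and t2: "(\<lambda>x. u (x + (- t))) \<in> L2" by (rule L2_translate(1)[OF u])+
  have fu: "fourier u \<in> L2" by (rule fourier_spec[OF u])
  define D where "D x = 1 * u (x + t) + (-1) * u (x + (- t))" for x
  have D: "D \<in> L2" unfolding D_def[abs_def] by (intro L2_add L2_scale t1 t2)
  have "AE \<xi> in lebesgue. fourier D \<xi> = 1 * fourier (\<lambda>x. u (x + t)) \<xi> + (-1) * fourier (\<lambda>x. u (x + (- t))) \<xi>"
    unfolding D_def[abs_def] by (rule fourier_linear[OF t1 t2])
  then have "AE \<xi> in lebesgue. cmod (fourier D \<xi>) \<le> cmod (2 * (complex_of_real (\<xi> \<bullet> t) * fourier u \<xi>))"
    using fourier_translation[OF u, of t] fourier_translation[OF u, of "- t"]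
  proof eventually_elim
    case (elim \<xi>)
    have "fourier D \<xi> = (cis (\<xi> \<bullet> t) - cis (- (\<xi> \<bullet> t))) * fourier u \<xi>"
      using elim by (simp add: algebra_simps)
    also have "cis (\<xi> \<bullet> t) - cis (- (\<xi> \<bullet> t)) = 2 * \<i> * complex_of_real (sin (\<xi> \<bullet> t))"
      by (simp add: complex_eq_iff)
    finally have "cmod (fourier D \<xi>) = 2 * \<bar>sin (\<xi> \<bullet> t)\<bar> * cmod (fourier u \<xi>)" by (simp add: norm_mult)
    also have "\<dots> \<le> 2 * \<bar>\<xi> \<bullet> t\<bar> * cmod (fourier u \<xi>)"
      by (intro mult_right_mono mult_left_mono abs_sin_x_le_abs_x) auto
    finally show ?case by (simp add: norm_mult)
  qed
  then have "L2_norm (fourier D) \<le> L2_norm (\<lambda>\<xi>. 2 * (complex_of_real (\<xi> \<bullet> t) * fourier u \<xi>))"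
    by (intro L2I_dom(2) L2_scale Y fourier_measurable D)
  then show ?thesis unfolding fourier_norm[OF D] L2_norm_scale by (simp add: D_def[abs_def])
qed

section \<open>The uncertainty principle\<close>

text \<open>The commutator \<open>[x, \<partial>]\<close> in integrated form: the derivative is replaced by a symmetric
  difference, so that only a translation of the integration variable is needed.\<close>

lemma heisenberg_direction:
  fixes u :: "real^'n \<Rightarrow> complex"
  assumes u: "u \<in> L2" and e: "norm e = 1" and X: "(\<lambda>x. complex_of_real (x \<bullet> e) * u x) \<in> L2"
    and Y: "(\<lambda>\<xi>. complex_of_real (\<xi> \<bullet> e) * fourier u \<xi>) \<in> L2"
  shows "(L2_norm u)\<^sup>2 \<le> 2 * (L2_norm (\<lambda>x. complex_of_real (x \<bullet> e) * u x) * L2_norm (\<lambda>\<xi>. complex_of_real (\<xi> \<bullet> e) * fourier u \<xi>))"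
proof -
  define xu where "xu = (\<lambda>x. complex_of_real (x \<bullet> e) * u x)"
  have xu: "xu \<in> L2" using X by (simp add: xu_def)
  let ?NX = "L2_norm xu" and ?NY = "L2_norm (\<lambda>\<xi>. complex_of_real (\<xi> \<bullet> e) * fourier u \<xi>)"
  have key: "Re (L2_inner u (\<lambda>x. u (x + h *\<^sub>R e))) \<le> 2 * (?NX * ?NY)" if h: "h > 0" for h
  proof -
    define t where "t = h *\<^sub>R e"
    have te: "t \<bullet> e = h" using e by (simp add: t_def norm_eq_1)
    have t1: "(\<lambda>x. u (x + t)) \<in> L2" "(\<lambda>x. u (x + (- t))) \<in> L2" by (rule L2_translate(1)[OF u])+
    have xt: "(\<lambda>x. xu (x + t)) \<in> L2" by (rule L2_translate(1)[OF xu])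
    define a where "a = L2_inner xu (\<lambda>x. u (x + t))"
    \<comment> \<open>Shifting the variable by \<open>t\<close> moves the translation onto
      \<open>xu\<close>, and \<open>(x + t) \<bullet> e = x \<bullet> e + h\<close> produces the
      extra term with \<open>h\<close>, the discrete commutator. The rest is the conjugate of
      \<open>a\<close> and cancels against \<open>a\<close> in the real part.\<close>
    have "L2_inner xu (\<lambda>x. u (x + (- t))) = (LINT x|lebesgue. cnj (xu (x + t)) * u ((x + t) + (- t)))"
      unfolding L2_inner_def using L2_measurable[OF xu] L2_measurable[OF t1(2)]
      by (subst lebesgue_integral_translation[where t=t, symmetric]) auto
    also have "\<dots> = L2_inner (\<lambda>x. xu (x + t)) u" by (simp add: L2_inner_def)
    also have "(\<lambda>x. xu (x + t)) = (\<lambda>x. complex_of_real (x \<bullet> e) * u (x + t) + complex_of_real h * u (x + t))"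
      by (rule ext) (simp add: xu_def inner_add_left te ring_distribs)
    also have "L2_inner \<dots> u = L2_inner (\<lambda>x. complex_of_real (x \<bullet> e) * u (x + t)) u + L2_inner (\<lambda>x. complex_of_real h * u (x + t)) u"
    proof (rule L2_inner_add_left[OF u])
      show "(\<lambda>x. complex_of_real h * u (x + t)) \<in> L2" by (intro L2_scale t1)
      then have "(\<lambda>x. xu (x + t) - complex_of_real h * u (x + t)) \<in> L2" by (intro L2_diff xt)
      then show "(\<lambda>x. complex_of_real (x \<bullet> e) * u (x + t)) \<in> L2" by (simp add: xu_def inner_add_left te ring_distribs)
    qed
    also have "L2_inner (\<lambda>x. complex_of_real (x \<bullet> e) * u (x + t)) u = cnj a"
      unfolding a_def L2_inner_cnj by (simp add: L2_inner_def xu_def mult_ac)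
    also have "L2_inner (\<lambda>x. complex_of_real h * u (x + t)) u = complex_of_real h * L2_inner (\<lambda>x. u (x + t)) u"
      by (simp add: L2_inner_scale_left)
    also have "L2_inner (\<lambda>x. u (x + t)) u = cnj (L2_inner u (\<lambda>x. u (x + t)))" by (simp add: L2_inner_cnj)
    finally have "Re (L2_inner xu (\<lambda>x. u (x + (- t)))) = Re a + h * Re (L2_inner u (\<lambda>x. u (x + t)))" by simp
    moreover have "L2_inner xu (\<lambda>x. u (x + t) - u (x + (- t))) = a - L2_inner xu (\<lambda>x. u (x + (- t)))"
      unfolding a_def by (rule L2_inner_diff_right[OF xu t1])
    ultimately have "h * Re (L2_inner u (\<lambda>x. u (x + t))) = - Re (L2_inner xu (\<lambda>x. u (x + t) - u (x + (- t))))" by simp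
    also have "\<dots> \<le> cmod (L2_inner xu (\<lambda>x. u (x + t) - u (x + (- t))))"
      using abs_Re_le_cmod[of "L2_inner xu (\<lambda>x. u (x + t) - u (x + (- t)))"] by linarith
    also have "\<dots> \<le> ?NX * L2_norm (\<lambda>x. u (x + t) - u (x - t))"
      using L2_Cauchy_Schwarz[OF xu L2_diff[OF t1]] by simp
    also have "\<dots> \<le> ?NX * (2 * (h * ?NY))"
    proof (rule mult_left_mono)
      have eq: "(\<lambda>\<xi>. complex_of_real (\<xi> \<bullet> t) * fourier u \<xi>) = (\<lambda>\<xi>. complex_of_real h * (complex_of_real (\<xi> \<bullet> e) * fourier u \<xi>))"
        by (rule ext) (simp add: t_def)
      have "(\<lambda>\<xi>. complex_of_real (\<xi> \<bullet> t) * fourier u \<xi>) \<in> L2" unfolding eq by (rule L2_scale[OF Y])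
      from translation_difference_norm[OF u this] 
      show "L2_norm (\<lambda>x. u (x + t) - u (x - t)) \<le> 2 * (h * ?NY)" unfolding eq L2_norm_scale using h by simp
    qed simp
    finally have "h * Re (L2_inner u (\<lambda>x. u (x + t))) \<le> h * (2 * (?NX * ?NY))" by (simp add: mult_ac)
    then show ?thesis using h by (simp add: t_def)
  qed
  define s where "s n = inverse (real (Suc n)) *\<^sub>R e" for n
  have s0: "s \<longlonglongrightarrow> 0" unfolding s_def
    using tendsto_scaleR[OF LIMSEQ_inverse_real_of_nat tendsto_const, of e] by simp
  have "(\<lambda>n. L2_inner u (\<lambda>x. u (x + s n))) \<longlonglongrightarrow> L2_inner u u"
    by (rule L2_tendsto_inner(1)[OF L2_translate(1)[OF u] u L2_translation_continuous[OF u s0] u])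
  then have "(\<lambda>n. Re (L2_inner u (\<lambda>x. u (x + s n)))) \<longlonglongrightarrow> Re (L2_inner u u)" by (rule tendsto_Re)
  then have "Re (L2_inner u u) \<le> 2 * (?NX * ?NY)"
    by (rule LIMSEQ_le_const2) (use key in \<open>auto simp: s_def\<close>)
  then show ?thesis by (simp add: L2_inner_self xu_def del: of_real_power)
qed

text \<open>Passage from the operator domain, with quadratic weight, to the form domain, with linear
  weight: the latter is dominated because \<open>r \<le> 1 + r^2\<close>, and half of the weight is
  moved into the other argument.\<close>

lemma L2_weight:
  fixes u :: "real^'n \<Rightarrow> complex"
  assumes u: "u \<in> L2" and k: "(\<lambda>x. complex_of_real ((norm x)\<^sup>2) * u x) \<in> L2"
  shows "(\<lambda>x. complex_of_real (norm x) * u x) \<in> L2"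
    "L2_inner u (\<lambda>x. complex_of_real ((norm x)\<^sup>2) * u x) = complex_of_real ((L2_norm (\<lambda>x. complex_of_real (norm x) * u x))\<^sup>2)"
proof -
  have um: "u \<in> borel_measurable lebesgue" by (rule L2_measurable[OF u])
  have a: "(\<lambda>x. complex_of_real (norm x) * u x) \<in> borel_measurable lebesgue" using um by simp
  have "(\<lambda>x. u x + complex_of_real ((norm x)\<^sup>2) * u x) \<in> L2" by (rule L2_add[OF u k])
  then show "(\<lambda>x. complex_of_real (norm x) * u x) \<in> L2"
  proof (rule L2I_dom(1)[OF _ a], intro AE_I2)
    fix x :: "real^'n"
    have "norm x \<le> 1 + (norm x)\<^sup>2"
    proof -
      have "0 \<le> (norm x - 1)\<^sup>2" by simp
      then have "2 * norm x \<le> 1 + (norm x)\<^sup>2" by (simp add: power2_diff)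
      then show ?thesis using norm_ge_zero[of x] by linarith
    qed
    have "u x + complex_of_real ((norm x)\<^sup>2) * u x = complex_of_real (1 + (norm x)\<^sup>2) * u x" by (simp add: ring_distribs)
    then have "cmod (u x + complex_of_real ((norm x)\<^sup>2) * u x) = (1 + (norm x)\<^sup>2) * cmod (u x)"
      by (simp only: norm_mult norm_of_real) (simp add: abs_of_nonneg)
    then show "cmod (complex_of_real (norm x) * u x) \<le> cmod (u x + complex_of_real ((norm x)\<^sup>2) * u x)"
      using mult_right_mono[OF \<open>norm x \<le> 1 + (norm x)\<^sup>2\<close>, of "cmod (u x)"] by (simp add: norm_mult)
  qed
  have "L2_inner u (\<lambda>x. complex_of_real ((norm x)\<^sup>2) * u x) = L2_inner (\<lambda>x. complex_of_real (norm x) * u x) (\<lambda>x. complex_of_real (norm x) * u x)"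
    unfolding L2_inner_def by (intro Bochner_Integration.integral_cong refl) (simp add: power2_eq_square)
  then show "L2_inner u (\<lambda>x. complex_of_real ((norm x)\<^sup>2) * u x) = complex_of_real ((L2_norm (\<lambda>x. complex_of_real (norm x) * u x))\<^sup>2)"
    by (simp only: L2_inner_self)
qed

lemma L2_norm_components:
  fixes u :: "real^'n \<Rightarrow> complex"
  assumes um: "u \<in> borel_measurable lebesgue" and X: "(\<lambda>x. complex_of_real (norm x) * u x) \<in> L2"
  shows "b \<in> Basis \<Longrightarrow> (\<lambda>x. complex_of_real (x \<bullet> b) * u x) \<in> L2"
    "(\<Sum>b\<in>Basis. (L2_norm (\<lambda>x. complex_of_real (x \<bullet> b) * u x))\<^sup>2) = (L2_norm (\<lambda>x. complex_of_real (norm x) * u x))\<^sup>2"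
proof -
  show 1: "(\<lambda>x. complex_of_real (x \<bullet> b) * u x) \<in> L2" if b: "b \<in> Basis" for b
  proof (rule L2I_dom(1)[OF X])
    show "AE x in lebesgue. cmod (complex_of_real (x \<bullet> b) * u x) \<le> cmod (complex_of_real (norm x) * u x)"
      using Basis_le_norm[OF b] by (auto simp: norm_mult intro!: mult_right_mono)
  qed (use um in simp)
  have "(\<Sum>b\<in>Basis. (L2_norm (\<lambda>x. complex_of_real (x \<bullet> b) * u x))\<^sup>2) =
     (LINT x|lebesgue. (\<Sum>b\<in>Basis. (cmod (complex_of_real (x \<bullet> b) * u x))\<^sup>2))"
    unfolding L2_norm_sq using 1 by (subst Bochner_Integration.integral_sum) (auto simp: L2_def)
  also have "\<dots> = (LINT x|lebesgue. (cmod (complex_of_real (norm x) * u x))\<^sup>2)"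
  proof (intro Bochner_Integration.integral_cong refl)
    fix x :: "real^'n"
    have "(norm x)\<^sup>2 = (\<Sum>b\<in>Basis. (x \<bullet> b)\<^sup>2)"
      unfolding power2_norm_eq_inner by (subst euclidean_inner) (simp only: power2_eq_square)
    then show "(\<Sum>b\<in>Basis. (cmod (complex_of_real (x \<bullet> b) * u x))\<^sup>2) = (cmod (complex_of_real (norm x) * u x))\<^sup>2"
      by (simp only: norm_mult norm_of_real power_mult_distrib power2_abs abs_norm_cancel sum_distrib_right)
  qed
  finally show "(\<Sum>b\<in>Basis. (L2_norm (\<lambda>x. complex_of_real (x \<bullet> b) * u x))\<^sup>2) = (L2_norm (\<lambda>x. complex_of_real (norm x) * u x))\<^sup>2"
    by (simp only: L2_norm_sq)
qed

text \<open>The directional inequality is weakened by \<open>2ab \<le> a^2 + b^2\<close> and summed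
  over an orthonormal basis. The resulting constant, the dimension, is the ground state energy of
  \<open>-\<Delta> + x^2\<close>; the prefactor \<open>e^e / d\<close> of the harmonic oscillator
  turns it into \<open>e^e\<close>.\<close>

lemma heisenberg:
  fixes u :: "real^'n \<Rightarrow> complex"
  assumes u: "u \<in> L2" and X: "(\<lambda>x. complex_of_real (norm x) * u x) \<in> L2"
    and Y: "(\<lambda>\<xi>. complex_of_real (norm \<xi>) * fourier u \<xi>) \<in> L2"
  shows "real CARD('n) * (L2_norm u)\<^sup>2 \<le> (L2_norm (\<lambda>x. complex_of_real (norm x) * u x))\<^sup>2
     + (L2_norm (\<lambda>\<xi>. complex_of_real (norm \<xi>) * fourier u \<xi>))\<^sup>2"
proof -
  note cX = L2_norm_components[OF L2_measurable[OF u] X] and cY = L2_norm_components[OF fourier_measurable[OF u] Y]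
  have "(\<Sum>b\<in>(Basis :: (real^'n) set). (L2_norm u)\<^sup>2) \<le> (\<Sum>b\<in>Basis. (L2_norm (\<lambda>x. complex_of_real (x \<bullet> b) * u x))\<^sup>2 + (L2_norm (\<lambda>\<xi>. complex_of_real (\<xi> \<bullet> b) * fourier u \<xi>))\<^sup>2)"
  proof (rule sum_mono)
    fix b :: "real^'n" assume b: "b \<in> Basis"
    have "(L2_norm u)\<^sup>2 \<le> 2 * (L2_norm (\<lambda>x. complex_of_real (x \<bullet> b) * u x) * L2_norm (\<lambda>\<xi>. complex_of_real (\<xi> \<bullet> b) * fourier u \<xi>))"
      by (rule heisenberg_direction[OF u _ cX(1)[OF b] cY(1)[OF b]]) (use b in simp)
    also have "\<dots> \<le> (L2_norm (\<lambda>x. complex_of_real (x \<bullet> b) * u x))\<^sup>2 + (L2_norm (\<lambda>\<xi>. complex_of_real (\<xi> \<bullet> b) * fourier u \<xi>))\<^sup>2"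
      using sum_squares_bound[of "L2_norm (\<lambda>x. complex_of_real (x \<bullet> b) * u x)" "L2_norm (\<lambda>\<xi>. complex_of_real (\<xi> \<bullet> b) * fourier u \<xi>)"] by (simp add: mult.assoc)
    finally show "(L2_norm u)\<^sup>2 \<le> (L2_norm (\<lambda>x. complex_of_real (x \<bullet> b) * u x))\<^sup>2 + (L2_norm (\<lambda>\<xi>. complex_of_real (\<xi> \<bullet> b) * fourier u \<xi>))\<^sup>2" .
  qed
  then show ?thesis by (simp add: sum.distrib cX(2) cY(2))
qed

lemma harmonic_oscillator_form:
  fixes u f :: "real^'n \<Rightarrow> complex"
  assumes "(u, f) \<in> harmonic_oscillator"
  shows "u \<in> L2" "f \<in> L2" "(\<lambda>x. complex_of_real (norm x) * u x) \<in> L2" "(\<lambda>\<xi>. complex_of_real (norm \<xi>) * fourier u \<xi>) \<in> L2"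
    "L2_inner u f = complex_of_real (exp (exp 1) / real CARD('n) * ((L2_norm (\<lambda>x. complex_of_real (norm x) * u x))\<^sup>2
     + (L2_norm (\<lambda>\<xi>. complex_of_real (norm \<xi>) * fourier u \<xi>))\<^sup>2))"
proof -
  obtain g k where gk: "(u, g) \<in> neg_laplacian" "(u, k) \<in> square_multiplication" and f: "f \<in> L2"
     and fe: "AE x in lebesgue. f x = complex_of_real (exp (exp 1) / real CARD('n)) * (g x + k x)"
    using assms unfolding harmonic_oscillator_def by auto
  have u: "u \<in> L2" and g: "g \<in> L2" and k: "k \<in> L2"
    and ge: "AE \<xi> in lebesgue. fourier g \<xi> = complex_of_real ((norm \<xi>)\<^sup>2) * fourier u \<xi>"
    and ke: "AE x in lebesgue. k x = complex_of_real ((norm x)\<^sup>2) * u x"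
    using gk unfolding neg_laplacian_def square_multiplication_def by auto
  show "u \<in> L2" "f \<in> L2" by fact+
  have fu: "fourier u \<in> L2" by (rule fourier_spec[OF u])
  have um: "u \<in> borel_measurable lebesgue" and fum: "fourier u \<in> borel_measurable lebesgue"
    using u fu by (auto dest: L2_measurable)
  have k2: "(\<lambda>x. complex_of_real ((norm x)\<^sup>2) * u x) \<in> L2"
    by (rule L2_cong_AE(1)[OF k]) (use um ke in \<open>auto elim: eventually_mono\<close>)
  have g2: "(\<lambda>\<xi>. complex_of_real ((norm \<xi>)\<^sup>2) * fourier u \<xi>) \<in> L2"
    by (rule L2_cong_AE(1)[OF fourier_spec(1)[OF g]]) (use fum ge in \<open>auto elim: eventually_mono\<close>)
  show "(\<lambda>x. complex_of_real (norm x) * u x) \<in> L2" by (rule L2_weight(1)[OF u k2])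
  show "(\<lambda>\<xi>. complex_of_real (norm \<xi>) * fourier u \<xi>) \<in> L2" by (rule L2_weight(1)[OF fu g2])
  have "L2_inner u f = L2_inner u (\<lambda>x. complex_of_real (exp (exp 1) / real CARD('n)) * (g x + k x))"
    by (rule L2_inner_cong_AE) (use f fe um L2_measurable[OF g] L2_measurable[OF k] in \<open>auto dest: L2_measurable\<close>)
  also have "\<dots> = complex_of_real (exp (exp 1) / real CARD('n)) * (L2_inner u g + L2_inner u k)"
    by (simp only: L2_inner_scale_right L2_inner_add_right[OF u g k])
  also have "L2_inner u g = L2_inner (fourier u) (fourier g)" by (rule fourier_inner[OF u g, symmetric])
  also have "\<dots> = L2_inner (fourier u) (\<lambda>\<xi>. complex_of_real ((norm \<xi>)\<^sup>2) * fourier u \<xi>)"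
    by (rule L2_inner_cong_AE) (use ge fum fourier_measurable[OF g] in auto)
  also have "\<dots> = complex_of_real ((L2_norm (\<lambda>\<xi>. complex_of_real (norm \<xi>) * fourier u \<xi>))\<^sup>2)" by (rule L2_weight(2)[OF fu g2])
  also have "L2_inner u k = L2_inner u (\<lambda>x. complex_of_real ((norm x)\<^sup>2) * u x)"
    by (rule L2_inner_cong_AE) (use ke um L2_measurable[OF k] in auto)
  also have "\<dots> = complex_of_real ((L2_norm (\<lambda>x. complex_of_real (norm x) * u x))\<^sup>2)" by (rule L2_weight(2)[OF u k2])
  finally show "L2_inner u f = complex_of_real (exp (exp 1) / real CARD('n) * ((L2_norm (\<lambda>x. complex_of_real (norm x) * u x))\<^sup>2
     + (L2_norm (\<lambda>\<xi>. complex_of_real (norm \<xi>) * fourier u \<xi>))\<^sup>2))"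
    by (simp only: of_real_mult of_real_add add.commute)
qed

section \<open>Projection-valued measures\<close>

locale pvm =
  fixes E :: "real set \<Rightarrow> (real^'n \<Rightarrow> complex) \<Rightarrow> (real^'n \<Rightarrow> complex)"
  assumes pvm: "projection_valued_measure E"
begin

lemma proj: "S \<in> sets borel \<Longrightarrow> orthogonal_projection (E S)"
  using pvm unfolding projection_valued_measure_def by blast

lemma E_L2: "S \<in> sets borel \<Longrightarrow> u \<in> L2 \<Longrightarrow> E S u \<in> L2"
  using proj unfolding orthogonal_projection_def by blast

lemma E_sym: "S \<in> sets borel \<Longrightarrow> u \<in> L2 \<Longrightarrow> v \<in> L2 \<Longrightarrow> L2_inner (E S u) v = L2_inner u (E S v)"
  using proj unfolding orthogonal_projection_def by blast

lemma E_idem: "S \<in> sets borel \<Longrightarrow> u \<in> L2 \<Longrightarrow> AE x in lebesgue. E S (E S u) x = E S u x"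
  using proj unfolding orthogonal_projection_def by blast

lemma E_UNIV: "u \<in> L2 \<Longrightarrow> AE x in lebesgue. E UNIV u x = u x"
  using pvm unfolding projection_valued_measure_def by blast

lemma E_UN:
  assumes "range A \<subseteq> sets borel" "disjoint_family (A :: nat \<Rightarrow> _)" "u \<in> L2"
  shows "(\<lambda>n. L2_norm (\<lambda>x. (\<Sum>i<n. E (A i) u x) - E (\<Union>i. A i) u x)) \<longlonglongrightarrow> 0"
  using pvm assms unfolding projection_valued_measure_def
  by (subst L2_norm_minus_commute) blast

lemma E_self:
  assumes "S \<in> sets borel" "u \<in> L2"
  shows "L2_inner u (E S u) = complex_of_real ((L2_norm (E S u))\<^sup>2)"
proof -
  have "L2_inner (E S u) (E S u) = L2_inner u (E S (E S u))" by (intro E_sym E_L2 assms)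
  also have "\<dots> = L2_inner u (E S u)"
    using E_idem[OF assms] E_L2 assms by (intro L2_inner_cong_AE) (auto intro: L2_measurable)
  finally show ?thesis by (simp only: L2_inner_self)
qed

text \<open>Not part of the definition. Countable additivity for the family consisting of empty sets
  says that \<open>n\<close> copies of \<open>E {} u\<close> converge to one copy, which is possible
  only if the norm vanishes.\<close>

lemma E_empty:
  assumes u: "u \<in> L2" shows "L2_norm (E {} u) = 0"
proof -
  have e: "E {} u \<in> L2" using u by (intro E_L2) auto
  have "(\<lambda>n. L2_norm (\<lambda>x. (\<Sum>i<n. E {} u x) - E (\<Union>i::nat. {}) u x)) \<longlonglongrightarrow> 0"
    by (rule E_UN) (auto simp: disjoint_family_on_def u)
  then have "(\<lambda>n. L2_norm (\<lambda>x. complex_of_real (real n - 1) * E {} u x)) \<longlonglongrightarrow> 0"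
    by (simp add: algebra_simps)
  then have l: "(\<lambda>n. \<bar>real n - 1\<bar> * L2_norm (E {} u)) \<longlonglongrightarrow> 0"
    unfolding L2_norm_scale by (simp only: norm_of_real)
  have "L2_norm (E {} u) \<le> 0"
  proof (rule LIMSEQ_le_const[OF l], intro exI allI impI)
    fix n :: nat assume "n \<ge> 2"
    then have "1 \<le> \<bar>real n - 1\<bar>" by simp
    then show "L2_norm (E {} u) \<le> \<bar>real n - 1\<bar> * L2_norm (E {} u)"
      using mult_right_mono[of 1 "\<bar>real n - 1\<bar>" "L2_norm (E {} u)"] by simp
  qed
  then show ?thesis by (simp add: order_antisym)
qed

text \<open>Two sets are padded with empty ones to a disjoint sequence. From the second partial sum
  on, the sums agree almost everywhere with the claimed value.\<close>

lemma E_Un: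
  assumes A: "A \<in> sets borel" and B: "B \<in> sets borel" and d: "A \<inter> B = {}" and u: "u \<in> L2"
  shows "AE x in lebesgue. E (A \<union> B) u x = E A u x + E B u x"
proof (rule L2_limit_unique)
  define C where "C i = (if i = 0 then A else if i = 1 then B else {})" for i :: nat
  have C: "range C \<subseteq> sets borel" "disjoint_family C" using A B d by (auto simp: C_def disjoint_family_on_def)
  have U: "(\<Union>i. C i) = A \<union> B"
  proof
    show "A \<union> B \<subseteq> (\<Union>i. C i)" using UN_upper[of 0 UNIV C] UN_upper[of 1 UNIV C] by (simp add: C_def)
  qed (auto simp: C_def split: if_splits)
  show "(\<lambda>n. L2_norm (\<lambda>x. (\<Sum>i<n. E (C i) u x) - E (A \<union> B) u x)) \<longlonglongrightarrow> 0"
    using E_UN[OF C u] by (simp add: U)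
  show CL: "(\<lambda>x. \<Sum>i<n. E (C i) u x) \<in> L2" for n using C by (intro L2_sum E_L2 u) auto
  show "E (A \<union> B) u \<in> L2" "(\<lambda>x. E A u x + E B u x) \<in> L2" using A B u by (auto intro!: E_L2 L2_add)
  have z: "AE x in lebesgue. E {} u x = 0" using E_empty[OF u] L2_norm_eq_0[of "E {} u"] E_L2[of "{}" u] u by auto
  have "L2_norm (\<lambda>x. (\<Sum>i<n. E (C i) u x) - (E A u x + E B u x)) = 0" if "n \<ge> 2" for n
  proof -
    have s: "(\<Sum>i<n. E (C i) u x) = E A u x + E B u x + (\<Sum>i\<in>{2..<n}. E {} u x)" for x
    proof -
      have "{..<n} = {0,1} \<union> {2..<n}" using that by auto
      then have "(\<Sum>i<n. E (C i) u x) = (\<Sum>i\<in>{0,1}. E (C i) u x) + (\<Sum>i\<in>{2..<n}. E (C i) u x)"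
        by (simp only:) (rule sum.union_disjoint, auto)
      also have "(\<Sum>i\<in>{2..<n}. E (C i) u x) = (\<Sum>i\<in>{2..<n}. E {} u x)"
        by (intro sum.cong) (auto simp: C_def)
      finally show ?thesis by (simp add: C_def)
    qed
    have "AE x in lebesgue. (\<Sum>i<n. E (C i) u x) - (E A u x + E B u x) = 0"
      using z by eventually_elim (simp add: s)
    then show ?thesis using L2_norm_eq_0[OF L2_diff[OF CL \<open>(\<lambda>x. E A u x + E B u x) \<in> L2\<close>]] by blast
  qed
  then have "\<forall>\<^sub>F n in sequentially. L2_norm (\<lambda>x. (\<Sum>i<n. E (C i) u x) - (E A u x + E B u x)) = 0"
    unfolding eventually_sequentially by blast
  then show "(\<lambda>n. L2_norm (\<lambda>x. (\<Sum>i<n. E (C i) u x) - (E A u x + E B u x))) \<longlonglongrightarrow> 0"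
    by (rule tendsto_eventually)
qed

text \<open>Computing the squared norm of \<open>E (A \<union> B) w\<close> in two ways gives
  vanishing real part of the inner product of \<open>E A w\<close> and \<open>E B w\<close>, for
  every \<open>w\<close>. For \<open>w = E B v\<close> this real part is the squared norm of
  \<open>E A (E B v)\<close>, so the product of the two projections is zero and the inner product
  vanishes for different arguments as well.\<close>

lemma E_orth:
  assumes A: "A \<in> sets borel" and B: "B \<in> sets borel" and d: "A \<inter> B = {}" and u: "u \<in> L2" and v: "v \<in> L2"
  shows "L2_inner (E A u) (E B v) = 0"
proof -
  have R: "Re (L2_inner (E A w) (E B w)) = 0" if w: "w \<in> L2" for w
  proof -
    have AB: "E A w \<in> L2" "E B w \<in> L2" "E (A \<union> B) w \<in> L2" using A B w by (auto intro: E_L2)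
    have s: "(\<lambda>x. E A w x + E B w x) \<in> L2" by (rule L2_add[OF AB(1,2)])
    have n: "L2_norm (E (A \<union> B) w) = L2_norm (\<lambda>x. E A w x + E B w x)"
      using E_Un[OF A B d w] s AB by (intro L2_norm_cong_AE) (auto intro: L2_measurable)
    have "complex_of_real ((L2_norm (E (A \<union> B) w))\<^sup>2) = L2_inner w (E (A \<union> B) w)" using E_self[of "A \<union> B" w] A B w by simp
    also have "\<dots> = L2_inner w (\<lambda>x. E A w x + E B w x)"
      using E_Un[OF A B d w] s AB w by (intro L2_inner_cong_AE) (auto intro: L2_measurable)
    also have "\<dots> = complex_of_real ((L2_norm (E A w))\<^sup>2 + (L2_norm (E B w))\<^sup>2)"
      unfolding L2_inner_add_right[OF w AB(1,2)] E_self[OF A w] E_self[OF B w] by simp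
    finally have "(L2_norm (\<lambda>x. E A w x + E B w x))\<^sup>2 = (L2_norm (E A w))\<^sup>2 + (L2_norm (E B w))\<^sup>2"
      unfolding n by (simp only: of_real_eq_iff)
    then show ?thesis by (simp add: L2_norm_add_sq[OF AB(1,2)])
  qed
  have Bv: "E B v \<in> L2" by (rule E_L2[OF B v])
  have ABv: "E A (E B v) \<in> L2" by (rule E_L2[OF A Bv])
  have "L2_inner (E A (E B v)) (E B (E B v)) = L2_inner (E A (E B v)) (E B v)"
    using E_idem[OF B v] Bv ABv E_L2[OF B Bv] by (intro L2_inner_cong_AE) (auto intro: L2_measurable)
  also have "\<dots> = L2_inner (E B v) (E A (E B v))" by (rule E_sym[OF A Bv Bv])
  also have "\<dots> = complex_of_real ((L2_norm (E A (E B v)))\<^sup>2)" by (rule E_self[OF A Bv])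
  finally have "(L2_norm (E A (E B v)))\<^sup>2 = 0" using R[OF Bv] by simp
  then have z: "AE x in lebesgue. E A (E B v) x = 0" using L2_norm_eq_0[OF ABv] by simp
  have "L2_inner (E A u) (E B v) = L2_inner u (E A (E B v))" by (rule E_sym[OF A u Bv])
  also have "\<dots> = L2_inner u (\<lambda>_. 0)"
    using z u ABv by (intro L2_inner_cong_AE) (auto intro: L2_measurable)
  finally show ?thesis by (simp add: L2_inner_def)
qed

lemma E_inner:
  assumes A: "A \<in> sets borel" and B: "B \<in> sets borel" and u: "u \<in> L2"
  shows "L2_inner (E A u) (E B u) = complex_of_real ((L2_norm (E (A \<inter> B) u))\<^sup>2)"
proof -
  have s: "A \<inter> B \<in> sets borel" "A - B \<in> sets borel" "B - A \<in> sets borel" using A B by auto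
  have A': "AE x in lebesgue. E A u x = E (A \<inter> B) u x + E (A - B) u x"
    using E_Un[OF s(1,2) _ u] by (simp add: Int_Diff_disjoint Int_Diff_Un)
  have B': "AE x in lebesgue. E B u x = E (A \<inter> B) u x + E (B - A) u x"
    using E_Un[of "A \<inter> B" "B - A" u] s u by (simp add: Int_commute[of A] Int_Diff_disjoint Int_Diff_Un)
  have L: "E A u \<in> L2" "E B u \<in> L2" "E (A \<inter> B) u \<in> L2" "E (A - B) u \<in> L2" "E (B - A) u \<in> L2"
    using A B s u by (auto intro: E_L2)
  have "L2_inner (E A u) (E B u) = L2_inner (\<lambda>x. E (A \<inter> B) u x + E (A - B) u x) (\<lambda>x. E (A \<inter> B) u x + E (B - A) u x)"
    using A' B' L by (intro L2_inner_cong_AE) (auto intro!: L2_measurable L2_add)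
  also have "\<dots> = L2_inner (E (A \<inter> B) u) (E (A \<inter> B) u) + L2_inner (E (A \<inter> B) u) (E (B - A) u)
     + (L2_inner (E (A - B) u) (E (A \<inter> B) u) + L2_inner (E (A - B) u) (E (B - A) u))"
    using L by (subst L2_inner_add_left) (auto intro!: L2_add simp: L2_inner_add_right)
  also have "\<dots> = L2_inner (E (A \<inter> B) u) (E (A \<inter> B) u)"
  proof -
    have "A \<inter> B \<inter> (B - A) = {}" "(A - B) \<inter> (A \<inter> B) = {}" "(A - B) \<inter> (B - A) = {}" by auto
    then show ?thesis by (simp add: E_orth[OF s(1,3) _ u u] E_orth[OF s(2,1) _ u u] E_orth[OF s(2,3) _ u u])
  qed
  finally show ?thesis by (simp only: L2_inner_self)
qed

section \<open>Scalar spectral measures and spectral integrals\<close>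

abbreviation mu where "mu v \<equiv> scalar_spectral_measure E v"

lemma sets_mu [simp, measurable_cong]: "sets (mu v) = sets borel"
  unfolding scalar_spectral_measure_def
  using sigma_algebra.sets_measure_of_eq[OF sets.sigma_algebra_axioms[of borel]] by simp

lemma space_mu [simp]: "space (mu v) = UNIV"
  unfolding scalar_spectral_measure_def by (simp add: space_measure_of_conv)

text \<open>\<open>measure_of\<close> reproduces the given set function only once countable
  additivity is known. The squared norm equals the inner product of \<open>v\<close> with
  \<open>E S v\<close>, which is linear in the projection, so additivity follows from strong
  convergence.\<close>

lemma emeasure_mu:
  assumes v: "v \<in> L2" and S: "S \<in> sets borel"
  shows "emeasure (mu v) S = ennreal ((L2_norm (E S v))\<^sup>2)"
proof (rule emeasure_measure_of[OF scalar_spectral_measure_def])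
  show "positive (sets (mu v)) (\<lambda>S. ennreal ((L2_norm (E S v))\<^sup>2))" by (simp add: positive_def E_empty[OF v])
  show "countably_additive (sets (mu v)) (\<lambda>S. ennreal ((L2_norm (E S v))\<^sup>2))"
  proof (rule countably_additiveI)
    fix A :: "nat \<Rightarrow> real set" assume A: "range A \<subseteq> sets (mu v)" "disjoint_family A"
    have A': "range A \<subseteq> sets borel" using A(1) by simp
    then have Ai: "A i \<in> sets borel" for i by auto
    have UA: "(\<Union>i. A i) \<in> sets borel" using A' by auto
    have "(\<lambda>n. L2_inner v (\<lambda>x. \<Sum>i<n. E (A i) v x)) \<longlonglongrightarrow> L2_inner v (E (\<Union>i. A i) v)"
      by (rule L2_tendsto_inner(1)[OF _ _ E_UN[OF A' A(2) v] v]) (use Ai UA v in \<open>auto intro!: L2_sum E_L2\<close>)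
    moreover have "L2_inner v (\<lambda>x. \<Sum>i<n. E (A i) v x) = complex_of_real (\<Sum>i<n. (L2_norm (E (A i) v))\<^sup>2)" for n
      using Ai v by (subst L2_inner_sum_right) (auto intro: E_L2 simp: E_self)
    ultimately have "(\<lambda>n. complex_of_real (\<Sum>i<n. (L2_norm (E (A i) v))\<^sup>2)) \<longlonglongrightarrow> complex_of_real ((L2_norm (E (\<Union>i. A i) v))\<^sup>2)"
      using E_self[OF UA v] by simp
    then have "(\<lambda>i. (L2_norm (E (A i) v))\<^sup>2) sums ((L2_norm (E (\<Union>i. A i) v))\<^sup>2)"
      unfolding sums_def by (simp only: tendsto_of_real_iff)
    then show "(\<Sum>i. ennreal ((L2_norm (E (A i) v))\<^sup>2)) = ennreal ((L2_norm (E (\<Union> (range A)) v))\<^sup>2)"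
      by (intro suminf_ennreal_eq) auto
  qed
qed (use S in auto)

lemma measure_mu: "v \<in> L2 \<Longrightarrow> S \<in> sets borel \<Longrightarrow> measure (mu v) S = (L2_norm (E S v))\<^sup>2"
  by (simp add: measure_def emeasure_mu)

lemma E_UNIV_norm: "v \<in> L2 \<Longrightarrow> L2_norm (E UNIV v) = L2_norm v"
  using E_UNIV[of v] E_L2[of UNIV v] by (intro L2_norm_cong_AE) (auto intro: L2_measurable)

lemma finite_measure_mu: "v \<in> L2 \<Longrightarrow> finite_measure (mu v)"
  by (rule finite_measureI) (simp add: emeasure_mu)

abbreviation sse where "sse \<equiv> simple_spectral_integral E"

lemma simple_fun_facts:
  assumes "simple_function borel (g :: real \<Rightarrow> real)"
  shows "finite (range g)" "g -` {y} \<in> sets borel" "g \<in> borel_measurable borel" 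
    "g t = (\<Sum>y\<in>range g. y * indicator (g -` {y}) t)"
proof -
  show f: "finite (range g)" using assms by (simp add: simple_function_def)
  show m: "g \<in> borel_measurable borel" using assms by (rule borel_measurable_simple_function)
  show "g -` {y} \<in> sets borel" using measurable_sets[OF m, of "{y}"] by simp
  have "(\<Sum>y\<in>range g. y * indicator (g -` {y}) t) = (\<Sum>y\<in>range g. if y = g t then y else 0)"
    by (intro sum.cong) (auto simp: indicator_def)
  then show "g t = (\<Sum>y\<in>range g. y * indicator (g -` {y}) t)" using f by simp
qed

lemma sse_L2: "simple_function borel g \<Longrightarrow> v \<in> L2 \<Longrightarrow> sse g v \<in> L2"
  unfolding simple_spectral_integral_def[abs_def] by (intro L2_sum L2_scale E_L2 simple_fun_facts(2))

lemma simple_integrable_mu: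
  fixes g :: "real \<Rightarrow> real"
  assumes "simple_function borel g" "v \<in> L2" shows "integrable (mu v) g"
proof -
  interpret finite_measure "mu v" by (rule finite_measure_mu[OF assms(2)])
  have "\<bar>g t\<bar> \<le> (\<Sum>y\<in>range g. \<bar>y\<bar>)" for t
    using simple_fun_facts(1)[OF assms(1)] by (intro member_le_sum) auto
  then have "AE t in mu v. norm (g t) \<le> (\<Sum>y\<in>range g. \<bar>y\<bar>)" by (intro AE_I2) simp
  moreover have "g \<in> borel_measurable (mu v)" using simple_fun_facts(3)[OF assms(1)] by simp
  ultimately show ?thesis by (rule integrable_const_bound)
qed

text \<open>The isometry behind the functional calculus: by orthogonality of disjoint parts, the
  inner product of two level projections is the mass of the intersection of the level sets.\<close>

lemma sse_inner:
  assumes g: "simple_function borel g" and h: "simple_function borel h" and v: "v \<in> L2"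
  shows "L2_inner (sse g v) (sse h v) = complex_of_real (LINT t|mu v. g t * h t)"
proof -
  interpret finite_measure "mu v" by (rule finite_measure_mu[OF v])
  note G = simple_fun_facts[OF g] and H = simple_fun_facts[OF h]
  have "L2_inner (sse g v) (sse h v) = (\<Sum>y\<in>range g. complex_of_real y * L2_inner (E (g -` {y}) v) (sse h v))"
    unfolding simple_spectral_integral_def[of E g v, abs_def] using G(2) sse_L2[OF h v] v
    by (subst L2_inner_sum_left) (auto intro!: L2_scale E_L2 simp: L2_inner_scale_left)
  also have "\<dots> = (\<Sum>y\<in>range g. \<Sum>z\<in>range h. complex_of_real y * (complex_of_real z * L2_inner (E (g -` {y}) v) (E (h -` {z}) v)))"
  proof (rule sum.cong[OF refl])
    fix y
    have Ey: "E (g -` {y}) v \<in> L2" using G(2) v by (intro E_L2)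
    have "L2_inner (E (g -` {y}) v) (sse h v) = (\<Sum>z\<in>range h. complex_of_real z * L2_inner (E (g -` {y}) v) (E (h -` {z}) v))"
      unfolding simple_spectral_integral_def[of E h v, abs_def] using H(2) Ey v
      by (subst L2_inner_sum_right) (auto intro!: L2_scale E_L2 simp: L2_inner_scale_right)
    then show "complex_of_real y * L2_inner (E (g -` {y}) v) (sse h v) =
        (\<Sum>z\<in>range h. complex_of_real y * (complex_of_real z * L2_inner (E (g -` {y}) v) (E (h -` {z}) v)))"
      by (simp only: sum_distrib_left)
  qed
  also have "\<dots> = complex_of_real (\<Sum>y\<in>range g. \<Sum>z\<in>range h. y * z * measure (mu v) (g -` {y} \<inter> h -` {z}))"
    using G(2) H(2) v by (simp add: E_inner measure_mu mult.assoc)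
  also have "(\<Sum>y\<in>range g. \<Sum>z\<in>range h. y * z * measure (mu v) (g -` {y} \<inter> h -` {z})) =
     (LINT t|mu v. (\<Sum>y\<in>range g. \<Sum>z\<in>range h. y * z * indicator (g -` {y} \<inter> h -` {z}) t))"
    using G(2) H(2) by (simp add: integrable_real_indicator less_top[symmetric] emeasure_eq_measure)
  also have "(\<lambda>t. \<Sum>y\<in>range g. \<Sum>z\<in>range h. y * z * indicator (g -` {y} \<inter> h -` {z}) t) = (\<lambda>t. g t * h t)"
  proof
    fix t
    have "g t * h t = (\<Sum>y\<in>range g. y * indicator (g -` {y}) t) * (\<Sum>z\<in>range h. z * indicator (h -` {z}) t)"
      using G(4)[of t] H(4)[of t] by (rule arg_cong2)
    then show "(\<Sum>y\<in>range g. \<Sum>z\<in>range h. y * z * indicator (g -` {y} \<inter> h -` {z}) t) = g t * h t"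
      by (simp add: sum_product indicator_inter_arith mult_ac)
  qed
  finally show ?thesis .
qed

lemma sse_norm_sq:
  assumes g: "simple_function borel g" and v: "v \<in> L2"
  shows "(L2_norm (sse g v))\<^sup>2 = (LINT t|mu v. (g t)\<^sup>2)"
  using sse_inner[OF g g v] unfolding L2_inner_self of_real_eq_iff by (simp only: power2_eq_square)

lemma sse_expectation:
  assumes g: "simple_function borel g" and v: "v \<in> L2"
  shows "L2_inner v (sse g v) = complex_of_real (LINT t|mu v. g t)"
proof -
  have "AE x in lebesgue. sse (\<lambda>_. 1) v x = v x"
    using E_UNIV[OF v] by (simp add: simple_spectral_integral_def)
  then have "L2_inner v (sse g v) = L2_inner (sse (\<lambda>_. 1) v) (sse g v)"
    using v sse_L2[OF g v] sse_L2[of "\<lambda>_. 1" v] by (intro L2_inner_cong_AE) (auto intro: L2_measurable)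
  also have "\<dots> = complex_of_real (LINT t|mu v. g t)"
    using sse_inner[of "\<lambda>_. 1" g v] g v by simp
  finally show ?thesis .
qed

text \<open>The factor 2 comes from \<open>f^2 \<le> 2 g^2 + 2 (g - f)^2\<close>, used with the
  simple functions \<open>g n\<close>. It spares a discussion of norm convergence with respect to
  the scalar measure and only enters the final constant.\<close>

lemma spectral_integral_bound:
  assumes vw: "(v, w) \<in> spectral_integral E f" and f [measurable]: "f \<in> borel_measurable borel"
  shows "(\<integral>\<^sup>+t. ennreal ((f t)\<^sup>2) \<partial>mu v) \<le> ennreal (2 * (L2_norm w)\<^sup>2)"
proof -
  obtain g where v: "v \<in> L2" and w: "w \<in> L2" and g: "\<And>n. simple_function borel (g n)"
    and gl: "(\<lambda>n. \<integral>\<^sup>+ t. ennreal ((g n t - f t)\<^sup>2) \<partial>mu v) \<longlonglongrightarrow> 0"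
    and sl: "(\<lambda>n. L2_norm (\<lambda>x. sse (g n) v x - w x)) \<longlonglongrightarrow> 0"
    using vw unfolding spectral_integral_def by auto
  have [measurable]: "g n \<in> borel_measurable borel" for n using simple_fun_facts(3)[OF g] .
  define e where "e n = (\<integral>\<^sup>+ t. ennreal ((g n t - f t)\<^sup>2) \<partial>mu v)" for n
  have b: "(\<integral>\<^sup>+t. ennreal ((f t)\<^sup>2) \<partial>mu v) \<le> ennreal (2 * (L2_norm (sse (g n) v))\<^sup>2) + (e n + e n)" for n
  proof -
    have "integrable (mu v) (\<lambda>t. (g n t)\<^sup>2)"
      by (rule simple_integrable_mu[OF _ v]) (intro simple_function_compose1[OF g])
    then have "(\<integral>\<^sup>+t. ennreal ((g n t)\<^sup>2) \<partial>mu v) = ennreal ((L2_norm (sse (g n) v))\<^sup>2)"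
      unfolding sse_norm_sq[OF g v] by (intro nn_integral_eq_integral) auto
    then have G: "(\<integral>\<^sup>+t. 2 * ennreal ((g n t)\<^sup>2) \<partial>mu v) = ennreal (2 * (L2_norm (sse (g n) v))\<^sup>2)"
      by (subst nn_integral_cmult) (auto simp: ennreal_mult')
    have "(\<integral>\<^sup>+t. ennreal ((f t)\<^sup>2) \<partial>mu v) \<le> (\<integral>\<^sup>+t. 2 * ennreal ((g n t)\<^sup>2) + (ennreal ((g n t - f t)\<^sup>2) + ennreal ((g n t - f t)\<^sup>2)) \<partial>mu v)"
    proof (rule nn_integral_mono)
      fix t
      have "(f t)\<^sup>2 \<le> 2 * (g n t)\<^sup>2 + ((g n t - f t)\<^sup>2 + (g n t - f t)\<^sup>2)"
        using zero_le_power2[of "2 * g n t - f t"] by (simp add: power2_eq_square algebra_simps)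
      then show "ennreal ((f t)\<^sup>2) \<le> 2 * ennreal ((g n t)\<^sup>2) + (ennreal ((g n t - f t)\<^sup>2) + ennreal ((g n t - f t)\<^sup>2))"
        by (simp add: ennreal_mult'[symmetric] flip: ennreal_plus ennreal_numeral)
    qed
    also have "\<dots> = ennreal (2 * (L2_norm (sse (g n) v))\<^sup>2) + (e n + e n)"
      by (simp add: nn_integral_add G e_def)
    finally show ?thesis .
  qed
  have "(\<lambda>n. L2_norm (sse (g n) v)) \<longlonglongrightarrow> L2_norm w" by (rule L2_tendsto_norm[OF sse_L2[OF g v] w sl])
  then have "(\<lambda>n. ennreal (2 * (L2_norm (sse (g n) v))\<^sup>2) + (e n + e n)) \<longlonglongrightarrow> ennreal (2 * (L2_norm w)\<^sup>2) + (0 + 0)"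
    using gl unfolding e_def by (intro tendsto_add tendsto_ennrealI tendsto_intros)
  then show ?thesis using b by (intro LIMSEQ_le_const[where X="\<lambda>n. ennreal (2 * (L2_norm (sse (g n) v))\<^sup>2) + (e n + e n)"]) auto
qed

text \<open>Spectral localisation puts \<open>E S v\<close> into the operator domain, where the
  energy identity of the harmonic oscillator is available. The image \<open>f\<close> is constructed
  as a limit of simple spectral integrals; approximating the identity function from below gives the
  energy bound with the constant \<open>b\<close>.\<close>

lemma bounded_spectral_part:
  assumes S [measurable]: "S \<in> sets borel" and Sab: "S \<subseteq> {a..b}" and v: "v \<in> L2"
  shows "\<exists>f. (E S v, f) \<in> spectral_integral E (\<lambda>t. t) \<and> Re (L2_inner (E S v) f) \<le> b * (L2_norm (E S v))\<^sup>2"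
proof -
  define u where "u = E S v"
  have u: "u \<in> L2" unfolding u_def by (rule E_L2[OF S v])
  interpret finite_measure "mu u" by (rule finite_measure_mu[OF u])
  have tot: "measure (mu u) UNIV = (L2_norm u)\<^sup>2" "emeasure (mu u) UNIV = ennreal ((L2_norm u)\<^sup>2)"
    using u by (simp_all add: measure_mu emeasure_mu E_UNIV_norm)
  \<comment> \<open>The scalar measure of \<open>u\<close> is carried by \<open>S\<close>, because
    \<open>E (-S)\<close> annihilates the range of \<open>E S\<close>.\<close>
  have "L2_inner (E (-S) u) (E S v) = 0" using S by (intro E_orth u v) auto
  then have "L2_inner u (E (-S) u) = 0" using E_sym[of "-S" u u] S u by (simp add: u_def)
  then have "L2_norm (E (-S) u) = 0" using E_self[of "-S" u] S u by simp
  then have "-S \<in> null_sets (mu u)" using S u by (auto simp: null_sets_def emeasure_mu)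
  then have AES: "AE t in mu u. t \<in> S" by (rule AE_I') auto
  \<comment> \<open>Rounding down to multiples of \<open>1/(n+1)\<close>. Boundedness of
    \<open>S\<close> together with the value 0 outside makes the range finite.\<close>
  define g where "g n t = (if t \<in> S then of_int \<lfloor>real (Suc n) * t\<rfloor> / real (Suc n) else 0)" for n :: nat and t
  have [measurable]: "g n \<in> borel_measurable borel" for n unfolding g_def by measurable
  have gs: "simple_function borel (g n)" for n
  proof (rule simple_function_borel_measurable)
    have "g n ` space borel \<subseteq> insert 0 ((\<lambda>k. of_int k / real (Suc n)) ` {\<lfloor>real (Suc n) * a\<rfloor>..\<lfloor>real (Suc n) * b\<rfloor>})"
    proof
      fix y assume "y \<in> g n ` space borel"
      then obtain t where t: "y = g n t" by auto
      show "y \<in> insert 0 ((\<lambda>k. of_int k / real (Suc n)) ` {\<lfloor>real (Suc n) * a\<rfloor>..\<lfloor>real (Suc n) * b\<rfloor>})"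
      proof (cases "t \<in> S")
        case True
        then have "a \<le> t" "t \<le> b" using Sab by auto
        then have "\<lfloor>real (Suc n) * t\<rfloor> \<in> {\<lfloor>real (Suc n) * a\<rfloor>..\<lfloor>real (Suc n) * b\<rfloor>}"
          by (auto intro!: floor_mono mult_left_mono)
        then show ?thesis using True t by (auto simp: g_def)
      qed (use t in \<open>simp add: g_def\<close>)
    qed
    then show "finite (g n ` space borel)" by (rule finite_subset) simp
  qed simp
  have gle: "g n t \<le> t" and gge: "t - g n t \<le> 1 / real (Suc n)" if "t \<in> S" for n t
  proof -
    have f: "of_int \<lfloor>real (Suc n) * t\<rfloor> \<le> real (Suc n) * t" "real (Suc n) * t - of_int \<lfloor>real (Suc n) * t\<rfloor> \<le> 1" by linarith+
    show "g n t \<le> t"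
      using that f(1) by (simp add: g_def divide_le_eq mult.commute del: of_nat_Suc)
    have "t - g n t = (real (Suc n) * t - of_int \<lfloor>real (Suc n) * t\<rfloor>) / real (Suc n)"
      using that by (simp add: g_def diff_divide_distrib del: of_nat_Suc)
    also have "\<dots> \<le> 1 / real (Suc n)" using f(2) by (rule divide_right_mono) simp
    finally show "t - g n t \<le> 1 / real (Suc n)" .
  qed
  define s where "s n = sse (g n) u" for n
  have sL: "s n \<in> L2" for n unfolding s_def by (rule sse_L2[OF gs u])
  define d where "d n = 1 / real (Suc n)" for n
  have d0: "0 \<le> d n" for n by (simp add: d_def)
  have dl: "d \<longlonglongrightarrow> 0" unfolding d_def using LIMSEQ_inverse_real_of_nat by (simp add: inverse_eq_divide)
  have smn: "(L2_norm (\<lambda>x. s m x - s n x))\<^sup>2 \<le> ((d m + d n) * L2_norm u)\<^sup>2" for m n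
  proof -
    have i: "integrable (mu u) (\<lambda>t. g i t * g j t)" for i j
      by (rule simple_integrable_mu[OF _ u]) (intro simple_function_mult gs)
    have "complex_of_real ((L2_norm (\<lambda>x. s m x - s n x))\<^sup>2) = L2_inner (s m) (s m) - L2_inner (s m) (s n) - (L2_inner (s n) (s m) - L2_inner (s n) (s n))"
      unfolding L2_inner_self[symmetric] using sL
      by (subst L2_inner_diff_left) (auto intro!: L2_diff simp: L2_inner_diff_right)
    also have "\<dots> = complex_of_real (LINT t|mu u. g m t * g m t - g m t * g n t - (g n t * g m t - g n t * g n t))"
      unfolding s_def sse_inner[OF gs gs u] using i by (simp add: mult.commute)
    finally have "(L2_norm (\<lambda>x. s m x - s n x))\<^sup>2 = (LINT t|mu u. g m t * g m t - g m t * g n t - (g n t * g m t - g n t * g n t))"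
      by (simp only: of_real_eq_iff)
    also have "\<dots> \<le> (LINT t|mu u. (d m + d n)\<^sup>2)"
    proof (rule integral_mono_AE)
      show "AE t in mu u. g m t * g m t - g m t * g n t - (g n t * g m t - g n t * g n t) \<le> (d m + d n)\<^sup>2"
        using AES
      proof eventually_elim
        case (elim t)
        have "\<bar>g m t - g n t\<bar> \<le> d m + d n"
          using gle[OF elim, of m] gle[OF elim, of n] gge[OF elim, of m] gge[OF elim, of n] d0[of m] d0[of n] unfolding d_def by linarith
        then have "(g m t - g n t)\<^sup>2 \<le> (d m + d n)\<^sup>2" using abs_le_square_iff[of "g m t - g n t" "d m + d n"] d0[of m] d0[of n] by simp
        then show ?case by (simp add: power2_eq_square algebra_simps)
      qed
    qed (use i in auto)
    also have "\<dots> = ((d m + d n) * L2_norm u)\<^sup>2" by (simp add: tot power_mult_distrib)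
    finally show ?thesis .
  qed
  have smn': "L2_norm (\<lambda>x. s m x - s n x) \<le> (d m + d n) * L2_norm u" for m n
    using smn by (rule power2_le_imp_le) (simp add: d0)
  have "\<exists>f\<in>L2. (\<lambda>n. L2_norm (\<lambda>x. s n x - f x)) \<longlonglongrightarrow> 0"
  proof (rule L2_complete[OF sL])
    fix e :: real assume e: "e > 0"
    have "(\<lambda>n. (d n + d n) * L2_norm u) \<longlonglongrightarrow> (0 + 0) * L2_norm u" by (intro tendsto_intros dl)
    then have "(\<lambda>n. (d n + d n) * L2_norm u) \<longlonglongrightarrow> 0" by simp
    from LIMSEQ_D[OF this e] obtain N where "norm ((d N + d N) * L2_norm u - 0) < e" by blast
    then have N: "(d N + d N) * L2_norm u < e" by (simp add: abs_less_iff)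
    have dm: "d m \<le> d N" if "m \<ge> N" for m using that by (simp add: d_def frac_le)
    show "\<exists>N. \<forall>m\<ge>N. \<forall>n\<ge>N. L2_norm (\<lambda>x. s m x - s n x) < e"
    proof (intro exI allI impI)
      fix m n assume mn: "m \<ge> N" "n \<ge> N"
      have "L2_norm (\<lambda>x. s m x - s n x) \<le> (d m + d n) * L2_norm u" by (rule smn')
      also have "\<dots> \<le> (d N + d N) * L2_norm u" using dm mn by (intro mult_right_mono add_mono) auto
      finally show "L2_norm (\<lambda>x. s m x - s n x) < e" using N by linarith
    qed
  qed
  then obtain f where f: "f \<in> L2" "(\<lambda>n. L2_norm (\<lambda>x. s n x - f x)) \<longlonglongrightarrow> 0" by blast
  have "(u, f) \<in> spectral_integral E (\<lambda>t. t)"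
    unfolding spectral_integral_def
  proof (clarsimp, intro conjI u f(1))
    have "(\<integral>\<^sup>+ t. ennreal (t\<^sup>2) \<partial>mu u) \<le> (\<integral>\<^sup>+ t. ennreal ((\<bar>a\<bar> + \<bar>b\<bar>)\<^sup>2) \<partial>mu u)"
    proof (rule nn_integral_mono_AE)
      show "AE t in mu u. ennreal (t\<^sup>2) \<le> ennreal ((\<bar>a\<bar> + \<bar>b\<bar>)\<^sup>2)"
        using AES
      proof eventually_elim
        case (elim t)
        then have "a \<le> t" "t \<le> b" using Sab by auto
        then have "\<bar>t\<bar> \<le> \<bar>a\<bar> + \<bar>b\<bar>" by linarith
        then have "\<bar>t\<bar>\<^sup>2 \<le> (\<bar>a\<bar> + \<bar>b\<bar>)\<^sup>2" by (intro power_mono) auto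
        then show ?case by (intro ennreal_leI) simp
      qed
    qed
    also have "\<dots> < \<infinity>" by (simp add: tot ennreal_mult_less_top)
    finally show "(\<integral>\<^sup>+ t. ennreal (t\<^sup>2) \<partial>mu u) < top" by simp
    show "\<exists>g. (\<forall>n. simple_function borel (g n)) \<and> (\<lambda>n. \<integral>\<^sup>+ t. ennreal ((g n t - t)\<^sup>2) \<partial>mu u) \<longlonglongrightarrow> 0 \<and>
        (\<lambda>n. L2_norm (\<lambda>x. sse (g n) u x - f x)) \<longlonglongrightarrow> 0"
    proof (intro exI conjI allI)
      show "simple_function borel (g n)" for n by (rule gs)
      show "(\<lambda>n. L2_norm (\<lambda>x. sse (g n) u x - f x)) \<longlonglongrightarrow> 0" using f(2) by (simp add: s_def)
      have le: "(\<integral>\<^sup>+ t. ennreal ((g n t - t)\<^sup>2) \<partial>mu u) \<le> ennreal ((d n)\<^sup>2 * (L2_norm u)\<^sup>2)" for n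
      proof -
        have "(\<integral>\<^sup>+ t. ennreal ((g n t - t)\<^sup>2) \<partial>mu u) \<le> (\<integral>\<^sup>+ t. ennreal ((d n)\<^sup>2) \<partial>mu u)"
        proof (rule nn_integral_mono_AE)
          show "AE t in mu u. ennreal ((g n t - t)\<^sup>2) \<le> ennreal ((d n)\<^sup>2)"
            using AES
          proof eventually_elim
            case (elim t)
            have "\<bar>g n t - t\<bar> \<le> d n" using gle[OF elim, of n] gge[OF elim, of n] by (simp add: d_def)
            then show ?case using abs_le_square_iff[of "g n t - t" "d n"] d0[of n] by (intro ennreal_leI) simp
          qed
        qed
        then show ?thesis by (simp add: tot ennreal_mult')
      qed
      have "(\<lambda>n. ennreal ((d n)\<^sup>2 * (L2_norm u)\<^sup>2)) \<longlonglongrightarrow> ennreal (0\<^sup>2 * (L2_norm u)\<^sup>2)"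
        by (intro tendsto_ennrealI tendsto_intros dl)
      then have "(\<lambda>n. ennreal ((d n)\<^sup>2 * (L2_norm u)\<^sup>2)) \<longlonglongrightarrow> 0" by simp
      then show "(\<lambda>n. \<integral>\<^sup>+ t. ennreal ((g n t - t)\<^sup>2) \<partial>mu u) \<longlonglongrightarrow> 0"
        by (rule tendsto_sandwich[OF always_eventually always_eventually tendsto_const, rotated 2])
          (simp, intro allI le)
    qed
  qed
  moreover have "Re (L2_inner u f) \<le> b * (L2_norm u)\<^sup>2"
  proof (rule LIMSEQ_le_const2)
    show "(\<lambda>n. Re (L2_inner u (s n))) \<longlonglongrightarrow> Re (L2_inner u f)"
      by (intro tendsto_Re L2_tendsto_inner(1)[OF sL f u])
    have "Re (L2_inner u (s n)) \<le> b * (L2_norm u)\<^sup>2" for n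
    proof -
      have "Re (L2_inner u (s n)) = (LINT t|mu u. g n t)" unfolding s_def sse_expectation[OF gs u] by simp
      also have "\<dots> \<le> (LINT t|mu u. b)"
      proof (rule integral_mono_AE)
        show "AE t in mu u. g n t \<le> b" using AES
        proof eventually_elim
          case (elim t)
          then have "t \<le> b" using Sab by auto
          with gle[OF elim, of n] show ?case by linarith
        qed
      qed (use simple_integrable_mu[OF gs u] in auto)
      finally show ?thesis by (simp add: tot mult.commute)
    qed
    then show "\<exists>N. \<forall>n\<ge>N. Re (L2_inner u (s n)) \<le> b * (L2_norm u)\<^sup>2" by blast
  qed
  ultimately show ?thesis unfolding u_def by blast
qed

end

section \<open>The spectral measure of the harmonic oscillator\<close>

locale ho_pvm = pvm E for E :: "real set \<Rightarrow> (real^'n \<Rightarrow> complex) \<Rightarrow> (real^'n \<Rightarrow> complex)" +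
  assumes spectral: "spectral_integral E (\<lambda>t. t) = harmonic_oscillator"
begin

lemma ho_bounded_part:
  assumes S: "S \<in> sets borel" "S \<subseteq> {a..b}" and v: "v \<in> L2"
  defines "u \<equiv> E S v"
  shows "(\<lambda>x. complex_of_real (norm x) * u x) \<in> L2" "(\<lambda>\<xi>. complex_of_real (norm \<xi>) * fourier u \<xi>) \<in> L2"
    "exp (exp 1) / real CARD('n) * ((L2_norm (\<lambda>x. complex_of_real (norm x) * u x))\<^sup>2
     + (L2_norm (\<lambda>\<xi>. complex_of_real (norm \<xi>) * fourier u \<xi>))\<^sup>2) \<le> b * (L2_norm u)\<^sup>2"
proof -
  obtain f where f: "(u, f) \<in> harmonic_oscillator" "Re (L2_inner u f) \<le> b * (L2_norm u)\<^sup>2"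
    using bounded_spectral_part[OF S v] unfolding spectral u_def by blast
  show "(\<lambda>x. complex_of_real (norm x) * u x) \<in> L2" "(\<lambda>\<xi>. complex_of_real (norm \<xi>) * fourier u \<xi>) \<in> L2"
    by (rule harmonic_oscillator_form[OF f(1)])+
  show "exp (exp 1) / real CARD('n) * ((L2_norm (\<lambda>x. complex_of_real (norm x) * u x))\<^sup>2
     + (L2_norm (\<lambda>\<xi>. complex_of_real (norm \<xi>) * fourier u \<xi>))\<^sup>2) \<le> b * (L2_norm u)\<^sup>2"
    using f(2) unfolding harmonic_oscillator_form(5)[OF f(1)] Re_complex_of_real .
qed

text \<open>A spectral part over \<open>S n\<close> would have energy at most
  \<open>(e^e - 1/(n+1))\<close> times its squared norm, whereas the uncertainty principle demands
  at least \<open>e^e\<close> times it; so it vanishes. The sets \<open>S n\<close> are bounded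
  because only bounded parts are known to lie in the operator domain, and they exhaust the half-line
  below \<open>e^e\<close>.\<close>

lemma ho_support:
  assumes v: "v \<in> L2"
  shows "AE t in mu v. exp (exp 1) \<le> t"
proof -
  define S where "S n = {- real n .. exp (exp 1) - 1 / real (Suc n)}" for n
  have "S n \<in> null_sets (mu v)" for n
  proof -
    have S: "S n \<in> sets borel" by (simp add: S_def)
    define u where "u = E (S n) v"
    have u: "u \<in> L2" unfolding u_def by (rule E_L2[OF S v])
    note H = ho_bounded_part[OF S _ v, of "- real n" "exp (exp 1) - 1 / real (Suc n)", folded u_def]
    have "exp (exp 1) * (L2_norm u)\<^sup>2 = exp (exp 1) / real CARD('n) * (real CARD('n) * (L2_norm u)\<^sup>2)" by simp
    also have "\<dots> \<le> exp (exp 1) / real CARD('n) * ((L2_norm (\<lambda>x. complex_of_real (norm x) * u x))\<^sup>2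
     + (L2_norm (\<lambda>\<xi>. complex_of_real (norm \<xi>) * fourier u \<xi>))\<^sup>2)"
      by (intro mult_left_mono heisenberg u H(1,2)) (auto simp: S_def)
    also have "\<dots> \<le> (exp (exp 1) - 1 / real (Suc n)) * (L2_norm u)\<^sup>2" by (rule H(3)) (simp add: S_def)
    finally have "1 / real (Suc n) * (L2_norm u)\<^sup>2 \<le> 0" by (simp add: left_diff_distrib)
    then have "L2_norm u = 0" by (simp add: mult_le_0_iff divide_le_0_iff)
    then show ?thesis using emeasure_mu[OF v S] S by (simp add: null_sets_def u_def)
  qed
  then have "(\<Union>n. S n) \<in> null_sets (mu v)" by (intro null_sets_UN)
  then show ?thesis
  proof (rule AE_I')
    show "{t \<in> space (mu v). \<not> exp (exp 1) \<le> t} \<subseteq> (\<Union>n. S n)"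
    proof
      fix t :: real assume "t \<in> {t \<in> space (mu v). \<not> exp (exp 1) \<le> t}"
      then have t: "t < exp (exp 1)" by simp
      obtain m :: nat where m: "- t \<le> real m" using real_arch_simple by blast
      obtain k :: nat where k: "inverse (real (Suc k)) < exp (exp 1) - t" using reals_Archimedean[of "exp (exp 1) - t"] t by auto
      have "1 / real (Suc (max m k)) \<le> inverse (real (Suc k))" by (simp add: inverse_eq_divide frac_le)
      then have "t \<in> S (max m k)" using m k by (auto simp: S_def)
      then show "t \<in> (\<Union>n. S n)" by blast
    qed
  qed
qed

text \<open>\<open>A\<close> has controlled energy in position and in frequency at once, so one
  splitting serves both moments; \<open>B\<close> carries the tail of the scalar measure. The
  complement of \<open>{0..a}\<close> and \<open>{a<..}\<close> differ by negative numbers, which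
  have no mass.\<close>

lemma ho_tail_split:
  assumes v: "v \<in> L2" and a: "a \<ge> 0"
  defines "A \<equiv> E {0..a} v" and "B \<equiv> E (- {0..a}) v"
  shows "A \<in> L2" "B \<in> L2" "AE x in lebesgue. v x = A x + B x"
    "(\<lambda>x. complex_of_real (norm x) * A x) \<in> L2" "(\<lambda>\<xi>. complex_of_real (norm \<xi>) * fourier A \<xi>) \<in> L2"
    "(L2_norm (\<lambda>x. complex_of_real (norm x) * A x))\<^sup>2 \<le> a * (real CARD('n) * (L2_norm v)\<^sup>2)"
    "(L2_norm (\<lambda>\<xi>. complex_of_real (norm \<xi>) * fourier A \<xi>))\<^sup>2 \<le> a * (real CARD('n) * (L2_norm v)\<^sup>2)"
    "ennreal ((L2_norm B)\<^sup>2) = emeasure (mu v) {a<..}"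
proof -
  have S: "{0..a} \<in> sets borel" "- {0..a} \<in> sets borel" by auto
  show A: "A \<in> L2" and B: "B \<in> L2" unfolding A_def B_def using S v by (auto intro: E_L2)
  have "AE x in lebesgue. E ({0..a} \<union> - {0..a}) v x = A x + B x"
    unfolding A_def B_def by (rule E_Un[OF S _ v]) simp
  then show AB: "AE x in lebesgue. v x = A x + B x"
    using E_UNIV[OF v] by (simp add: Compl_partition) (auto elim: eventually_elim2)
  note H = ho_bounded_part[OF S(1) subset_refl v, folded A_def]
  show "(\<lambda>x. complex_of_real (norm x) * A x) \<in> L2" "(\<lambda>\<xi>. complex_of_real (norm \<xi>) * fourier A \<xi>) \<in> L2" by (rule H)+
  have nA: "(L2_norm A)\<^sup>2 \<le> (L2_norm v)\<^sup>2"
  proof -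
    interpret finite_measure "mu v" by (rule finite_measure_mu[OF v])
    have "measure (mu v) {0..a} \<le> measure (mu v) UNIV" by (intro finite_measure_mono) auto
    then show ?thesis using measure_mu[OF v] S by (simp add: A_def E_UNIV_norm[OF v])
  qed
  let ?X = "(L2_norm (\<lambda>x. complex_of_real (norm x) * A x))\<^sup>2" and ?Y = "(L2_norm (\<lambda>\<xi>. complex_of_real (norm \<xi>) * fourier A \<xi>))\<^sup>2"
  \<comment> \<open>Of the numerator \<open>exp (exp 1)\<close> of the prefactor only the lower
    bound 1 is kept.\<close>
  have "(?X + ?Y) \<le> real CARD('n) * (exp (exp 1) / real CARD('n) * (?X + ?Y))"
    using mult_right_mono[of 1 "exp (exp 1)" "?X + ?Y"] by simp
  also have "\<dots> \<le> real CARD('n) * (a * (L2_norm v)\<^sup>2)"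
    using H(3) mult_left_mono[OF nA a] by (intro mult_left_mono) auto
  finally have XY: "?X + ?Y \<le> a * (real CARD('n) * (L2_norm v)\<^sup>2)" by (simp add: mult_ac)
  show "?X \<le> a * (real CARD('n) * (L2_norm v)\<^sup>2)" using XY zero_le_power2[of "L2_norm (\<lambda>\<xi>. complex_of_real (norm \<xi>) * fourier A \<xi>)"] by linarith
  show "?Y \<le> a * (real CARD('n) * (L2_norm v)\<^sup>2)" using XY zero_le_power2[of "L2_norm (\<lambda>x. complex_of_real (norm x) * A x)"] by linarith
  have "emeasure (mu v) (- {0..a}) = emeasure (mu v) {a<..}"
  proof (rule emeasure_eq_AE)
    show "AE t in mu v. t \<in> - {0..a} \<longleftrightarrow> t \<in> {a<..}"
      using ho_support[OF v]
    proof eventually_elim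
      case (elim t)
      then have "0 \<le> t" using exp_ge_zero order_trans by blast
      then show ?case by auto
    qed
  qed auto
  then show "ennreal ((L2_norm B)\<^sup>2) = emeasure (mu v) {a<..}"
    using emeasure_mu[OF v S(2)] by (simp add: B_def)
qed

end

section \<open>Logarithmic moments\<close>

text \<open>A discrete layer cake: for \<open>r > e\<close> the left side is at most
  \<open>1 + ln r\<close>, and \<open>ln r\<close> exceeds the number of levels below it by at most
  1. Smaller \<open>r\<close> are covered by the constant 2, since then
  \<open>2 + r \<le> e^2\<close>.\<close>

lemma ln_le_count:
  fixes r :: real assumes "r \<ge> 0"
  shows "ennreal (ln (2 + r)) \<le> 2 + (\<Sum>k. indicator {exp (real (Suc k))<..} r)"
proof -
  have e2: "(2::real) \<le> exp 1" using exp_ge_add_one_self[of 1] by simp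
  show ?thesis
  proof (cases "r \<le> exp 1")
    case True
    have "2 * exp 1 \<le> exp 1 * (exp 1 :: real)" by (rule mult_right_mono[OF e2]) simp
    then have "2 + r \<le> exp 1 * exp 1" using True e2 by linarith
    then have "ln (2 + r) \<le> ln (exp 2)" using assms by (subst ln_le_cancel_iff) (auto simp flip: exp_add)
    then have "ennreal (ln (2 + r)) \<le> ennreal 2" by (intro ennreal_leI) simp
    also have "\<dots> \<le> 2 + (\<Sum>k. indicator {exp (real (Suc k))<..} r)" by simp
    finally show ?thesis .
  next
    case False
    then have r: "r > exp 1" by simp
    then have r0: "r > 0" using exp_gt_zero[of 1] by linarith
    have L1: "ln r > 1" using r r0 by (simp add: ln_less_cancel_iff[of "exp 1" r, simplified] less_eq_real_def)
    \<comment> \<open>The largest integer strictly below \<open>ln r\<close>; strictness matches the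
      open half-lines in the sum.\<close>
    define K where "K = nat (\<lceil>ln r\<rceil> - 1)"
    have cl: "\<lceil>ln r\<rceil> > 1" using L1 by linarith
    have K: "real K < ln r" "ln r \<le> real K + 1" using cl by (auto simp: K_def of_nat_nat) linarith+
    have "2 + r \<le> exp 1 * r"
    proof -
      have "2 \<le> (exp 1 - 1) * r" using mult_mono[of 1 "exp 1 - 1" 2 r] e2 r by simp
      then show ?thesis by (simp add: algebra_simps)
    qed
    then have "ln (2 + r) \<le> ln (exp 1 * r)" using r0 by (subst ln_le_cancel_iff) auto
    also have "\<dots> = 1 + ln r" using r0 by (simp add: ln_mult)
    also have "\<dots> \<le> 2 + real K" using K by simp
    finally have 1: "ennreal (ln (2 + r)) \<le> ennreal (2 + real K)" by (intro ennreal_leI)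
    have ind: "indicator {exp (real (Suc k))<..} r = (1::ennreal)" if "k < K" for k
    proof -
      have "real (Suc k) < ln r" using that K by linarith
      then have "exp (real (Suc k)) < r" using r0 by (metis exp_less_cancel_iff exp_ln)
      then show ?thesis by simp
    qed
    have "ennreal (2 + real K) = 2 + (\<Sum>k<K. indicator {exp (real (Suc k))<..} r)"
      using ind by (simp add: ennreal_of_nat_eq_real_of_nat)
    also have "\<dots> \<le> 2 + (\<Sum>k. indicator {exp (real (Suc k))<..} r)"
      by (intro add_left_mono sum_le_suminf) auto
    finally show ?thesis using 1 by (rule order_trans[rotated])
  qed
qed

text \<open>The reverse comparison, for the spectral variable: it bounds the sum of all tail masses
  by the integral of \<open>ln t\<close>.\<close>

lemma count_le_ln:
  fixes t :: real assumes "t \<ge> 1"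
  shows "(\<Sum>k. indicator {exp (real (Suc k))<..} t) \<le> ennreal (ln t)"
proof -
  define N where "N = nat \<lfloor>ln t\<rfloor>"
  have z: "indicator {exp (real (Suc k))<..} t = (0::ennreal)" if "k \<notin> {..<N}" for k
  proof -
    have "ln t < real N + 1" unfolding N_def using assms by (simp add: of_nat_nat)
    moreover have "real N \<le> real k" using that by simp
    ultimately have "ln t \<le> real (Suc k)" by simp
    then have "t \<le> exp (real (Suc k))" using assms by (metis exp_le_cancel_iff exp_ln less_le_trans zero_less_one)
    then show ?thesis by simp
  qed
  have "(\<Sum>k. indicator {exp (real (Suc k))<..} t) = (\<Sum>k\<in>{..<N}. indicator {exp (real (Suc k))<..} t :: ennreal)"
    using z by (intro suminf_finite) auto
  also have "\<dots> \<le> (\<Sum>k\<in>{..<N}. 1)" by (intro sum_mono) (simp add: indicator_def)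
  also have "\<dots> = ennreal (real N)" by (simp add: ennreal_of_nat_eq_real_of_nat)
  also have "\<dots> \<le> ennreal (ln t)" unfolding N_def using assms by (intro ennreal_leI) (simp add: of_nat_nat)
  finally show ?thesis .
qed

text \<open>Layer cake over the sets \<open>|x| > e\<^sup>k\<^sup>+\<^sup>1\<close>: there \<open>A k\<close> has mass at most
  \<open>D / e\<^sup>k\<^sup>+\<^sup>1\<close> by Chebyshev, which is summable, and \<open>B k\<close> is estimated by its full mass.\<close>

lemma log_weight_bound:
  fixes Z :: "real^'n \<Rightarrow> complex"
  assumes Z: "Z \<in> L2" and A: "\<And>k. A k \<in> L2" and B: "\<And>k. B k \<in> L2"
    and split: "\<And>k. AE x in lebesgue. Z x = A k x + B k x"
    and XA: "\<And>k. (\<lambda>x. complex_of_real (norm x) * A k x) \<in> L2"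
    and XAb: "\<And>k. (L2_norm (\<lambda>x. complex_of_real (norm x) * A k x))\<^sup>2 \<le> exp (real (Suc k)) * D"
    and D: "D \<ge> 0" and m: "\<And>k. ennreal ((L2_norm (B k))\<^sup>2) \<le> m k"
  shows "(\<integral>\<^sup>+x. ennreal (ln (2 + norm x) * (cmod (Z x))\<^sup>2) \<partial>lebesgue)
      \<le> ennreal (2 * (L2_norm Z)\<^sup>2) + (ennreal (2 * D) + 2 * (\<Sum>k. m k))"
proof -
  have [measurable]: "Z \<in> borel_measurable lebesgue" "\<And>k. A k \<in> borel_measurable lebesgue" "\<And>k. B k \<in> borel_measurable lebesgue"
    using Z A B by (auto intro: L2_measurable)
  have [measurable]: "(\<lambda>x::real^'n. norm x) \<in> borel_measurable lebesgue" by simp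
  define T where "T k = (\<integral>\<^sup>+x. indicator {exp (real (Suc k))<..} (norm x) * ennreal ((cmod (Z x))\<^sup>2) \<partial>lebesgue)" for k
  have T: "T k \<le> ennreal (2 * exp (- real (Suc k)) * D) + 2 * m k" for k
  proof -
    define r where "r = exp (real (Suc k))"
    have r: "r > 0" by (simp add: r_def)
    have "T k \<le> (\<integral>\<^sup>+x. ennreal (2 / r\<^sup>2) * ennreal ((cmod (complex_of_real (norm x) * A k x))\<^sup>2) + 2 * ennreal ((cmod (B k x))\<^sup>2) \<partial>lebesgue)"
      unfolding T_def r_def[symmetric]
    proof (rule nn_integral_mono_AE)
      show "AE x in lebesgue. indicator {r<..} (norm x) * ennreal ((cmod (Z x))\<^sup>2)
        \<le> ennreal (2 / r\<^sup>2) * ennreal ((cmod (complex_of_real (norm x) * A k x))\<^sup>2) + 2 * ennreal ((cmod (B k x))\<^sup>2)"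
        using split[of k]
      proof eventually_elim
        case (elim x)
        show ?case
        proof (cases "norm x > r")
          case True
          have "(cmod (Z x))\<^sup>2 \<le> (cmod (A k x) + cmod (B k x))\<^sup>2"
            unfolding elim by (intro power_mono norm_triangle_ineq) auto
          also have "\<dots> \<le> 2 * (cmod (A k x))\<^sup>2 + 2 * (cmod (B k x))\<^sup>2"
            using sum_squares_bound[of "cmod (A k x)" "cmod (B k x)"] by (simp add: power2_sum)
          also have "(cmod (A k x))\<^sup>2 \<le> (norm x / r)\<^sup>2 * (cmod (A k x))\<^sup>2"
          proof -
            have "1 \<le> (norm x / r)\<^sup>2" using True r by (intro one_le_power) simp
            then show ?thesis using mult_right_mono[of 1 "(norm x / r)\<^sup>2" "(cmod (A k x))\<^sup>2"] by simp
          qed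
          finally have "(cmod (Z x))\<^sup>2 \<le> 2 / r\<^sup>2 * (cmod (complex_of_real (norm x) * A k x))\<^sup>2 + 2 * (cmod (B k x))\<^sup>2"
            by (simp add: norm_mult power_mult_distrib power_divide)
          then have "ennreal ((cmod (Z x))\<^sup>2) \<le> ennreal (2 / r\<^sup>2 * (cmod (complex_of_real (norm x) * A k x))\<^sup>2 + 2 * (cmod (B k x))\<^sup>2)"
            by (rule ennreal_leI)
          also have "\<dots> = ennreal (2 / r\<^sup>2) * ennreal ((cmod (complex_of_real (norm x) * A k x))\<^sup>2) + 2 * ennreal ((cmod (B k x))\<^sup>2)"
          proof -
            have "ennreal (2 / r\<^sup>2 * (cmod (complex_of_real (norm x) * A k x))\<^sup>2) = ennreal (2 / r\<^sup>2) * ennreal ((cmod (complex_of_real (norm x) * A k x))\<^sup>2)"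
              by (rule ennreal_mult'') simp
            moreover have "ennreal (2 * (cmod (B k x))\<^sup>2) = 2 * ennreal ((cmod (B k x))\<^sup>2)" by (simp add: ennreal_mult')
            ultimately show ?thesis by (subst ennreal_plus) auto
          qed
          finally show ?thesis using True by simp
        qed simp
      qed
    qed
    also have "\<dots> = ennreal (2 / r\<^sup>2) * ennreal ((L2_norm (\<lambda>x. complex_of_real (norm x) * A k x))\<^sup>2) + 2 * ennreal ((L2_norm (B k))\<^sup>2)"
      unfolding L2_norm_nn[OF XA] L2_norm_nn[OF B] using XA by (subst nn_integral_add) (auto simp: nn_integral_cmult)
    also have "\<dots> \<le> ennreal (2 / r\<^sup>2) * ennreal (r * D) + 2 * m k"
      using XAb[of k] m[of k] by (intro add_mono mult_left_mono ennreal_leI) (auto simp: r_def)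
    also have "ennreal (2 / r\<^sup>2) * ennreal (r * D) = ennreal (2 / r\<^sup>2 * (r * D))" by (rule ennreal_mult''[symmetric]) (use r D in simp)
    also have "2 / r\<^sup>2 * (r * D) = 2 * exp (- real (Suc k)) * D"
    proof -
      have "exp (- real (Suc k)) = 1 / r" unfolding r_def by (simp add: exp_minus inverse_eq_divide del: of_nat_Suc)
      then show ?thesis using r by (simp add: power2_eq_square del: of_nat_Suc)
    qed
    finally show ?thesis .
  qed
  have sexp: "(\<Sum>k. ennreal (2 * exp (- real (Suc k)) * D)) \<le> ennreal (2 * D)"
  proof -
    \<comment> \<open>Replacing \<open>1/e\<close> by \<open>1/2\<close> makes the series of
      Chebyshev terms explicitly summable, with total \<open>2 * D\<close>.\<close>
    have e2: "exp (- 1) \<le> (1/2::real)" using exp_ge_add_one_self[of 1] by (simp add: exp_minus field_simps)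
    have "(\<lambda>k. (1/2::real)^(Suc k) * (2 * D)) sums (1 * (2 * D))"
      by (intro sums_mult2 power_half_series)
    then have "(\<Sum>k. ennreal ((1/2)^(Suc k) * (2 * D))) = ennreal (2 * D)"
      using D by (intro suminf_ennreal_eq) auto
    moreover have "(\<Sum>k. ennreal (2 * exp (- real (Suc k)) * D)) \<le> (\<Sum>k. ennreal ((1/2)^(Suc k) * (2 * D)))"
    proof (intro suminf_le ennreal_leI)
      fix k
      have "exp (- real (Suc k)) = exp (- 1) ^ Suc k" by (metis exp_of_nat_mult mult_minus_right mult.right_neutral)
      also have "\<dots> \<le> (1/2) ^ Suc k" by (rule power_mono[OF e2]) simp
      finally show "2 * exp (- real (Suc k)) * D \<le> (1/2) ^ Suc k * (2 * D)" using D by (simp add: mult_right_mono)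
    qed auto
    ultimately show ?thesis by simp
  qed
  have "(\<integral>\<^sup>+x. ennreal (ln (2 + norm x) * (cmod (Z x))\<^sup>2) \<partial>lebesgue) \<le>
    (\<integral>\<^sup>+x. 2 * ennreal ((cmod (Z x))\<^sup>2) + (\<Sum>k. indicator {exp (real (Suc k))<..} (norm x) * ennreal ((cmod (Z x))\<^sup>2)) \<partial>lebesgue)"
  proof (rule nn_integral_mono)
    fix x :: "real^'n"
    have "ennreal (ln (2 + norm x) * (cmod (Z x))\<^sup>2) = ennreal (ln (2 + norm x)) * ennreal ((cmod (Z x))\<^sup>2)"
      by (simp add: ennreal_mult'')
    also have "\<dots> \<le> (2 + (\<Sum>k. indicator {exp (real (Suc k))<..} (norm x))) * ennreal ((cmod (Z x))\<^sup>2)"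
      by (intro mult_right_mono ln_le_count) auto
    finally show "ennreal (ln (2 + norm x) * (cmod (Z x))\<^sup>2) \<le> 2 * ennreal ((cmod (Z x))\<^sup>2) + (\<Sum>k. indicator {exp (real (Suc k))<..} (norm x) * ennreal ((cmod (Z x))\<^sup>2))"
      by (simp add: distrib_right ennreal_suminf_multc)
  qed
  also have "\<dots> = 2 * ennreal ((L2_norm Z)\<^sup>2) + (\<Sum>k. T k)"
  proof -
    have meas [measurable]: "(\<lambda>x::real^'n. indicator {exp (real (Suc k))<..} (norm x) * ennreal ((cmod (Z x))\<^sup>2)) \<in> borel_measurable lebesgue" for k
      by measurable
    have "(\<integral>\<^sup>+x. (\<Sum>k. indicator {exp (real (Suc k))<..} (norm x) * ennreal ((cmod (Z x))\<^sup>2)) \<partial>lebesgue) = (\<Sum>k. T k)"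
      unfolding T_def by (rule nn_integral_suminf[OF meas])
    moreover have "(\<integral>\<^sup>+x. 2 * ennreal ((cmod (Z x))\<^sup>2) \<partial>lebesgue) = 2 * ennreal ((L2_norm Z)\<^sup>2)"
      unfolding L2_norm_nn[OF Z] by (rule nn_integral_cmult) measurable
    moreover have "(\<lambda>x. 2 * ennreal ((cmod (Z x))\<^sup>2)) \<in> borel_measurable lebesgue" by simp
    moreover note borel_measurable_suminf_order[OF meas]
    ultimately show ?thesis by (simp only: nn_integral_add)
  qed
  also have "(\<Sum>k. T k) \<le> (\<Sum>k. ennreal (2 * exp (- real (Suc k)) * D) + 2 * m k)"
    by (intro suminf_le T) auto
  also have "\<dots> = (\<Sum>k. ennreal (2 * exp (- real (Suc k)) * D)) + 2 * (\<Sum>k. m k)"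
    by (subst suminf_add[symmetric]) (auto simp: ennreal_suminf_cmult)
  also have "\<dots> \<le> ennreal (2 * D) + 2 * (\<Sum>k. m k)" by (intro add_right_mono sexp)
  finally show ?thesis by (simp add: ennreal_mult' add_left_mono)
qed

text \<open>The vector is split at the levels \<open>e^(k+1)\<close>, and
  \<open>log_weight_bound\<close> is applied once to \<open>v\<close> and once to its transform.
  Both \<open>(L2_norm v)\<^sup>2\<close> and the sum of the tail masses are at most
  \<open>2 * (L2_norm w)\<^sup>2\<close>, so the three terms of that bound contribute
  \<open>4\<close>, \<open>4 d\<close> and \<open>4\<close> times
  \<open>(L2_norm w)\<^sup>2\<close>, which explains \<open>K\<close>.\<close>

lemma functional_calculus_log_bounds:
  fixes v w :: "real^'n \<Rightarrow> complex"
  assumes eps: "\<epsilon> > 0" and vw: "(v, w) \<in> functional_calculus harmonic_oscillator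
           (\<lambda>t. (ln t) powr (1/2) * (ln (ln t)) powr (1/2 + \<epsilon>))"
  defines "K \<equiv> (8 + 4 * real CARD('n)) * (L2_norm w)\<^sup>2"
  shows "v \<in> L2" "(\<integral>\<^sup>+x. ennreal (ln (2 + norm x) * (cmod (v x))\<^sup>2) \<partial>lebesgue) \<le> ennreal K"
    "(\<integral>\<^sup>+\<xi>. ennreal (ln (2 + norm \<xi>) * (cmod (fourier v \<xi>))\<^sup>2) \<partial>lebesgue) \<le> ennreal K"
proof -
  let ?f = "\<lambda>t. (ln t) powr (1/2) * (ln (ln t)) powr (1/2 + \<epsilon>)"
  obtain E where E: "spectral_measure_of harmonic_oscillator E" and vE: "(v, w) \<in> spectral_integral E ?f"
    using vw unfolding functional_calculus_def by blast
  interpret ho_pvm E using E by unfold_locales (auto simp: spectral_measure_of_def)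
  show v: "v \<in> L2" using vE unfolding spectral_integral_def by blast
  have B: "(\<integral>\<^sup>+t. ennreal ((?f t)\<^sup>2) \<partial>mu v) \<le> ennreal (2 * (L2_norm w)\<^sup>2)"
    by (rule spectral_integral_bound[OF vE]) measurable
  have f: "ln t \<le> (?f t)\<^sup>2" "1 \<le> ln t" "1 \<le> t" if t: "exp (exp 1) \<le> t" for t
  proof -
    have t0: "t > 0" using t exp_gt_zero[of "exp 1"] by linarith
    have l: "exp 1 \<le> ln t" using t t0 by (simp add: ln_ge_iff)
    then have l0: "ln t > 0" using exp_gt_zero[of "1::real"] by linarith
    have ll: "1 \<le> ln (ln t)" using l l0 by (simp add: ln_ge_iff)
    show "1 \<le> ln t" using l exp_ge_add_one_self[of 1] by simp
    then show "1 \<le> t" using t0 by (metis exp_le_cancel_iff exp_ln exp_ge_add_one_self le_add_same_cancel1 order_trans zero_le_one add.commute)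
    have "1 \<le> ln (ln t) powr (1/2 + \<epsilon>)" using ll eps by (intro ge_one_powr_ge_zero) auto
    then have "1 \<le> (ln (ln t) powr (1/2 + \<epsilon>))\<^sup>2" by (rule one_le_power)
    then have "ln t * 1 \<le> ln t * (ln (ln t) powr (1/2 + \<epsilon>))\<^sup>2" using l0 by (intro mult_left_mono) auto
    moreover have "(ln t powr (1/2))\<^sup>2 = ln t" using l0 by (simp add: powr_half_sqrt)
    ultimately show "ln t \<le> (?f t)\<^sup>2" by (simp add: power_mult_distrib)
  qed
  have L: "(\<integral>\<^sup>+t. ennreal (ln t) \<partial>mu v) \<le> ennreal (2 * (L2_norm w)\<^sup>2)"
    using ho_support[OF v] f by (intro order_trans[OF nn_integral_mono_AE B]) (auto elim!: eventually_mono intro!: ennreal_leI)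
  have "ennreal ((L2_norm v)\<^sup>2) = (\<integral>\<^sup>+t. 1 \<partial>mu v)" using emeasure_mu[OF v, of UNIV] by (simp add: E_UNIV_norm[OF v])
  also have "\<dots> \<le> (\<integral>\<^sup>+t. ennreal (ln t) \<partial>mu v)"
    using ho_support[OF v] f by (intro nn_integral_mono_AE) (auto elim!: eventually_mono)
  also note L
  finally have vN: "(L2_norm v)\<^sup>2 \<le> 2 * (L2_norm w)\<^sup>2" by simp
  define m where "m k = emeasure (mu v) {exp (real (Suc k))<..}" for k
  have "(\<Sum>k. m k) = (\<integral>\<^sup>+t. (\<Sum>k. indicator {exp (real (Suc k))<..} t) \<partial>mu v)"
    unfolding m_def by (subst nn_integral_suminf) auto
  also have "\<dots> \<le> (\<integral>\<^sup>+t. ennreal (ln t) \<partial>mu v)"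
    using ho_support[OF v] f by (intro nn_integral_mono_AE) (auto elim!: eventually_mono intro!: count_le_ln simp del: of_nat_Suc)
  also note L
  finally have M: "(\<Sum>k. m k) \<le> ennreal (2 * (L2_norm w)\<^sup>2)" .
  define D where "D = real CARD('n) * (L2_norm v)\<^sup>2"
  have D: "D \<ge> 0" by (simp add: D_def)
  note S = ho_tail_split[OF v exp_ge_zero, folded D_def]
  have fin: "ennreal (2 * (L2_norm v)\<^sup>2) + (ennreal (2 * D) + 2 * (\<Sum>k. m k)) \<le> ennreal K"
  proof -
    have "ennreal (2 * (L2_norm v)\<^sup>2) + (ennreal (2 * D) + 2 * (\<Sum>k. m k)) \<le>
        ennreal (2 * (L2_norm v)\<^sup>2) + (ennreal (2 * D) + 2 * ennreal (2 * (L2_norm w)\<^sup>2))"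
      by (intro add_left_mono mult_left_mono M) auto
    also have "\<dots> = ennreal (2 * (L2_norm v)\<^sup>2 + (2 * D + 2 * (2 * (L2_norm w)\<^sup>2)))"
      using D by (simp add: ennreal_plus ennreal_mult')
    also have "\<dots> \<le> ennreal K"
    proof (rule ennreal_leI)
      have "D \<le> real CARD('n) * (2 * (L2_norm w)\<^sup>2)" unfolding D_def using vN by (intro mult_left_mono) auto
      then show "2 * (L2_norm v)\<^sup>2 + (2 * D + 2 * (2 * (L2_norm w)\<^sup>2)) \<le> K"
        using vN unfolding K_def by (simp add: algebra_simps)
    qed
    finally show ?thesis .
  qed
  show "(\<integral>\<^sup>+x. ennreal (ln (2 + norm x) * (cmod (v x))\<^sup>2) \<partial>lebesgue) \<le> ennreal K"
    by (rule order_trans[OF log_weight_bound[OF v S(1) S(2) S(3) S(4) S(6) D] fin]) (simp add: S(8) m_def)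
  have F: "AE \<xi> in lebesgue. fourier v \<xi> = fourier (E {0..exp (real (Suc k))} v) \<xi> + fourier (E (- {0..exp (real (Suc k))}) v) \<xi>" for k
  proof -
    let ?A = "E {0..exp (real (Suc k))} v" and ?B = "E (- {0..exp (real (Suc k))}) v"
    have "fourier v = fourier (\<lambda>x. 1 * ?A x + 1 * ?B x)"
      using S(1,2,3)[of "real (Suc k)"] v by (intro fourier_cong_AE) (auto intro!: L2_measurable L2_add)
    then show ?thesis using fourier_linear[OF S(1,2)[of "real (Suc k)"], of 1 1] by simp
  qed
  have "(\<integral>\<^sup>+\<xi>. ennreal (ln (2 + norm \<xi>) * (cmod (fourier v \<xi>))\<^sup>2) \<partial>lebesgue)
      \<le> ennreal (2 * (L2_norm (fourier v))\<^sup>2) + (ennreal (2 * D) + 2 * (\<Sum>k. m k))"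
    by (rule log_weight_bound[OF fourier_spec(1)[OF v] fourier_spec(1)[OF S(1)] fourier_spec(1)[OF S(2)] F S(5) S(7) D])
      (simp add: fourier_norm[OF S(2)] S(8) m_def)
  then show "(\<integral>\<^sup>+\<xi>. ennreal (ln (2 + norm \<xi>) * (cmod (fourier v \<xi>))\<^sup>2) \<partial>lebesgue) \<le> ennreal K"
    using fin by (simp add: fourier_norm[OF v])
qed

section \<open>Dyadic frequency shells\<close>

lemma power_diff_le:
  \<comment> \<open>Mean value bound for the power function; it measures thin spherical
    layers.\<close>
  fixes a b :: real assumes "0 \<le> a" "a \<le> b"
  shows "b ^ n - a ^ n \<le> real n * (b - a) * b ^ (n - 1)"
proof -
  have "b ^ n - a ^ n = (b - a) * (\<Sum>i<n. a ^ (n - Suc i) * b ^ i)" by (rule power_diff_sumr2)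
  also have "\<dots> \<le> (b - a) * (\<Sum>i<n. b ^ (n - 1))"
  proof (intro mult_left_mono sum_mono)
    fix i assume i: "i \<in> {..<n}"
    have "a ^ (n - Suc i) * b ^ i \<le> b ^ (n - Suc i) * b ^ i"
      using assms by (intro mult_right_mono power_mono) auto
    also have "\<dots> = b ^ (n - 1)" using i by (simp flip: power_add)
    finally show "a ^ (n - Suc i) * b ^ i \<le> b ^ (n - 1)" .
  qed (use assms in auto)
  finally show ?thesis by (simp add: mult_ac)
qed

text \<open>About \<open>log 2 (2 + r)\<close> terms are bounded by 1, and after them the terms
  decay geometrically. Both logarithmic weights in the spectral estimates arise from this sum over
  dyadic scales.\<close>

lemma sum_min_geometric_le_ln:
  fixes r :: real assumes r: "r \<ge> 0"
  shows "(\<Sum>j<J. min 1 (r / 2 ^ j)) \<le> 8 * ln (2 + r)"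
proof -
  define K where "K = nat \<lceil>log 2 (2 + r)\<rceil>"
  have l1: "log 2 (2 + r) \<ge> 1" using r by (simp add: le_log_iff)
  have K: "log 2 (2 + r) \<le> real K" "real K \<le> log 2 (2 + r) + 1" unfolding K_def using l1 by (simp_all add: of_nat_nat)
  have "2 + r \<le> 2 powr (real K)" using K(1) r by (subst (asm) log_le_iff) auto
  then have rK: "r \<le> 2 ^ K" by (simp add: powr_realpow)
  have "(\<Sum>j<J. min 1 (r / 2 ^ j)) \<le> (\<Sum>j<K + J. min 1 (r / 2 ^ j))"
    using r by (intro sum_mono2) auto
  also have "\<dots> = (\<Sum>j<K. min 1 (r / 2 ^ j)) + (\<Sum>j<J. min 1 (r / 2 ^ (K + j)))"
    by (induction J) auto
  also have "\<dots> \<le> (\<Sum>j<K. 1) + (\<Sum>j<J. (1/2) ^ j)"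
  proof (intro add_mono sum_mono)
    fix j
    have "r / 2 ^ (K + j) \<le> 2 ^ K / 2 ^ (K + j)" by (intro divide_right_mono rK) simp
    also have "\<dots> = (1/2) ^ j" by (simp add: power_add power_divide)
    finally show "min 1 (r / 2 ^ (K + j)) \<le> (1/2) ^ j" by simp
  qed simp
  also have "\<dots> \<le> real K + 2" using sum_gp_strict[of "1/2::real" J] by simp
  \<comment> \<open>The left side is at most \<open>log 2 (2 + r) + 3\<close>, and the logarithm is
    at least 1; afterwards \<open>1 / ln 2 \<le> 2\<close> turns 4 into 8.\<close>
  also have "\<dots> \<le> 4 * log 2 (2 + r)" using K l1 by linarith
  also have "\<dots> = 4 / ln 2 * ln (2 + r)" by (simp add: log_def)
  also have "\<dots> \<le> 8 * ln (2 + r)"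
  proof (intro mult_right_mono)
    have "(1/2::real) \<le> ln 2" using ln_one_minus_pos_upper_bound[of "1/2"] by (simp add: ln_div)
    then show "4 / ln 2 \<le> (8::real)" by (simp add: field_simps)
  qed (use r in simp)
  finally show ?thesis .
qed

text \<open>A geometric sum is comparable to its last term, here the largest power below
  \<open>y\<close>. Applied with ratio \<open>2^(d/2)\<close> and \<open>y = 8 |v|\<close>, it makes
  the trace-norm contributions quadratic in \<open>v\<close>.\<close>

lemma sum_geometric_below:
  fixes \<rho> y :: real assumes rho: "\<rho> > 1" and y: "y \<ge> 0"
  shows "(\<Sum>j<J. if \<rho> ^ j < y then \<rho> ^ j else 0) \<le> \<rho> / (\<rho> - 1) * y"
proof (induction J)
  case 0 then show ?case using assms by simp
next
  case (Suc J)
  show ?case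
  proof (cases "\<rho> ^ J < y")
    case True
    have "(\<Sum>j<Suc J. if \<rho> ^ j < y then \<rho> ^ j else 0) \<le> (\<Sum>j<Suc J. \<rho> ^ j)"
      using rho by (intro sum_mono) auto
    also have "\<dots> = (\<rho> ^ Suc J - 1) / (\<rho> - 1)" using rho geometric_sum[of \<rho> "Suc J"] by simp
    also have "\<dots> \<le> \<rho> * \<rho> ^ J / (\<rho> - 1)" using rho by (intro divide_right_mono) auto
    also have "\<dots> \<le> \<rho> * y / (\<rho> - 1)" using rho True by (intro divide_right_mono mult_left_mono) auto
    finally show ?thesis by simp
  next
    case False then show ?thesis using Suc by simp
  qed
qed

section \<open>Volumes of shells and of their overlaps\<close>

abbreviation ball_vol :: "'n::finite itself \<Rightarrow> real" where
  "ball_vol _ \<equiv> unit_ball_vol (real CARD('n))"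

definition annulus :: "real \<Rightarrow> real \<Rightarrow> (real^'n) set" where
  "annulus a b = {\<xi>. a \<le> norm \<xi> \<and> norm \<xi> < b}"

lemma annulus_eq: "annulus a b = ball 0 b - ball 0 a"
  by (auto simp: annulus_def)

lemma annulus_borel [measurable]: "annulus a b \<in> sets borel"
  unfolding annulus_eq by auto

lemma annulus_lebesgue [measurable, simp]: "annulus a b \<in> sets lebesgue"
  by (rule sets_completionI_sets) simp

lemma emeasure_annulus:
  assumes "0 \<le> a" "a \<le> b"
  shows "emeasure lborel (annulus a b :: (real^'n) set) = ennreal (ball_vol TYPE('n) * (b ^ CARD('n) - a ^ CARD('n)))"
proof -
  have "emeasure lborel (annulus a b :: (real^'n) set) = emeasure lborel (ball 0 b :: (real^'n) set) - emeasure lborel (ball 0 a :: (real^'n) set)"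
    unfolding annulus_eq using assms by (intro emeasure_Diff) (auto simp: emeasure_ball)
  also have "\<dots> = ennreal (ball_vol TYPE('n) * b ^ CARD('n)) - ennreal (ball_vol TYPE('n) * a ^ CARD('n))"
    using assms by (simp add: emeasure_ball)
  also have "\<dots> = ennreal (ball_vol TYPE('n) * (b ^ CARD('n) - a ^ CARD('n)))"
    using assms by (simp add: ennreal_minus right_diff_distrib)
  finally show ?thesis .
qed

abbreviation shell :: "nat \<Rightarrow> (real^'n) set" where
  "shell j \<equiv> annulus (2 ^ j) (2 ^ Suc j)"

lemma emeasure_shell_le:
  "emeasure lborel (shell j :: (real^'n) set) \<le> ennreal (ball_vol TYPE('n) * 2 ^ CARD('n) * (2 ^ j) ^ CARD('n))"
proof -
  have "ball_vol TYPE('n) * ((2 ^ Suc j) ^ CARD('n) - (2 ^ j) ^ CARD('n)) \<le> ball_vol TYPE('n) * (2 ^ Suc j) ^ CARD('n)"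
    by (intro mult_left_mono) auto
  then show ?thesis by (subst emeasure_annulus) (auto simp: power_mult_distrib intro!: ennreal_leI)
qed

text \<open>A shift by \<open>\<theta>\<close> moves a point out of the shell only if it lies within
  \<open>norm \<theta>\<close> of one of the two bounding spheres, and such layers have volume of
  order \<open>norm \<theta> * 2^(j(d-1))\<close>. For shifts longer than \<open>2^j\<close> the
  full volume is used. The gain \<open>min 1 (norm \<theta> / 2^j)\<close> is what makes the sum
  over all shells only logarithmic.\<close>

lemma shell_overlap:
  fixes \<theta> :: "real^'n"
  shows "emeasure lborel {\<xi>\<in>shell j. \<xi> + \<theta> \<notin> shell j}
     \<le> ennreal (2 * real CARD('n) * ball_vol TYPE('n) * 2 ^ CARD('n) * (2 ^ j) ^ CARD('n) * min 1 (norm \<theta> / 2 ^ j))"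
proof -
  let ?d = "CARD('n)" and ?w = "ball_vol TYPE('n)"
  define r where "r = norm \<theta>"
  define a where "a = (2::real) ^ j"
  have a: "a > 0" by (simp add: a_def)
  have d1: "1 \<le> real ?d" by (simp add: Suc_leI)
  have w: "?w \<ge> 0" by simp
  show ?thesis
  proof (cases "r \<le> a")
    case False
    have "emeasure lborel {\<xi>\<in>shell j. \<xi> + \<theta> \<notin> shell j} \<le> emeasure lborel (shell j :: (real^'n) set)"
      by (intro emeasure_mono) auto
    also have "\<dots> \<le> ennreal (?w * 2 ^ ?d * (2 ^ j) ^ ?d)" by (rule emeasure_shell_le)
    also have "\<dots> \<le> ennreal (2 * real ?d * ?w * 2 ^ ?d * (2 ^ j) ^ ?d * min 1 (norm \<theta> / 2 ^ j))"
    proof (rule ennreal_leI)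
      have m: "min 1 (norm \<theta> / 2 ^ j) = 1" using False a unfolding r_def a_def by (simp add: min_def field_simps)
      have "1 * (?w * 2 ^ ?d * (2 ^ j) ^ ?d) \<le> (2 * real ?d) * (?w * 2 ^ ?d * (2 ^ j) ^ ?d)"
      proof (rule mult_right_mono)
        show "1 \<le> 2 * real ?d" using d1 by linarith
      qed (use w in simp)
      then show "?w * 2 ^ ?d * (2 ^ j) ^ ?d \<le> 2 * real ?d * ?w * 2 ^ ?d * (2 ^ j) ^ ?d * min 1 (norm \<theta> / 2 ^ j)"
        unfolding m by (simp add: mult_ac)
    qed
    finally show ?thesis .
  next
    case True
    have r0: "r \<ge> 0" by (simp add: r_def)
    have "{\<xi>\<in>shell j. \<xi> + \<theta> \<notin> shell j} \<subseteq> annulus a (a + r) \<union> annulus (2 * a - r) (2 * a)"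
    proof
      fix \<xi> assume x: "\<xi> \<in> {\<xi>\<in>shell j. \<xi> + \<theta> \<notin> shell j}"
      then have 1: "a \<le> norm \<xi>" "norm \<xi> < 2 * a" and 2: "norm (\<xi> + \<theta>) < a \<or> 2 * a \<le> norm (\<xi> + \<theta>)"
        by (auto simp: annulus_def a_def)
      have "norm \<xi> \<le> norm (\<xi> + \<theta>) + r" using norm_triangle_ineq4[of "\<xi> + \<theta>" \<theta>] by (simp add: r_def)
      moreover have "norm (\<xi> + \<theta>) \<le> norm \<xi> + r" using norm_triangle_ineq[of \<xi> \<theta>] by (simp add: r_def)
      ultimately show "\<xi> \<in> annulus a (a + r) \<union> annulus (2 * a - r) (2 * a)" using 1 2 by (auto simp: annulus_def)
    qed
    then have "emeasure lborel {\<xi>\<in>shell j. \<xi> + \<theta> \<notin> shell j} \<le> emeasure lborel (annulus a (a + r) \<union> annulus (2 * a - r) (2 * a) :: (real^'n) set)"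
      by (intro emeasure_mono) auto
    also have "\<dots> \<le> emeasure lborel (annulus a (a + r) :: (real^'n) set) + emeasure lborel (annulus (2 * a - r) (2 * a) :: (real^'n) set)"
      by (intro emeasure_subadditive) auto
    also have "\<dots> = ennreal (?w * ((a + r) ^ ?d - a ^ ?d)) + ennreal (?w * ((2 * a) ^ ?d - (2 * a - r) ^ ?d))"
      using a r0 True by (subst (1 2) emeasure_annulus) auto
    also have "\<dots> = ennreal (?w * ((a + r) ^ ?d - a ^ ?d) + ?w * ((2 * a) ^ ?d - (2 * a - r) ^ ?d))"
    proof -
      have "a ^ ?d \<le> (a + r) ^ ?d" by (rule power_mono) (use a r0 in simp_all)
      moreover have "(2 * a - r) ^ ?d \<le> (2 * a) ^ ?d" by (rule power_mono) (use a r0 True in simp_all)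
      ultimately show ?thesis using w by (intro ennreal_plus[symmetric] mult_nonneg_nonneg) (simp_all only: diff_ge_0_iff_ge)
    qed
    also have "\<dots> \<le> ennreal (2 * real ?d * ?w * 2 ^ ?d * (2 ^ j) ^ ?d * min 1 (norm \<theta> / 2 ^ j))"
    proof (rule ennreal_leI)
      have p: "(2 * a) ^ (?d - 1) \<le> 2 ^ ?d * a ^ ?d / a"
      proof -
        have "(2 * a) ^ (?d - 1) = (2::real) ^ (?d - 1) * (a ^ ?d / a)"
          using a by (cases "?d") (auto simp: power_mult_distrib)
        also have "\<dots> \<le> 2 ^ ?d * (a ^ ?d / a)" using a by (intro mult_right_mono power_increasing) auto
        finally show ?thesis by simp
      qed
      have "(a + r) ^ ?d - a ^ ?d \<le> real ?d * (a + r - a) * (a + r) ^ (?d - 1)" using a r0 by (intro power_diff_le) auto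
      also have "\<dots> \<le> real ?d * r * (2 * a) ^ (?d - 1)"
      proof -
        have "(a + r) ^ (?d - 1) \<le> (2 * a) ^ (?d - 1)" by (rule power_mono) (use a r0 True in simp_all)
        then show ?thesis using r0 by (simp add: mult_left_mono del: power_mult_distrib)
      qed
      finally have A: "(a + r) ^ ?d - a ^ ?d \<le> real ?d * r * (2 * a) ^ (?d - 1)" .
      have B: "(2 * a) ^ ?d - (2 * a - r) ^ ?d \<le> real ?d * r * (2 * a) ^ (?d - 1)"
        using power_diff_le[of "2 * a - r" "2 * a" ?d] a r0 True by simp
      have "?w * ((a + r) ^ ?d - a ^ ?d) + ?w * ((2 * a) ^ ?d - (2 * a - r) ^ ?d) \<le> ?w * (real ?d * r * (2 * a) ^ (?d - 1)) + ?w * (real ?d * r * (2 * a) ^ (?d - 1))"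
        using A B w by (intro add_mono mult_left_mono)
      also have "\<dots> \<le> ?w * (real ?d * r * (2 ^ ?d * a ^ ?d / a)) + ?w * (real ?d * r * (2 ^ ?d * a ^ ?d / a))"
        using p w r0 by (intro add_mono mult_left_mono) auto
      also have "\<dots> = 2 * real ?d * ?w * 2 ^ ?d * a ^ ?d * (r / a)" by (simp add: mult_ac)
      also have "r / a = min 1 (norm \<theta> / 2 ^ j)" using True a unfolding r_def a_def by (simp add: min_def field_simps)
      finally show "?w * ((a + r) ^ ?d - a ^ ?d) + ?w * ((2 * a) ^ ?d - (2 * a - r) ^ ?d) \<le> 2 * real ?d * ?w * 2 ^ ?d * (2 ^ j) ^ ?d * min 1 (norm \<theta> / 2 ^ j)"
        unfolding a_def .
    qed
    finally show ?thesis .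
  qed
qed

text \<open>The Hilbert--Schmidt norm of the off-diagonal part of multiplication by \<open>v\<close> with respect to
  the dyadic frequency shells; \<open>g\<close> is the Fourier transform of \<open>v\<close>.\<close>

lemma off_diagonal_HS:
  fixes g :: "real^'n \<Rightarrow> complex"
  assumes g [measurable]: "g \<in> borel_measurable borel"
  shows "(\<Sum>j<J. ennreal (1 / (2 ^ j) ^ CARD('n)) * (\<integral>\<^sup>+\<xi>. indicator (shell j) \<xi> * (\<integral>\<^sup>+\<eta>. indicator (- shell j) \<eta> * ennreal ((cmod (g (\<eta> - \<xi>)))\<^sup>2) \<partial>lborel) \<partial>lborel))
    \<le> ennreal (16 * real CARD('n) * ball_vol TYPE('n) * 2 ^ CARD('n)) * (\<integral>\<^sup>+\<theta>. ennreal (ln (2 + norm \<theta>) * (cmod (g \<theta>))\<^sup>2) \<partial>lborel)"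
proof -
  let ?d = "CARD('n)"
  define C where "C = 2 * real ?d * ball_vol TYPE('n) * 2 ^ ?d"
  have C: "C \<ge> 0" by (simp add: C_def)
  define G where "G \<theta> = ennreal ((cmod (g \<theta>))\<^sup>2)" for \<theta>
  have [measurable]: "G \<in> borel_measurable borel" unfolding G_def by measurable
  \<comment> \<open>With \<open>\<eta> = \<xi> + \<theta>\<close> the factor
    \<open>G \<theta>\<close> separates, and the remaining integral over \<open>\<xi>\<close> is the
    overlap volume; its growth \<open>(2^j)^d\<close> cancels the prefactor.\<close>
  have shift: "(\<integral>\<^sup>+\<eta>. indicator (- shell j) \<eta> * G (\<eta> - \<xi>) \<partial>lborel) = (\<integral>\<^sup>+\<theta>. indicator (- shell j) (\<xi> + \<theta>) * G \<theta> \<partial>lborel)" for j and \<xi> :: "real^'n"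
  proof -
    have m: "(\<lambda>\<eta>. indicator (- shell j) \<eta> * G (\<eta> - \<xi>)) \<in> borel_measurable borel" by measurable
    show ?thesis
      using lebesgue_nn_integral_translation[of "\<lambda>\<eta>. indicator (- shell j) \<eta> * G (\<eta> - \<xi>)" \<xi>] m
      by (simp add: nn_integral_completion add.commute)
  qed
  have 1: "ennreal (1 / (2 ^ j) ^ ?d) * (\<integral>\<^sup>+\<xi>. indicator (shell j) \<xi> * (\<integral>\<^sup>+\<eta>. indicator (- shell j) \<eta> * G (\<eta> - \<xi>) \<partial>lborel) \<partial>lborel)
     \<le> (\<integral>\<^sup>+\<theta>. ennreal (C * min 1 (norm \<theta> / 2 ^ j)) * G \<theta> \<partial>lborel)" for j
  proof -
    have "(\<integral>\<^sup>+\<xi>. indicator (shell j) \<xi> * (\<integral>\<^sup>+\<eta>. indicator (- shell j) \<eta> * G (\<eta> - \<xi>) \<partial>lborel) \<partial>lborel)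
      = (\<integral>\<^sup>+\<xi>. \<integral>\<^sup>+\<theta>. indicator (shell j) \<xi> * (indicator (- shell j) (\<xi> + \<theta>) * G \<theta>) \<partial>lborel \<partial>(lborel :: (real^'n) measure))"
      unfolding shift by (intro nn_integral_cong nn_integral_cmult[symmetric]) measurable
    also have "\<dots> = (\<integral>\<^sup>+\<theta>. \<integral>\<^sup>+\<xi>. indicator (shell j) \<xi> * (indicator (- shell j) (\<xi> + \<theta>) * G \<theta>) \<partial>lborel \<partial>(lborel :: (real^'n) measure))"
      by (rule lborel_pair.Fubini'[symmetric]) measurable
    also have "\<dots> = (\<integral>\<^sup>+\<theta>. emeasure lborel {\<xi>\<in>shell j. \<xi> + \<theta> \<notin> shell j} * G \<theta> \<partial>lborel)"
    proof (rule nn_integral_cong)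
      fix \<theta> :: "real^'n"
      have "{\<xi>. \<xi> \<in> shell j \<and> \<xi> + \<theta> \<notin> shell j} = shell j - ((\<lambda>\<xi>. \<xi> + \<theta>) -` shell j)" by auto
      moreover have "(\<lambda>\<xi>. \<xi> + \<theta>) -` shell j \<in> sets borel"
        using measurable_sets[of "\<lambda>\<xi>. \<xi> + \<theta>" borel borel "shell j"] by simp
      ultimately have s: "{\<xi>\<in>shell j. \<xi> + \<theta> \<notin> shell j} \<in> sets lborel" by simp
      have "(\<integral>\<^sup>+\<xi>. indicator (shell j) \<xi> * (indicator (- shell j) (\<xi> + \<theta>) * G \<theta>) \<partial>lborel) = (\<integral>\<^sup>+\<xi>. indicator {\<xi>\<in>shell j. \<xi> + \<theta> \<notin> shell j} \<xi> * G \<theta> \<partial>lborel)"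
        by (intro nn_integral_cong) (auto simp: indicator_def)
      also have "\<dots> = emeasure lborel {\<xi>\<in>shell j. \<xi> + \<theta> \<notin> shell j} * G \<theta>"
        using s by (subst nn_integral_multc) auto
      finally show "(\<integral>\<^sup>+\<xi>. indicator (shell j) \<xi> * (indicator (- shell j) (\<xi> + \<theta>) * G \<theta>) \<partial>lborel) = emeasure lborel {\<xi>\<in>shell j. \<xi> + \<theta> \<notin> shell j} * G \<theta>" .
    qed
    also have "\<dots> \<le> (\<integral>\<^sup>+\<theta>. ennreal (C * (2 ^ j) ^ ?d * min 1 (norm \<theta> / 2 ^ j)) * G \<theta> \<partial>lborel)"
      unfolding C_def by (intro nn_integral_mono mult_right_mono shell_overlap) auto
    also have "\<dots> = (\<integral>\<^sup>+\<theta>. ennreal ((2 ^ j) ^ ?d) * (ennreal (C * min 1 (norm \<theta> / 2 ^ j)) * G \<theta>) \<partial>lborel)"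
    proof (intro nn_integral_cong)
      fix \<theta> :: "real^'n"
      have "ennreal (C * (2 ^ j) ^ ?d * min 1 (norm \<theta> / 2 ^ j)) = ennreal ((2 ^ j) ^ ?d) * ennreal (C * min 1 (norm \<theta> / 2 ^ j))"
        by (subst ennreal_mult'[symmetric]) (auto simp: mult_ac)
      then show "ennreal (C * (2 ^ j) ^ ?d * min 1 (norm \<theta> / 2 ^ j)) * G \<theta> = ennreal ((2 ^ j) ^ ?d) * (ennreal (C * min 1 (norm \<theta> / 2 ^ j)) * G \<theta>)"
        by (simp only: mult.assoc)
    qed
    also have "\<dots> = ennreal ((2 ^ j) ^ ?d) * (\<integral>\<^sup>+\<theta>. ennreal (C * min 1 (norm \<theta> / 2 ^ j)) * G \<theta> \<partial>lborel)"
      by (rule nn_integral_cmult) measurable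
    finally have "ennreal (1 / (2 ^ j) ^ ?d) * (\<integral>\<^sup>+\<xi>. indicator (shell j) \<xi> * (\<integral>\<^sup>+\<eta>. indicator (- shell j) \<eta> * G (\<eta> - \<xi>) \<partial>lborel) \<partial>lborel)
      \<le> ennreal (1 / (2 ^ j) ^ ?d) * (ennreal ((2 ^ j) ^ ?d) * (\<integral>\<^sup>+\<theta>. ennreal (C * min 1 (norm \<theta> / 2 ^ j)) * G \<theta> \<partial>lborel))"
      by (intro mult_left_mono) auto
    also have "\<dots> = (\<integral>\<^sup>+\<theta>. ennreal (C * min 1 (norm \<theta> / 2 ^ j)) * G \<theta> \<partial>lborel)"
      unfolding mult.assoc[symmetric] by (subst ennreal_mult'[symmetric]) auto
    finally show ?thesis .
  qed
  have "(\<Sum>j<J. ennreal (1 / (2 ^ j) ^ ?d) * (\<integral>\<^sup>+\<xi>. indicator (shell j) \<xi> * (\<integral>\<^sup>+\<eta>. indicator (- shell j) \<eta> * G (\<eta> - \<xi>) \<partial>lborel) \<partial>lborel))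
    \<le> (\<Sum>j<J. \<integral>\<^sup>+\<theta>. ennreal (C * min 1 (norm \<theta> / 2 ^ j)) * G \<theta> \<partial>lborel)" by (intro sum_mono 1)
  also have "\<dots> = (\<integral>\<^sup>+\<theta>. (\<Sum>j<J. ennreal (C * min 1 (norm \<theta> / 2 ^ j)) * G \<theta>) \<partial>lborel)"
    by (rule nn_integral_sum[symmetric]) measurable
  also have "\<dots> \<le> (\<integral>\<^sup>+\<theta>. ennreal (8 * C) * ennreal (ln (2 + norm \<theta>) * (cmod (g \<theta>))\<^sup>2) \<partial>lborel)"
  proof (rule nn_integral_mono)
    fix \<theta> :: "real^'n"
    have "(\<Sum>j<J. ennreal (C * min 1 (norm \<theta> / 2 ^ j)) * G \<theta>) = ennreal (\<Sum>j<J. C * min 1 (norm \<theta> / 2 ^ j)) * G \<theta>"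
      using C by (simp add: sum_ennreal sum_distrib_right[symmetric])
    also have "\<dots> \<le> ennreal (8 * C * ln (2 + norm \<theta>)) * G \<theta>"
      using mult_left_mono[OF sum_min_geometric_le_ln[of "norm \<theta>" J] C]
      by (intro mult_right_mono ennreal_leI) (auto simp: sum_distrib_left[symmetric] mult_ac)
    also have "\<dots> = ennreal (8 * C) * ennreal (ln (2 + norm \<theta>) * (cmod (g \<theta>))\<^sup>2)"
      using C unfolding G_def by (simp add: ennreal_mult'[symmetric] ennreal_mult''[symmetric] mult.assoc)
    finally show "(\<Sum>j<J. ennreal (C * min 1 (norm \<theta> / 2 ^ j)) * G \<theta>) \<le> ennreal (8 * C) * ennreal (ln (2 + norm \<theta>) * (cmod (g \<theta>))\<^sup>2)" .
  qed
  also have "\<dots> = ennreal (8 * C) * (\<integral>\<^sup>+\<theta>. ennreal (ln (2 + norm \<theta>) * (cmod (g \<theta>))\<^sup>2) \<partial>lborel)"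
    by (rule nn_integral_cmult) measurable
  finally show ?thesis by (simp add: G_def C_def mult_ac)
qed

text \<open>The infrared part: after subtracting \<open>1\<close> from the exponential, \<open>|\<xi>|\<^sup>-\<^sup>d\<close> becomes integrable at
  the origin up to a logarithm.\<close>

lemma infrared_integral:
  fixes x :: "real^'n"
  shows "(\<integral>\<^sup>+\<xi>. indicator (ball 0 1) \<xi> * ennreal ((cmod (cis (x \<bullet> \<xi>) - 1))\<^sup>2 / norm \<xi> ^ CARD('n)) \<partial>lborel)
    \<le> ennreal (32 * ball_vol TYPE('n) * 2 ^ CARD('n) * ln (2 + norm x))"
proof -
  let ?d = "CARD('n)" and ?w = "ball_vol TYPE('n)"
  \<comment> \<open>Dyadic annuli shrinking to the origin: on each, \<open>norm \<xi> ^ d\<close> is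
    comparable to the volume, so every scale contributes a bounded amount times the gain from the
    exponential.\<close>
  define S where "S j = (annulus (1 / 2 ^ Suc j) (1 / 2 ^ j) :: (real^'n) set)" for j
  have Sm [measurable]: "S j \<in> sets borel" for j unfolding S_def by simp
  \<comment> \<open>The quadratic vanishing at 0 is weakened to a linear one, so that the sum over
    the annuli has exactly the form of \<open>sum_min_geometric_le_ln\<close>.\<close>
  have cs: "(cmod (cis a - 1))\<^sup>2 \<le> 4 * min 1 \<bar>a\<bar>" for a
  proof (cases "\<bar>a\<bar> \<le> 1")
    case True
    have "cmod (cis a - 1) \<le> \<bar>a\<bar>" 
    proof -
      have "cis a - 1 = 2 * \<i> * complex_of_real (sin (a / 2)) * cis (a / 2)"
      proof (rule complex_eqI)
        show "Re (cis a - 1) = Re (2 * \<i> * complex_of_real (sin (a / 2)) * cis (a / 2))"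
          using cos_double_sin[of "a/2"] by (simp add: power2_eq_square)
        show "Im (cis a - 1) = Im (2 * \<i> * complex_of_real (sin (a / 2)) * cis (a / 2))"
          using sin_double[of "a/2"] by simp
      qed
      then have "cmod (cis a - 1) = 2 * \<bar>sin (a / 2)\<bar>" by (simp add: norm_mult)
      also have "\<dots> \<le> 2 * \<bar>a / 2\<bar>" by (intro mult_left_mono abs_sin_x_le_abs_x) auto
      finally show ?thesis by simp
    qed
    then have "(cmod (cis a - 1))\<^sup>2 \<le> \<bar>a\<bar> * \<bar>a\<bar>" unfolding power2_eq_square by (intro mult_mono) auto
    also have "\<dots> \<le> 1 * \<bar>a\<bar>" using True by (intro mult_right_mono) auto
    also have "\<dots> \<le> 4 * min 1 \<bar>a\<bar>" using True by (simp add: min_def)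
    finally show ?thesis .
  next
    case False
    have "cmod (cis a - 1) \<le> 2" using norm_triangle_ineq4[of "cis a" 1] by simp
    then have "(cmod (cis a - 1))\<^sup>2 \<le> 2\<^sup>2" by (intro power_mono) auto
    then show ?thesis using False by (simp add: min_def)
  qed
  define F where "F \<xi> = ennreal ((cmod (cis (x \<bullet> \<xi>) - 1))\<^sup>2 / norm \<xi> ^ ?d)" for \<xi>
  have [measurable]: "F \<in> borel_measurable borel" unfolding F_def by measurable
  have FS: "(\<integral>\<^sup>+\<xi>. indicator (S j) \<xi> * F \<xi> \<partial>lborel) \<le> ennreal (4 * ?w * 2 ^ ?d * min 1 (norm x / 2 ^ j))" for j
  proof -
    have "(\<integral>\<^sup>+\<xi>. indicator (S j) \<xi> * F \<xi> \<partial>lborel) \<le> (\<integral>\<^sup>+\<xi>. ennreal (4 * min 1 (norm x / 2 ^ j) * (2 ^ Suc j) ^ ?d) * indicator (S j) \<xi> \<partial>lborel)"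
    proof (rule nn_integral_mono)
      fix \<xi> :: "real^'n"
      show "indicator (S j) \<xi> * F \<xi> \<le> ennreal (4 * min 1 (norm x / 2 ^ j) * (2 ^ Suc j) ^ ?d) * indicator (S j) \<xi>"
      proof (cases "\<xi> \<in> S j")
        case True
        then have n: "1 / 2 ^ Suc j \<le> norm \<xi>" "norm \<xi> < 1 / 2 ^ j" by (auto simp: S_def annulus_def)
        have "\<bar>x \<bullet> \<xi>\<bar> \<le> norm x * norm \<xi>" by (rule Cauchy_Schwarz_ineq2)
        also have "\<dots> \<le> norm x / 2 ^ j" using mult_left_mono[of "norm \<xi>" "1 / 2 ^ j" "norm x"] n by simp
        finally have m: "min 1 \<bar>x \<bullet> \<xi>\<bar> \<le> min 1 (norm x / 2 ^ j)" by simp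
        have "(1 / 2 ^ Suc j) ^ ?d \<le> norm \<xi> ^ ?d" using n by (intro power_mono) auto
        then have p: "1 / norm \<xi> ^ ?d \<le> 1 / (1 / 2 ^ Suc j) ^ ?d" using n by (intro divide_left_mono) (auto intro!: mult_pos_pos zero_less_power less_le_trans[OF _ n(1)])
        have "(cmod (cis (x \<bullet> \<xi>) - 1))\<^sup>2 / norm \<xi> ^ ?d \<le> (4 * min 1 (norm x / 2 ^ j)) * (1 / (1 / 2 ^ Suc j) ^ ?d)"
          using mult_mono[OF order_trans[OF cs[of "x \<bullet> \<xi>"] mult_left_mono[OF m, of 4]] p] by simp
        also have "1 / (1 / 2 ^ Suc j) ^ ?d = (2 ^ Suc j :: real) ^ ?d" by (simp add: power_divide)
        finally show ?thesis using True by (simp add: F_def ennreal_leI)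
      qed simp
    qed
    also have "\<dots> = ennreal (4 * min 1 (norm x / 2 ^ j) * (2 ^ Suc j) ^ ?d) * emeasure lborel (S j)"
      by (subst nn_integral_cmult_indicator) auto
    also have "\<dots> \<le> ennreal (4 * min 1 (norm x / 2 ^ j) * (2 ^ Suc j) ^ ?d) * ennreal (?w * (1 / 2 ^ j) ^ ?d)"
    proof (rule mult_left_mono)
      have "?w * ((1 / 2 ^ j) ^ ?d - (1 / 2 ^ Suc j) ^ ?d) \<le> ?w * (1 / 2 ^ j) ^ ?d" by (intro mult_left_mono) auto
      then show "emeasure lborel (S j) \<le> ennreal (?w * (1 / 2 ^ j) ^ ?d)"
        unfolding S_def by (subst emeasure_annulus) (auto simp: field_simps intro!: ennreal_leI)
    qed simp
    also have "\<dots> = ennreal (4 * min 1 (norm x / 2 ^ j) * (2 ^ Suc j) ^ ?d * (?w * (1 / 2 ^ j) ^ ?d))"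
      by (rule ennreal_mult''[symmetric]) simp
    also have "4 * min 1 (norm x / 2 ^ j) * (2 ^ Suc j) ^ ?d * (?w * (1 / 2 ^ j) ^ ?d) = 4 * ?w * 2 ^ ?d * min 1 (norm x / 2 ^ j)"
      by (simp add: power_mult_distrib power_divide)
    finally show ?thesis .
  qed
  have "(\<integral>\<^sup>+\<xi>. indicator (ball 0 1) \<xi> * F \<xi> \<partial>lborel) \<le> (\<integral>\<^sup>+\<xi>. (\<Sum>j. indicator (S j) \<xi> * F \<xi>) \<partial>lborel)"
  proof (rule nn_integral_mono)
    fix \<xi> :: "real^'n"
    show "indicator (ball 0 1) \<xi> * F \<xi> \<le> (\<Sum>j. indicator (S j) \<xi> * F \<xi>)"
    \<comment> \<open>The origin lies in none of the annuli, but the integrand vanishes there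
      because \<open>cis 0 = 1\<close>.\<close>
    proof (cases "\<xi> \<in> ball 0 1 \<and> \<xi> \<noteq> 0")
      case True
      then have n: "0 < norm \<xi>" "norm \<xi> < 1" by auto
      obtain m where m: "(1/2) ^ m < norm \<xi>" using real_arch_pow_inv[OF n(1), of "1/2"] by auto
      define k where "k = (LEAST m. 1 / 2 ^ m \<le> norm \<xi>)"
      have km: "1 / 2 ^ k \<le> norm \<xi>" unfolding k_def by (rule LeastI[of _ m]) (use m in \<open>simp add: power_divide\<close>)
      have "k \<noteq> 0" using km n by (intro notI) simp
      then obtain j where j: "k = Suc j" by (cases k) auto
      have "\<not> 1 / 2 ^ j \<le> norm \<xi>" using not_less_Least[of j "\<lambda>m. 1 / 2 ^ m \<le> norm \<xi>"] j by (simp add: k_def)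
      then have "\<xi> \<in> S j" using km j by (auto simp: S_def annulus_def)
      then have "indicator (ball 0 1) \<xi> * F \<xi> \<le> (\<Sum>i\<in>{j}. indicator (S i) \<xi> * F \<xi>)" by (simp add: indicator_def)
      also have "\<dots> \<le> (\<Sum>j. indicator (S j) \<xi> * F \<xi>)" by (rule sum_le_suminf) auto
      finally show ?thesis .
    next
      case False
      then have "indicator (ball 0 1) \<xi> * F \<xi> = 0" by (auto simp: F_def indicator_def)
      then show ?thesis by (metis zero_le)
    qed
  qed
  also have "\<dots> = (\<Sum>j. \<integral>\<^sup>+\<xi>. indicator (S j) \<xi> * F \<xi> \<partial>lborel)" by (rule nn_integral_suminf) measurable
  also have "\<dots> \<le> ennreal (32 * ?w * 2 ^ ?d * ln (2 + norm x))"
  proof (rule suminf_le_const)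
    fix J
    have "(\<Sum>j<J. \<integral>\<^sup>+\<xi>. indicator (S j) \<xi> * F \<xi> \<partial>lborel) \<le> (\<Sum>j<J. ennreal (4 * ?w * 2 ^ ?d * min 1 (norm x / 2 ^ j)))"
      by (intro sum_mono FS)
    also have "\<dots> = ennreal (\<Sum>j<J. 4 * ?w * 2 ^ ?d * min 1 (norm x / 2 ^ j))" by (rule sum_ennreal) simp
    also have "\<dots> \<le> ennreal (32 * ?w * 2 ^ ?d * ln (2 + norm x))"
    proof (rule ennreal_leI)
      have "4 * ?w * 2 ^ ?d * (\<Sum>j<J. min 1 (norm x / 2 ^ j)) \<le> 4 * ?w * 2 ^ ?d * (8 * ln (2 + norm x))"
        by (intro mult_left_mono sum_min_geometric_le_ln) auto
      then show "(\<Sum>j<J. 4 * ?w * 2 ^ ?d * min 1 (norm x / 2 ^ j)) \<le> 32 * ?w * 2 ^ ?d * ln (2 + norm x)"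
        by (simp add: sum_distrib_left[symmetric] mult_ac)
    qed
    finally show "(\<Sum>j<J. \<integral>\<^sup>+\<xi>. indicator (S j) \<xi> * F \<xi> \<partial>lborel) \<le> ennreal (32 * ?w * 2 ^ ?d * ln (2 + norm x))" .
  qed auto
  finally show ?thesis by (simp add: F_def)
qed

section \<open>The Birman--Schwinger form on Bessel families\<close>

text \<open>Equivalently, a synthesis map of norm at most 1. Orthonormality would be too strong: the
  weighted transforms of the trial functions are only dominated by an orthonormal family.\<close>

definition bessel :: "'i set \<Rightarrow> ('i \<Rightarrow> real^'n \<Rightarrow> complex) \<Rightarrow> bool" where
  "bessel I f \<longleftrightarrow> finite I \<and> (\<forall>i\<in>I. f i \<in> L2) \<and>
     (\<forall>g\<in>L2. (\<Sum>i\<in>I. (cmod (L2_inner (f i) g))\<^sup>2) \<le> (L2_norm g)\<^sup>2)"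

lemma besselD:
  assumes "bessel I f"
  shows "finite I" "i \<in> I \<Longrightarrow> f i \<in> L2" "g \<in> L2 \<Longrightarrow> (\<Sum>i\<in>I. (cmod (L2_inner (f i) g))\<^sup>2) \<le> (L2_norm g)\<^sup>2"
  using assms by (auto simp: bessel_def)

text \<open>Testing the inequality on \<open>f i\<close> itself bounds the fourth power of its norm
  by the second.\<close>

lemma bessel_norm_le:
  assumes f: "bessel I f" and i: "i \<in> I" shows "L2_norm (f i) \<le> 1"
proof -
  note B = besselD[OF f]
  have "(cmod (L2_inner (f i) (f i)))\<^sup>2 \<le> (\<Sum>k\<in>I. (cmod (L2_inner (f k) (f i)))\<^sup>2)"
    using B(1) i by (intro member_le_sum) auto
  also have "\<dots> \<le> (L2_norm (f i))\<^sup>2" by (rule B(3)[OF B(2)[OF i]])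
  finally have "((L2_norm (f i))\<^sup>2)\<^sup>2 \<le> (L2_norm (f i))\<^sup>2 * 1" by (simp add: L2_inner_self del: of_real_power)
  then have "(L2_norm (f i))\<^sup>2 * (L2_norm (f i))\<^sup>2 \<le> (L2_norm (f i))\<^sup>2 * 1" by (simp only: power2_eq_square)
  then have "(L2_norm (f i))\<^sup>2 \<le> 1"
    using mult_le_cancel_left_pos[of "(L2_norm (f i))\<^sup>2" "(L2_norm (f i))\<^sup>2" 1] by (cases "L2_norm (f i) = 0") simp_all
  then show ?thesis using power2_le_imp_le[of "L2_norm (f i)" 1] by simp
qed

lemma bessel_sum_norm:
  assumes f: "bessel I f"
  shows "(\<Sum>i\<in>I. \<integral>\<^sup>+x. ennreal ((cmod (f i x))\<^sup>2) \<partial>lebesgue) \<le> ennreal (real (card I))"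
proof -
  have "(\<Sum>i\<in>I. \<integral>\<^sup>+x. ennreal ((cmod (f i x))\<^sup>2) \<partial>lebesgue) \<le> (\<Sum>i\<in>I. 1)"
  proof (rule sum_mono)
    fix i assume i: "i \<in> I"
    have "(L2_norm (f i))\<^sup>2 \<le> 1" using bessel_norm_le[OF f i] by (simp add: power_le_one)
    then have "ennreal ((L2_norm (f i))\<^sup>2) \<le> ennreal 1" by (rule ennreal_leI)
    then show "(\<integral>\<^sup>+x. ennreal ((cmod (f i x))\<^sup>2) \<partial>lebesgue) \<le> 1" using L2_norm_nn[OF besselD(2)[OF f i]] by simp
  qed
  then show ?thesis by (simp add: ennreal_of_nat_eq_real_of_nat)
qed

lemma bessel_fourier:
  fixes f :: "'i \<Rightarrow> real^'n \<Rightarrow> complex"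
  assumes f: "bessel I f" shows "bessel I (\<lambda>i. fourier (f i))"
  unfolding bessel_def
proof (intro conjI ballI)
  show "finite I" by (rule besselD(1)[OF f])
  show "fourier (f i) \<in> L2" if "i \<in> I" for i by (intro fourier_spec besselD(2)[OF f] that)
  fix g :: "real^'n \<Rightarrow> complex" assume g: "g \<in> L2"
  have "(\<Sum>i\<in>I. (cmod (L2_inner (fourier (f i)) g))\<^sup>2) = (\<Sum>i\<in>I. (cmod (L2_inner (f i) (ifourier g)))\<^sup>2)"
    by (intro sum.cong refl) (simp add: fourier_adjoint besselD(2)[OF f] g)
  also have "\<dots> \<le> (L2_norm g)\<^sup>2" using besselD(3)[OF f ifourier_L2[OF g]] by (simp add: ifourier_norm[OF g])
  finally show "(\<Sum>i\<in>I. (cmod (L2_inner (fourier (f i)) g))\<^sup>2) \<le> (L2_norm g)\<^sup>2" .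
qed

text \<open>Values of \<open>ifourier1\<close> at a point are integrals against a kernel. This form
  bounds the sum of their squares over the whole family by the norm of the kernel, independently of
  the number of functions.\<close>

lemma bessel_integral:
  fixes f :: "'i \<Rightarrow> real^'n \<Rightarrow> complex"
  assumes f: "bessel I f" and g: "g \<in> L2"
  shows "(\<Sum>i\<in>I. (cmod (LINT \<xi>|lebesgue. g \<xi> * f i \<xi>))\<^sup>2) \<le> (L2_norm g)\<^sup>2"
proof -
  have "cmod (LINT \<xi>|lebesgue. g \<xi> * f i \<xi>) = cmod (L2_inner (f i) (\<lambda>x. cnj (g x)))" for i
  proof -
    have "(LINT \<xi>|lebesgue. g \<xi> * f i \<xi>) = L2_inner (\<lambda>x. cnj (g x)) (f i)" by (simp add: L2_inner_def)
    also have "\<dots> = cnj (L2_inner (f i) (\<lambda>x. cnj (g x)))" by (simp add: L2_inner_cnj)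
    finally show ?thesis by simp
  qed
  then show ?thesis using besselD(3)[OF f L2_cnj[OF g]] by (simp add: L2_norm_cnj)
qed

lemma ifourier_adjoint:
  fixes a f :: "real^'n \<Rightarrow> complex"
  assumes "a \<in> L2" "f \<in> L2" shows "L2_inner (ifourier a) f = L2_inner a (fourier f)"
proof -
  have "cnj (L2_inner f (ifourier a)) = cnj (L2_inner (fourier f) a)" using fourier_adjoint[OF assms(2,1)] by simp
  then show ?thesis by (simp only: L2_inner_cnj)
qed

lemma ifourier1_L2:
  fixes g :: "real^'n \<Rightarrow> complex"
  assumes "integrable lebesgue g" "g \<in> L2"
  shows "ifourier1 g \<in> L2" "L2_norm (ifourier1 g) = L2_norm g"
proof -
  have e: "ifourier1 g = (\<lambda>x. cnj (fourier1 (\<lambda>\<xi>. cnj (g \<xi>)) x))" by (rule ext) (rule ifourier1_eq)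
  have c: "integrable lebesgue (\<lambda>\<xi>. cnj (g \<xi>))" "(\<lambda>\<xi>. cnj (g \<xi>)) \<in> L2" using assms by (auto intro: L2_cnj)
  show "ifourier1 g \<in> L2" unfolding e by (intro L2_cnj plancherel_fourier1 c)
  show "L2_norm (ifourier1 g) = L2_norm g" unfolding e L2_norm_cnj by (simp add: plancherel_fourier1(2)[OF c] L2_norm_cnj)
qed

lemma ifourier1_nn_norm:
  fixes g :: "real^'n \<Rightarrow> complex"
  assumes "integrable lebesgue g" "g \<in> L2"
  shows "(\<integral>\<^sup>+x. ennreal ((cmod (ifourier1 g x))\<^sup>2) \<partial>lebesgue) = (\<integral>\<^sup>+\<xi>. ennreal ((cmod (g \<xi>))\<^sup>2) \<partial>lebesgue)"
  unfolding L2_norm_nn[OF ifourier1_L2(1)[OF assms], symmetric] L2_norm_nn[OF assms(2), symmetric]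
  by (simp add: ifourier1_L2(2)[OF assms])

lemma ifourier1_measurable: "integrable lebesgue g \<Longrightarrow> ifourier1 g \<in> borel_measurable borel" for g :: "real^'n \<Rightarrow> complex"
proof -
  assume g: "integrable lebesgue g"
  have e: "ifourier1 g = (\<lambda>x. cnj (fourier1 (\<lambda>\<xi>. cnj (g \<xi>)) x))" by (rule ext) (rule ifourier1_eq)
  have "fourier1 (\<lambda>\<xi>. cnj (g \<xi>)) \<in> borel_measurable borel" using g by (intro fourier1_measurable) simp
  then show ?thesis unfolding e by (rule borel_measurable_cnj_lebesgue)
qed

lemma fconst_le_1: "fconst TYPE('n::finite) \<le> 1"
proof -
  have "1 \<le> 2 * pi" using pi_gt3 by linarith
  then have "(2 * pi) powr (- real CARD('n) / 2) \<le> (2 * pi) powr 0" by (intro powr_mono) auto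
  then show ?thesis using pi_gt_zero by simp
qed

lemma ifourier1_bound: "cmod (ifourier1 g x) \<le> (LINT \<xi>|lebesgue. cmod (g \<xi>))" for g :: "real^'n \<Rightarrow> complex"
proof -
  have "cmod (ifourier1 g x) = cmod (fourier1 (\<lambda>\<xi>. cnj (g \<xi>)) x)" by (simp add: ifourier1_eq)
  also have "\<dots> \<le> fconst TYPE('n) * (LINT \<xi>|lebesgue. cmod (g \<xi>))"
    using fourier1_bound[of "\<lambda>\<xi>. cnj (g \<xi>)" x] by simp
  also have "\<dots> \<le> 1 * (LINT \<xi>|lebesgue. cmod (g \<xi>))" by (intro mult_right_mono fconst_le_1) simp
  finally show ?thesis by simp
qed

text \<open>Frequencies are always truncated to bounded sets first: there the transform is
  integrable, its inverse is bounded, and multiplication by an arbitrary \<open>v\<close> in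
  \<open>L2\<close> is harmless.\<close>

lemma L2_mult_ifourier1:
  fixes v g :: "real^'n \<Rightarrow> complex"
  assumes v: "v \<in> L2" and g: "integrable lebesgue g"
  shows "(\<lambda>x. v x * ifourier1 g x) \<in> L2"
proof -
  have "(\<lambda>x. ifourier1 g x * v x) \<in> L2"
    by (rule L2_mult_bounded(1)[OF v _ ifourier1_bound]) (use ifourier1_measurable[OF g] in simp)
  then show ?thesis by (simp add: mult.commute)
qed

lemma shell_subset_cball: "(annulus a b :: (real^'n) set) \<subseteq> cball 0 b"
  by (auto simp: annulus_def)

text \<open>\<open>hw\<close> is the weight \<open>|\<xi>|\<^sup>s\<close>, \<open>s = d/2\<close>, of the critical Sobolev space.\<close>

definition hw :: "real^'n \<Rightarrow> real" where
  "hw \<xi> = norm \<xi> powr (real CARD('n) / 2)"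

lemma hw_measurable [measurable]: "hw \<in> borel_measurable borel"
  unfolding hw_def[abs_def] by measurable

lemma hw_nonneg [simp]: "0 \<le> hw \<xi>" by (simp add: hw_def)

lemma hw_sq: "(hw \<xi>)\<^sup>2 = norm \<xi> ^ CARD('n)" for \<xi> :: "real^'n"
proof (cases "\<xi> = 0")
  case True then show ?thesis by (simp add: hw_def power_0_left)
next
  case False
  then have "(hw \<xi>)\<^sup>2 = norm \<xi> powr (real CARD('n))" by (simp add: hw_def power2_eq_square flip: powr_add)
  then show ?thesis using False by (simp add: powr_realpow)
qed

lemma hw_shell: "\<xi> \<in> shell j \<Longrightarrow> (2 ^ j) ^ CARD('n) * (cmod z)\<^sup>2 \<le> (cmod (complex_of_real (hw \<xi>) * z))\<^sup>2" for \<xi> :: "real^'n"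
  unfolding norm_mult norm_of_real power_mult_distrib power2_abs hw_sq
  by (intro mult_right_mono power_mono) (auto simp: annulus_def)

section \<open>Estimates on a single frequency shell\<close>

context
  fixes I :: "'i set" and \<Psi> G :: "'i \<Rightarrow> real^'n \<Rightarrow> complex" and v :: "real^'n \<Rightarrow> complex" and j :: nat
  assumes Psi: "bessel I \<Psi>" and G: "\<And>i. i \<in> I \<Longrightarrow> G i \<in> L2"
    and Phi: "bessel I (\<lambda>i \<xi>. complex_of_real (hw \<xi>) * G i \<xi>)" and v: "v \<in> L2"
begin

abbreviation (input) "Sj \<equiv> (shell j :: (real^'n) set)"
text \<open>Sums over the family at a fixed \<open>x\<close> require pointwise defined inverse
  transforms, which \<open>ifourier1\<close> provides on the bounded shell. On its complement the
  function need not be integrable, so \<open>qj\<close> uses the \<open>L2\<close> inverse.\<close>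

abbreviation (input) "uj i \<equiv> ifourier1 (\<lambda>\<xi>. indicator (shell j) \<xi> * G i \<xi>)"
abbreviation (input) "pj i \<equiv> ifourier1 (\<lambda>\<xi>. indicator (shell j) \<xi> * \<Psi> i \<xi>)"
abbreviation (input) "qj i \<equiv> ifourier (\<lambda>\<xi>. indicator (- shell j) \<xi> * \<Psi> i \<xi>)"

text \<open>Cutting at \<open>|v| = 2\<^sup>j\<^sup>d\<^sup>/\<^sup>2 / 8\<close> separates a part of small operator norm, absorbed into
  the two energies, from a part of finite trace norm.\<close>

lemma shell_diag:
  "(\<Sum>i\<in>I. \<integral>\<^sup>+x. ennreal (cmod (pj i x) * (cmod (v x) * cmod (uj i x))) \<partial>lebesgue) \<le>
    ennreal (1/16) * (\<Sum>i\<in>I. \<integral>\<^sup>+\<xi>. indicator (shell j) \<xi> * ennreal ((cmod (\<Psi> i \<xi>))\<^sup>2) \<partial>lebesgue)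
    + ennreal (1/16) * (\<Sum>i\<in>I. \<integral>\<^sup>+\<xi>. indicator (shell j) \<xi> * ennreal ((cmod (complex_of_real (hw \<xi>) * G i \<xi>))\<^sup>2) \<partial>lebesgue)
    + ennreal (ball_vol TYPE('n) * 2 ^ CARD('n)) * (\<integral>\<^sup>+x. ennreal (if sqrt (2 ^ CARD('n)) ^ j < 8 * cmod (v x) then cmod (v x) * sqrt (2 ^ CARD('n)) ^ j else 0) \<partial>lebesgue)"
proof -
  let ?d = "CARD('n)" and ?W = "ball_vol TYPE('n) * 2 ^ CARD('n)"
  \<comment> \<open>This is \<open>2^(jd/2)\<close>, the lower bound of \<open>hw\<close> on the
    shell, written as a \<open>j\<close>-th power so that the later sum over \<open>j\<close> is
    geometric.\<close>
  define r where "r = sqrt (2 ^ ?d) ^ j"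
  have r: "r > 0" by (simp add: r_def)
  have r2: "r\<^sup>2 = (2 ^ j) ^ ?d"
  proof -
    have "r\<^sup>2 = (sqrt (2 ^ ?d))\<^sup>2 ^ j" unfolding r_def by (metis power_mult mult.commute)
    also have "\<dots> = (2 ^ ?d) ^ j" by simp
    also have "\<dots> = (2 ^ j) ^ ?d" by (metis power_mult mult.commute)
    finally show ?thesis .
  qed
  have W: "?W \<ge> 0" by simp
  have Psi2: "\<Psi> i \<in> L2" if "i \<in> I" for i using besselD(2)[OF Psi that] .
  have iG: "integrable lebesgue (\<lambda>\<xi>. indicator (shell j) \<xi> * G i \<xi>)" and iG2: "(\<lambda>\<xi>. indicator (shell j) \<xi> * G i \<xi>) \<in> L2" if "i \<in> I" for i
    using integrable_indicator_L2[OF G[OF that] _ shell_subset_cball] L2_indicator(1)[OF G[OF that]] by auto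
  have iP: "integrable lebesgue (\<lambda>\<xi>. indicator (shell j) \<xi> * \<Psi> i \<xi>)" and iP2: "(\<lambda>\<xi>. indicator (shell j) \<xi> * \<Psi> i \<xi>) \<in> L2" if "i \<in> I" for i
    using integrable_indicator_L2[OF Psi2[OF that] _ shell_subset_cball] L2_indicator(1)[OF Psi2[OF that]] by auto
  have um: "uj i \<in> borel_measurable lebesgue" and pm: "pj i \<in> borel_measurable lebesgue" if "i \<in> I" for i
    using ifourier1_measurable[OF iG[OF that]] ifourier1_measurable[OF iP[OF that]] by auto
  have vm [measurable]: "v \<in> borel_measurable lebesgue" by (rule L2_measurable[OF v])
  define e where "e x \<xi> = complex_of_real (fconst TYPE('n)) * cis (x \<bullet> \<xi>) * indicator (shell j) \<xi>" for x \<xi> :: "real^'n"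
  have shell_nn: "(\<integral>\<^sup>+(\<xi>::real^'n). indicator (shell j) \<xi> \<partial>lebesgue) \<le> ennreal (?W * r\<^sup>2)"
    using emeasure_shell_le[of j, where 'n='n] by (simp add: emeasure_completion r2)
  have emeas: "(\<lambda>\<xi>. e x \<xi>) \<in> borel_measurable lebesgue" for x
    unfolding e_def by (intro lebesgue_measurable_lborel) measurable
  have eb: "cmod (e x \<xi>) \<le> indicator (shell j) \<xi>" for x \<xi>
    using fconst_le_1[where 'n='n] by (simp add: e_def norm_mult indicator_def)
  have e2: "e x \<in> L2" "(L2_norm (e x))\<^sup>2 \<le> ?W * r\<^sup>2" for x
  proof -
    have "(\<integral>\<^sup>+\<xi>. ennreal ((cmod (e x \<xi>))\<^sup>2) \<partial>lebesgue) \<le> (\<integral>\<^sup>+(\<xi>::real^'n). indicator (shell j) \<xi> \<partial>lebesgue)"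
    proof (rule nn_integral_mono)
      fix \<xi>
      have "(cmod (e x \<xi>))\<^sup>2 \<le> (indicator (shell j) \<xi>)\<^sup>2" using eb by (intro power_mono) auto
      then show "ennreal ((cmod (e x \<xi>))\<^sup>2) \<le> indicator (shell j) \<xi>" using eb[of x \<xi>] by (auto simp: indicator_def power_le_one split: if_splits intro!: order_trans[OF ennreal_leI])
    qed
    then have le: "(\<integral>\<^sup>+\<xi>. ennreal ((cmod (e x \<xi>))\<^sup>2) \<partial>lebesgue) \<le> ennreal (?W * r\<^sup>2)" using shell_nn by (rule order_trans)
    then show e: "e x \<in> L2" using emeas[of x] by (auto simp: L2_iff intro: le_less_trans)
    show "(L2_norm (e x))\<^sup>2 \<le> ?W * r\<^sup>2" using le W unfolding L2_norm_nn[OF e, symmetric] by simp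
  qed
  \<comment> \<open>Bessel's inequality with the truncated exponential as kernel, whose squared norm
    is at most the shell volume.\<close>
  have P: "(\<Sum>i\<in>I. (cmod (pj i x))\<^sup>2) \<le> ?W * r\<^sup>2" for x
  proof -
    have "pj i x = (LINT \<xi>|lebesgue. e x \<xi> * \<Psi> i \<xi>)" for i
      unfolding ifourier1_def e_def by (subst Bochner_Integration.integral_mult_right_zero[symmetric]) (simp add: mult_ac)
    then show ?thesis using order_trans[OF bessel_integral[OF Psi e2(1)[of x]] e2(2)[of x]] by simp
  qed
  \<comment> \<open>Dividing the kernel by \<open>hw\<close>, which is at least \<open>r\<close>,
    moves the weight onto \<open>G\<close>. The factor \<open>r^(-2)\<close> gained in this way
    cancels the growth \<open>r^2\<close> of the volume.\<close>
  have U: "(\<Sum>i\<in>I. (cmod (uj i x))\<^sup>2) \<le> ?W" for x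
  proof -
    define f where "f \<xi> = complex_of_real (1 / hw \<xi>) * e x \<xi>" for \<xi>
    have fb: "cmod (f \<xi>) \<le> cmod (complex_of_real (1 / r) * e x \<xi>)" for \<xi>
    proof (cases "\<xi> \<in> Sj")
      case True
      have "r\<^sup>2 \<le> (hw \<xi>)\<^sup>2" using hw_shell[OF True, of 1] by (simp add: r2 norm_mult)
      then have "r \<le> hw \<xi>" by (rule power2_le_imp_le) simp
      then have "1 / hw \<xi> \<le> 1 / r" using r by (intro divide_left_mono) auto
      then show ?thesis using r mult_right_mono[of "1 / hw \<xi>" "1 / r" "cmod (e x \<xi>)"] by (simp add: f_def norm_mult norm_divide)
    qed (simp add: f_def e_def)
    have fm: "f \<in> borel_measurable lebesgue"
      unfolding f_def[abs_def] e_def by (intro lebesgue_measurable_lborel) measurable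
    note F = L2I_dom[OF L2_scale[OF e2(1)[of x]] fm AE_I2[OF fb]]
    have "(L2_norm f)\<^sup>2 \<le> (L2_norm (\<lambda>\<xi>. complex_of_real (1 / r) * e x \<xi>))\<^sup>2"
      using F(2) by (intro power_mono) auto
    also have "\<dots> = (1 / r)\<^sup>2 * (L2_norm (e x))\<^sup>2" using r by (simp only: L2_norm_scale power_mult_distrib norm_of_real power2_abs)
    also have "\<dots> \<le> (1 / r)\<^sup>2 * (?W * r\<^sup>2)" using e2(2)[of x] by (intro mult_left_mono) auto
    also have "\<dots> = ?W" using r by (simp add: power_divide)
    finally have f2: "(L2_norm f)\<^sup>2 \<le> ?W" .
    have "uj i x = (LINT \<xi>|lebesgue. f \<xi> * (complex_of_real (hw \<xi>) * G i \<xi>))" for i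
      unfolding ifourier1_def
    proof (subst Bochner_Integration.integral_mult_right_zero[symmetric], intro Bochner_Integration.integral_cong refl)
      fix \<xi> :: "real^'n"
      show "complex_of_real (fconst TYPE('n)) * (cis (x \<bullet> \<xi>) * (indicator (shell j) \<xi> * G i \<xi>)) = f \<xi> * (complex_of_real (hw \<xi>) * G i \<xi>)"
      proof (cases "\<xi> \<in> Sj")
        case True
        have "r\<^sup>2 \<le> (hw \<xi>)\<^sup>2" using hw_shell[OF True, of 1] by (simp add: r2 norm_mult)
        then have "hw \<xi> \<noteq> 0" using r by auto
        then show ?thesis using True by (simp add: f_def e_def)
      qed (simp add: f_def e_def)
    qed
    then show ?thesis using order_trans[OF bessel_integral[OF Phi F(1)] f2] by simp
  qed
  define m where "m x = (if r < 8 * cmod (v x) then cmod (v x) * r else 0)" for x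
  have mm [measurable]: "m \<in> borel_measurable lebesgue" unfolding m_def[abs_def] by measurable
  have pt: "(\<Sum>i\<in>I. ennreal (cmod (pj i x) * (cmod (v x) * cmod (uj i x)))) \<le>
      ennreal (1/16) * (\<Sum>i\<in>I. ennreal ((cmod (pj i x))\<^sup>2)) + ennreal (1/16) * (\<Sum>i\<in>I. ennreal (r\<^sup>2 * (cmod (uj i x))\<^sup>2)) + ennreal ?W * ennreal (m x)" for x
  proof -
    \<comment> \<open>The weight \<open>r\<close> balances the two kernel bounds, which differ by
      the factor \<open>r^2\<close>.\<close>
    have amgm: "a * b \<le> (a\<^sup>2 / r + r * b\<^sup>2) / 2" for a b :: real
    proof -
      have "0 \<le> (a - r * b)\<^sup>2 / r" using r by simp
      also have "(a - r * b)\<^sup>2 / r = a\<^sup>2 / r + r * b\<^sup>2 - 2 * (a * b)" using r by (simp add: field_simps power2_eq_square)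
      finally show ?thesis by simp
    qed
    have "(\<Sum>i\<in>I. cmod (pj i x) * (cmod (v x) * cmod (uj i x))) \<le> 1/16 * (\<Sum>i\<in>I. (cmod (pj i x))\<^sup>2) + 1/16 * (\<Sum>i\<in>I. r\<^sup>2 * (cmod (uj i x))\<^sup>2) + ?W * m x"
    proof (cases "r < 8 * cmod (v x)")
      case True
      \<comment> \<open>Large \<open>|v|\<close>: the kernel bounds at the point \<open>x\<close>
        suffice. They do not involve the number of functions, which is the trace-norm character of
        this part.\<close>
      have "(\<Sum>i\<in>I. cmod (pj i x) * cmod (uj i x)) \<le> (\<Sum>i\<in>I. ((cmod (pj i x))\<^sup>2 / r + r * (cmod (uj i x))\<^sup>2) / 2)"
        by (intro sum_mono amgm)
      also have "(\<Sum>i\<in>I. ((cmod (pj i x))\<^sup>2 / r + r * (cmod (uj i x))\<^sup>2) / 2) = ((\<Sum>i\<in>I. (cmod (pj i x))\<^sup>2) / r + r * (\<Sum>i\<in>I. (cmod (uj i x))\<^sup>2)) / 2"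
        by (simp add: sum_divide_distrib[symmetric] sum.distrib sum_distrib_left)
      also have "\<dots> \<le> (?W * r\<^sup>2 / r + r * ?W) / 2"
        using r P[of x] U[of x] by (intro divide_right_mono add_mono mult_left_mono) auto
      also have "\<dots> = ?W * r" using r by (simp add: power2_eq_square)
      finally have "(\<Sum>i\<in>I. cmod (pj i x) * cmod (uj i x)) \<le> ?W * r" .
      then have "cmod (v x) * (\<Sum>i\<in>I. cmod (pj i x) * cmod (uj i x)) \<le> cmod (v x) * (?W * r)"
        by (rule mult_left_mono) simp
      then have "(\<Sum>i\<in>I. cmod (pj i x) * (cmod (v x) * cmod (uj i x))) \<le> ?W * m x"
        using True by (simp add: m_def sum_distrib_left mult_ac)
      moreover have "0 \<le> 1/16 * (\<Sum>i\<in>I. (cmod (pj i x))\<^sup>2)" "0 \<le> 1/16 * (\<Sum>i\<in>I. r\<^sup>2 * (cmod (uj i x))\<^sup>2)"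
        by (auto intro!: sum_nonneg)
      ultimately show ?thesis by linarith
    next
      case False
      \<comment> \<open>Small \<open>|v|\<close>: the bound \<open>r / 8\<close> and the factor
        \<open>1/2\<close> of the mean give the share \<open>1/16\<close> of each energy.\<close>
      have "(\<Sum>i\<in>I. cmod (pj i x) * (cmod (v x) * cmod (uj i x))) \<le> (\<Sum>i\<in>I. 1/16 * (cmod (pj i x))\<^sup>2 + 1/16 * (r\<^sup>2 * (cmod (uj i x))\<^sup>2))"
      proof (rule sum_mono)
        fix i
        have "cmod (pj i x) * (cmod (v x) * cmod (uj i x)) = cmod (v x) * (cmod (pj i x) * cmod (uj i x))" by simp
        also have "\<dots> \<le> r / 8 * (cmod (pj i x) * cmod (uj i x))" using False by (intro mult_right_mono) auto
        also have "\<dots> \<le> r / 8 * (((cmod (pj i x))\<^sup>2 / r + r * (cmod (uj i x))\<^sup>2) / 2)" using r by (intro mult_left_mono amgm) auto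
        also have "\<dots> = 1/16 * (cmod (pj i x))\<^sup>2 + 1/16 * (r\<^sup>2 * (cmod (uj i x))\<^sup>2)" using r by (simp add: field_simps power2_eq_square)
        finally show "cmod (pj i x) * (cmod (v x) * cmod (uj i x)) \<le> 1/16 * (cmod (pj i x))\<^sup>2 + 1/16 * (r\<^sup>2 * (cmod (uj i x))\<^sup>2)" .
      qed
      then show ?thesis using False by (simp add: m_def sum.distrib sum_distrib_left)
    qed
    then have "ennreal (\<Sum>i\<in>I. cmod (pj i x) * (cmod (v x) * cmod (uj i x))) \<le> ennreal (1/16 * (\<Sum>i\<in>I. (cmod (pj i x))\<^sup>2) + 1/16 * (\<Sum>i\<in>I. r\<^sup>2 * (cmod (uj i x))\<^sup>2) + ?W * m x)"
      by (rule ennreal_leI)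
    also have "\<dots> = ennreal (1/16) * (\<Sum>i\<in>I. ennreal ((cmod (pj i x))\<^sup>2)) + ennreal (1/16) * (\<Sum>i\<in>I. ennreal (r\<^sup>2 * (cmod (uj i x))\<^sup>2)) + ennreal ?W * ennreal (m x)"
    proof -
      have m0: "0 \<le> m x" using r by (simp add: m_def)
      have s1: "0 \<le> (\<Sum>i\<in>I. (cmod (pj i x))\<^sup>2)" and s2: "0 \<le> (\<Sum>i\<in>I. r\<^sup>2 * (cmod (uj i x))\<^sup>2)" by (auto intro!: sum_nonneg)
      have "ennreal (1/16 * (\<Sum>i\<in>I. (cmod (pj i x))\<^sup>2) + 1/16 * (\<Sum>i\<in>I. r\<^sup>2 * (cmod (uj i x))\<^sup>2) + ?W * m x) =
        ennreal (1/16 * (\<Sum>i\<in>I. (cmod (pj i x))\<^sup>2)) + ennreal (1/16 * (\<Sum>i\<in>I. r\<^sup>2 * (cmod (uj i x))\<^sup>2)) + ennreal (?W * m x)"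
        using s1 s2 m0 W by (subst ennreal_plus, simp, simp)+ simp
      moreover have "ennreal (1/16 * (\<Sum>i\<in>I. (cmod (pj i x))\<^sup>2)) = ennreal (1/16) * (\<Sum>i\<in>I. ennreal ((cmod (pj i x))\<^sup>2))"
        by (subst ennreal_mult') (simp_all add: sum_ennreal)
      moreover have "ennreal (1/16 * (\<Sum>i\<in>I. r\<^sup>2 * (cmod (uj i x))\<^sup>2)) = ennreal (1/16) * (\<Sum>i\<in>I. ennreal (r\<^sup>2 * (cmod (uj i x))\<^sup>2))"
        by (subst ennreal_mult') (simp_all add: sum_ennreal)
      moreover have "ennreal (?W * m x) = ennreal ?W * ennreal (m x)" by (rule ennreal_mult') (rule W)
      ultimately show ?thesis by (simp only:)
    qed
    finally show ?thesis by (simp add: sum_ennreal)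
  qed
  have "(\<Sum>i\<in>I. \<integral>\<^sup>+x. ennreal (cmod (pj i x) * (cmod (v x) * cmod (uj i x))) \<partial>lebesgue) =
      (\<integral>\<^sup>+x. (\<Sum>i\<in>I. ennreal (cmod (pj i x) * (cmod (v x) * cmod (uj i x)))) \<partial>lebesgue)"
    by (rule nn_integral_sum[symmetric]) (use um pm in simp)
  also have "\<dots> \<le> (\<integral>\<^sup>+x. ennreal (1/16) * (\<Sum>i\<in>I. ennreal ((cmod (pj i x))\<^sup>2)) + ennreal (1/16) * (\<Sum>i\<in>I. ennreal (r\<^sup>2 * (cmod (uj i x))\<^sup>2)) + ennreal ?W * ennreal (m x) \<partial>lebesgue)"
    by (intro nn_integral_mono pt)
  also have "\<dots> = ennreal (1/16) * (\<Sum>i\<in>I. \<integral>\<^sup>+x. ennreal ((cmod (pj i x))\<^sup>2) \<partial>lebesgue) + ennreal (1/16) * (\<Sum>i\<in>I. \<integral>\<^sup>+x. ennreal (r\<^sup>2 * (cmod (uj i x))\<^sup>2) \<partial>lebesgue) + ennreal ?W * (\<integral>\<^sup>+x. ennreal (m x) \<partial>lebesgue)"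
  proof -
    define A where "A x = (\<Sum>i\<in>I. ennreal ((cmod (pj i x))\<^sup>2))" for x
    define B where "B x = (\<Sum>i\<in>I. ennreal (r\<^sup>2 * (cmod (uj i x))\<^sup>2))" for x
    have [measurable]: "A \<in> borel_measurable lebesgue" "B \<in> borel_measurable lebesgue"
      unfolding A_def[abs_def] B_def[abs_def] by (intro borel_measurable_sum, use um pm in simp)+
    have b: "(\<integral>\<^sup>+x. A x \<partial>lebesgue) = (\<Sum>i\<in>I. \<integral>\<^sup>+x. ennreal ((cmod (pj i x))\<^sup>2) \<partial>lebesgue)"
      "(\<integral>\<^sup>+x. B x \<partial>lebesgue) = (\<Sum>i\<in>I. \<integral>\<^sup>+x. ennreal (r\<^sup>2 * (cmod (uj i x))\<^sup>2) \<partial>lebesgue)"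
      unfolding A_def B_def by (rule nn_integral_sum, use um pm in simp)+
    have "(\<integral>\<^sup>+x. ennreal (1/16) * A x + ennreal (1/16) * B x + ennreal ?W * ennreal (m x) \<partial>lebesgue) =
        ennreal (1/16) * (\<integral>\<^sup>+x. A x \<partial>lebesgue) + ennreal (1/16) * (\<integral>\<^sup>+x. B x \<partial>lebesgue) + ennreal ?W * (\<integral>\<^sup>+x. ennreal (m x) \<partial>lebesgue)"
      by (simp add: nn_integral_add nn_integral_cmult)
    then show ?thesis unfolding b unfolding A_def B_def .
  qed
  also have "(\<Sum>i\<in>I. \<integral>\<^sup>+x. ennreal ((cmod (pj i x))\<^sup>2) \<partial>lebesgue) = (\<Sum>i\<in>I. \<integral>\<^sup>+\<xi>. indicator (shell j) \<xi> * ennreal ((cmod (\<Psi> i \<xi>))\<^sup>2) \<partial>lebesgue)"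
  proof (rule sum.cong[OF refl])
    fix i assume i: "i \<in> I"
    have "(\<integral>\<^sup>+x. ennreal ((cmod (pj i x))\<^sup>2) \<partial>lebesgue) = (\<integral>\<^sup>+\<xi>. ennreal ((cmod (indicator (shell j) \<xi> * \<Psi> i \<xi>))\<^sup>2) \<partial>lebesgue)"
      by (rule ifourier1_nn_norm[OF iP[OF i] iP2[OF i]])
    also have "\<dots> = (\<integral>\<^sup>+\<xi>. indicator (shell j) \<xi> * ennreal ((cmod (\<Psi> i \<xi>))\<^sup>2) \<partial>lebesgue)"
      by (intro nn_integral_cong) (simp add: indicator_def)
    finally show "(\<integral>\<^sup>+x. ennreal ((cmod (pj i x))\<^sup>2) \<partial>lebesgue) = (\<integral>\<^sup>+\<xi>. indicator (shell j) \<xi> * ennreal ((cmod (\<Psi> i \<xi>))\<^sup>2) \<partial>lebesgue)" .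
  qed
  also have "(\<Sum>i\<in>I. \<integral>\<^sup>+x. ennreal (r\<^sup>2 * (cmod (uj i x))\<^sup>2) \<partial>lebesgue) \<le> (\<Sum>i\<in>I. \<integral>\<^sup>+\<xi>. indicator (shell j) \<xi> * ennreal ((cmod (complex_of_real (hw \<xi>) * G i \<xi>))\<^sup>2) \<partial>lebesgue)"
  proof (rule sum_mono)
    fix i assume i: "i \<in> I"
    have "(\<integral>\<^sup>+x. ennreal (r\<^sup>2 * (cmod (uj i x))\<^sup>2) \<partial>lebesgue) = ennreal (r\<^sup>2) * (\<integral>\<^sup>+x. ennreal ((cmod (uj i x))\<^sup>2) \<partial>lebesgue)"
      using um[OF i] by (subst nn_integral_cmult[symmetric]) (auto simp: ennreal_mult')
    also have "(\<integral>\<^sup>+x. ennreal ((cmod (uj i x))\<^sup>2) \<partial>lebesgue) = (\<integral>\<^sup>+\<xi>. ennreal ((cmod (indicator (shell j) \<xi> * G i \<xi>))\<^sup>2) \<partial>lebesgue)"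
      by (rule ifourier1_nn_norm[OF iG[OF i] iG2[OF i]])
    also have "ennreal (r\<^sup>2) * \<dots> = (\<integral>\<^sup>+\<xi>. ennreal (r\<^sup>2) * ennreal ((cmod (indicator (shell j) \<xi> * G i \<xi>))\<^sup>2) \<partial>lebesgue)"
      using L2_measurable[OF iG2[OF i]] by (intro nn_integral_cmult[symmetric]) simp
    also have "\<dots> \<le> (\<integral>\<^sup>+\<xi>. indicator (shell j) \<xi> * ennreal ((cmod (complex_of_real (hw \<xi>) * G i \<xi>))\<^sup>2) \<partial>lebesgue)"
    proof (rule nn_integral_mono)
      fix \<xi> :: "real^'n"
      show "ennreal (r\<^sup>2) * ennreal ((cmod (indicator (shell j) \<xi> * G i \<xi>))\<^sup>2) \<le> indicator (shell j) \<xi> * ennreal ((cmod (complex_of_real (hw \<xi>) * G i \<xi>))\<^sup>2)"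
      proof (cases "\<xi> \<in> Sj")
        case True
        have "ennreal (r\<^sup>2 * (cmod (G i \<xi>))\<^sup>2) \<le> ennreal ((cmod (complex_of_real (hw \<xi>) * G i \<xi>))\<^sup>2)"
          unfolding r2 by (intro ennreal_leI hw_shell[OF True])
        then show ?thesis using True by (simp add: ennreal_mult')
      qed simp
    qed
    finally show "(\<integral>\<^sup>+x. ennreal (r\<^sup>2 * (cmod (uj i x))\<^sup>2) \<partial>lebesgue) \<le> (\<integral>\<^sup>+\<xi>. indicator (shell j) \<xi> * ennreal ((cmod (complex_of_real (hw \<xi>) * G i \<xi>))\<^sup>2) \<partial>lebesgue)" .
  qed
  finally show ?thesis unfolding m_def r_def by (simp add: mult_left_mono add_mono)
qed

text \<open>The multiplication by \<open>v\<close> is moved to the other side and read in frequency: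
  at \<open>\<xi>\<close> in the shell, the inverse transform of \<open>h i\<close> is, up to
  \<open>fconst\<close>, the inner product of \<open>\<Psi> i\<close> with the transform of
  \<open>v\<close> shifted by \<open>\<xi>\<close> and restricted to the complement of the shell.
  Bessel's inequality then bounds the sum over the family by the Hilbert-Schmidt density
  \<open>N \<xi>\<close>.\<close>

lemma shell_off_diag:
  assumes g [measurable]: "g \<in> borel_measurable borel" and gv: "AE \<xi> in lebesgue. fourier v \<xi> = g \<xi>"
  shows "(\<Sum>i\<in>I. ennreal (cmod (L2_inner (qj i) (\<lambda>x. v x * uj i x)))) \<le>
    ennreal (1/8) * (\<Sum>i\<in>I. \<integral>\<^sup>+\<xi>. indicator (shell j) \<xi> * ennreal ((cmod (complex_of_real (hw \<xi>) * G i \<xi>))\<^sup>2) \<partial>lebesgue)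
    + 2 * (ennreal (1 / (2 ^ j) ^ CARD('n)) * (\<integral>\<^sup>+\<xi>. indicator (shell j) \<xi> * (\<integral>\<^sup>+\<eta>. indicator (- shell j) \<eta> * ennreal ((cmod (g (\<eta> - \<xi>)))\<^sup>2) \<partial>lborel) \<partial>lborel))"
proof -
  let ?d = "CARD('n)"
  define R where "R = ((2::real) ^ j) ^ ?d"
  have R: "R > 0" by (simp add: R_def)
  have Psi2: "\<Psi> i \<in> L2" if "i \<in> I" for i using besselD(2)[OF Psi that] .
  have cS: "- shell j \<in> sets (lebesgue :: (real^'n) measure)" unfolding Compl_eq_Diff_UNIV by (intro sets.Diff) auto
  define Q where "Q i = (\<lambda>\<xi>. indicator (- shell j) \<xi> * \<Psi> i \<xi>)" for i
  have Q2: "Q i \<in> L2" if "i \<in> I" for i unfolding Q_def by (rule L2_indicator(1)[OF Psi2[OF that] cS])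
  have q2: "ifourier (Q i) \<in> L2" if "i \<in> I" for i by (rule ifourier_L2[OF Q2[OF that]])
  have iG: "integrable lebesgue (\<lambda>\<xi>. indicator (shell j) \<xi> * G i \<xi>)" if "i \<in> I" for i
    using integrable_indicator_L2[OF G[OF that] _ shell_subset_cball] by auto
  define h where "h i = (\<lambda>x. cnj (ifourier (Q i) x) * v x)" for i
  have hi: "integrable lebesgue (h i)" if "i \<in> I" for i unfolding h_def by (rule L2_inner_integrable[OF q2[OF that] v])
  define N where "N \<xi> = (\<integral>\<^sup>+\<eta>. indicator (- shell j) \<eta> * ennreal ((cmod (g (\<eta> - \<xi>)))\<^sup>2) \<partial>lborel)" for \<xi> :: "real^'n"
  have Nm [measurable]: "N \<in> borel_measurable borel" unfolding N_def by measurable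
  have N: "(\<Sum>i\<in>I. ennreal ((cmod (ifourier1 (h i) \<xi>))\<^sup>2)) \<le> N \<xi>" for \<xi>
  proof -
    note md = fourier_modulation[OF v, of \<xi>]
    have fv: "(\<lambda>\<eta>. fourier v (\<eta> - \<xi>)) \<in> L2" using L2_translate(1)[OF fourier_spec(1)[OF v], of "- \<xi>"] by simp
    define k where "k = (\<lambda>\<eta>. indicator (- shell j) \<eta> * fourier v (\<eta> - \<xi>))"
    have k2: "k \<in> L2" unfolding k_def by (rule L2_indicator(1)[OF fv cS])
    have a: "cmod (ifourier1 (h i) \<xi>) \<le> cmod (L2_inner (\<Psi> i) k)" if i: "i \<in> I" for i
    proof -
      have "ifourier1 (h i) \<xi> = complex_of_real (fconst TYPE('n)) * L2_inner (ifourier (Q i)) (\<lambda>x. cis (x \<bullet> \<xi>) * v x)"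
        unfolding ifourier1_def h_def L2_inner_def by (simp add: mult_ac inner_commute)
      also have "L2_inner (ifourier (Q i)) (\<lambda>x. cis (x \<bullet> \<xi>) * v x) = L2_inner (Q i) (fourier (\<lambda>x. cis (x \<bullet> \<xi>) * v x))"
        by (rule ifourier_adjoint[OF Q2[OF i] md(1)])
      also have "\<dots> = L2_inner (Q i) (\<lambda>\<eta>. fourier v (\<eta> - \<xi>))"
        using md(2) Q2[OF i] fv md(1) by (intro L2_inner_cong_AE) (auto intro!: L2_measurable fourier_spec)
      also have "\<dots> = L2_inner (\<Psi> i) k"
        unfolding L2_inner_def Q_def k_def by (intro Bochner_Integration.integral_cong refl) (simp add: indicator_def)
      finally have "cmod (ifourier1 (h i) \<xi>) = fconst TYPE('n) * cmod (L2_inner (\<Psi> i) k)" by (simp add: norm_mult)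
      also have "\<dots> \<le> 1 * cmod (L2_inner (\<Psi> i) k)" by (intro mult_right_mono fconst_le_1) simp
      finally show ?thesis by simp
    qed
    have "(\<Sum>i\<in>I. ennreal ((cmod (ifourier1 (h i) \<xi>))\<^sup>2)) = ennreal (\<Sum>i\<in>I. (cmod (ifourier1 (h i) \<xi>))\<^sup>2)" by (simp add: sum_ennreal)
    also have "\<dots> \<le> ennreal ((L2_norm k)\<^sup>2)"
      using order_trans[OF sum_mono besselD(3)[OF Psi k2]] a by (intro ennreal_leI) (simp add: power_mono)
    also have "\<dots> = (\<integral>\<^sup>+\<eta>. ennreal ((cmod (k \<eta>))\<^sup>2) \<partial>lebesgue)" by (rule L2_norm_nn[OF k2])
    also have "\<dots> = (\<integral>\<^sup>+\<eta>. indicator (- shell j) \<eta> * ennreal ((cmod (g (\<eta> - \<xi>)))\<^sup>2) \<partial>lebesgue)"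
    proof (rule nn_integral_cong_AE)
      show "AE \<eta> in lebesgue. ennreal ((cmod (k \<eta>))\<^sup>2) = indicator (- shell j) \<eta> * ennreal ((cmod (g (\<eta> - \<xi>)))\<^sup>2)"
        using AE_lebesgue_translation[OF gv, of "- \<xi>"] by eventually_elim (simp add: k_def indicator_def)
    qed
    also have "\<dots> = N \<xi>" unfolding N_def by (simp add: nn_integral_completion)
    finally show ?thesis .
  qed
  have T: "ennreal (cmod (L2_inner (ifourier (Q i)) (\<lambda>x. v x * uj i x))) \<le>
     (\<integral>\<^sup>+\<xi>. ennreal (1/8) * (indicator (shell j) \<xi> * ennreal ((cmod (complex_of_real (hw \<xi>) * G i \<xi>))\<^sup>2)) + 2 * (ennreal (1 / R) * (indicator (shell j) \<xi> * ennreal ((cmod (ifourier1 (h i) \<xi>))\<^sup>2))) \<partial>lebesgue)" if i: "i \<in> I" for i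
  proof -
    let ?B = "\<lambda>\<xi>. indicator (shell j) \<xi> * G i \<xi>"
    have ch: "integrable lebesgue (\<lambda>x. cnj (h i x))" using hi[OF i] by simp
    have "L2_inner (ifourier (Q i)) (\<lambda>x. v x * uj i x) = L2_inner (\<lambda>x. cnj (h i x)) (ifourier1 ?B)"
      unfolding L2_inner_def h_def by (simp add: mult.assoc)
    also have "\<dots> = L2_inner (fourier1 (\<lambda>x. cnj (h i x))) ?B" by (rule fourier1_adjoint[OF ch iG[OF i], symmetric])
    also have "\<dots> = (LINT \<xi>|lebesgue. ifourier1 (h i) \<xi> * ?B \<xi>)" unfolding L2_inner_def ifourier1_eq ..
    finally have e: "L2_inner (ifourier (Q i)) (\<lambda>x. v x * uj i x) = (LINT \<xi>|lebesgue. ifourier1 (h i) \<xi> * ?B \<xi>)" .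
    have hm: "ifourier1 (h i) \<in> borel_measurable lebesgue" using ifourier1_measurable[OF hi[OF i]] by simp
    have "integrable lebesgue (\<lambda>\<xi>. ifourier1 (h i) \<xi> * ?B \<xi>)"
    proof (rule Bochner_Integration.integrable_bound)
      show "integrable lebesgue (\<lambda>\<xi>. complex_of_real (LINT x|lebesgue. cmod (h i x)) * ?B \<xi>)" using iG[OF i] by simp
      show "(\<lambda>\<xi>. ifourier1 (h i) \<xi> * ?B \<xi>) \<in> borel_measurable lebesgue" by (rule borel_measurable_times[OF hm borel_measurable_integrable[OF iG[OF i]]])
      show "AE \<xi> in lebesgue. norm (ifourier1 (h i) \<xi> * ?B \<xi>) \<le> norm (complex_of_real (LINT x|lebesgue. cmod (h i x)) * ?B \<xi>)"
        using ifourier1_bound[of "h i"] by (intro AE_I2) (simp add: norm_mult mult_right_mono order_trans[OF _ abs_ge_self])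
    qed
    then have "ennreal (cmod (L2_inner (ifourier (Q i)) (\<lambda>x. v x * uj i x))) \<le> (\<integral>\<^sup>+\<xi>. ennreal (cmod (ifourier1 (h i) \<xi> * ?B \<xi>)) \<partial>lebesgue)"
      unfolding e by (rule integral_norm_bound_ennreal)
    also have "\<dots> \<le> (\<integral>\<^sup>+\<xi>. ennreal (1/8) * (indicator (shell j) \<xi> * ennreal ((cmod (complex_of_real (hw \<xi>) * G i \<xi>))\<^sup>2)) + 2 * (ennreal (1 / R) * (indicator (shell j) \<xi> * ennreal ((cmod (ifourier1 (h i) \<xi>))\<^sup>2))) \<partial>lebesgue)"
    proof (rule nn_integral_mono)
      fix \<xi> :: "real^'n"
      show "ennreal (cmod (ifourier1 (h i) \<xi> * ?B \<xi>)) \<le> ennreal (1/8) * (indicator (shell j) \<xi> * ennreal ((cmod (complex_of_real (hw \<xi>) * G i \<xi>))\<^sup>2)) + 2 * (ennreal (1 / R) * (indicator (shell j) \<xi> * ennreal ((cmod (ifourier1 (h i) \<xi>))\<^sup>2)))"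
      proof (cases "\<xi> \<in> Sj")
        case True
        define a b c where "a = cmod (ifourier1 (h i) \<xi>)" and "b = cmod (G i \<xi>)" and "c = (cmod (complex_of_real (hw \<xi>) * G i \<xi>))\<^sup>2"
        have "R * b\<^sup>2 \<le> c" unfolding R_def b_def c_def by (rule hw_shell[OF True])
        \<comment> \<open>A completed square, with weights chosen so that the energy enters with the
          share \<open>1/8\<close>; the weight \<open>R\<close> is the lower bound of
          \<open>hw^2\<close> on the shell.\<close>
        have "0 \<le> (R * b / 4 - a)\<^sup>2 * 2 / R" using R by simp
        also have "\<dots> = 1/8 * (R * b\<^sup>2) + 2 * (1 / R * a\<^sup>2) - a * b" using R by (simp add: field_simps power2_eq_square)
        finally have "a * b \<le> 1/8 * c + 2 * (1 / R * a\<^sup>2)" using \<open>R * b\<^sup>2 \<le> c\<close> by linarith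
        then have "ennreal (a * b) \<le> ennreal (1/8 * c + 2 * (1 / R * a\<^sup>2))" by (rule ennreal_leI)
        also have "\<dots> = ennreal (1/8 * c) + ennreal (2 * (1 / R * a\<^sup>2))" using R by (intro ennreal_plus) (auto simp: c_def)
        also have "ennreal (1/8 * c) = ennreal (1/8) * ennreal c" by (rule ennreal_mult') simp
        also have "ennreal (2 * (1 / R * a\<^sup>2)) = 2 * (ennreal (1 / R) * ennreal (a\<^sup>2))"
          using R ennreal_mult'[of 2 "1 / R * a\<^sup>2"] ennreal_mult'[of "1 / R" "a\<^sup>2"] by simp
        finally show ?thesis using True by (simp add: norm_mult a_def b_def c_def)
      qed simp
    qed
    finally show ?thesis .
  qed
  have Gm: "G i \<in> borel_measurable lebesgue" if "i \<in> I" for i by (rule L2_measurable[OF G[OF that]])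
  have hwm: "hw \<in> borel_measurable lebesgue" by simp
  have Sm: "(indicator (shell j) :: real^'n \<Rightarrow> ennreal) \<in> borel_measurable lebesgue" by (intro borel_measurable_indicator) simp
  define A where "A i \<xi> = indicator (shell j) \<xi> * ennreal ((cmod (complex_of_real (hw \<xi>) * G i \<xi>))\<^sup>2)" for i \<xi>
  have Am: "A i \<in> borel_measurable lebesgue" if "i \<in> I" for i unfolding A_def[abs_def] using Gm[OF that] hwm by (intro borel_measurable_times_ennreal Sm) simp
  define B where "B i \<xi> = indicator (shell j) \<xi> * ennreal ((cmod (ifourier1 (h i) \<xi>))\<^sup>2)" for i \<xi>
  have Bm: "B i \<in> borel_measurable lebesgue" if "i \<in> I" for i
    unfolding B_def[abs_def] using ifourier1_measurable[OF hi[OF that]] by (intro borel_measurable_times_ennreal Sm) simp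
  have "(\<Sum>i\<in>I. ennreal (cmod (L2_inner (ifourier (Q i)) (\<lambda>x. v x * uj i x)))) \<le>
     (\<Sum>i\<in>I. \<integral>\<^sup>+\<xi>. ennreal (1/8) * A i \<xi> + 2 * (ennreal (1 / R) * B i \<xi>) \<partial>lebesgue)"
    unfolding A_def B_def by (intro sum_mono T)
  also have "\<dots> = (\<Sum>i\<in>I. ennreal (1/8) * (\<integral>\<^sup>+\<xi>. A i \<xi> \<partial>lebesgue) + 2 * (ennreal (1 / R) * (\<integral>\<^sup>+\<xi>. B i \<xi> \<partial>lebesgue)))"
  proof (rule sum.cong[OF refl])
    fix i assume i: "i \<in> I"
    note [measurable] = Am[OF i] Bm[OF i]
    show "(\<integral>\<^sup>+\<xi>. ennreal (1/8) * A i \<xi> + 2 * (ennreal (1 / R) * B i \<xi>) \<partial>lebesgue) =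
        ennreal (1/8) * (\<integral>\<^sup>+\<xi>. A i \<xi> \<partial>lebesgue) + 2 * (ennreal (1 / R) * (\<integral>\<^sup>+\<xi>. B i \<xi> \<partial>lebesgue))"
      by (simp add: nn_integral_add nn_integral_cmult)
  qed
  also have "\<dots> = ennreal (1/8) * (\<Sum>i\<in>I. \<integral>\<^sup>+\<xi>. A i \<xi> \<partial>lebesgue) + 2 * (ennreal (1 / R) * (\<Sum>i\<in>I. \<integral>\<^sup>+\<xi>. B i \<xi> \<partial>lebesgue))"
    by (simp add: sum.distrib sum_distrib_left)
  also have "(\<Sum>i\<in>I. \<integral>\<^sup>+\<xi>. B i \<xi> \<partial>lebesgue) = (\<integral>\<^sup>+\<xi>. (\<Sum>i\<in>I. B i \<xi>) \<partial>lebesgue)" by (rule nn_integral_sum[symmetric]) (rule Bm)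
  also have "\<dots> \<le> (\<integral>\<^sup>+\<xi>. indicator (shell j) \<xi> * N \<xi> \<partial>lebesgue)"
    unfolding B_def sum_distrib_left[symmetric] by (intro nn_integral_mono mult_left_mono N) auto
  also have "\<dots> = (\<integral>\<^sup>+\<xi>. indicator (shell j) \<xi> * N \<xi> \<partial>lborel)" by (simp add: nn_integral_completion)
  finally show ?thesis unfolding A_def N_def Q_def R_def by (simp add: add_left_mono mult_left_mono)
qed

end

section \<open>Summation over the shells, and the low frequencies\<close>

lemma ennreal_cmod_sum_le: "ennreal (cmod (\<Sum>i\<in>I. f i)) \<le> (\<Sum>i\<in>I. ennreal (cmod (f i)))"
proof -
  have "ennreal (cmod (\<Sum>i\<in>I. f i)) \<le> ennreal (\<Sum>i\<in>I. cmod (f i))" by (intro ennreal_leI norm_sum)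
  then show ?thesis by (simp add: sum_ennreal)
qed

lemma ennreal_inner_le:
  assumes "p \<in> L2" "f \<in> L2"
  shows "ennreal (cmod (L2_inner p f)) \<le> (\<integral>\<^sup>+x. ennreal (cmod (p x) * cmod (f x)) \<partial>lebesgue)"
  using integral_norm_bound_ennreal[OF L2_inner_integrable[OF assms]] by (simp add: L2_inner_def norm_mult)

lemma nn_integral_disjoint_family_le:
  fixes f :: "'a \<Rightarrow> ennreal"
  assumes f: "f \<in> borel_measurable M" and S: "\<And>j. S j \<in> sets M" and d: "disjoint_family S"
  shows "(\<Sum>j<(J::nat). \<integral>\<^sup>+x. indicator (S j) x * f x \<partial>M) \<le> (\<integral>\<^sup>+x. f x \<partial>M)"
proof -
  have "(\<Sum>j<J. \<integral>\<^sup>+x. indicator (S j) x * f x \<partial>M) = (\<integral>\<^sup>+x. (\<Sum>j<J. indicator (S j) x * f x) \<partial>M)"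
    using f S by (intro nn_integral_sum[symmetric]) auto
  also have "\<dots> \<le> (\<integral>\<^sup>+x. f x \<partial>M)"
  proof (rule nn_integral_mono)
    fix x
    have "(\<Sum>j<J. indicator (S j) x :: ennreal) \<le> 1"
    proof (cases "\<exists>j<J. x \<in> S j")
      case True
      then obtain k where k: "k < J" "x \<in> S k" by blast
      have "(\<Sum>j<J. indicator (S j) x :: ennreal) = (\<Sum>j<J. if j = k then 1 else 0)"
        using k d by (intro sum.cong refl) (auto simp: indicator_def disjoint_family_on_def)
      then show ?thesis using k by simp
    next
      case False
      then have "(\<Sum>j<J. indicator (S j) x :: ennreal) = 0" by (intro sum.neutral) auto
      then show ?thesis by simp
    qed
    then show "(\<Sum>j<J. indicator (S j) x * f x) \<le> f x"
      using mult_right_mono[of "\<Sum>j<J. indicator (S j) x" 1 "f x"] by (simp add: sum_distrib_right)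
  qed
  finally show ?thesis .
qed

lemma disjoint_shells: "disjoint_family (\<lambda>j. shell j :: (real^'n) set)"
proof -
  have "\<not> (2 ^ i \<le> a \<and> a < 2 ^ Suc i \<and> 2 ^ j \<le> a \<and> a < 2 ^ Suc j)" if "i < j" for i j and a :: real
  proof -
    have "(2::real) ^ Suc i \<le> 2 ^ j" using that by (intro power_increasing) auto
    then show ?thesis by linarith
  qed
  then show ?thesis unfolding disjoint_family_on_def annulus_def by (auto, metis linorder_neqE_nat)
qed

text \<open>Large enough for three constants: that of the trace part, \<open>4 * 8\<close> times
  volume \<open>* 2^d\<close>; that of the off-diagonal part, twice the constant 16 of
  \<open>off_diagonal_HS\<close>; and that of \<open>infrared_integral\<close>.\<close>

definition Cmid :: "'n::finite itself \<Rightarrow> real" where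
  "Cmid _ = 32 * real CARD('n) * unit_ball_vol (real CARD('n)) * 2 ^ CARD('n)"

lemma Cmid_nonneg: "0 \<le> Cmid TYPE('n::finite)"
  by (simp add: Cmid_def)

text \<open>The shells are disjoint, so the energies over all of them add up to at most
  \<open>card I\<close> and the cost \<open>1/16 + 1/16 + 1/8 = 1/4\<close> does not grow with
  \<open>J\<close>. The other terms are summable as well, which gives a bound uniform in the number
  of shells.\<close>

lemma mid_frequency_bound:
  fixes \<psi> G :: "'i \<Rightarrow> real^'n \<Rightarrow> complex"
  assumes psi: "bessel I \<psi>" and G: "\<And>i. i \<in> I \<Longrightarrow> G i \<in> L2"
    and Phi: "bessel I (\<lambda>i \<xi>. complex_of_real (hw \<xi>) * G i \<xi>)" and v: "v \<in> L2" and K0: "K \<ge> 0"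
    and K: "(\<integral>\<^sup>+\<xi>. ennreal (ln (2 + norm \<xi>) * (cmod (fourier v \<xi>))\<^sup>2) \<partial>lebesgue) \<le> ennreal K"
  shows "cmod (\<Sum>j<J. \<Sum>i\<in>I. L2_inner (\<psi> i) (\<lambda>x. v x * ifourier1 (\<lambda>\<xi>. indicator (shell j) \<xi> * G i \<xi>) x))
    \<le> real (card I) / 4 + Cmid TYPE('n) * ((L2_norm v)\<^sup>2 + K)"
proof -
  let ?d = "CARD('n)" and ?W = "ball_vol TYPE('n) * 2 ^ CARD('n)"
  define \<Psi> where "\<Psi> = (\<lambda>i. fourier (\<psi> i))"
  have Psi: "bessel I \<Psi>" unfolding \<Psi>_def by (rule bessel_fourier[OF psi])
  \<comment> \<open>A Borel representative is needed for joint measurability of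
    \<open>g (\<eta> - \<xi>)\<close>.\<close>
  obtain g where g: "g \<in> borel_measurable borel" "AE \<xi> in lebesgue. fourier v \<xi> = g \<xi>"
    using lebesgue_ex_borel[OF fourier_measurable[OF v]] by blast
  have vm [measurable]: "v \<in> borel_measurable lebesgue" by (rule L2_measurable[OF v])
  have gK: "(\<integral>\<^sup>+\<theta>. ennreal (ln (2 + norm \<theta>) * (cmod (g \<theta>))\<^sup>2) \<partial>lborel) \<le> ennreal K"
  proof -
    have "(\<integral>\<^sup>+\<theta>. ennreal (ln (2 + norm \<theta>) * (cmod (g \<theta>))\<^sup>2) \<partial>lborel) = (\<integral>\<^sup>+\<theta>. ennreal (ln (2 + norm \<theta>) * (cmod (g \<theta>))\<^sup>2) \<partial>lebesgue)"
      by (simp add: nn_integral_completion)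
    also have "\<dots> = (\<integral>\<^sup>+\<xi>. ennreal (ln (2 + norm \<xi>) * (cmod (fourier v \<xi>))\<^sup>2) \<partial>lebesgue)"
      using g(2) by (intro nn_integral_cong_AE) (auto elim!: eventually_mono)
    finally show ?thesis using K by simp
  qed
  define a where "a j = (\<Sum>i\<in>I. \<integral>\<^sup>+\<xi>. indicator (shell j) \<xi> * ennreal ((cmod (\<Psi> i \<xi>))\<^sup>2) \<partial>lebesgue)" for j
  define b where "b j = (\<Sum>i\<in>I. \<integral>\<^sup>+\<xi>. indicator (shell j) \<xi> * ennreal ((cmod (complex_of_real (hw \<xi>) * G i \<xi>))\<^sup>2) \<partial>lebesgue)" for j
  define \<rho> where "\<rho> = sqrt (2 ^ ?d)"
  define m where "m j = (\<integral>\<^sup>+x. ennreal (if \<rho> ^ j < 8 * cmod (v x) then cmod (v x) * \<rho> ^ j else 0) \<partial>lebesgue)" for j :: nat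
  define H where "H j = ennreal (1 / (2 ^ j) ^ ?d) * (\<integral>\<^sup>+\<xi>. indicator (shell j) \<xi> * (\<integral>\<^sup>+\<eta>. indicator (- shell j) \<eta> * ennreal ((cmod (g (\<eta> - \<xi>)))\<^sup>2) \<partial>lborel) \<partial>lborel)" for j :: nat
  have one: "(\<Sum>i\<in>I. ennreal (cmod (L2_inner (\<psi> i) (\<lambda>x. v x * ifourier1 (\<lambda>\<xi>. indicator (shell j) \<xi> * G i \<xi>) x)))) \<le>
     (ennreal (1/16) * a j + ennreal (1/16) * b j + ennreal ?W * m j) + (ennreal (1/8) * b j + 2 * H j)" for j
  proof -
    define u where "u i = ifourier1 (\<lambda>\<xi>. indicator (shell j) \<xi> * G i \<xi>)" for i
    define p where "p i = ifourier1 (\<lambda>\<xi>. indicator (shell j) \<xi> * \<Psi> i \<xi>)" for i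
    define q where "q i = ifourier (\<lambda>\<xi>. indicator (- shell j) \<xi> * \<Psi> i \<xi>)" for i
    have t: "ennreal (cmod (L2_inner (\<psi> i) (\<lambda>x. v x * u i x))) \<le> (\<integral>\<^sup>+x. ennreal (cmod (p i x) * (cmod (v x) * cmod (u i x))) \<partial>lebesgue) + ennreal (cmod (L2_inner (q i) (\<lambda>x. v x * u i x)))" if i: "i \<in> I" for i
    proof -
      have P: "\<Psi> i \<in> L2" by (rule besselD(2)[OF Psi i])
      have iG: "integrable lebesgue (\<lambda>\<xi>. indicator (shell j) \<xi> * G i \<xi>)"
        by (rule integrable_indicator_L2[OF G[OF i] _ shell_subset_cball]) simp
      have iP: "integrable lebesgue (\<lambda>\<xi>. indicator (shell j) \<xi> * \<Psi> i \<xi>)"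
        by (rule integrable_indicator_L2[OF P _ shell_subset_cball]) simp
      have P1: "(\<lambda>\<xi>. indicator (shell j) \<xi> * \<Psi> i \<xi>) \<in> L2" "(\<lambda>\<xi>. indicator (- shell j) \<xi> * \<Psi> i \<xi>) \<in> L2"
        by (rule L2_indicator(1)[OF P], simp)+
      define f where "f = (\<lambda>x. v x * u i x)"
      have f: "f \<in> L2" unfolding f_def u_def by (rule L2_mult_ifourier1[OF v iG])
      have "L2_inner (\<psi> i) f = L2_inner (\<Psi> i) (fourier f)"
        unfolding \<Psi>_def by (rule fourier_inner[OF besselD(2)[OF psi i] f, symmetric])
      also have "\<Psi> i = (\<lambda>\<xi>. indicator (shell j) \<xi> * \<Psi> i \<xi> + indicator (- shell j) \<xi> * \<Psi> i \<xi>)"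
        by (rule ext) (simp add: indicator_def)
      also have "L2_inner \<dots> (fourier f) = L2_inner (\<lambda>\<xi>. indicator (shell j) \<xi> * \<Psi> i \<xi>) (fourier f) + L2_inner (\<lambda>\<xi>. indicator (- shell j) \<xi> * \<Psi> i \<xi>) (fourier f)"
        by (rule L2_inner_add_left[OF fourier_spec(1)[OF f] P1])
      also have "L2_inner (\<lambda>\<xi>. indicator (- shell j) \<xi> * \<Psi> i \<xi>) (fourier f) = L2_inner (q i) f"
        unfolding q_def by (rule ifourier_adjoint[OF P1(2) f, symmetric])
      also have "L2_inner (\<lambda>\<xi>. indicator (shell j) \<xi> * \<Psi> i \<xi>) (fourier f) = L2_inner (ifourier (\<lambda>\<xi>. indicator (shell j) \<xi> * \<Psi> i \<xi>)) f"
        by (rule ifourier_adjoint[OF P1(1) f, symmetric])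
      also have "\<dots> = L2_inner (p i) f"
        unfolding p_def using ifourier_eq_ifourier1[OF iP P1(1)] ifourier_L2[OF P1(1)] ifourier1_L2(1)[OF iP P1(1)] f
        by (intro L2_inner_cong_AE) (auto intro: L2_measurable)
      finally have "cmod (L2_inner (\<psi> i) f) \<le> cmod (L2_inner (p i) f) + cmod (L2_inner (q i) f)" by (simp add: norm_triangle_ineq)
      then have "ennreal (cmod (L2_inner (\<psi> i) f)) \<le> ennreal (cmod (L2_inner (p i) f)) + ennreal (cmod (L2_inner (q i) f))"
        by (simp flip: ennreal_plus add: ennreal_leI)
      also have "ennreal (cmod (L2_inner (p i) f)) \<le> (\<integral>\<^sup>+x. ennreal (cmod (p i x) * cmod (f x)) \<partial>lebesgue)"
        unfolding p_def by (rule ennreal_inner_le[OF ifourier1_L2(1)[OF iP P1(1)] f])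
      finally show ?thesis unfolding f_def by (simp add: norm_mult add_right_mono)
    qed
    have "(\<Sum>i\<in>I. ennreal (cmod (L2_inner (\<psi> i) (\<lambda>x. v x * u i x)))) \<le>
      (\<Sum>i\<in>I. (\<integral>\<^sup>+x. ennreal (cmod (p i x) * (cmod (v x) * cmod (u i x))) \<partial>lebesgue) + ennreal (cmod (L2_inner (q i) (\<lambda>x. v x * u i x))))"
      by (intro sum_mono t)
    also have "\<dots> = (\<Sum>i\<in>I. \<integral>\<^sup>+x. ennreal (cmod (p i x) * (cmod (v x) * cmod (u i x))) \<partial>lebesgue) + (\<Sum>i\<in>I. ennreal (cmod (L2_inner (q i) (\<lambda>x. v x * u i x))))"
      by (rule sum.distrib)
    also have "\<dots> \<le> (ennreal (1/16) * a j + ennreal (1/16) * b j + ennreal ?W * m j) + (ennreal (1/8) * b j + 2 * H j)"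
      unfolding a_def b_def m_def H_def \<rho>_def u_def p_def q_def
      by (rule add_mono[OF shell_diag[OF Psi G Phi v] shell_off_diag[OF Psi G Phi v g]])
    finally show ?thesis unfolding u_def .
  qed
  have sa: "(\<Sum>j<J. a j) \<le> ennreal (real (card I))"
  proof -
    have "(\<Sum>j<J. a j) = (\<Sum>i\<in>I. \<Sum>j<J. \<integral>\<^sup>+\<xi>. indicator (shell j) \<xi> * ennreal ((cmod (\<Psi> i \<xi>))\<^sup>2) \<partial>lebesgue)"
      unfolding a_def by (rule sum.swap)
    also have "\<dots> \<le> (\<Sum>i\<in>I. \<integral>\<^sup>+\<xi>. ennreal ((cmod (\<Psi> i \<xi>))\<^sup>2) \<partial>lebesgue)"
      using L2_measurable[OF besselD(2)[OF Psi]] by (intro sum_mono nn_integral_disjoint_family_le disjoint_shells) auto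
    also have "\<dots> \<le> ennreal (real (card I))" by (rule bessel_sum_norm[OF Psi])
    finally show ?thesis .
  qed
  have sb: "(\<Sum>j<J. b j) \<le> ennreal (real (card I))"
  proof -
    have "(\<Sum>j<J. b j) = (\<Sum>i\<in>I. \<Sum>j<J. \<integral>\<^sup>+\<xi>. indicator (shell j) \<xi> * ennreal ((cmod (complex_of_real (hw \<xi>) * G i \<xi>))\<^sup>2) \<partial>lebesgue)"
      unfolding b_def by (rule sum.swap)
    also have "\<dots> \<le> (\<Sum>i\<in>I. \<integral>\<^sup>+\<xi>. ennreal ((cmod (complex_of_real (hw \<xi>) * G i \<xi>))\<^sup>2) \<partial>lebesgue)"
    proof (intro sum_mono nn_integral_disjoint_family_le disjoint_shells)
      fix i assume i: "i \<in> I"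
      have "(\<lambda>\<xi>. complex_of_real (hw \<xi>) * G i \<xi>) \<in> borel_measurable lebesgue"
        using L2_measurable[OF besselD(2)[OF Phi i]] .
      then show "(\<lambda>\<xi>. ennreal ((cmod (complex_of_real (hw \<xi>) * G i \<xi>))\<^sup>2)) \<in> borel_measurable lebesgue" by simp
    qed simp
    also have "\<dots> \<le> ennreal (real (card I))" by (rule bessel_sum_norm[OF Phi])
    finally show ?thesis .
  qed
  have sm: "(\<Sum>j<J. m j) \<le> ennreal (32 * (L2_norm v)\<^sup>2)"
  proof -
    \<comment> \<open>A rational lower bound for \<open>sqrt 2\<close>, which makes
      \<open>\<rho> / (\<rho> - 1) \<le> 4\<close>; with the cut at \<open>8 |v|\<close> this yields
      32.\<close>
    have rho: "\<rho> \<ge> 4/3"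
    proof -
      have "(4/3::real)\<^sup>2 \<le> 2 ^ 1" by (simp add: power2_eq_square)
      also have "(2::real) ^ 1 \<le> 2 ^ ?d" by (intro power_increasing) (auto simp: Suc_leI)
      finally show ?thesis unfolding \<rho>_def by (rule real_le_rsqrt)
    qed
    have "(\<Sum>j<J. m j) = (\<integral>\<^sup>+x. (\<Sum>j<J. ennreal (if \<rho> ^ j < 8 * cmod (v x) then cmod (v x) * \<rho> ^ j else 0)) \<partial>lebesgue)"
      unfolding m_def by (rule nn_integral_sum[symmetric]) measurable
    also have "\<dots> \<le> (\<integral>\<^sup>+x. 32 * ennreal ((cmod (v x))\<^sup>2) \<partial>lebesgue)"
    proof (rule nn_integral_mono)
      fix x
      have "(\<Sum>j<J. if \<rho> ^ j < 8 * cmod (v x) then cmod (v x) * \<rho> ^ j else 0) = cmod (v x) * (\<Sum>j<J. if \<rho> ^ j < 8 * cmod (v x) then \<rho> ^ j else 0)"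
        unfolding sum_distrib_left by (intro sum.cong) auto
      also have "\<dots> \<le> cmod (v x) * (\<rho> / (\<rho> - 1) * (8 * cmod (v x)))"
        using rho by (intro mult_left_mono sum_geometric_below) auto
      also have "\<dots> \<le> cmod (v x) * (4 * (8 * cmod (v x)))"
        using rho by (intro mult_left_mono mult_right_mono) (auto simp: field_simps)
      finally have "(\<Sum>j<J. if \<rho> ^ j < 8 * cmod (v x) then cmod (v x) * \<rho> ^ j else 0) \<le> 32 * (cmod (v x))\<^sup>2" by (simp add: power2_eq_square mult_ac)
      then have "ennreal (\<Sum>j<J. if \<rho> ^ j < 8 * cmod (v x) then cmod (v x) * \<rho> ^ j else 0) \<le> ennreal (32 * (cmod (v x))\<^sup>2)" by (rule ennreal_leI)
      also have "\<dots> = 32 * ennreal ((cmod (v x))\<^sup>2)" by (simp add: ennreal_mult')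
      also have "ennreal (\<Sum>j<J. if \<rho> ^ j < 8 * cmod (v x) then cmod (v x) * \<rho> ^ j else 0) = (\<Sum>j<J. ennreal (if \<rho> ^ j < 8 * cmod (v x) then cmod (v x) * \<rho> ^ j else 0))"
        using rho by (intro sum_ennreal[symmetric]) auto
      finally show "(\<Sum>j<J. ennreal (if \<rho> ^ j < 8 * cmod (v x) then cmod (v x) * \<rho> ^ j else 0)) \<le> 32 * ennreal ((cmod (v x))\<^sup>2)" .
    qed
    also have "\<dots> = 32 * ennreal ((L2_norm v)\<^sup>2)" unfolding L2_norm_nn[OF v] by (rule nn_integral_cmult) simp
    finally show ?thesis by (simp add: ennreal_mult')
  qed
  have sH: "(\<Sum>j<J. H j) \<le> ennreal (16 * real ?d * ?W * K)"
  proof -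
    have "(\<Sum>j<J. H j) \<le> ennreal (16 * real ?d * ball_vol TYPE('n) * 2 ^ ?d) * (\<integral>\<^sup>+\<theta>. ennreal (ln (2 + norm \<theta>) * (cmod (g \<theta>))\<^sup>2) \<partial>lborel)"
      unfolding H_def by (rule off_diagonal_HS[OF g(1)])
    also have "\<dots> \<le> ennreal (16 * real ?d * ball_vol TYPE('n) * 2 ^ ?d) * ennreal K" by (intro mult_left_mono gK) simp
    also have "\<dots> = ennreal (16 * real ?d * ball_vol TYPE('n) * 2 ^ ?d * K)" by (rule ennreal_mult'[symmetric]) simp
    finally show ?thesis by (simp add: mult_ac)
  qed
  let ?c = "real (card I)"
  have "ennreal (cmod (\<Sum>j<J. \<Sum>i\<in>I. L2_inner (\<psi> i) (\<lambda>x. v x * ifourier1 (\<lambda>\<xi>. indicator (shell j) \<xi> * G i \<xi>) x))) \<le>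
      (\<Sum>j<J. \<Sum>i\<in>I. ennreal (cmod (L2_inner (\<psi> i) (\<lambda>x. v x * ifourier1 (\<lambda>\<xi>. indicator (shell j) \<xi> * G i \<xi>) x))))"
    by (rule order_trans[OF ennreal_cmod_sum_le]) (intro sum_mono ennreal_cmod_sum_le)
  also have "\<dots> \<le> (\<Sum>j<J. (ennreal (1/16) * a j + ennreal (1/16) * b j + ennreal ?W * m j) + (ennreal (1/8) * b j + 2 * H j))"
    by (intro sum_mono one)
  also have "\<dots> = (ennreal (1/16) * (\<Sum>j<J. a j) + ennreal (1/16) * (\<Sum>j<J. b j) + ennreal ?W * (\<Sum>j<J. m j)) + (ennreal (1/8) * (\<Sum>j<J. b j) + 2 * (\<Sum>j<J. H j))"
    by (simp add: sum.distrib sum_distrib_left)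
  also have "\<dots> \<le> (ennreal (1/16) * ennreal ?c + ennreal (1/16) * ennreal ?c + ennreal ?W * ennreal (32 * (L2_norm v)\<^sup>2)) + (ennreal (1/8) * ennreal ?c + 2 * ennreal (16 * real ?d * ?W * K))"
    by (intro add_mono mult_left_mono sa sb sm sH) auto
  also have "\<dots> = ennreal (1/16 * ?c + 1/16 * ?c + ?W * (32 * (L2_norm v)\<^sup>2) + (1/8 * ?c + 2 * (16 * real ?d * ?W * K)))"
  proof -
    have e: "ennreal (1/16) * ennreal ?c = ennreal (1/16 * ?c)" "ennreal (1/8) * ennreal ?c = ennreal (1/8 * ?c)"
      "ennreal ?W * ennreal (32 * (L2_norm v)\<^sup>2) = ennreal (?W * (32 * (L2_norm v)\<^sup>2))"
      "2 * ennreal (16 * real ?d * ?W * K) = ennreal (2 * (16 * real ?d * ?W * K))"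
      using ennreal_mult'[of "1/16" ?c] ennreal_mult'[of "1/8" ?c] ennreal_mult'[of ?W "32 * (L2_norm v)\<^sup>2"] ennreal_mult'[of 2 "16 * real ?d * ?W * K"] by simp_all
    have n: "0 \<le> 1/16 * ?c" "0 \<le> ?W * (32 * (L2_norm v)\<^sup>2)" "0 \<le> 1/8 * ?c" "0 \<le> 2 * (16 * real ?d * ?W * K)" using K0 by simp_all
    show ?thesis unfolding e by (simp only: ennreal_plus[symmetric] n add_nonneg_nonneg)
  qed
  finally have "cmod (\<Sum>j<J. \<Sum>i\<in>I. L2_inner (\<psi> i) (\<lambda>x. v x * ifourier1 (\<lambda>\<xi>. indicator (shell j) \<xi> * G i \<xi>) x)) \<le> 
     1/16 * ?c + 1/16 * ?c + ?W * (32 * (L2_norm v)\<^sup>2) + (1/8 * ?c + 2 * (16 * real ?d * ?W * K))"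
    using K0 by (subst (asm) ennreal_le_iff) (auto intro!: add_nonneg_nonneg mult_nonneg_nonneg)
  also have "\<dots> = ?c / 4 + 32 * ?W * (L2_norm v)\<^sup>2 + 32 * real ?d * ?W * K" by simp
  also have "\<dots> \<le> ?c / 4 + Cmid TYPE('n) * (L2_norm v)\<^sup>2 + Cmid TYPE('n) * K"
  proof -
    have d1: "1 \<le> real ?d" by (simp add: Suc_leI)
    have "1 * (32 * ?W * (L2_norm v)\<^sup>2) \<le> real ?d * (32 * ?W * (L2_norm v)\<^sup>2)" by (rule mult_right_mono[OF d1]) simp
    then show ?thesis by (simp add: Cmid_def mult_ac)
  qed
  finally show ?thesis by (simp add: distrib_left)
qed

text \<open>At fixed \<open>x\<close>, Bessel's inequality with the kernel
  \<open>(cis (x \<bullet> \<xi>) - 1) / hw \<xi>\<close> on the unit ball bounds the sum of the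
  squares \<open>|u_i(x)|^2\<close> by a multiple of \<open>ln (2 + norm x)\<close>. Integration
  against \<open>|v|^2\<close> then produces the moment in position.\<close>

lemma low_frequency_bound:
  fixes \<psi> G :: "'i \<Rightarrow> real^'n \<Rightarrow> complex"
  assumes psi: "bessel I \<psi>" and G: "\<And>i. i \<in> I \<Longrightarrow> G i \<in> L2"
    and Phi: "bessel I (\<lambda>i \<xi>. complex_of_real (hw \<xi>) * G i \<xi>)" and v: "v \<in> L2" and K0: "K \<ge> 0"
    and zero: "\<And>i. i \<in> I \<Longrightarrow> (LINT \<xi>|lebesgue. indicator (ball 0 1) \<xi> * G i \<xi>) = 0"
    and K: "(\<integral>\<^sup>+x. ennreal (ln (2 + norm x) * (cmod (v x))\<^sup>2) \<partial>lebesgue) \<le> ennreal K"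
  shows "cmod (\<Sum>i\<in>I. L2_inner (\<psi> i) (\<lambda>x. v x * ifourier1 (\<lambda>\<xi>. indicator (ball 0 1) \<xi> * G i \<xi>) x))
    \<le> real (card I) / 8 + 2 * Cmid TYPE('n) * K"
proof -
  let ?d = "CARD('n)"
  define W where "W = 32 * ball_vol TYPE('n) * 2 ^ ?d"
  have W: "W \<ge> 0" by (simp add: W_def)
  define u where "u i = ifourier1 (\<lambda>\<xi>. indicator (ball 0 1) \<xi> * G i \<xi>)" for i
  have iG: "integrable lebesgue (\<lambda>\<xi>. indicator (ball 0 1) \<xi> * G i \<xi>)" if "i \<in> I" for i
    by (rule integrable_indicator_L2[OF G[OF that] _ ball_subset_cball]) simp
  have um: "u i \<in> borel_measurable lebesgue" if "i \<in> I" for i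
    unfolding u_def using ifourier1_measurable[OF iG[OF that]] by simp
  have vm [measurable]: "v \<in> borel_measurable lebesgue" by (rule L2_measurable[OF v])
  have psi2: "\<psi> i \<in> L2" if "i \<in> I" for i by (rule besselD(2)[OF psi that])
  have U: "(\<Sum>i\<in>I. (cmod (u i x))\<^sup>2) \<le> W * ln (2 + norm x)" for x
  proof -
    define f where "f \<xi> = complex_of_real (fconst TYPE('n) / hw \<xi>) * indicator (ball 0 1) \<xi> * (cis (x \<bullet> \<xi>) - 1)" for \<xi>
    have [measurable]: "ball 0 1 \<in> sets (borel :: (real^'n) measure)" by simp
    have "f \<in> borel_measurable borel" unfolding f_def by measurable
    then have fm: "f \<in> borel_measurable lebesgue" by simp
    have "(\<integral>\<^sup>+\<xi>. ennreal ((cmod (f \<xi>))\<^sup>2) \<partial>lebesgue) \<le> (\<integral>\<^sup>+\<xi>. indicator (ball 0 1) \<xi> * ennreal ((cmod (cis (x \<bullet> \<xi>) - 1))\<^sup>2 / norm \<xi> ^ ?d) \<partial>lebesgue)"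
    proof (rule nn_integral_mono)
      fix \<xi> :: "real^'n"
      have c: "(fconst TYPE('n))\<^sup>2 \<le> 1" using fconst_le_1[where 'n='n] by (simp add: power_le_one)
      have "(cmod (f \<xi>))\<^sup>2 = (fconst TYPE('n))\<^sup>2 * (indicator (ball 0 1) \<xi> * ((cmod (cis (x \<bullet> \<xi>) - 1))\<^sup>2 / norm \<xi> ^ ?d))"
        by (simp add: f_def norm_mult norm_divide power_mult_distrib power_divide hw_sq indicator_def)
      also have "\<dots> \<le> 1 * (indicator (ball 0 1) \<xi> * ((cmod (cis (x \<bullet> \<xi>) - 1))\<^sup>2 / norm \<xi> ^ ?d))"
        by (intro mult_right_mono c) auto
      finally show "ennreal ((cmod (f \<xi>))\<^sup>2) \<le> indicator (ball 0 1) \<xi> * ennreal ((cmod (cis (x \<bullet> \<xi>) - 1))\<^sup>2 / norm \<xi> ^ ?d)"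
        by (auto simp: indicator_def split: if_splits intro: ennreal_leI)
    qed
    also have "\<dots> = (\<integral>\<^sup>+\<xi>. indicator (ball 0 1) \<xi> * ennreal ((cmod (cis (x \<bullet> \<xi>) - 1))\<^sup>2 / norm \<xi> ^ ?d) \<partial>lborel)"
      by (rule nn_integral_completion)
    also have "\<dots> \<le> ennreal (W * ln (2 + norm x))" unfolding W_def by (rule infrared_integral)
    finally have le: "(\<integral>\<^sup>+\<xi>. ennreal ((cmod (f \<xi>))\<^sup>2) \<partial>lebesgue) \<le> ennreal (W * ln (2 + norm x))" .
    have f2: "f \<in> L2" using le fm by (auto simp: L2_iff intro: le_less_trans)
    have fn: "(L2_norm f)\<^sup>2 \<le> W * ln (2 + norm x)" using le W unfolding L2_norm_nn[OF f2, symmetric] by simp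
    have "u i x = (LINT \<xi>|lebesgue. f \<xi> * (complex_of_real (hw \<xi>) * G i \<xi>))" if i: "i \<in> I" for i
    proof -
      have "u i x = complex_of_real (fconst TYPE('n)) * ((LINT \<xi>|lebesgue. cis (x \<bullet> \<xi>) * (indicator (ball 0 1) \<xi> * G i \<xi>)) - (LINT \<xi>|lebesgue. indicator (ball 0 1) \<xi> * G i \<xi>))"
        unfolding u_def ifourier1_def zero[OF i] by simp
      also have "(LINT \<xi>|lebesgue. cis (x \<bullet> \<xi>) * (indicator (ball 0 1) \<xi> * G i \<xi>)) - (LINT \<xi>|lebesgue. indicator (ball 0 1) \<xi> * G i \<xi>) =
        (LINT \<xi>|lebesgue. cis (x \<bullet> \<xi>) * (indicator (ball 0 1) \<xi> * G i \<xi>) - indicator (ball 0 1) \<xi> * G i \<xi>)"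
        using integrable_cis_mult(2)[OF iG[OF i], of x] iG[OF i] by (intro Bochner_Integration.integral_diff[symmetric]) (simp_all add: inner_commute)
      also have "complex_of_real (fconst TYPE('n)) * \<dots> = (LINT \<xi>|lebesgue. complex_of_real (fconst TYPE('n)) * (cis (x \<bullet> \<xi>) * (indicator (ball 0 1) \<xi> * G i \<xi>) - indicator (ball 0 1) \<xi> * G i \<xi>))"
        by simp
      also have "\<dots> = (LINT \<xi>|lebesgue. f \<xi> * (complex_of_real (hw \<xi>) * G i \<xi>))"
      proof (intro Bochner_Integration.integral_cong refl)
        fix \<xi> :: "real^'n"
        show "complex_of_real (fconst TYPE('n)) * (cis (x \<bullet> \<xi>) * (indicator (ball 0 1) \<xi> * G i \<xi>) - indicator (ball 0 1) \<xi> * G i \<xi>) = f \<xi> * (complex_of_real (hw \<xi>) * G i \<xi>)"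
        \<comment> \<open>At the origin \<open>hw\<close> vanishes and cannot be cancelled, but both
          sides are 0 there.\<close>
        proof (cases "\<xi> = 0")
          case False
          then have "hw \<xi> \<noteq> 0" by (simp add: hw_def)
          then have "f \<xi> * (complex_of_real (hw \<xi>) * G i \<xi>) = complex_of_real (fconst TYPE('n)) * (indicator (ball 0 1) \<xi> * (cis (x \<bullet> \<xi>) - 1) * G i \<xi>)"
            by (simp add: f_def)
          then show ?thesis by (simp only:) (simp add: algebra_simps)
        qed (simp add: f_def)
      qed
      finally show ?thesis .
    qed
    then have "(\<Sum>i\<in>I. (cmod (u i x))\<^sup>2) = (\<Sum>i\<in>I. (cmod (LINT \<xi>|lebesgue. f \<xi> * (complex_of_real (hw \<xi>) * G i \<xi>)))\<^sup>2)" by (intro sum.cong) auto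
    then show ?thesis using order_trans[OF bessel_integral[OF Phi f2] fn] by simp
  qed
  have psim: "\<psi> i \<in> borel_measurable lebesgue" if "i \<in> I" for i by (rule L2_measurable[OF psi2[OF that]])
  have "ennreal (cmod (\<Sum>i\<in>I. L2_inner (\<psi> i) (\<lambda>x. v x * u i x))) \<le> (\<Sum>i\<in>I. ennreal (cmod (L2_inner (\<psi> i) (\<lambda>x. v x * u i x))))"
    by (rule ennreal_cmod_sum_le)
  also have "\<dots> \<le> (\<Sum>i\<in>I. \<integral>\<^sup>+x. ennreal (cmod (\<psi> i x) * cmod (v x * u i x)) \<partial>lebesgue)"
    unfolding u_def by (intro sum_mono ennreal_inner_le psi2 L2_mult_ifourier1[OF v iG])
  also have "\<dots> \<le> (\<Sum>i\<in>I. \<integral>\<^sup>+x. ennreal (1/8) * ennreal ((cmod (\<psi> i x))\<^sup>2) + 2 * ennreal ((cmod (v x))\<^sup>2 * (cmod (u i x))\<^sup>2) \<partial>lebesgue)"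
  proof (intro sum_mono nn_integral_mono)
    fix i x
    \<comment> \<open>The completed square that leaves only \<open>1/8\<close> of the squared norm
      of each \<open>\<psi> i\<close> and pays with the factor 2 on the potential side.\<close>
    have "0 \<le> (cmod (\<psi> i x) / 4 - cmod (v x) * cmod (u i x))\<^sup>2 * 2" by simp
    then have "cmod (\<psi> i x) * cmod (v x * u i x) \<le> 1/8 * (cmod (\<psi> i x))\<^sup>2 + 2 * ((cmod (v x))\<^sup>2 * (cmod (u i x))\<^sup>2)"
      by (simp add: norm_mult power2_eq_square algebra_simps)
    then have "ennreal (cmod (\<psi> i x) * cmod (v x * u i x)) \<le> ennreal (1/8 * (cmod (\<psi> i x))\<^sup>2 + 2 * ((cmod (v x))\<^sup>2 * (cmod (u i x))\<^sup>2))" by (rule ennreal_leI)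
    also have "\<dots> = ennreal (1/8 * (cmod (\<psi> i x))\<^sup>2) + ennreal (2 * ((cmod (v x))\<^sup>2 * (cmod (u i x))\<^sup>2))" by (rule ennreal_plus) auto
    also have "\<dots> = ennreal (1/8) * ennreal ((cmod (\<psi> i x))\<^sup>2) + 2 * ennreal ((cmod (v x))\<^sup>2 * (cmod (u i x))\<^sup>2)"
      using ennreal_mult'[of "1/8" "(cmod (\<psi> i x))\<^sup>2"] ennreal_mult'[of 2 "(cmod (v x))\<^sup>2 * (cmod (u i x))\<^sup>2"] by simp
    finally show "ennreal (cmod (\<psi> i x) * cmod (v x * u i x)) \<le> ennreal (1/8) * ennreal ((cmod (\<psi> i x))\<^sup>2) + 2 * ennreal ((cmod (v x))\<^sup>2 * (cmod (u i x))\<^sup>2)" .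
  qed
  also have "\<dots> = ennreal (1/8) * (\<Sum>i\<in>I. \<integral>\<^sup>+x. ennreal ((cmod (\<psi> i x))\<^sup>2) \<partial>lebesgue) + 2 * (\<Sum>i\<in>I. \<integral>\<^sup>+x. ennreal ((cmod (v x))\<^sup>2 * (cmod (u i x))\<^sup>2) \<partial>lebesgue)"
    unfolding sum_distrib_left sum.distrib[symmetric]
  proof (rule sum.cong[OF refl])
    fix i assume i: "i \<in> I"
    note [measurable] = psim[OF i] um[OF i]
    show "(\<integral>\<^sup>+x. ennreal (1/8) * ennreal ((cmod (\<psi> i x))\<^sup>2) + 2 * ennreal ((cmod (v x))\<^sup>2 * (cmod (u i x))\<^sup>2) \<partial>lebesgue) =
      ennreal (1/8) * (\<integral>\<^sup>+x. ennreal ((cmod (\<psi> i x))\<^sup>2) \<partial>lebesgue) + 2 * (\<integral>\<^sup>+x. ennreal ((cmod (v x))\<^sup>2 * (cmod (u i x))\<^sup>2) \<partial>lebesgue)"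
      by (simp add: nn_integral_add nn_integral_cmult)
  qed
  also have "\<dots> \<le> ennreal (1/8) * ennreal (real (card I)) + 2 * ennreal (W * K)"
  proof (intro add_mono mult_left_mono bessel_sum_norm psi)
    have "(\<Sum>i\<in>I. \<integral>\<^sup>+x. ennreal ((cmod (v x))\<^sup>2 * (cmod (u i x))\<^sup>2) \<partial>lebesgue) = (\<integral>\<^sup>+x. (\<Sum>i\<in>I. ennreal ((cmod (v x))\<^sup>2 * (cmod (u i x))\<^sup>2)) \<partial>lebesgue)"
      by (rule nn_integral_sum[symmetric], use um in measurable)
    also have "\<dots> \<le> (\<integral>\<^sup>+x. ennreal W * ennreal (ln (2 + norm x) * (cmod (v x))\<^sup>2) \<partial>lebesgue)"
    proof (rule nn_integral_mono)
      fix x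
      have "(\<Sum>i\<in>I. ennreal ((cmod (v x))\<^sup>2 * (cmod (u i x))\<^sup>2)) = ennreal ((cmod (v x))\<^sup>2 * (\<Sum>i\<in>I. (cmod (u i x))\<^sup>2))"
        by (simp add: sum_ennreal sum_distrib_left)
      also have "\<dots> \<le> ennreal ((cmod (v x))\<^sup>2 * (W * ln (2 + norm x)))" by (intro ennreal_leI mult_left_mono U) auto
      also have "\<dots> = ennreal W * ennreal (ln (2 + norm x) * (cmod (v x))\<^sup>2)" using W by (simp add: ennreal_mult'[symmetric] mult_ac)
      finally show "(\<Sum>i\<in>I. ennreal ((cmod (v x))\<^sup>2 * (cmod (u i x))\<^sup>2)) \<le> ennreal W * ennreal (ln (2 + norm x) * (cmod (v x))\<^sup>2)" .
    qed
    also have "\<dots> = ennreal W * (\<integral>\<^sup>+x. ennreal (ln (2 + norm x) * (cmod (v x))\<^sup>2) \<partial>lebesgue)"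
    proof (rule nn_integral_cmult)
      have "(\<lambda>x::real^'n. ln (2 + norm x)) \<in> borel_measurable lebesgue" by (intro lebesgue_measurable_lborel) measurable
      then show "(\<lambda>x. ennreal (ln (2 + norm x) * (cmod (v x))\<^sup>2)) \<in> borel_measurable lebesgue" by measurable
    qed
    also have "\<dots> \<le> ennreal W * ennreal K" by (intro mult_left_mono K) simp
    also have "\<dots> = ennreal (W * K)" by (rule ennreal_mult'[symmetric]) (rule W)
    finally show "(\<Sum>i\<in>I. \<integral>\<^sup>+x. ennreal ((cmod (v x))\<^sup>2 * (cmod (u i x))\<^sup>2) \<partial>lebesgue) \<le> ennreal (W * K)" .
  qed auto
  also have "\<dots> = ennreal (real (card I) / 8 + 2 * (W * K))"
    using W K0 ennreal_mult'[of "1/8" "real (card I)"] ennreal_mult'[of 2 "W * K"] by (subst ennreal_plus) auto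
  finally have "cmod (\<Sum>i\<in>I. L2_inner (\<psi> i) (\<lambda>x. v x * u i x)) \<le> real (card I) / 8 + 2 * (W * K)"
    using W K0 by (subst (asm) ennreal_le_iff) auto
  also have "W * K \<le> Cmid TYPE('n) * K"
  proof (rule mult_right_mono[OF _ K0])
    have "1 \<le> real ?d" by (simp add: Suc_leI)
    from mult_right_mono[OF this W] show "W \<le> Cmid TYPE('n)" by (simp add: W_def Cmid_def mult_ac)
  qed
  finally show ?thesis unfolding u_def by (simp add: mult_ac)
qed

section \<open>Removing the frequency cutoff\<close>

definition band_limit :: "(real^'n \<Rightarrow> complex) \<Rightarrow> nat \<Rightarrow> real^'n \<Rightarrow> complex" where
  "band_limit G J = ifourier1 (\<lambda>\<xi>. indicator (ball 0 (2 ^ J)) \<xi> * G \<xi>)"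

lemma ifourier1_add:
  fixes f g :: "real^'n \<Rightarrow> complex"
  assumes "integrable lebesgue f" "integrable lebesgue g"
  shows "ifourier1 (\<lambda>\<xi>. f \<xi> + g \<xi>) x = ifourier1 f x + ifourier1 g x"
proof -
  have "(LINT \<xi>|lebesgue. cis (x \<bullet> \<xi>) * (f \<xi> + g \<xi>)) = (LINT \<xi>|lebesgue. cis (x \<bullet> \<xi>) * f \<xi> + cis (x \<bullet> \<xi>) * g \<xi>)"
    by (simp add: distrib_left)
  also have "\<dots> = (LINT \<xi>|lebesgue. cis (x \<bullet> \<xi>) * f \<xi>) + (LINT \<xi>|lebesgue. cis (x \<bullet> \<xi>) * g \<xi>)"
    using integrable_cis_mult(2)[OF assms(1), of x] integrable_cis_mult(2)[OF assms(2), of x]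
    by (intro Bochner_Integration.integral_add) (simp_all add: inner_commute)
  finally show ?thesis unfolding ifourier1_def by (simp add: distrib_left)
qed

lemma ifourier1_scale: "ifourier1 (\<lambda>\<xi>. c * f \<xi>) x = c * ifourier1 f x"
  unfolding ifourier1_def by (simp add: mult.left_commute)

lemma integrable_ball_L2:
  fixes G :: "real^'n \<Rightarrow> complex"
  assumes "G \<in> L2" shows "integrable lebesgue (\<lambda>\<xi>. indicator (ball 0 r) \<xi> * G \<xi>)"
  by (rule integrable_indicator_L2[OF assms _ ball_subset_cball]) simp

lemma integrable_shell_L2:
  fixes G :: "real^'n \<Rightarrow> complex"
  assumes "G \<in> L2" shows "integrable lebesgue (\<lambda>\<xi>. indicator (shell j) \<xi> * G \<xi>)"
  by (rule integrable_indicator_L2[OF assms _ shell_subset_cball]) simp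

lemma band_limit_decomp:
  fixes G :: "real^'n \<Rightarrow> complex"
  assumes G: "G \<in> L2"
  shows "band_limit G J x = ifourier1 (\<lambda>\<xi>. indicator (ball 0 1) \<xi> * G \<xi>) x + (\<Sum>j<J. ifourier1 (\<lambda>\<xi>. indicator (shell j) \<xi> * G \<xi>) x)"
proof (induction J)
  case 0 then show ?case by (simp add: band_limit_def)
next
  case (Suc J)
  have "(\<lambda>\<xi>. indicator (ball 0 (2 ^ Suc J)) \<xi> * G \<xi>) = (\<lambda>\<xi>. indicator (ball 0 (2 ^ J)) \<xi> * G \<xi> + indicator (shell J) \<xi> * G \<xi>)"
  proof
    fix \<xi> :: "real^'n"
    have p: "(0::real) < 2 ^ J" by simp
    show "indicator (ball 0 (2 ^ Suc J)) \<xi> * G \<xi> = indicator (ball 0 (2 ^ J)) \<xi> * G \<xi> + indicator (shell J) \<xi> * G \<xi>"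
    proof (cases "norm \<xi> < 2 ^ J")
      case True
      then have "norm \<xi> < 2 * 2 ^ J" using p by linarith
      then show ?thesis using True by (simp add: indicator_def annulus_def)
    qed (simp add: indicator_def annulus_def)
  qed
  then have "band_limit G (Suc J) x = band_limit G J x + ifourier1 (\<lambda>\<xi>. indicator (shell J) \<xi> * G \<xi>) x"
    unfolding band_limit_def by (simp only: ifourier1_add[OF integrable_ball_L2[OF G] integrable_shell_L2[OF G]])
  then show ?case by (simp add: Suc)
qed

text \<open>The shares \<open>1/8\<close> and \<open>1/4\<close> of \<open>card I\<close> are
  rounded up to \<open>1/2\<close>; any factor below 1 would allow absorption. Two multiples of
  \<open>K\<close> come from the low frequencies and one from the shells.\<close>

lemma band_limited_form_bound:
  fixes \<psi> G :: "'i \<Rightarrow> real^'n \<Rightarrow> complex"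
  assumes psi: "bessel I \<psi>" and G: "\<And>i. i \<in> I \<Longrightarrow> G i \<in> L2"
    and Phi: "bessel I (\<lambda>i \<xi>. complex_of_real (hw \<xi>) * G i \<xi>)" and v: "v \<in> L2" and K0: "K \<ge> 0"
    and zero: "\<And>i. i \<in> I \<Longrightarrow> (LINT \<xi>|lebesgue. indicator (ball 0 1) \<xi> * G i \<xi>) = 0"
    and Kx: "(\<integral>\<^sup>+x. ennreal (ln (2 + norm x) * (cmod (v x))\<^sup>2) \<partial>lebesgue) \<le> ennreal K"
    and K: "(\<integral>\<^sup>+\<xi>. ennreal (ln (2 + norm \<xi>) * (cmod (fourier v \<xi>))\<^sup>2) \<partial>lebesgue) \<le> ennreal K"
  shows "cmod (\<Sum>i\<in>I. L2_inner (\<psi> i) (\<lambda>x. v x * band_limit (G i) J x))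
    \<le> real (card I) / 2 + Cmid TYPE('n) * ((L2_norm v)\<^sup>2 + 3 * K)"
proof -
  define l where "l i = (\<lambda>x. v x * ifourier1 (\<lambda>\<xi>. indicator (ball 0 1) \<xi> * G i \<xi>) x)" for i
  define u where "u j i = (\<lambda>x. v x * ifourier1 (\<lambda>\<xi>. indicator (shell j) \<xi> * G i \<xi>) x)" for j i
  have l2: "l i \<in> L2" and u2: "u j i \<in> L2" if "i \<in> I" for i j
    unfolding l_def u_def
    by (rule L2_mult_ifourier1[OF v integrable_ball_L2[OF G[OF that]]], rule L2_mult_ifourier1[OF v integrable_shell_L2[OF G[OF that]]])
  have "L2_inner (\<psi> i) (\<lambda>x. v x * band_limit (G i) J x) = L2_inner (\<psi> i) (l i) + (\<Sum>j<J. L2_inner (\<psi> i) (u j i))" if i: "i \<in> I" for i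
  proof -
    have p: "\<psi> i \<in> L2" by (rule besselD(2)[OF psi i])
    have "(\<lambda>x. v x * band_limit (G i) J x) = (\<lambda>x. l i x + (\<Sum>j<J. u j i x))"
      by (rule ext) (simp add: band_limit_decomp[OF G[OF i]] l_def u_def distrib_left sum_distrib_left)
    then show ?thesis using p l2[OF i] u2[OF i] by (simp add: L2_inner_add_right L2_inner_sum_right L2_sum)
  qed
  then have "(\<Sum>i\<in>I. L2_inner (\<psi> i) (\<lambda>x. v x * band_limit (G i) J x)) = (\<Sum>i\<in>I. L2_inner (\<psi> i) (l i)) + (\<Sum>i\<in>I. \<Sum>j<J. L2_inner (\<psi> i) (u j i))"
    by (simp add: sum.distrib)
  also have "(\<Sum>i\<in>I. \<Sum>j<J. L2_inner (\<psi> i) (u j i)) = (\<Sum>j<J. \<Sum>i\<in>I. L2_inner (\<psi> i) (u j i))" by (rule sum.swap)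
  finally have e: "(\<Sum>i\<in>I. L2_inner (\<psi> i) (\<lambda>x. v x * band_limit (G i) J x)) = (\<Sum>i\<in>I. L2_inner (\<psi> i) (l i)) + (\<Sum>j<J. \<Sum>i\<in>I. L2_inner (\<psi> i) (u j i))" .
  have 1: "cmod (\<Sum>i\<in>I. L2_inner (\<psi> i) (l i)) \<le> real (card I) / 8 + 2 * Cmid TYPE('n) * K"
    unfolding l_def by (rule low_frequency_bound[OF psi G Phi v K0 zero Kx])
  have 2: "cmod (\<Sum>j<J. \<Sum>i\<in>I. L2_inner (\<psi> i) (u j i)) \<le> real (card I) / 4 + Cmid TYPE('n) * ((L2_norm v)\<^sup>2 + K)"
    unfolding u_def by (rule mid_frequency_bound[OF psi G Phi v K0 K])
  have "cmod (\<Sum>i\<in>I. L2_inner (\<psi> i) (\<lambda>x. v x * band_limit (G i) J x)) \<le> cmod (\<Sum>i\<in>I. L2_inner (\<psi> i) (l i)) + cmod (\<Sum>j<J. \<Sum>i\<in>I. L2_inner (\<psi> i) (u j i))"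
    unfolding e by (rule norm_triangle_ineq)
  then show ?thesis using 1 2 by (simp add: algebra_simps)
qed

lemma bessel_single:
  fixes f :: "real^'n \<Rightarrow> complex"
  assumes f: "f \<in> L2" "L2_norm f \<le> 1"
  shows "bessel {()} (\<lambda>_. f)"
proof -
  have "(cmod (L2_inner f g))\<^sup>2 \<le> (L2_norm g)\<^sup>2" if g: "g \<in> L2" for g
  proof (rule power_mono)
    show "cmod (L2_inner f g) \<le> L2_norm g"
      using L2_Cauchy_Schwarz[OF f(1) g] mult_right_mono[OF f(2), of "L2_norm g"] by simp
  qed simp
  then show ?thesis using f by (simp add: bessel_def)
qed

text \<open>Duality with one-element families: \<open>\<psi>\<close> is the normalised difference
  itself, and \<open>G'\<close> is the part of \<open>G\<close> beyond \<open>2^M\<close> divided by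
  \<open>c\<close>, so that its weighted norm is at most 1. Only the shells from \<open>M\<close> up
  to \<open>J\<close> see \<open>G'\<close>, and there \<open>mid_frequency_bound\<close>
  applies.\<close>

lemma band_difference_bound:
  fixes v G :: "real^'n \<Rightarrow> complex"
  assumes G: "G \<in> L2" and phi: "(\<lambda>\<xi>. complex_of_real (hw \<xi>) * G \<xi>) \<in> L2" and v: "v \<in> L2" and K0: "K \<ge> 0"
    and K: "(\<integral>\<^sup>+\<xi>. ennreal (ln (2 + norm \<xi>) * (cmod (fourier v \<xi>))\<^sup>2) \<partial>lebesgue) \<le> ennreal K"
    and c: "c > 0" "L2_norm (\<lambda>\<xi>. indicator (- ball 0 (2 ^ M)) \<xi> * (complex_of_real (hw \<xi>) * G \<xi>)) \<le> c" and MJ: "M \<le> J"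
  shows "L2_norm (\<lambda>x. v x * band_limit G J x - v x * band_limit G M x) \<le> (1 / 4 + Cmid TYPE('n) * ((L2_norm v)\<^sup>2 + K)) * c"
proof -
  define f where "f = (\<lambda>x. v x * band_limit G J x - v x * band_limit G M x)"
  have bl: "(\<lambda>x. v x * band_limit G J x) \<in> L2" for J
    unfolding band_limit_def by (rule L2_mult_ifourier1[OF v integrable_ball_L2[OF G]])
  have f: "f \<in> L2" unfolding f_def by (intro L2_diff bl)
  define C0 where "C0 = 1 / 4 + Cmid TYPE('n) * ((L2_norm v)\<^sup>2 + K)"
  have C0: "C0 \<ge> 0" using Cmid_nonneg[where 'n='n] K0 by (simp add: C0_def)
  have bm: "- ball 0 (2 ^ M) \<in> sets (lebesgue :: (real^'n) measure)" unfolding Compl_eq_Diff_UNIV by (intro sets.Diff) auto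
  show ?thesis
  proof (cases "L2_norm f = 0")
    case True then show ?thesis using C0 c by (simp add: f_def C0_def)
  next
    case False
    then have n: "L2_norm f > 0" using L2_norm_nonneg[of f] by linarith
    define \<psi> where "\<psi> = (\<lambda>x. complex_of_real (1 / L2_norm f) * f x)"
    define G' where "G' = (\<lambda>\<xi>. complex_of_real (1 / c) * (indicator (- ball 0 (2 ^ M)) \<xi> * G \<xi>))"
    have G2: "G' \<in> L2" unfolding G'_def by (intro L2_scale L2_indicator(1) G bm)
    have hG: "(\<lambda>\<xi>. complex_of_real (hw \<xi>) * G' \<xi>) = (\<lambda>\<xi>. complex_of_real (1 / c) * (indicator (- ball 0 (2 ^ M)) \<xi> * (complex_of_real (hw \<xi>) * G \<xi>)))"
      by (rule ext) (simp add: G'_def mult_ac)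
    have b1: "bessel {()} (\<lambda>_. \<psi>)"
    proof (rule bessel_single)
      show "\<psi> \<in> L2" unfolding \<psi>_def by (rule L2_scale[OF f])
      show "L2_norm \<psi> \<le> 1" unfolding \<psi>_def L2_norm_scale using n by (simp add: norm_divide)
    qed
    have b2: "bessel {()} (\<lambda>_ \<xi>. complex_of_real (hw \<xi>) * G' \<xi>)"
    proof (rule bessel_single)
      show "(\<lambda>\<xi>. complex_of_real (hw \<xi>) * G' \<xi>) \<in> L2" unfolding hG by (intro L2_scale L2_indicator(1) phi bm)
      show "L2_norm (\<lambda>\<xi>. complex_of_real (hw \<xi>) * G' \<xi>) \<le> 1" unfolding hG L2_norm_scale using c by (simp add: norm_divide divide_le_eq)
    qed
    define t where "t j = (\<lambda>x. v x * ifourier1 (\<lambda>\<xi>. indicator (shell j) \<xi> * G' \<xi>) x)" for j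
    have t2: "t j \<in> L2" for j unfolding t_def by (rule L2_mult_ifourier1[OF v integrable_shell_L2[OF G2]])
    have "cmod (\<Sum>j<J. \<Sum>i\<in>{()}. L2_inner \<psi> (\<lambda>x. v x * ifourier1 (\<lambda>\<xi>. indicator (shell j) \<xi> * G' \<xi>) x)) \<le> real (card {()}) / 4 + Cmid TYPE('n) * ((L2_norm v)\<^sup>2 + K)"
      by (rule mid_frequency_bound[OF b1 G2 b2 v K0 K])
    then have 1: "cmod (\<Sum>j<J. L2_inner \<psi> (t j)) \<le> C0" by (simp add: C0_def t_def)
    have "(\<Sum>j<J. L2_inner \<psi> (t j)) = L2_inner \<psi> (\<lambda>x. \<Sum>j<J. t j x)"
      using besselD(2)[OF b1] t2 by (simp add: L2_inner_sum_right)
    also have "(\<lambda>x. \<Sum>j<J. t j x) = (\<lambda>x. complex_of_real (1 / c) * f x)"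
    proof
      fix x
      define s where "s j = ifourier1 (\<lambda>\<xi>. indicator (shell j) \<xi> * G \<xi>) x" for j
      have "ifourier1 (\<lambda>\<xi>. indicator (shell j) \<xi> * G' \<xi>) x = (if M \<le> j then complex_of_real (1 / c) * s j else 0)" for j
      proof (cases "M \<le> j")
        case True
        have le: "(2::real) ^ M \<le> 2 ^ j" using True by (intro power_increasing) auto
        have "2 ^ M \<le> norm \<xi>" if "\<xi> \<in> shell j" for \<xi> :: "real^'n" using that order_trans[OF le] by (simp add: annulus_def)
        then have "(\<lambda>\<xi>. indicator (shell j) \<xi> * G' \<xi>) = (\<lambda>\<xi>. complex_of_real (1 / c) * (indicator (shell j) \<xi> * G \<xi>))"
          by (intro ext) (auto simp: G'_def indicator_def not_less)
        then show ?thesis using True by (simp only: ifourier1_scale s_def) simp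
      next
        case False
        have le: "(2::real) ^ Suc j \<le> 2 ^ M" using False by (intro power_increasing) auto
        have "norm \<xi> < 2 ^ M" if "\<xi> \<in> shell j" for \<xi> :: "real^'n" using that less_le_trans[OF _ le] by (simp add: annulus_def)
        then have "(\<lambda>\<xi>. indicator (shell j) \<xi> * G' \<xi>) = (\<lambda>\<xi>. 0)"
          by (intro ext) (auto simp: G'_def indicator_def)
        then show ?thesis using False by (simp only:) (simp add: ifourier1_def)
      qed
      then have "(\<Sum>j<J. t j x) = (\<Sum>j<J. if M \<le> j then v x * (complex_of_real (1 / c) * s j) else 0)"
        unfolding t_def by (intro sum.cong) auto
      also have "\<dots> = (\<Sum>j\<in>{M..<J}. v x * (complex_of_real (1 / c) * s j))"
        by (simp add: sum.If_cases) (intro sum.cong, auto)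
      also have "\<dots> = complex_of_real (1 / c) * (v x * (\<Sum>j\<in>{M..<J}. s j))" by (simp add: sum_distrib_left mult_ac)
      also have "(\<Sum>j\<in>{M..<J}. s j) = (\<Sum>j<J. s j) - (\<Sum>j<M. s j)"
        using MJ by (simp add: sum_diff_nat_ivl lessThan_atLeast0 sum.atLeastLessThan_concat[of 0 M J s, symmetric])
      also have "\<dots> = band_limit G J x - band_limit G M x" unfolding band_limit_decomp[OF G] s_def by simp
      finally show "(\<Sum>j<J. t j x) = complex_of_real (1 / c) * f x" by (simp add: f_def right_diff_distrib)
    qed
    also have "L2_inner \<psi> (\<lambda>x. complex_of_real (1 / c) * f x) = complex_of_real (L2_norm f / c)"
      unfolding \<psi>_def L2_inner_scale_right L2_inner_scale_left L2_inner_self using n by (simp add: power2_eq_square)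
    finally have "L2_norm f / c \<le> C0" using 1 n c by (simp add: norm_divide)
    then show ?thesis using c by (simp add: divide_le_eq f_def C0_def)
  qed
qed

lemma band_limit_tendsto:
  fixes u :: "real^'n \<Rightarrow> complex"
  assumes u: "u \<in> L2"
  shows "band_limit (fourier u) J \<in> L2" "(\<lambda>J. L2_norm (\<lambda>x. band_limit (fourier u) J x - u x)) \<longlonglongrightarrow> 0"
proof -
  have G: "fourier u \<in> L2" by (rule fourier_spec[OF u])
  define g where "g J = (\<lambda>\<xi>. indicator (ball 0 (2 ^ J)) \<xi> * fourier u \<xi>)" for J :: nat
  have g2: "g J \<in> L2" and gi: "integrable lebesgue (g J)" for J
    unfolding g_def by (rule L2_indicator(1)[OF G], simp, rule integrable_ball_L2[OF G])
  have b: "band_limit (fourier u) J = ifourier1 (g J)" for J by (simp add: band_limit_def g_def)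
  show b2: "band_limit (fourier u) J \<in> L2" for J unfolding b by (rule ifourier1_L2[OF gi g2])
  have "L2_norm (\<lambda>x. band_limit (fourier u) J x - u x) = L2_norm (\<lambda>\<xi>. g J \<xi> - fourier u \<xi>)" for J
  proof -
    have d: "(\<lambda>x. 1 * band_limit (fourier u) J x + (-1) * u x) \<in> L2" by (intro L2_add L2_scale b2 u)
    have "fourier (band_limit (fourier u) J) = fourier (ifourier (g J))"
      unfolding b using ifourier_eq_ifourier1[OF gi g2, of J] ifourier1_L2(1)[OF gi g2, of J] ifourier_L2[OF g2, of J]
      by (intro fourier_cong_AE L2_measurable) (auto elim: eventually_mono)
    then have "AE \<xi> in lebesgue. fourier (\<lambda>x. 1 * band_limit (fourier u) J x + (-1) * u x) \<xi> = g J \<xi> - fourier u \<xi>"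
      using fourier_linear[OF b2[of J] u, of 1 "-1"] fourier_ifourier[OF g2[of J]] by (auto elim: eventually_elim2)
    then have "L2_norm (fourier (\<lambda>x. 1 * band_limit (fourier u) J x + (-1) * u x)) = L2_norm (\<lambda>\<xi>. g J \<xi> - fourier u \<xi>)"
      using d g2[of J] G by (intro L2_norm_cong_AE) (auto intro!: L2_measurable L2_diff fourier_spec elim: eventually_mono)
    then show ?thesis using fourier_norm[OF d] by simp
  qed
  moreover have "(\<lambda>J. L2_norm (\<lambda>\<xi>. g J \<xi> - fourier u \<xi>)) \<longlonglongrightarrow> 0"
  proof (rule L2_dominated(3)[OF G])
    show "AE \<xi> in lebesgue. (\<lambda>J. g J \<xi>) \<longlonglongrightarrow> fourier u \<xi>"
    proof (intro AE_I2)
      fix \<xi> :: "real^'n"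
      obtain N where N: "norm \<xi> < 2 ^ N" using real_arch_pow[of 2 "norm \<xi>"] by auto
      have "eventually (\<lambda>J. g J \<xi> = fourier u \<xi>) sequentially"
        using eventually_ge_at_top[of N]
      proof eventually_elim
        case (elim J)
        have "(2::real) ^ N \<le> 2 ^ J" using elim by (intro power_increasing) auto
        then have "norm \<xi> < 2 ^ J" using N by linarith
        then show ?case by (simp add: g_def)
      qed
      then show "(\<lambda>J. g J \<xi>) \<longlonglongrightarrow> fourier u \<xi>" by (rule tendsto_eventually)
    qed
    show "AE \<xi> in lebesgue. cmod (g J \<xi>) \<le> cmod (fourier u \<xi>)" for J by (auto simp: g_def indicator_def)
  qed (use g2 G in \<open>auto intro: L2_measurable\<close>)
  ultimately show "(\<lambda>J. L2_norm (\<lambda>x. band_limit (fourier u) J x - u x)) \<longlonglongrightarrow> 0" by simp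
qed

text \<open>Functions of the critical Sobolev space can be unbounded and \<open>v\<close> is merely
  in \<open>L2\<close>, so integrability of the product is a genuine claim. The differences of the
  truncated products are controlled by the high-frequency tail of the weighted transform, hence they
  converge; comparing almost everywhere limits identifies the limit as \<open>v u\<close>.\<close>

lemma form_bounded:
  fixes u v :: "real^'n \<Rightarrow> complex"
  assumes u: "u \<in> L2" and phi: "(\<lambda>\<xi>. complex_of_real (hw \<xi>) * fourier u \<xi>) \<in> L2" and v: "v \<in> L2" and K0: "K \<ge> 0"
    and K: "(\<integral>\<^sup>+\<xi>. ennreal (ln (2 + norm \<xi>) * (cmod (fourier v \<xi>))\<^sup>2) \<partial>lebesgue) \<le> ennreal K"
  shows "(\<lambda>x. v x * u x) \<in> L2" "\<And>J. (\<lambda>x. v x * band_limit (fourier u) J x) \<in> L2"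
    "(\<lambda>J. L2_norm (\<lambda>x. v x * band_limit (fourier u) J x - v x * u x)) \<longlonglongrightarrow> 0"
proof -
  have G: "fourier u \<in> L2" by (rule fourier_spec[OF u])
  define \<phi> where "\<phi> = (\<lambda>\<xi>. complex_of_real (hw \<xi>) * fourier u \<xi>)"
  have phi2: "\<phi> \<in> L2" unfolding \<phi>_def by (rule phi)
  define f where "f J = (\<lambda>x. v x * band_limit (fourier u) J x)" for J
  show f2: "(\<lambda>x. v x * band_limit (fourier u) J x) \<in> L2" for J
    unfolding band_limit_def by (rule L2_mult_ifourier1[OF v integrable_ball_L2[OF G]])
  have fL: "f J \<in> L2" for J unfolding f_def by (rule f2)
  define C0 where "C0 = 1 / 4 + Cmid TYPE('n) * ((L2_norm v)\<^sup>2 + K)"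
  have C0: "C0 > 0" using Cmid_nonneg[where 'n='n] K0 by (simp add: C0_def add_pos_nonneg)
  \<comment> \<open>The summand \<open>1/(M+1)\<close> keeps \<open>c\<close> positive, because
    \<open>band_difference_bound\<close> normalises by it and the tail may vanish.\<close>
  define c where "c M = L2_norm (\<lambda>\<xi>. indicator (- ball 0 (2 ^ M)) \<xi> * \<phi> \<xi>) + 1 / real (Suc M)" for M :: nat
  have cp: "c M > 0" for M unfolding c_def by (intro add_nonneg_pos) auto
  have cl: "c \<longlonglongrightarrow> 0"
  proof -
    have bm: "- ball 0 (2 ^ M) \<in> sets (lebesgue :: (real^'n) measure)" for M :: nat unfolding Compl_eq_Diff_UNIV by (intro sets.Diff) auto
    have "(\<lambda>M. L2_norm (\<lambda>\<xi>. indicator (- ball 0 (2 ^ M)) \<xi> * \<phi> \<xi> - 0)) \<longlonglongrightarrow> 0"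
    proof (rule L2_dominated(3)[OF phi2])
      show "(\<lambda>\<xi>. indicator (- ball 0 (2 ^ M)) \<xi> * \<phi> \<xi>) \<in> borel_measurable lebesgue" for M :: nat
        by (rule L2_measurable[OF L2_indicator(1)[OF phi2 bm]])
      show "AE \<xi> in lebesgue. (\<lambda>M. indicator (- ball 0 (2 ^ M)) \<xi> * \<phi> \<xi>) \<longlonglongrightarrow> 0"
      proof (intro AE_I2)
        fix \<xi> :: "real^'n"
        obtain N where N: "norm \<xi> < 2 ^ N" using real_arch_pow[of 2 "norm \<xi>"] by auto
        have "eventually (\<lambda>M. indicator (- ball 0 (2 ^ M)) \<xi> * \<phi> \<xi> = 0) sequentially"
          using eventually_ge_at_top[of N]
        proof eventually_elim
          case (elim M)
          have "(2::real) ^ N \<le> 2 ^ M" using elim by (intro power_increasing) auto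
          then have "norm \<xi> < 2 ^ M" using N by linarith
          then show ?case by simp
        qed
        then show "(\<lambda>M. indicator (- ball 0 (2 ^ M)) \<xi> * \<phi> \<xi>) \<longlonglongrightarrow> 0" by (rule tendsto_eventually)
      qed
      show "AE \<xi> in lebesgue. cmod (indicator (- ball 0 (2 ^ M)) \<xi> * \<phi> \<xi>) \<le> cmod (\<phi> \<xi>)" for M :: nat by (auto simp: indicator_def)
    qed simp
    then have "c \<longlonglongrightarrow> 0 + 0" unfolding c_def using LIMSEQ_inverse_real_of_nat by (intro tendsto_add) (simp_all add: inverse_eq_divide)
    then show ?thesis by simp
  qed
  have b: "L2_norm (\<lambda>x. f J x - f M x) \<le> C0 * c M" if "M \<le> J" for M J
    unfolding f_def C0_def
    by (rule band_difference_bound[OF G phi v K0 K cp _ that]) (simp add: c_def \<phi>_def)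
  have "\<exists>\<gamma>\<in>L2. (\<lambda>n. L2_norm (\<lambda>x. f n x - \<gamma> x)) \<longlonglongrightarrow> 0"
  proof (rule L2_complete[OF fL])
    fix e :: real assume e: "e > 0"
    have "(\<lambda>M. C0 * c M + C0 * c M) \<longlonglongrightarrow> C0 * 0 + C0 * 0" by (intro tendsto_intros cl)
    then have "(\<lambda>M. C0 * c M + C0 * c M) \<longlonglongrightarrow> 0" by simp
    from LIMSEQ_D[OF this e] obtain N where "norm (C0 * c N + C0 * c N - 0) < e" by blast
    then have N: "C0 * c N + C0 * c N < e" by simp
    show "\<exists>N. \<forall>m\<ge>N. \<forall>n\<ge>N. L2_norm (\<lambda>x. f m x - f n x) < e"
    proof (intro exI allI impI)
      fix m n assume mn: "m \<ge> N" "n \<ge> N"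
      have "L2_norm (\<lambda>x. f m x - f n x) \<le> L2_norm (\<lambda>x. f m x - f N x) + L2_norm (\<lambda>x. f N x - f n x)"
        by (rule L2_norm_triangle3[OF fL fL fL])
      also have "L2_norm (\<lambda>x. f N x - f n x) = L2_norm (\<lambda>x. f n x - f N x)" by (rule L2_norm_minus_commute)
      finally show "L2_norm (\<lambda>x. f m x - f n x) < e" using b[OF mn(1)] b[OF mn(2)] N by linarith
    qed
  qed
  then obtain \<gamma> where chi: "\<gamma> \<in> L2" "(\<lambda>n. L2_norm (\<lambda>x. f n x - \<gamma> x)) \<longlonglongrightarrow> 0" by blast
  note B = band_limit_tendsto[OF u]
  obtain r where r: "strict_mono r" "AE x in lebesgue. (\<lambda>n. band_limit (fourier u) (r n) x) \<longlonglongrightarrow> u x"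
    using L2_tendsto_subseq_AE[OF B(1) u B(2)] by blast
  have "(\<lambda>n. L2_norm (\<lambda>x. f (r n) x - \<gamma> x)) \<longlonglongrightarrow> 0"
    using LIMSEQ_subseq_LIMSEQ[OF chi(2) r(1)] by (simp add: o_def)
  then obtain r' where r': "strict_mono r'" "AE x in lebesgue. (\<lambda>n. f (r (r' n)) x) \<longlonglongrightarrow> \<gamma> x"
    using L2_tendsto_subseq_AE[of "\<lambda>n. f (r n)" \<gamma>] fL chi(1) by blast
  \<comment> \<open>Along the second subsequence both the truncations and their products with
    \<open>v\<close> converge pointwise, which forces the two limits to match.\<close>
  have eq: "AE x in lebesgue. v x * u x = \<gamma> x"
    using r(2) r'(2)
  proof eventually_elim
    case (elim x)
    have "(\<lambda>n. v x * band_limit (fourier u) (r (r' n)) x) \<longlonglongrightarrow> v x * u x"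
      using LIMSEQ_subseq_LIMSEQ[OF elim(1) r'(1)] by (intro tendsto_mult_left) (simp add: o_def)
    then show ?case using elim(2) LIMSEQ_unique unfolding f_def by blast
  qed
  have m: "(\<lambda>x. v x * u x) \<in> borel_measurable lebesgue" using L2_measurable[OF u] L2_measurable[OF v] by simp
  show vu: "(\<lambda>x. v x * u x) \<in> L2" by (rule L2_cong_AE(1)[OF chi(1) m eq])
  have "L2_norm (\<lambda>x. f J x - v x * u x) = L2_norm (\<lambda>x. f J x - \<gamma> x)" for J
    using eq L2_diff[OF fL vu] L2_diff[OF fL chi(1)] by (intro L2_norm_cong_AE L2_measurable) auto
  then show "(\<lambda>J. L2_norm (\<lambda>x. v x * band_limit (fourier u) J x - v x * u x)) \<longlonglongrightarrow> 0"
    using chi(2) by (simp add: f_def)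
qed

lemma form_sum_bound:
  fixes \<psi> u :: "'i \<Rightarrow> real^'n \<Rightarrow> complex"
  assumes psi: "bessel I \<psi>" and u: "\<And>i. i \<in> I \<Longrightarrow> u i \<in> L2"
    and Phi: "bessel I (\<lambda>i \<xi>. complex_of_real (hw \<xi>) * fourier (u i) \<xi>)" and v: "v \<in> L2" and K0: "K \<ge> 0"
    and zero: "\<And>i. i \<in> I \<Longrightarrow> (LINT \<xi>|lebesgue. indicator (ball 0 1) \<xi> * fourier (u i) \<xi>) = 0"
    and Kx: "(\<integral>\<^sup>+x. ennreal (ln (2 + norm x) * (cmod (v x))\<^sup>2) \<partial>lebesgue) \<le> ennreal K"
    and K: "(\<integral>\<^sup>+\<xi>. ennreal (ln (2 + norm \<xi>) * (cmod (fourier v \<xi>))\<^sup>2) \<partial>lebesgue) \<le> ennreal K"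
  shows "cmod (\<Sum>i\<in>I. L2_inner (\<psi> i) (\<lambda>x. v x * u i x)) \<le> real (card I) / 2 + Cmid TYPE('n) * (5 * K)"
proof -
  \<comment> \<open>The logarithmic weight is at least \<open>ln 2 \<ge> 1/2\<close>, so the plain
    norm is absorbed into the moment; \<open>2 K + 3 K\<close> explains the 5.\<close>
  have vK: "(L2_norm v)\<^sup>2 \<le> 2 * K"
  proof -
    have vm [measurable]: "v \<in> borel_measurable lebesgue" by (rule L2_measurable[OF v])
    have l2: "(1/2::real) \<le> ln 2" using ln_one_minus_pos_upper_bound[of "1/2"] by (simp add: ln_div)
    have "ennreal ((L2_norm v)\<^sup>2) \<le> (\<integral>\<^sup>+x. 2 * ennreal (ln (2 + norm x) * (cmod (v x))\<^sup>2) \<partial>lebesgue)"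
      unfolding L2_norm_nn[OF v]
    proof (rule nn_integral_mono)
      fix x :: "real^'n"
      have "ln 2 \<le> ln (2 + norm x)" by (subst ln_le_cancel_iff) (auto intro: add_pos_nonneg)
      then have "1 \<le> 2 * ln (2 + norm x)" using l2 by linarith
      then have "(cmod (v x))\<^sup>2 \<le> 2 * (ln (2 + norm x) * (cmod (v x))\<^sup>2)"
        using mult_right_mono[of 1 "2 * ln (2 + norm x)" "(cmod (v x))\<^sup>2"] by simp
      then have "ennreal ((cmod (v x))\<^sup>2) \<le> ennreal (2 * (ln (2 + norm x) * (cmod (v x))\<^sup>2))" by (rule ennreal_leI)
      then show "ennreal ((cmod (v x))\<^sup>2) \<le> 2 * ennreal (ln (2 + norm x) * (cmod (v x))\<^sup>2)" by (simp add: ennreal_mult')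
    qed
    also have "\<dots> = 2 * (\<integral>\<^sup>+x. ennreal (ln (2 + norm x) * (cmod (v x))\<^sup>2) \<partial>lebesgue)"
    proof (rule nn_integral_cmult)
      have "(\<lambda>x::real^'n. ln (2 + norm x)) \<in> borel_measurable lebesgue" by (intro lebesgue_measurable_lborel) measurable
      then show "(\<lambda>x. ennreal (ln (2 + norm x) * (cmod (v x))\<^sup>2)) \<in> borel_measurable lebesgue" by measurable
    qed
    also have "\<dots> \<le> 2 * ennreal K" by (intro mult_left_mono Kx) simp
    also have "\<dots> = ennreal (2 * K)" by (simp add: ennreal_mult')
    finally show ?thesis using K0 by simp
  qed
  have G: "fourier (u i) \<in> L2" if "i \<in> I" for i by (rule fourier_spec[OF u[OF that]])
  have B: "cmod (\<Sum>i\<in>I. L2_inner (\<psi> i) (\<lambda>x. v x * band_limit (fourier (u i)) J x)) \<le> real (card I) / 2 + Cmid TYPE('n) * (5 * K)" for J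
  proof -
    have "cmod (\<Sum>i\<in>I. L2_inner (\<psi> i) (\<lambda>x. v x * band_limit (fourier (u i)) J x)) \<le> real (card I) / 2 + Cmid TYPE('n) * ((L2_norm v)\<^sup>2 + 3 * K)"
      by (rule band_limited_form_bound[OF psi G Phi v K0 zero Kx K])
    also have "\<dots> \<le> real (card I) / 2 + Cmid TYPE('n) * (5 * K)"
      using vK Cmid_nonneg[where 'n='n] by (intro add_left_mono mult_left_mono) auto
    finally show ?thesis .
  qed
  have "(\<lambda>J. \<Sum>i\<in>I. L2_inner (\<psi> i) (\<lambda>x. v x * band_limit (fourier (u i)) J x)) \<longlonglongrightarrow> (\<Sum>i\<in>I. L2_inner (\<psi> i) (\<lambda>x. v x * u i x))"
  proof (rule tendsto_sum)
    fix i assume i: "i \<in> I"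
    note F = form_bounded[OF u[OF i] besselD(2)[OF Phi i] v K0 K]
    show "(\<lambda>J. L2_inner (\<psi> i) (\<lambda>x. v x * band_limit (fourier (u i)) J x)) \<longlonglongrightarrow> L2_inner (\<psi> i) (\<lambda>x. v x * u i x)"
      by (rule L2_tendsto_inner(1)[OF F(2) F(1) F(3) besselD(2)[OF psi i]])
  qed
  from tendsto_norm[OF this] show ?thesis by (rule LIMSEQ_le_const2) (use B in blast)
qed

section \<open>Counting negative eigenvalues\<close>

text \<open>Gaussian elimination, by induction on the equations: a nonzero coefficient in the new
  equation expresses one unknown by the others, and the reduced system still has more unknowns than
  equations.\<close>

lemma underdetermined_system:
  fixes a :: "'k \<Rightarrow> 'i \<Rightarrow> complex"
  assumes "finite K" "finite I" "card K < card I"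
  shows "\<exists>c. (\<exists>i\<in>I. c i \<noteq> 0) \<and> (\<forall>k\<in>K. (\<Sum>i\<in>I. a k i * c i) = 0)"
  using assms
proof (induction K arbitrary: I a rule: finite_induct)
  case empty
  then have "I \<noteq> {}" by auto
  then obtain i where "i \<in> I" by blast
  then show ?case by (intro exI[of _ "\<lambda>_. 1"]) auto
next
  case (insert k K)
  show ?case
  proof (cases "\<forall>i\<in>I. a k i = 0")
    case True
    have "card K < card I" using insert by simp
    then obtain c where "\<exists>i\<in>I. c i \<noteq> 0" "\<forall>k\<in>K. (\<Sum>i\<in>I. a k i * c i) = 0" using insert.IH[OF insert.prems(1)] by blast
    then show ?thesis using True by (intro exI[of _ c]) auto
  next
    case False
    then obtain j where j: "j \<in> I" "a k j \<noteq> 0" by blast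
    define I' where "I' = I - {j}"
    have I': "finite I'" "card K < card I'" "j \<notin> I'" "I = insert j I'" using insert j by (auto simp: I'_def)
    obtain c where c: "\<exists>i\<in>I'. c i \<noteq> 0" "\<forall>l\<in>K. (\<Sum>i\<in>I'. (a l i - a l j * a k i / a k j) * c i) = 0"
      using insert.IH[OF I'(1,2), of "\<lambda>l i. a l i - a l j * a k i / a k j"] by blast
    define c' where "c' i = (if i = j then - (\<Sum>i\<in>I'. a k i * c i) / a k j else c i)" for i
    have cj: "c' j = - (\<Sum>i\<in>I'. a k i * c i) / a k j" by (simp add: c'_def)
    have s: "(\<Sum>i\<in>I. a l i * c' i) = a l j * c' j + (\<Sum>i\<in>I'. a l i * c i)" for l
    proof -
      have "(\<Sum>i\<in>I'. a l i * c' i) = (\<Sum>i\<in>I'. a l i * c i)" using I'(3) by (intro sum.cong) (auto simp: c'_def)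
      then show ?thesis using I' by simp
    qed
    have "(\<Sum>i\<in>I. a l i * c' i) = 0" if "l \<in> insert k K" for l
    proof (cases "l = k")
      case True then show ?thesis using j by (simp add: s cj)
    next
      case False
      then have "(\<Sum>i\<in>I'. (a l i - a l j * a k i / a k j) * c i) = 0" using c(2) that by simp
      also have "(\<Sum>i\<in>I'. (a l i - a l j * a k i / a k j) * c i) = (\<Sum>i\<in>I'. a l i * c i) - a l j / a k j * (\<Sum>i\<in>I'. a k i * c i)"
        by (simp add: left_diff_distrib sum_subtractf sum_distrib_left mult.assoc)
      finally show ?thesis by (simp add: s cj)
    qed
    moreover have "\<exists>i\<in>I. c' i \<noteq> 0"
    proof -
      obtain i where "i \<in> I'" "c i \<noteq> 0" using c(1) by blast
      then show ?thesis using I'(3,4) by (intro bexI[of _ i]) (auto simp: c'_def)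
    qed
    ultimately show ?thesis by blast
  qed
qed

text \<open>A map and its adjoint have the same norm: the synthesis bound is applied with the
  coefficients \<open>b i = L2_inner (f i) g\<close>, followed by the Cauchy-Schwarz
  inequality.\<close>

lemma bessel_synthesis:
  fixes f :: "'i \<Rightarrow> real^'n \<Rightarrow> complex"
  assumes I: "finite I" and f: "\<And>i. i \<in> I \<Longrightarrow> f i \<in> L2"
    and le: "\<And>b. (L2_norm (\<lambda>x. \<Sum>i\<in>I. b i * f i x))\<^sup>2 \<le> (\<Sum>i\<in>I. (cmod (b i))\<^sup>2)"
  shows "bessel I f"
  unfolding bessel_def
proof (intro conjI ballI I f)
  fix g :: "real^'n \<Rightarrow> complex" assume g: "g \<in> L2"
  define b where "b i = L2_inner (f i) g" for i
  define s where "s = (\<Sum>i\<in>I. (cmod (b i))\<^sup>2)"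
  have s0: "0 \<le> s" unfolding s_def by (intro sum_nonneg) auto
  define h where "h = (\<lambda>x. \<Sum>i\<in>I. b i * f i x)"
  have h: "h \<in> L2" unfolding h_def by (intro L2_sum L2_scale f)
  have "L2_inner h g = (\<Sum>i\<in>I. cnj (b i) * b i)"
    unfolding h_def using f g by (subst L2_inner_sum_left) (auto intro: L2_scale simp: L2_inner_scale_left b_def)
  also have "\<dots> = complex_of_real s" unfolding s_def of_real_sum by (intro sum.cong refl) (simp only: complex_norm_square mult.commute)
  finally have "s \<le> L2_norm h * L2_norm g" using L2_Cauchy_Schwarz[OF h g] s0 by simp
  then have "s\<^sup>2 \<le> (L2_norm h * L2_norm g)\<^sup>2" using s0 by (intro power_mono)
  also have "\<dots> = (L2_norm h)\<^sup>2 * (L2_norm g)\<^sup>2" by (rule power_mult_distrib)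
  also have "\<dots> \<le> s * (L2_norm g)\<^sup>2" using le[of b] unfolding h_def s_def by (intro mult_right_mono) auto
  finally have "s * s \<le> s * (L2_norm g)\<^sup>2" by (simp only: power2_eq_square)
  then have "s \<le> (L2_norm g)\<^sup>2" using s0 mult_le_cancel_left_pos[of s s "(L2_norm g)\<^sup>2"] by (cases "s = 0") auto
  then show "(\<Sum>i\<in>I. (cmod (L2_inner (f i) g))\<^sup>2) \<le> (L2_norm g)\<^sup>2" by (simp add: s_def b_def)
qed

lemma fourier_sum:
  fixes u :: "'i \<Rightarrow> real^'n \<Rightarrow> complex"
  assumes "finite I" "\<And>i. i \<in> I \<Longrightarrow> u i \<in> L2"
  shows "AE \<xi> in lebesgue. fourier (\<lambda>x. \<Sum>i\<in>I. c i * u i x) \<xi> = (\<Sum>i\<in>I. c i * fourier (u i) \<xi>)"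
  using assms
proof (induction I rule: finite_induct)
  case empty
  have "AE \<xi> in lebesgue. fourier (\<lambda>x. 0 * (0::complex) + 0 * 0) \<xi> = 0 * fourier (\<lambda>_::real^'n. 0) \<xi> + 0 * fourier (\<lambda>_. 0) \<xi>"
    by (rule fourier_linear[OF L2_zero L2_zero])
  then show ?case by simp
next
  case (insert k I)
  have s: "(\<lambda>x. \<Sum>i\<in>I. c i * u i x) \<in> L2" using insert by (intro L2_sum L2_scale) auto
  have "AE \<xi> in lebesgue. fourier (\<lambda>x. c k * u k x + 1 * (\<Sum>i\<in>I. c i * u i x)) \<xi> = c k * fourier (u k) \<xi> + 1 * fourier (\<lambda>x. \<Sum>i\<in>I. c i * u i x) \<xi>"
    using insert s by (intro fourier_linear) auto
  moreover have "AE \<xi> in lebesgue. fourier (\<lambda>x. \<Sum>i\<in>I. c i * u i x) \<xi> = (\<Sum>i\<in>I. c i * fourier (u i) \<xi>)"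
    using insert by simp
  ultimately show ?case using insert(1,2) by (auto elim: eventually_elim2)
qed

lemma L2_norm_sq_combination:
  fixes f :: "'i \<Rightarrow> real^'n \<Rightarrow> complex"
  assumes "finite I" "\<And>i. i \<in> I \<Longrightarrow> f i \<in> L2"
  shows "complex_of_real ((L2_norm (\<lambda>x. \<Sum>i\<in>I. c i * f i x))\<^sup>2) = (\<Sum>i\<in>I. \<Sum>k\<in>I. cnj (c i) * c k * L2_inner (f i) (f k))"
proof -
  have cf: "(\<lambda>x. c i * f i x) \<in> L2" if "i \<in> I" for i using assms that by (intro L2_scale)
  have s: "(\<lambda>x. \<Sum>i\<in>I. c i * f i x) \<in> L2" using cf by (intro L2_sum)
  have "complex_of_real ((L2_norm (\<lambda>x. \<Sum>i\<in>I. c i * f i x))\<^sup>2) = (\<Sum>i\<in>I. L2_inner (\<lambda>x. c i * f i x) (\<lambda>x. \<Sum>i\<in>I. c i * f i x))"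
    unfolding L2_inner_self[symmetric] using s cf by (intro L2_inner_sum_left)
  also have "\<dots> = (\<Sum>i\<in>I. \<Sum>k\<in>I. L2_inner (\<lambda>x. c i * f i x) (\<lambda>x. c k * f k x))"
    by (intro sum.cong refl L2_inner_sum_right cf)
  finally show ?thesis by (simp add: L2_inner_scale_left L2_inner_scale_right mult_ac)
qed

section \<open>Energy forms and families of negative energy\<close>

lemma sobolev_energy:
  fixes u :: "real^'n \<Rightarrow> complex"
  assumes "u \<in> sobolev (real CARD('n) / 2)"
  shows "u \<in> L2" "(\<lambda>\<xi>. complex_of_real (hw \<xi>) * fourier u \<xi>) \<in> L2"
proof -
  show u: "u \<in> L2" using assms by (simp add: sobolev_def)
  have i: "integrable lebesgue (\<lambda>\<xi>. (1 + (norm \<xi>)\<^sup>2) powr (real CARD('n) / 2) * (cmod (fourier u \<xi>))\<^sup>2)"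
    using assms by (simp add: sobolev_def)
  have fm: "fourier u \<in> borel_measurable lebesgue" by (rule fourier_measurable[OF u])
  have hm: "hw \<in> borel_measurable lebesgue" by (rule lebesgue_measurable_lborel[OF hw_measurable])
  have m: "(\<lambda>\<xi>. complex_of_real (hw \<xi>) * fourier u \<xi>) \<in> borel_measurable lebesgue" using fm hm by simp
  have "integrable lebesgue (\<lambda>\<xi>. (cmod (complex_of_real (hw \<xi>) * fourier u \<xi>))\<^sup>2)"
  proof (rule Bochner_Integration.integrable_bound[OF i])
    show "(\<lambda>\<xi>. (cmod (complex_of_real (hw \<xi>) * fourier u \<xi>))\<^sup>2) \<in> borel_measurable lebesgue" using m by simp
    show "AE \<xi> in lebesgue. norm ((cmod (complex_of_real (hw \<xi>) * fourier u \<xi>))\<^sup>2) \<le> norm ((1 + (norm \<xi>)\<^sup>2) powr (real CARD('n) / 2) * (cmod (fourier u \<xi>))\<^sup>2)"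
    proof (intro AE_I2)
      fix \<xi> :: "real^'n"
      have "(hw \<xi>)\<^sup>2 \<le> (1 + (norm \<xi>)\<^sup>2) powr (real CARD('n) / 2)"
      proof (cases "\<xi> = 0")
        case False
        have "(hw \<xi>)\<^sup>2 = ((norm \<xi>)\<^sup>2) powr (real CARD('n) / 2)"
          using False by (simp add: hw_def power2_eq_square powr_mult)
        also have "\<dots> \<le> (1 + (norm \<xi>)\<^sup>2) powr (real CARD('n) / 2)" by (intro powr_mono2) auto
        finally show ?thesis .
      qed (simp add: hw_def)
      then have "(hw \<xi>)\<^sup>2 * (cmod (fourier u \<xi>))\<^sup>2 \<le> (1 + (norm \<xi>)\<^sup>2) powr (real CARD('n) / 2) * (cmod (fourier u \<xi>))\<^sup>2" by (intro mult_right_mono) auto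
      then show "norm ((cmod (complex_of_real (hw \<xi>) * fourier u \<xi>))\<^sup>2) \<le> norm ((1 + (norm \<xi>)\<^sup>2) powr (real CARD('n) / 2) * (cmod (fourier u \<xi>))\<^sup>2)"
        by (simp add: norm_mult power_mult_distrib abs_mult)
    qed
  qed
  then show "(\<lambda>\<xi>. complex_of_real (hw \<xi>) * fourier u \<xi>) \<in> L2" using m by (simp add: L2_def)
qed

text \<open>Splitting both weights into square roots makes each term an inner product, so that the
  form on a finite family becomes a difference of two Gram matrices.\<close>

lemma schroedinger_form_eq:
  fixes V :: "real^'n \<Rightarrow> real"
  assumes "\<And>x. 0 \<le> V x"
  shows "schroedinger_form (real CARD('n) / 2) V w u =
    L2_inner (\<lambda>\<xi>. complex_of_real (hw \<xi>) * fourier w \<xi>) (\<lambda>\<xi>. complex_of_real (hw \<xi>) * fourier u \<xi>)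
    - L2_inner (\<lambda>x. complex_of_real (sqrt (V x)) * w x) (\<lambda>x. complex_of_real (sqrt (V x)) * u x)"
proof -
  have 1: "complex_of_real (norm \<xi> powr (2 * (real CARD('n) / 2))) = complex_of_real (hw \<xi>) * complex_of_real (hw \<xi>)" for \<xi> :: "real^'n"
    by (simp add: hw_def flip: powr_add of_real_mult)
  have 2: "complex_of_real (V x) = complex_of_real (sqrt (V x)) * complex_of_real (sqrt (V x))" for x
    using assms[of x] by (simp flip: of_real_mult)
  show ?thesis unfolding schroedinger_form_def L2_inner_def 1
    by (subst 2) (simp add: mult_ac)
qed

text \<open>On the span of eigenfunctions to negative eigenvalues the potential energy strictly dominates
  the kinetic energy; one of the available dimensions is spent on the condition \<open>\<integral>\<^sub>B u^ = 0\<close>, which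
  removes the infrared divergence.\<close>

lemma negative_family_card:
  fixes u :: "'i \<Rightarrow> real^'n \<Rightarrow> complex" and v :: "real^'n \<Rightarrow> complex" and \<mu> :: "'i \<Rightarrow> real"
  assumes I: "finite I" and u: "\<And>i. i \<in> I \<Longrightarrow> u i \<in> L2"
    and phi: "\<And>i. i \<in> I \<Longrightarrow> (\<lambda>\<xi>. complex_of_real (hw \<xi>) * fourier (u i) \<xi>) \<in> L2"
    and v: "v \<in> L2" and K0: "K \<ge> 0"
    and Kx: "(\<integral>\<^sup>+x. ennreal (ln (2 + norm x) * (cmod (v x))\<^sup>2) \<partial>lebesgue) \<le> ennreal K"
    and K: "(\<integral>\<^sup>+\<xi>. ennreal (ln (2 + norm \<xi>) * (cmod (fourier v \<xi>))\<^sup>2) \<partial>lebesgue) \<le> ennreal K"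
    and eig: "\<And>i k. i \<in> I \<Longrightarrow> k \<in> I \<Longrightarrow>
        L2_inner (\<lambda>\<xi>. complex_of_real (hw \<xi>) * fourier (u i) \<xi>) (\<lambda>\<xi>. complex_of_real (hw \<xi>) * fourier (u k) \<xi>)
        - L2_inner (\<lambda>x. v x * u i x) (\<lambda>x. v x * u k x) = complex_of_real (\<mu> k) * L2_inner (u i) (u k)"
    and neg: "\<And>i. i \<in> I \<Longrightarrow> \<mu> i < 0"
    and indep: "\<And>m c. (AE x in lebesgue. (\<Sum>i\<in>{i\<in>I. \<mu> i = m}. c i * u i x) = 0) \<Longrightarrow> (\<forall>i\<in>{i\<in>I. \<mu> i = m}. c i = 0)"
  shows "real (card I) - 1 \<le> 10 * Cmid TYPE('n) * K"
proof -
  define \<phi> where "\<phi> i = (\<lambda>\<xi>. complex_of_real (hw \<xi>) * fourier (u i) \<xi>)" for i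
  define y where "y i = (\<lambda>x. v x * u i x)" for i
  have phi2: "\<phi> i \<in> L2" if "i \<in> I" for i unfolding \<phi>_def by (rule phi[OF that])
  have y2: "y i \<in> L2" if "i \<in> I" for i unfolding y_def by (rule form_bounded(1)[OF u[OF that] phi[OF that] v K0 K])
  have eig': "L2_inner (\<phi> i) (\<phi> k) - L2_inner (y i) (y k) = complex_of_real (\<mu> k) * L2_inner (u i) (u k)" if "i \<in> I" "k \<in> I" for i k
    unfolding \<phi>_def y_def by (rule eig[OF that])
  \<comment> \<open>The left side of the eigenvalue relation is Hermitian in the two indices;
    exchanging them and conjugating gives the same inner product with the other, real,
    eigenvalue.\<close>
  have orth: "L2_inner (u i) (u k) = 0" if ik: "i \<in> I" "k \<in> I" "\<mu> i \<noteq> \<mu> k" for i k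
  proof -
    have "complex_of_real (\<mu> k) * L2_inner (u i) (u k) = cnj (L2_inner (\<phi> k) (\<phi> i) - L2_inner (y k) (y i))"
      using eig'[OF ik(1,2)] by (simp add: L2_inner_cnj)
    also have "\<dots> = complex_of_real (\<mu> i) * L2_inner (u i) (u k)"
      unfolding eig'[OF ik(2,1)] by (simp add: L2_inner_cnj)
    finally show ?thesis using ik(3) by simp
  qed
  define \<Phi> where "\<Phi> c = (\<lambda>\<xi>. \<Sum>i\<in>I. c i * \<phi> i \<xi>)" for c
  define Y where "Y c = (\<lambda>x. \<Sum>i\<in>I. c i * y i x)" for c
  have Phi2: "\<Phi> c \<in> L2" and Y2: "Y c \<in> L2" for c
    unfolding \<Phi>_def Y_def by (intro L2_sum L2_scale phi2 y2; assumption)+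
  define S where "S m c = (\<lambda>x. \<Sum>i\<in>{i\<in>I. \<mu> i = m}. c i * u i x)" for m c
  \<comment> \<open>By orthogonality only pairs with equal eigenvalue contribute, so the form is
    diagonal in the spectral components \<open>S m c\<close>.\<close>
  have diff: "(L2_norm (\<Phi> c))\<^sup>2 - (L2_norm (Y c))\<^sup>2 = (\<Sum>m\<in>\<mu> ` I. m * (L2_norm (S m c))\<^sup>2)" for c
  proof -
    have "complex_of_real ((L2_norm (\<Phi> c))\<^sup>2) = (\<Sum>i\<in>I. \<Sum>k\<in>I. cnj (c i) * c k * L2_inner (\<phi> i) (\<phi> k))"
      unfolding \<Phi>_def by (rule L2_norm_sq_combination[OF I phi2])
    moreover have "complex_of_real ((L2_norm (Y c))\<^sup>2) = (\<Sum>i\<in>I. \<Sum>k\<in>I. cnj (c i) * c k * L2_inner (y i) (y k))"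
      unfolding Y_def by (rule L2_norm_sq_combination[OF I y2])
    ultimately have "complex_of_real ((L2_norm (\<Phi> c))\<^sup>2 - (L2_norm (Y c))\<^sup>2) = (\<Sum>i\<in>I. \<Sum>k\<in>I. cnj (c i) * c k * (L2_inner (\<phi> i) (\<phi> k) - L2_inner (y i) (y k)))"
      by (simp only: of_real_diff right_diff_distrib sum_subtractf)
    also have "\<dots> = (\<Sum>i\<in>I. \<Sum>k\<in>I. cnj (c i) * c k * (complex_of_real (\<mu> k) * L2_inner (u i) (u k)))"
      by (intro sum.cong refl) (simp add: eig')
    also have "\<dots> = (\<Sum>k\<in>I. \<Sum>i\<in>I. cnj (c i) * c k * (complex_of_real (\<mu> k) * L2_inner (u i) (u k)))" by (rule sum.swap)
    also have "\<dots> = (\<Sum>k\<in>I. \<Sum>i\<in>{i\<in>I. \<mu> i = \<mu> k}. cnj (c i) * c k * (complex_of_real (\<mu> k) * L2_inner (u i) (u k)))"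
      using I orth by (intro sum.cong refl sum.mono_neutral_right) auto
    also have "\<dots> = (\<Sum>m\<in>\<mu> ` I. \<Sum>k\<in>{k\<in>I. \<mu> k = m}. \<Sum>i\<in>{i\<in>I. \<mu> i = \<mu> k}. cnj (c i) * c k * (complex_of_real (\<mu> k) * L2_inner (u i) (u k)))"
      by (rule sum.group[symmetric]) (use I in auto)
    also have "\<dots> = (\<Sum>m\<in>\<mu> ` I. complex_of_real m * complex_of_real ((L2_norm (S m c))\<^sup>2))"
    proof (rule sum.cong[OF refl])
      fix m
      have "complex_of_real ((L2_norm (S m c))\<^sup>2) = (\<Sum>i\<in>{i\<in>I. \<mu> i = m}. \<Sum>k\<in>{i\<in>I. \<mu> i = m}. cnj (c i) * c k * L2_inner (u i) (u k))"
        unfolding S_def by (rule L2_norm_sq_combination) (use I u in auto)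
      also have "\<dots> = (\<Sum>k\<in>{i\<in>I. \<mu> i = m}. \<Sum>i\<in>{i\<in>I. \<mu> i = m}. cnj (c i) * c k * L2_inner (u i) (u k))" by (rule sum.swap)
      finally have e: "complex_of_real ((L2_norm (S m c))\<^sup>2) = (\<Sum>k\<in>{i\<in>I. \<mu> i = m}. \<Sum>i\<in>{i\<in>I. \<mu> i = m}. cnj (c i) * c k * L2_inner (u i) (u k))" .
      show "(\<Sum>k\<in>{k\<in>I. \<mu> k = m}. \<Sum>i\<in>{i\<in>I. \<mu> i = \<mu> k}. cnj (c i) * c k * (complex_of_real (\<mu> k) * L2_inner (u i) (u k))) = complex_of_real m * complex_of_real ((L2_norm (S m c))\<^sup>2)"
        unfolding e sum_distrib_left by (intro sum.cong) (auto simp: mult_ac)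
    qed
    finally have "complex_of_real ((L2_norm (\<Phi> c))\<^sup>2 - (L2_norm (Y c))\<^sup>2) = complex_of_real (\<Sum>m\<in>\<mu> ` I. m * (L2_norm (S m c))\<^sup>2)" by simp
    then show ?thesis by (simp only: of_real_eq_iff)
  qed
  have le: "(L2_norm (\<Phi> c))\<^sup>2 \<le> (L2_norm (Y c))\<^sup>2" for c
  proof -
    have "(\<Sum>m\<in>\<mu> ` I. m * (L2_norm (S m c))\<^sup>2) \<le> 0" using neg by (intro sum_nonpos) (auto intro!: mult_nonpos_nonneg dest: less_imp_le)
    then show ?thesis using diff[of c] by linarith
  qed
  \<comment> \<open>Independence is given inside each eigenspace only. A nonzero coefficient makes
    one component \<open>S m c\<close> nonzero, the difference strictly negative, and hence the
    potential energy positive; thus \<open>Y\<close> is injective on coefficients.\<close>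
  have pos: "0 < L2_norm (Y c)" if c: "\<exists>i\<in>I. c i \<noteq> 0" for c
  proof -
    obtain j where j: "j \<in> I" "c j \<noteq> 0" using c by blast
    have SL: "S (\<mu> j) c \<in> L2" unfolding S_def using u by (intro L2_sum L2_scale) auto
    have "L2_norm (S (\<mu> j) c) \<noteq> 0"
    proof
      assume "L2_norm (S (\<mu> j) c) = 0"
      then have "AE x in lebesgue. S (\<mu> j) c x = 0" using L2_norm_eq_0[OF SL] by simp
      then show False using indep[where m="\<mu> j" and c=c] j by (auto simp: S_def)
    qed
    then have "\<mu> j * (L2_norm (S (\<mu> j) c))\<^sup>2 < 0" using neg[OF j(1)] by (simp add: mult_less_0_iff)
    moreover have "(\<Sum>m\<in>\<mu> ` I - {\<mu> j}. m * (L2_norm (S m c))\<^sup>2) \<le> 0"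
      using neg by (intro sum_nonpos) (auto intro!: mult_nonpos_nonneg dest: less_imp_le)
    ultimately have "(\<Sum>m\<in>\<mu> ` I. m * (L2_norm (S m c))\<^sup>2) < 0"
      using I j(1) by (subst sum.remove[of _ "\<mu> j"]) auto
    then have "(L2_norm (\<Phi> c))\<^sup>2 < (L2_norm (Y c))\<^sup>2" using diff[of c] by linarith
    then have "0 < (L2_norm (Y c))\<^sup>2" using zero_le_power2[of "L2_norm (\<Phi> c)"] by linarith
    then show ?thesis using L2_norm_nonneg[of "Y c"] by (metis less_le zero_less_power2)
  qed
  define l where "l i = (LINT \<xi>|lebesgue. indicator (ball 0 1) \<xi> * fourier (u i) \<xi>)" for i
  have Yinner: "L2_inner f (Y c) = (\<Sum>i\<in>I. L2_inner f (y i) * c i)" if "f \<in> L2" for f c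
    unfolding Y_def using that y2 by (subst L2_inner_sum_right) (auto intro: L2_scale simp: L2_inner_scale_right mult.commute)
  \<comment> \<open>Orthonormalisation in the potential-energy inner product. Each new vector is
    found by solving linear equations, so the mean-zero condition is imposed as one more equation;
    this restricts \<open>n\<close> to values below \<open>card I\<close>.\<close>
  have "\<exists>c :: nat \<Rightarrow> 'i \<Rightarrow> complex. (\<forall>a<n. (\<Sum>i\<in>I. l i * c a i) = 0) \<and>
      (\<forall>a<n. \<forall>b<n. L2_inner (Y (c a)) (Y (c b)) = (if a = b then 1 else 0))" if "n < card I" for n
    using that
  proof (induction n)
    case 0 then show ?case by simp
  next
    case (Suc n)
    then obtain c where c: "\<forall>a<n. (\<Sum>i\<in>I. l i * c a i) = 0"
      "\<forall>a<n. \<forall>b<n. L2_inner (Y (c a)) (Y (c b)) = (if a = b then 1 else 0)" by auto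
    have "card {..n} < card I" using Suc.prems by simp
    \<comment> \<open>Rows \<open>a < n\<close> express orthogonality to the vectors already found,
      and row \<open>n\<close> is the mean-zero condition.\<close>
    from underdetermined_system[OF finite_atMost I this, of "\<lambda>a i. if a < n then L2_inner (Y (c a)) (y i) else l i"]
    obtain d where d: "\<exists>i\<in>I. d i \<noteq> 0" "\<forall>a\<in>{..n}. (\<Sum>i\<in>I. (if a < n then L2_inner (Y (c a)) (y i) else l i) * d i) = 0" by (elim exE conjE)
    have d0: "(\<Sum>i\<in>I. l i * d i) = 0" using bspec[OF d(2), of n] by simp
    have do: "L2_inner (Y (c a)) (Y d) = 0" if "a < n" for a
      using bspec[OF d(2), of a] that by (simp add: Yinner[OF Y2])
    define N where "N = L2_norm (Y d)"
    have N: "N > 0" unfolding N_def by (rule pos[OF d(1)])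
    define e where "e i = complex_of_real (1 / N) * d i" for i
    have Ye: "Y e = (\<lambda>x. complex_of_real (1 / N) * Y d x)" by (rule ext) (simp add: Y_def e_def sum_distrib_left mult_ac)
    have ee: "L2_inner (Y e) (Y e) = 1"
      unfolding Ye L2_inner_scale_right L2_inner_scale_left L2_inner_self using N by (simp add: N_def power2_eq_square)
    have ce: "L2_inner (Y (c a)) (Y e) = 0" if "a < n" for a unfolding Ye L2_inner_scale_right using do[OF that] by simp
    have ec: "L2_inner (Y e) (Y (c a)) = 0" if "a < n" for a using ce[OF that] L2_inner_cnj[of "Y (c a)" "Y e"] by simp
    have e0: "(\<Sum>i\<in>I. l i * e i) = 0"
    proof -
      have "(\<Sum>i\<in>I. l i * e i) = complex_of_real (1 / N) * (\<Sum>i\<in>I. l i * d i)" by (simp add: e_def sum_distrib_left mult_ac)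
      then show ?thesis by (simp add: d0)
    qed
    show ?case
    proof (intro exI[of _ "\<lambda>a. if a = n then e else c a"] conjI allI impI)
      fix a assume "a < Suc n"
      then show "(\<Sum>i\<in>I. l i * (if a = n then e else c a) i) = 0" using c(1) e0 by (cases "a = n") auto
    next
      fix a b assume "a < Suc n" "b < Suc n"
      then show "L2_inner (Y (if a = n then e else c a)) (Y (if b = n then e else c b)) = (if a = b then 1 else 0)"
        using c(2) ee ce ec by (cases "a = n"; cases "b = n") auto
    qed
  qed
  note exists = this
  show ?thesis
  proof (cases "card I = 0")
    case True
    have "0 \<le> 10 * Cmid TYPE('n) * K" using K0 Cmid_nonneg[where 'n='n] by simp
    then show ?thesis using True by linarith
  next
    case False
    define n where "n = card I - 1"
    have n: "n < card I" using False by (simp add: n_def)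
    obtain c :: "nat \<Rightarrow> 'i \<Rightarrow> complex" where c: "\<forall>a<n. (\<Sum>i\<in>I. l i * c a i) = 0"
      "\<forall>a<n. \<forall>b<n. L2_inner (Y (c a)) (Y (c b)) = (if a = b then 1 else 0)"
      using exists[OF n] by blast
    define z where "z a = (\<lambda>x. \<Sum>i\<in>I. c a i * u i x)" for a
    have z2: "z a \<in> L2" for a unfolding z_def using u by (intro L2_sum L2_scale)
    have vz: "(\<lambda>x. v x * z a x) = Y (c a)" for a
      by (rule ext) (simp add: z_def Y_def y_def sum_distrib_left mult_ac)
    have fz: "AE \<xi> in lebesgue. fourier (z a) \<xi> = (\<Sum>i\<in>I. c a i * fourier (u i) \<xi>)" for a
      unfolding z_def by (rule fourier_sum[OF I u])
    have pz: "AE \<xi> in lebesgue. complex_of_real (hw \<xi>) * fourier (z a) \<xi> = \<Phi> (c a) \<xi>" for a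
      using fz[of a] by eventually_elim (simp add: \<Phi>_def \<phi>_def sum_distrib_left mult_ac)
    have hm: "hw \<in> borel_measurable lebesgue" by (rule lebesgue_measurable_lborel[OF hw_measurable])
    have pzm: "(\<lambda>\<xi>. complex_of_real (hw \<xi>) * fourier (z a) \<xi>) \<in> borel_measurable lebesgue" for a
      using hm fourier_measurable[OF z2[of a]] by simp
    have pz2: "(\<lambda>\<xi>. complex_of_real (hw \<xi>) * fourier (z a) \<xi>) \<in> L2" for a
      by (rule L2_cong_AE(1)[OF Phi2[of "c a"] pzm pz])
    have Ysum: "(\<lambda>x. \<Sum>a<n. b a * Y (c a) x) = Y (\<lambda>i. \<Sum>a<n. b a * c a i)" for b
      by (rule ext) (simp add: Y_def sum_distrib_left sum_distrib_right mult.assoc sum.swap[of _ I "{..<n}"])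
    have Phisum: "(\<lambda>x. \<Sum>a<n. b a * \<Phi> (c a) x) = \<Phi> (\<lambda>i. \<Sum>a<n. b a * c a i)" for b
      by (rule ext) (simp add: \<Phi>_def sum_distrib_left sum_distrib_right mult.assoc sum.swap[of _ I "{..<n}"])
    have Ynorm: "(L2_norm (\<lambda>x. \<Sum>a<n. b a * Y (c a) x))\<^sup>2 = (\<Sum>a<n. (cmod (b a))\<^sup>2)" for b
    proof -
      have "complex_of_real ((L2_norm (\<lambda>x. \<Sum>a<n. b a * Y (c a) x))\<^sup>2) = (\<Sum>a<n. \<Sum>k<n. cnj (b a) * b k * L2_inner (Y (c a)) (Y (c k)))"
        by (rule L2_norm_sq_combination) (auto intro: Y2)
      also have "\<dots> = (\<Sum>a<n. \<Sum>k<n. if a = k then cnj (b a) * b k else 0)" using c(2) by (intro sum.cong refl) auto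
      also have "\<dots> = (\<Sum>a<n. cnj (b a) * b a)" by (intro sum.cong refl) simp
      also have "\<dots> = complex_of_real (\<Sum>a<n. (cmod (b a))\<^sup>2)"
        unfolding of_real_sum by (intro sum.cong refl) (simp only: complex_norm_square mult.commute)
      finally show ?thesis by (simp only: of_real_eq_iff)
    qed
    have bY: "bessel {..<n} (\<lambda>a. Y (c a))" by (rule bessel_synthesis) (use Y2 Ynorm in auto)
    \<comment> \<open>For every combination the kinetic energy is at most the potential energy, and
      the latter equals the sum of the squared coefficients since the \<open>Y (c a)\<close> are
      orthonormal.\<close>
    have bP: "bessel {..<n} (\<lambda>a \<xi>. complex_of_real (hw \<xi>) * fourier (z a) \<xi>)"
    proof (rule bessel_synthesis)
      fix b
      have "AE \<xi> in lebesgue. \<forall>a\<in>{..<n}. complex_of_real (hw \<xi>) * fourier (z a) \<xi> = \<Phi> (c a) \<xi>"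
        using pz by (intro AE_finite_allI) auto
      then have "AE \<xi> in lebesgue. (\<Sum>a<n. b a * (complex_of_real (hw \<xi>) * fourier (z a) \<xi>)) = (\<Sum>a<n. b a * \<Phi> (c a) \<xi>)"
        by eventually_elim (intro sum.cong, auto)
      then have "L2_norm (\<lambda>\<xi>. \<Sum>a<n. b a * (complex_of_real (hw \<xi>) * fourier (z a) \<xi>)) = L2_norm (\<lambda>\<xi>. \<Sum>a<n. b a * \<Phi> (c a) \<xi>)"
        by (intro L2_norm_cong_AE L2_measurable L2_sum L2_scale Phi2 pz2)
      also have "\<dots> = L2_norm (\<Phi> (\<lambda>i. \<Sum>a<n. b a * c a i))" by (simp only: Phisum)
      finally have "(L2_norm (\<lambda>\<xi>. \<Sum>a<n. b a * (complex_of_real (hw \<xi>) * fourier (z a) \<xi>)))\<^sup>2 = (L2_norm (\<Phi> (\<lambda>i. \<Sum>a<n. b a * c a i)))\<^sup>2" by simp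
      also have "\<dots> \<le> (L2_norm (Y (\<lambda>i. \<Sum>a<n. b a * c a i)))\<^sup>2" by (rule le)
      also have "\<dots> = (\<Sum>a<n. (cmod (b a))\<^sup>2)" unfolding Ysum[symmetric] by (rule Ynorm)
      finally show "(L2_norm (\<lambda>\<xi>. \<Sum>a\<in>{..<n}. b a * (complex_of_real (hw \<xi>) * fourier (z a) \<xi>)))\<^sup>2 \<le> (\<Sum>a\<in>{..<n}. (cmod (b a))\<^sup>2)" .
    qed (auto intro: pz2)
    have zero: "(LINT \<xi>|lebesgue. indicator (ball 0 1) \<xi> * fourier (z a) \<xi>) = 0" if a: "a \<in> {..<n}" for a
    proof -
      have ib: "integrable lebesgue (\<lambda>\<xi>. indicator (ball 0 1) \<xi> * fourier (u i) \<xi>)" if "i \<in> I" for i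
        by (rule integrable_ball_L2[OF fourier_spec(1)[OF u[OF that]]])
      have "(LINT \<xi>|lebesgue. indicator (ball 0 1) \<xi> * fourier (z a) \<xi>) = (LINT \<xi>|lebesgue. (\<Sum>i\<in>I. c a i * (indicator (ball 0 1) \<xi> * fourier (u i) \<xi>)))"
      proof (rule integral_cong_AE)
        show "(\<lambda>\<xi>. indicator (ball 0 1) \<xi> * fourier (z a) \<xi>) \<in> borel_measurable lebesgue"
          by (rule borel_measurable_integrable[OF integrable_ball_L2[OF fourier_spec(1)[OF z2]]])
        show "(\<lambda>\<xi>. \<Sum>i\<in>I. c a i * (indicator (ball 0 1) \<xi> * fourier (u i) \<xi>)) \<in> borel_measurable lebesgue"
          using ib by (intro borel_measurable_integrable Bochner_Integration.integrable_sum integrable_mult_right) auto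
        show "AE \<xi> in lebesgue. indicator (ball 0 1) \<xi> * fourier (z a) \<xi> = (\<Sum>i\<in>I. c a i * (indicator (ball 0 1) \<xi> * fourier (u i) \<xi>))"
          using fz[of a] by eventually_elim (simp add: sum_distrib_left mult_ac)
      qed
      also have "\<dots> = (\<Sum>i\<in>I. c a i * l i)"
        unfolding l_def using ib by (subst Bochner_Integration.integral_sum) auto
      also have "\<dots> = 0" using c(1) a by (simp add: mult.commute)
      finally show ?thesis .
    qed
    have "cmod (\<Sum>a\<in>{..<n}. L2_inner (Y (c a)) (\<lambda>x. v x * z a x)) \<le> real (card {..<n}) / 2 + Cmid TYPE('n) * (5 * K)"
      by (rule form_sum_bound[OF bY z2 bP v K0 zero Kx K])
    moreover have "(\<Sum>a\<in>{..<n}. L2_inner (Y (c a)) (\<lambda>x. v x * z a x)) = of_nat n" using c(2) by (simp add: vz)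
    \<comment> \<open>The test functions are \<open>v\<close> times the trial functions, so the sum
      consists of \<open>n\<close> inner products equal to 1. Absorbing \<open>n / 2\<close> doubles
      5 to 10.\<close>
    ultimately have "real n \<le> real n / 2 + Cmid TYPE('n) * (5 * K)" by simp
    moreover have "real (card I) - 1 = real n" using False by (simp add: n_def of_nat_diff)
    ultimately show ?thesis by simp
  qed
qed

text \<open>The dimension is a supremum in \<open>enat\<close>. A common bound on the size of
  independent families makes it a maximum, and a family realising it can be handed to the counting
  estimate.\<close>

lemma L2_dim_attained:
  assumes bd: "\<And>n u. (\<forall>i<n. u i \<in> S) \<Longrightarrow> L2_independent n u \<Longrightarrow> n \<le> N"
  shows "\<exists>n u. L2_dim S = enat n \<and> (\<forall>i<n. u i \<in> S) \<and> L2_independent n u"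
proof -
  define D where "D = {n. \<exists>u. (\<forall>i<n. u i \<in> S) \<and> L2_independent n u}"
  have fin: "finite D" by (rule finite_subset[of _ "{..N}"]) (use bd in \<open>auto simp: D_def\<close>)
  \<comment> \<open>The empty family keeps the set nonempty, also for a number that is not an
    eigenvalue.\<close>
  have "0 \<in> D" by (simp add: D_def L2_independent_def)
  then have ne: "D \<noteq> {}" by blast
  define n where "n = Max D"
  have nD: "n \<in> D" unfolding n_def by (rule Max_in[OF fin ne])
  have "L2_dim S = (SUP n\<in>D. enat n)" by (simp add: L2_dim_def D_def)
  also have "\<dots> = enat n"
  proof (rule antisym)
    show "(SUP n\<in>D. enat n) \<le> enat n" by (rule SUP_least) (use fin in \<open>simp add: n_def\<close>)
    show "enat n \<le> (SUP n\<in>D. enat n)" by (rule SUP_upper[OF nD])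
  qed
  finally show ?thesis using nD unfolding D_def by blast
qed

text \<open>The families of all eigenspaces are joined into one, indexed by pairs of eigenvalue and
  position. Every eigenfunction lies in the form domain, so each eigenvalue equation may be tested
  against all other members, which yields the Gram relations required by
  \<open>negative_family_card\<close>.\<close>

lemma negative_eigenvalue_family_bound:
  fixes V :: "real^'n \<Rightarrow> real" and U :: "real \<Rightarrow> nat \<Rightarrow> real^'n \<Rightarrow> complex"
  defines "v \<equiv> \<lambda>x. complex_of_real (sqrt (V x))"
  assumes V: "\<And>x. 0 \<le> V x" and v: "v \<in> L2" and K0: "K \<ge> 0"
    and Kx: "(\<integral>\<^sup>+x. ennreal (ln (2 + norm x) * (cmod (v x))\<^sup>2) \<partial>lebesgue) \<le> ennreal K"
    and K: "(\<integral>\<^sup>+\<xi>. ennreal (ln (2 + norm \<xi>) * (cmod (fourier v \<xi>))\<^sup>2) \<partial>lebesgue) \<le> ennreal K"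
    and F: "finite F" "F \<subseteq> {..<0}"
    and U: "\<And>m i. m \<in> F \<Longrightarrow> i < n m \<Longrightarrow> U m i \<in> eigenspace (fractional_schroedinger (real CARD('n) / 2) V) m"
    and ind: "\<And>m. m \<in> F \<Longrightarrow> L2_independent (n m) (U m)"
  shows "real (\<Sum>m\<in>F. n m) - 1 \<le> 10 * Cmid TYPE('n) * K"
proof -
  define I where "I = Sigma F (\<lambda>m. {..<n m})"
  define u where "u p = U (fst p) (snd p)" for p :: "real \<times> nat"
  have e: "u p \<in> eigenspace (fractional_schroedinger (real CARD('n) / 2) V) (fst p)" if "p \<in> I" for p
    using that U by (auto simp: I_def u_def)
  have sob: "u p \<in> sobolev (real CARD('n) / 2)" if "p \<in> I" for p
    using e[OF that] unfolding eigenspace_def fractional_schroedinger_def form_operator_def by simp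
  have eq: "schroedinger_form (real CARD('n) / 2) V w (u p) = L2_inner w (\<lambda>x. complex_of_real (fst p) * u p x)" if "p \<in> I" "w \<in> sobolev (real CARD('n) / 2)" for p w
    using e[OF that(1)] that(2) unfolding eigenspace_def fractional_schroedinger_def form_operator_def by simp
  have "real (card I) - 1 \<le> 10 * Cmid TYPE('n) * K"
  proof (rule negative_family_card[where u=u and v=v and \<mu>=fst])
    show "finite I" unfolding I_def using F by auto
    show "u p \<in> L2" if "p \<in> I" for p by (rule sobolev_energy(1)[OF sob[OF that]])
    show "(\<lambda>\<xi>. complex_of_real (hw \<xi>) * fourier (u p) \<xi>) \<in> L2" if "p \<in> I" for p by (rule sobolev_energy(2)[OF sob[OF that]])
    show "L2_inner (\<lambda>\<xi>. complex_of_real (hw \<xi>) * fourier (u i) \<xi>) (\<lambda>\<xi>. complex_of_real (hw \<xi>) * fourier (u k) \<xi>)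
        - L2_inner (\<lambda>x. v x * u i x) (\<lambda>x. v x * u k x) = complex_of_real (fst k) * L2_inner (u i) (u k)" if "i \<in> I" "k \<in> I" for i k
      using eq[OF that(2) sob[OF that(1)]] unfolding schroedinger_form_eq[OF V] L2_inner_scale_right v_def .
    show "fst p < 0" if "p \<in> I" for p using that F by (auto simp: I_def)
    fix m c assume ae: "AE x in lebesgue. (\<Sum>i\<in>{i\<in>I. fst i = m}. c i * u i x) = 0"
    show "\<forall>i\<in>{i\<in>I. fst i = m}. c i = 0"
    proof (cases "m \<in> F")
      case True
      have "{i\<in>I. fst i = m} = Pair m ` {..<n m}" using True by (auto simp: I_def)
      then have s: "(\<Sum>i\<in>{i\<in>I. fst i = m}. c i * u i x) = (\<Sum>i<n m. c (m, i) * U m i x)" for x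
        by (simp add: sum.reindex inj_on_def u_def)
      have "\<forall>i<n m. c (m, i) = 0" using ind[OF True] ae unfolding L2_independent_def s by (rule spec[where x="\<lambda>i. c (m, i)", THEN mp])
      then show ?thesis by (auto simp: I_def)
    qed (auto simp: I_def)
  qed (rule v K0 Kx K)+
  moreover have "card I = (\<Sum>m\<in>F. n m)" unfolding I_def using F by simp
  ultimately show ?thesis by simp
qed

theorem theorem1p5:
  fixes \<epsilon> :: real
  assumes "\<epsilon> > 0"
  shows "\<exists>C>0. \<forall>V :: real^'n \<Rightarrow> real. \<forall>w :: real^'n \<Rightarrow> complex.
    V \<in> borel_measurable lebesgue \<longrightarrow> (\<forall>x. 0 \<le> V x) \<longrightarrow>
    ((\<lambda>x. complex_of_real (sqrt (V x))), w)
       \<in> functional_calculus harmonic_oscillator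
           (\<lambda>t. (ln t) powr (1/2) * (ln (ln t)) powr (1/2 + \<epsilon>)) \<longrightarrow>
    ereal_of_enat (num_negative_eigenvalues (fractional_schroedinger (real CARD('n) / 2) V)) - 1
      \<le> ereal (C * (L2_norm w)\<^sup>2)"
proof (intro exI conjI allI impI)
  \<comment> \<open>The factor 10 comes from the counting bound and \<open>8 + 4 d\<close> from the
    spectral moments; \<open>+ 1\<close> secures strict positivity.\<close>
  let ?C = "10 * Cmid TYPE('n) * (8 + 4 * real CARD('n)) + 1"
  show "0 < ?C" using Cmid_nonneg[where 'n='n] by (intro add_nonneg_pos) auto
  fix V :: "real^'n \<Rightarrow> real" and w :: "real^'n \<Rightarrow> complex"
  assume "\<forall>x. 0 \<le> V x" and vw: "((\<lambda>x. complex_of_real (sqrt (V x))), w)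
       \<in> functional_calculus harmonic_oscillator (\<lambda>t. (ln t) powr (1/2) * (ln (ln t)) powr (1/2 + \<epsilon>))"
  then have V: "0 \<le> V x" for x by blast
  let ?A = "fractional_schroedinger (real CARD('n) / 2) V"
  define K where "K = (8 + 4 * real CARD('n)) * (L2_norm w)\<^sup>2"
  have K0: "K \<ge> 0" by (simp add: K_def)
  note B = functional_calculus_log_bounds[OF assms vw, folded K_def]
  define b where "b = 10 * Cmid TYPE('n) * K"
  have b0: "b \<ge> 0" using K0 Cmid_nonneg[where 'n='n] by (simp add: b_def)
  note fam = negative_eigenvalue_family_bound[OF V B(1) K0 B(2,3), folded b_def]
  \<comment> \<open>The largest integer \<open>k\<close> with \<open>k - 1 \<le> b\<close>. A bound
    by a natural number is needed to show that the \<open>enat\<close>-valued count is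
    finite.\<close>
  define N where "N = nat \<lfloor>b\<rfloor> + 1"
  have N: "real N \<le> b + 1" using b0 by (simp add: N_def)
  have toN: "k \<le> N" if "real k - 1 \<le> b" for k :: nat
  proof -
    have "int k \<le> \<lfloor>b\<rfloor> + 1" using that by linarith
    then show ?thesis using b0 by (simp add: N_def)
  qed
  have "num_negative_eigenvalues ?A \<le> enat N"
    unfolding num_negative_eigenvalues_def
  proof (rule SUP_least)
    fix F :: "real set" assume "F \<in> {F. finite F \<and> F \<subseteq> {..<0}}"
    then have F: "finite F" "F \<subseteq> {..<0}" by auto
    \<comment> \<open>The family bound is used twice: here for a single eigenvalue, to see that its
      eigenspace has finite dimension, and then for maximal families of all members of
      \<open>F\<close> together.\<close>
    have "\<exists>n u. L2_dim (eigenspace ?A m) = enat n \<and> (\<forall>i<n. u i \<in> eigenspace ?A m) \<and> L2_independent n u" if m: "m \<in> F" for m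
    proof (rule L2_dim_attained[where N=N])
      fix n u assume u: "\<forall>i<n. u i \<in> eigenspace ?A m" "L2_independent n u"
      have "real (\<Sum>m\<in>{m}. n) - 1 \<le> b" by (rule fam[of "{m}" "\<lambda>_. n" "\<lambda>_. u"]) (use u m F in auto)
      then show "n \<le> N" by (intro toN) simp
    qed
    then obtain n u where nu: "\<And>m. m \<in> F \<Longrightarrow> L2_dim (eigenspace ?A m) = enat (n m)"
       "\<And>m i. m \<in> F \<Longrightarrow> i < n m \<Longrightarrow> u m i \<in> eigenspace ?A m" "\<And>m. m \<in> F \<Longrightarrow> L2_independent (n m) (u m)"
      by metis
    have "real (\<Sum>m\<in>F. n m) - 1 \<le> b" by (rule fam[OF F nu(2,3)])
    then have "(\<Sum>m\<in>F. n m) \<le> N" by (rule toN)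
    moreover have "(\<Sum>m\<in>F. L2_dim (eigenspace ?A m)) = enat (\<Sum>m\<in>F. n m)"
      using nu(1) by (simp add: of_nat_eq_enat[symmetric])
    ultimately show "(\<Sum>m\<in>F. L2_dim (eigenspace ?A m)) \<le> enat N" by simp
  qed
  then obtain k where k: "num_negative_eigenvalues ?A = enat k" "k \<le> N" by (cases "num_negative_eigenvalues ?A") auto
  have "real k - 1 \<le> b" using k(2) N by linarith
  also have "b \<le> ?C * (L2_norm w)\<^sup>2" by (simp add: b_def K_def distrib_right mult.assoc)
  finally show "ereal_of_enat (num_negative_eigenvalues ?A) - 1 \<le> ereal (?C * (L2_norm w)\<^sup>2)"
    by (simp add: k(1) one_ereal_def)
qed

end
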